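(* Let $n\ge 2$, $k>0$, and $r\in\{1,\ldots,n-1\}$. Then the Riesz distribution $R_{kr}$ on $\mathbb R^n$ is a positive Radon measure, namely $$R_{kr}=\frac{1}{n!}\sum_{\sigma\in S_n}\bigl(R'_{kn}\otimes\delta_0''\bigr)^\sigma,$$ where $\delta_0''$ is the point measure at $0\in\mathbb R^{n-r}$ and $R'_{kn}$ is the positive measure on $\mathbb R^r$ given by $\langle R'_{kn},\psi\rangle=\frac{1}{d_r(k)\Gamma_r(kn;k)}\int_{\mathbb R_+^r}\psi(x')D(x')^{kn-k(r-1)-1}\omega_k(x')\,dx'$ (with $x'=(x_1,\ldots,x_r)$, $D(x')=x_1\cdots x_r$, $\omega_k(x')=\prod_{1\le i<j\le r}|x_i-x_j|^{2k}$, which is $1$ if $r=1$). The support of $R_{kr}$ is $\partial_r(\mathbb R_+^n)=\bigcup_{\sigma\in S_n}\{x\in\overline{\mathbb R_+^n}: x_{\sigma(r+1)}=\cdots=x_{\sigma(n)}=0\}$.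
   Context: Here $\mathbb R^n=\mathbb R^r\times\mathbb R^{n-r}$, $x=(x',x'')$. For $m\ge1$, $d_m(k)=\prod_{j=1}^m\frac{\Gamma(1+jk)}{\Gamma(1+k)}$ and $\Gamma_m(\mu;k)=\prod_{j=1}^m\Gamma(\mu-k(j-1))$. $S_n$ acts on $\mathbb R^n$ by permuting coordinates; for $\varphi:\mathbb R^n\to\mathbb C$ put $\varphi^\sigma=\varphi\circ\sigma^{-1}$, and for a distribution $u$ put $\langle u^\sigma,\varphi\rangle=\langle u,\varphi^{\sigma^{-1}}\rangle$. The Dunkl operators of type $A_{n-1}$ are $T_i(k)=\frac{\partial}{\partial x_i}+k\sum_{j\ne i}\frac{1}{x_i-x_j}(1-\sigma_{ij})$ ($\sigma_{ij}$ exchanges $x_i,x_j$), $D(T(k))=\prod_iT_i(k)$, acting on $\mathcal S'(\mathbb R^n)$ by $\langle T_i(k)u,\varphi\rangle=-\langle u,T_i(k)\varphi\rangle$. With $\mu_0=k(n-1)$, $\omega_k(x)=\prod_{1\le i<j\le n}|x_i-x_j|^{2k}$, $D(x)=\prod_{i=1}^nx_i$, the Riesz measure for $\mathrm{Re}\,\mu>\mu_0$ is $\langle R_\mu,\varphi\rangle=\frac{1}{d_n(k)\Gamma_n(\mu;k)}\int_{\mathbb R_+^n}\varphi(x)D(x)^{\mu-\mu_0-1}\omega_k(x)dx$, and for general $\mu\in\mathbb C$, $R_\mu$ denotes the unique holomorphic $\mathcal S'(\mathbb R^n)$-valued extension of $\mu\mapsto R_\mu$ to $\mathbb C$ (it satisfies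 $D(T(k))R_\mu=R_{\mu-1}$). *)

theory Defs
  imports "HOL-Analysis.Analysis"
begin

definition pdiff :: "'n::finite \<Rightarrow> (real^'n \<Rightarrow> complex) \<Rightarrow> (real^'n \<Rightarrow> complex)" where
  "pdiff i f x = vector_derivative (\<lambda>t. f (x + t *\<^sub>R axis i 1)) (at 0)"

definition iter_pdiff :: "'n::finite list \<Rightarrow> (real^'n \<Rightarrow> complex) \<Rightarrow> (real^'n \<Rightarrow> complex)" where
  "iter_pdiff is f = foldr pdiff is f"

definition smooth_fun :: "(real^'n::finite \<Rightarrow> complex) \<Rightarrow> bool" where
  "smooth_fun f \<longleftrightarrow> (\<forall>is. continuous_on UNIV (iter_pdiff is f) \<and>
     (\<forall>i x. ((\<lambda>t. iter_pdiff is f (x + t *\<^sub>R axis i 1)) has_vector_derivative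
              iter_pdiff (i # is) f x) (at 0)))"

definition schwartz :: "(real^'n::finite \<Rightarrow> complex) \<Rightarrow> bool" where
  "schwartz f \<longleftrightarrow> smooth_fun f \<and>
     (\<forall>is m. \<exists>B. \<forall>x. (1 + norm x) ^ m * norm (iter_pdiff is f x) \<le> B)"

definition test_fun :: "(real^'n::finite \<Rightarrow> complex) \<Rightarrow> bool" where
  "test_fun f \<longleftrightarrow> smooth_fun f \<and> compact (closure {x. f x \<noteq> 0})"

definition schwartz_seminorm :: "nat \<Rightarrow> (real^'n::finite \<Rightarrow> complex) \<Rightarrow> real" where
  "schwartz_seminorm N f =
     Sup {(1 + norm x) ^ N * norm (iter_pdiff is f x) | x is. length is \<le> N}"

definition tempered :: "((real^'n::finite \<Rightarrow> complex) \<Rightarrow> complex) \<Rightarrow> bool" where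
  "tempered u \<longleftrightarrow>
     (\<forall>f g. schwartz f \<and> schwartz g \<longrightarrow> u (\<lambda>x. f x + g x) = u f + u g) \<and>
     (\<forall>c f. schwartz f \<longrightarrow> u (\<lambda>x. c * f x) = c * u f) \<and>
     (\<exists>C N. \<forall>f. schwartz f \<longrightarrow> norm (u f) \<le> C * schwartz_seminorm N f)"

definition dist_support :: "((real^'n::finite \<Rightarrow> complex) \<Rightarrow> complex) \<Rightarrow> (real^'n) set" where
  "dist_support u = {x. \<forall>U. open U \<and> x \<in> U \<longrightarrow>
      (\<exists>f. test_fun f \<and> closure {y. f y \<noteq> 0} \<subseteq> U \<and> u f \<noteq> 0)}"

definition perm_vec :: "('n::finite \<Rightarrow> 'n) \<Rightarrow> real^'n \<Rightarrow> real^'n" where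
  "perm_vec \<sigma> x = (\<chi> j. x $ (inv \<sigma> j))"

text \<open>u^sigma applied to phi is u applied to phi^(sigma^-1) = phi o sigma.\<close>
definition perm_dist :: "('n::finite \<Rightarrow> 'n) \<Rightarrow> ((real^'n \<Rightarrow> complex) \<Rightarrow> complex)
    \<Rightarrow> (real^'n \<Rightarrow> complex) \<Rightarrow> complex" where
  "perm_dist \<sigma> u \<phi> = u (\<lambda>x. \<phi> (perm_vec \<sigma> x))"

definition d_const :: "nat \<Rightarrow> real \<Rightarrow> real" where
  "d_const m k = (\<Prod>j=1..m. Gamma (1 + real j * k) / Gamma (1 + k))"

definition Gamma_m :: "nat \<Rightarrow> complex \<Rightarrow> real \<Rightarrow> complex" where
  "Gamma_m m \<mu> k = (\<Prod>j=1..m. Gamma (\<mu> - of_real (k * (real j - 1))))"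

definition D_on :: "'n set \<Rightarrow> ('n \<Rightarrow> real) \<Rightarrow> real" where
  "D_on A y = (\<Prod>i\<in>A. y i)"

definition omega_on :: "real \<Rightarrow> ('n::linorder) set \<Rightarrow> ('n \<Rightarrow> real) \<Rightarrow> real" where
  "omega_on k A y = (\<Prod>p\<in>{(i,j). i \<in> A \<and> j \<in> A \<and> i < j}. \<bar>y (fst p) - y (snd p)\<bar> powr (2 * k))"

definition first_idx :: "nat \<Rightarrow> ('n::{finite,linorder}) set" where
  "first_idx r = {i. card {j. j < i} < r}"

text \<open>Riesz measure for Re mu > mu_0 = k(n-1).\<close>
definition riesz_int :: "real \<Rightarrow> complex \<Rightarrow> (real^'n::{finite,linorder} \<Rightarrow> complex) \<Rightarrow> complex" where
  "riesz_int k \<mu> \<phi> =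
     (1 / (of_real (d_const CARD('n) k) * Gamma_m CARD('n) \<mu> k)) *
     (LINT x : {x. \<forall>i. 0 < x $ i} | lborel.
        \<phi> x * (of_real (D_on UNIV (vec_nth x))) powr (\<mu> - of_real (k * (real CARD('n) - 1)) - 1)
            * of_real (omega_on k UNIV (vec_nth x)))"

definition is_riesz_family :: "real \<Rightarrow> (complex \<Rightarrow> (real^'n::{finite,linorder} \<Rightarrow> complex) \<Rightarrow> complex) \<Rightarrow> bool" where
  "is_riesz_family k R \<longleftrightarrow>
     (\<forall>\<mu>. tempered (R \<mu>)) \<and>
     (\<forall>\<phi>. schwartz \<phi> \<longrightarrow> (\<lambda>\<mu>. R \<mu> \<phi>) holomorphic_on UNIV) \<and>
     (\<forall>\<mu> \<phi>. schwartz \<phi> \<and> Re \<mu> > k * (real CARD('n) - 1) \<longrightarrow> R \<mu> \<phi> = riesz_int k \<mu> \<phi>)"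

definition embed_vec :: "'n set \<Rightarrow> ('n \<Rightarrow> real) \<Rightarrow> real^'n::finite" where
  "embed_vec A y = (\<chi> i. if i \<in> A then y i else 0)"

definition Rprime_delta :: "real \<Rightarrow> nat \<Rightarrow> (real^'n::{finite,linorder} \<Rightarrow> complex) \<Rightarrow> complex" where
  "Rprime_delta k r \<psi> =
     (let A = (first_idx r :: 'n set); n = CARD('n) in
      (1 / (of_real (d_const r k) * Gamma_m r (of_real (k * real n)) k)) *
      (LINT y : {y. \<forall>i\<in>A. 0 < y i} | PiM A (\<lambda>_. lborel).
         \<psi> (embed_vec A y) *
         of_real (D_on A y powr (k * real n - k * (real r - 1) - 1) * omega_on k A y)))"

definition boundary_r :: "nat \<Rightarrow> (real^'n::{finite,linorder}) set" where
  "boundary_r r = (\<Union>\<sigma>\<in>{\<sigma>. \<sigma> permutes (UNIV::'n set)}.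
     {x. (\<forall>i. 0 \<le> x $ i) \<and> (\<forall>i. i \<notin> first_idx r \<longrightarrow> x $ (\<sigma> i) = 0)})"

end

theory Submission
  imports Defs "HOL-Complex_Analysis.Complex_Analysis" "HOL-Real_Asymp.Real_Asymp"
begin

text \<open>
  The functional \<open>R\<^bsub>kr\<^esub>\<close> and the symmetrised measure are compared on \<open>p exp (- \<Sum> x\<^sub>i)\<close> with \<open>p\<close> a
  product of power sums. Integration by parts against \<open>\<Sum>\<^sub>i x\<^sub>i\<^sup>a\<^sup>+\<^sup>1 \<partial>\<^sub>i\<close> gives recursive relations
  (loop equations) which determine all these moments. They extend from large \<open>\<mu>\<close> to all \<open>\<mu>\<close> by
  analytic continuation, the normalisation being Selberg's integral for the Laguerre weight. The
  equations depend on the number \<open>N\<close> of variables and on \<open>\<mu>\<close> only through \<open>\<mu> + k N\<close> and \<open>\<mu> k N\<close>,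
  hence they are the same for \<open>n\<close> variables at \<open>\<mu> = k r\<close> as for \<open>r\<close> variables at \<open>\<mu> = k n\<close>.
  Both functionals are symmetric, continuous and supported in the closed orthant. Symmetrisation
  reduces monomials to power sums, a power series expansion then reaches all exponentials
  \<open>exp (- \<Sum> c\<^sub>i x\<^sub>i)\<close>, and these are dense by Stone--Weierstrass.
\<close>

text \<open>The parameter k r is at most k (n - 1), outside the half plane in which the Riesz
  distribution is an integral, so every property of it must be an identity entire in the parameter.
  On the dual side there is a genuine integral: with s = mu - k (N - 1) the weight converges for all
  s > 0, and r variables at mu = k n give s = k (n - r + 1). The loop equations determine the
  moments because each one expresses a product of power sums through products of smaller total
  degree. Density must hold in Schwartz seminorms on the whole space, where exponentials blow up in
  negative directions. Hence a cutoff equal to 1 on the closed orthant, and estimates on a slightly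
  larger orthant. Exponents are raised by quarters so that the growth of the Taylor remainder stays
  below the decay exp(-x_i) already present. Selberg's constant arises in three stages: Aomoto's
  recursion gives the normalisation the same functional equation in s as a product of Gamma
  functions, a Bohr--Mollerup argument makes the quotient constant, and at s = 1 splitting off the
  smallest coordinate lowers the number of variables.\<close>

no_notation fps_nth (infixl "$" 75)

subsection \<open>Smooth functions\<close>

lemma iter_pdiff_Nil [simp]: "iter_pdiff [] f = f"
  by (simp add: iter_pdiff_def)

lemma iter_pdiff_Cons: "iter_pdiff (i # is) f = pdiff i (iter_pdiff is f)"
  by (simp add: iter_pdiff_def)

lemma iter_pdiff_append: "iter_pdiff (is @ js) f = iter_pdiff is (iter_pdiff js f)"
  by (simp add: iter_pdiff_def)

lemma iter_pdiff_snoc: "iter_pdiff (is @ [i]) f = iter_pdiff is (pdiff i f)"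
  by (simp add: iter_pdiff_def)

text \<open>\<open>pdiff\<close> is a total operator based on choice, so an equation about it says
  nothing about differentiability. The relation carries existence, and by uniqueness of derivatives
  it also determines \<open>pdiff\<close>.\<close>

definition has_pdiff :: "(real^'n::finite \<Rightarrow> complex) \<Rightarrow> 'n \<Rightarrow> (real^'n \<Rightarrow> complex) \<Rightarrow> bool" where
  "has_pdiff f i g \<longleftrightarrow> (\<forall>x. ((\<lambda>t. f (x + t *\<^sub>R axis i 1)) has_vector_derivative g x) (at 0))"

lemma has_pdiff_imp: "has_pdiff f i g \<Longrightarrow> pdiff i f = g"
  by (auto simp: has_pdiff_def pdiff_def fun_eq_iff intro!: vector_derivative_at)

lemma smooth_fun_has_pdiff: "smooth_fun f \<Longrightarrow> has_pdiff f i (pdiff i f)"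
  using iter_pdiff_Cons[of i "[]" f]
  unfolding smooth_fun_def has_pdiff_def by (metis iter_pdiff_Nil)

lemma smooth_fun_iter: "smooth_fun f \<Longrightarrow> smooth_fun (iter_pdiff js f)"
  unfolding smooth_fun_def by (metis iter_pdiff_append append_Cons)

lemma smooth_fun_pdiff: "smooth_fun f \<Longrightarrow> smooth_fun (pdiff j f)"
  using smooth_fun_iter[of f "[j]"] by (simp add: iter_pdiff_Cons)

lemma smooth_fun_continuous: "smooth_fun f \<Longrightarrow> continuous_on A f"
  unfolding smooth_fun_def by (metis iter_pdiff_Nil continuous_on_subset subset_UNIV)

text \<open>Smoothness is coinductive: in a family of continuous functions closed under partial
  derivatives, every iterated partial stays in the family, so all of them exist and are
  continuous.\<close>

lemma smooth_fun_coinduct: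
  assumes "f \<in> S" "\<And>f. f \<in> S \<Longrightarrow> continuous_on UNIV f"
    and "\<And>f i. f \<in> S \<Longrightarrow> \<exists>g\<in>S. has_pdiff f i g"
  shows "smooth_fun f"
proof -
  have S: "iter_pdiff is f \<in> S" for "is"
  proof (induction "is")
    case (Cons i "is")
    then show ?case using assms(3)[OF Cons, of i] by (auto simp: iter_pdiff_Cons has_pdiff_imp)
  qed (use assms in auto)
  have "has_pdiff (iter_pdiff is f) i (iter_pdiff (i # is) f)" for "is" i
    using assms(3)[OF S] by (metis has_pdiff_imp iter_pdiff_Cons)
  then show ?thesis using assms(2)[OF S] by (auto simp: smooth_fun_def has_pdiff_def)
qed

lemma has_pdiff_add: "has_pdiff f i f' \<Longrightarrow> has_pdiff g i g' \<Longrightarrow>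
    has_pdiff (\<lambda>x. f x + g x) i (\<lambda>x. f' x + g' x)"
  by (auto simp: has_pdiff_def intro!: derivative_intros)

lemma has_pdiff_mult: "has_pdiff f i f' \<Longrightarrow> has_pdiff g i g' \<Longrightarrow>
    has_pdiff (\<lambda>x. f x * g x) i (\<lambda>x. f' x * g x + f x * g' x)"
  unfolding has_pdiff_def
  by (auto intro!: has_vector_derivative_eq_rhs[OF has_vector_derivative_mult])

text \<open>Products alone are not closed under differentiation, since the product rule yields a sum
  of two. Finite sums of products are, which makes this class an invariant for
  \<open>smooth_fun_coinduct\<close>.\<close>

inductive prod_span :: "(real^'n::finite \<Rightarrow> complex) \<Rightarrow> bool" where
  prod: "smooth_fun f \<Longrightarrow> smooth_fun g \<Longrightarrow> prod_span (\<lambda>x. f x * g x)"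
| add: "prod_span f \<Longrightarrow> prod_span g \<Longrightarrow> prod_span (\<lambda>x. f x + g x)"

lemma prod_span_smooth:
  assumes "prod_span f" shows "smooth_fun f"
proof (rule smooth_fun_coinduct[of _ "Collect prod_span"])
  fix f assume "f \<in> Collect prod_span"
  then have f: "prod_span f" by simp
  show "continuous_on UNIV f"
    using f
  proof induction
    case (prod f g)
    then show ?case by (intro continuous_on_mult smooth_fun_continuous)
  next
    case (add f g)
    then show ?case by (intro continuous_on_add)
  qed
  fix i
  show "\<exists>g\<in>Collect prod_span. has_pdiff f i g"
    using f
  proof induction
    case (prod f g)
    have "prod_span (\<lambda>x. pdiff i f x * g x + f x * pdiff i g x)"
      by (intro prod_span.intros prod smooth_fun_pdiff)
    then show ?case using has_pdiff_mult[OF smooth_fun_has_pdiff smooth_fun_has_pdiff, OF prod, of i] 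
      by blast
  next
    case (add f g)
    then obtain f' g' where "prod_span f'" "prod_span g'" "has_pdiff f i f'" "has_pdiff g i g'" by auto
    then show ?case by (auto intro!: bexI has_pdiff_add prod_span.intros)
  qed
qed (use assms in auto)

lemma has_pdiff_const: "has_pdiff (\<lambda>x. c) i (\<lambda>x. 0)"
  by (auto simp: has_pdiff_def)

lemma smooth_fun_const: "smooth_fun (\<lambda>x. c)"
  by (rule smooth_fun_coinduct[of _ "range (\<lambda>c x. c)"]) (auto intro!: has_pdiff_const)

lemma smooth_fun_mult: "smooth_fun f \<Longrightarrow> smooth_fun g \<Longrightarrow> smooth_fun (\<lambda>x. f x * g x)"
  by (rule prod_span_smooth[OF prod_span.prod])

lemma smooth_fun_add:
  assumes "smooth_fun f" "smooth_fun g" shows "smooth_fun (\<lambda>x. f x + g x)"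
proof -
  have "prod_span (\<lambda>x. f x * 1 + g x * 1)"
    by (intro prod_span.intros assms smooth_fun_const)
  then show ?thesis using prod_span_smooth by simp
qed

lemma smooth_fun_cmult: "smooth_fun f \<Longrightarrow> smooth_fun (\<lambda>x. c * f x)"
  by (intro smooth_fun_mult smooth_fun_const)

lemma smooth_fun_diff: "smooth_fun f \<Longrightarrow> smooth_fun g \<Longrightarrow> smooth_fun (\<lambda>x. f x - g x)"
  using smooth_fun_add[of f "\<lambda>x. (-1) * g x"] smooth_fun_cmult[of g "-1"] by simp

lemma smooth_fun_prod: "(\<And>a. a \<in> A \<Longrightarrow> smooth_fun (f a)) \<Longrightarrow> smooth_fun (\<lambda>x. \<Prod>a\<in>A. f a x)"
  by (induction A rule: infinite_finite_induct) (auto intro!: smooth_fun_const smooth_fun_mult)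

lemma pdiff_add: "smooth_fun f \<Longrightarrow> smooth_fun g \<Longrightarrow> pdiff i (\<lambda>x. f x + g x) = (\<lambda>x. pdiff i f x + pdiff i g x)"
  by (intro has_pdiff_imp has_pdiff_add smooth_fun_has_pdiff)

lemma pdiff_mult: "smooth_fun f \<Longrightarrow> smooth_fun g \<Longrightarrow>
   pdiff i (\<lambda>x. f x * g x) = (\<lambda>x. pdiff i f x * g x + f x * pdiff i g x)"
  by (intro has_pdiff_imp has_pdiff_mult smooth_fun_has_pdiff)

lemma iter_pdiff_add: "smooth_fun f \<Longrightarrow> smooth_fun g \<Longrightarrow>
   iter_pdiff is (\<lambda>x. f x + g x) = (\<lambda>x. iter_pdiff is f x + iter_pdiff is g x)"
  by (induction "is") (auto simp: iter_pdiff_Cons pdiff_add smooth_fun_iter)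

lemma iter_pdiff_const: "iter_pdiff is (\<lambda>x. c) = (\<lambda>x. if is = [] then c else 0)"
  by (induction "is") (auto simp: iter_pdiff_Cons intro!: has_pdiff_imp has_pdiff_const)

lemma iter_pdiff_cmult: "smooth_fun f \<Longrightarrow>
   iter_pdiff is (\<lambda>x. c * f x) = (\<lambda>x. c * iter_pdiff is f x)"
proof (induction "is")
  case (Cons i "is")
  then show ?case using pdiff_mult[OF smooth_fun_const[where c = c] smooth_fun_iter[of f "is"], of i] 
      has_pdiff_imp[OF has_pdiff_const[where c = c and i = i]]
    by (auto simp: iter_pdiff_Cons)
qed auto

lemma iter_pdiff_diff: "smooth_fun f \<Longrightarrow> smooth_fun g \<Longrightarrow>
   iter_pdiff is (\<lambda>x. f x - g x) = (\<lambda>x. iter_pdiff is f x - iter_pdiff is g x)"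
  using iter_pdiff_add[of f "\<lambda>x. (-1) * g x" "is"] iter_pdiff_cmult[of g "is" "-1"] smooth_fun_cmult[of g "-1"]
  by (simp add: fun_eq_iff)

text \<open>The Leibniz rule counted crudely: an order m derivative of a product is a sum of 2^m
  products of derivatives of the factors. The bounds are assumed at the single point x. The
  induction peels off the innermost derivative, where the product rule is an identity between
  functions.\<close>

lemma iter_pdiff_mult_bound:
  assumes "smooth_fun f" "smooth_fun g"
    and "\<And>js. length js \<le> length is \<Longrightarrow> norm (iter_pdiff js f x) \<le> A"
    and "\<And>js. length js \<le> length is \<Longrightarrow> norm (iter_pdiff js g x) \<le> B"
  shows "norm (iter_pdiff is (\<lambda>x. f x * g x) x) \<le> 2 ^ length is * A * B"
  using assms
proof (induction "is" arbitrary: f g rule: rev_induct)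
  case Nil
  from Nil(3)[of "[]"] Nil(4)[of "[]"] show ?case by (auto simp: norm_mult intro!: mult_mono intro: order_trans[OF norm_ge_zero])
next
  case (snoc i "is")
  note sm = snoc.prems(1,2)
  have 1: "norm (iter_pdiff is (\<lambda>x. pdiff i f x * g x) x) \<le> 2 ^ length is * A * B"
  proof (rule snoc.IH)
    fix js :: "'a list" assume "length js \<le> length is"
    then show "cmod (iter_pdiff js (pdiff i f) x) \<le> A" "cmod (iter_pdiff js g x) \<le> B"
      using snoc.prems(3)[of "js @ [i]"] snoc.prems(4)[of js] by (auto simp: iter_pdiff_snoc)
  qed (use sm in \<open>auto intro!: smooth_fun_pdiff\<close>)
  have 2: "norm (iter_pdiff is (\<lambda>x. f x * pdiff i g x) x) \<le> 2 ^ length is * A * B"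
  proof (rule snoc.IH)
    fix js :: "'a list" assume "length js \<le> length is"
    then show "cmod (iter_pdiff js (pdiff i g) x) \<le> B" "cmod (iter_pdiff js f x) \<le> A"
      using snoc.prems(4)[of "js @ [i]"] snoc.prems(3)[of js] by (auto simp: iter_pdiff_snoc)
  qed (use sm in \<open>auto intro!: smooth_fun_pdiff\<close>)
  have "iter_pdiff (is @ [i]) (\<lambda>x. f x * g x) x =
      iter_pdiff is (\<lambda>x. pdiff i f x * g x) x + iter_pdiff is (\<lambda>x. f x * pdiff i g x) x"
    using sm by (simp add: iter_pdiff_snoc pdiff_mult iter_pdiff_add smooth_fun_mult smooth_fun_pdiff)
  also have "norm \<dots> \<le> 2 ^ length is * A * B + 2 ^ length is * A * B"
    using norm_triangle_mono[OF 1 2] .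
  finally show ?case by (simp add: algebra_simps)
qed

section \<open>Locality of iterated partial derivatives\<close>

lemma pdiff_local:
  assumes "open U" "x \<in> U" "\<And>y. y \<in> U \<Longrightarrow> f y = g y"
  shows "pdiff i f x = pdiff i g x"
proof -
  have "\<forall>\<^sub>F t in at 0. x + t *\<^sub>R axis i 1 \<in> U"
    by (rule topological_tendstoD[of _ x]) (use assms in \<open>auto intro!: tendsto_eq_intros\<close>)
  then have "\<forall>\<^sub>F t in at 0. f (x + t *\<^sub>R axis i 1) = g (x + t *\<^sub>R axis i 1)"
    by eventually_elim (use assms in auto)
  then have ev: "\<forall>\<^sub>F t in nhds 0. t \<in> UNIV \<longrightarrow> f (x + t *\<^sub>R axis i 1) = g (x + t *\<^sub>R axis i 1)"
    using assms by (subst (asm) eventually_at_filter) (auto elim!: eventually_mono)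
  show ?thesis unfolding pdiff_def using ev assms
    by (intro vector_derivative_cong_eq) auto
qed

lemma iter_pdiff_local:
  assumes "open U" "\<And>y. y \<in> U \<Longrightarrow> f y = g y"
  shows "x \<in> U \<Longrightarrow> iter_pdiff is f x = iter_pdiff is g x"
  by (induction "is" arbitrary: x) (auto simp: assms iter_pdiff_Cons intro!: pdiff_local[OF assms(1)])

lemma iter_pdiff_zero:
  assumes "open U" "\<And>y. y \<in> U \<Longrightarrow> f y = 0" "x \<in> U"
  shows "iter_pdiff is f x = 0"
  using iter_pdiff_local[of U f "\<lambda>_. 0" x "is"] assms by (auto simp: iter_pdiff_const)

lemma has_pdiff_line:
  assumes "has_pdiff f i g"
  shows "((\<lambda>t. f (x + t *\<^sub>R axis i 1)) has_vector_derivative g (x + s *\<^sub>R axis i 1)) (at s within T)"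
proof -
  have "((\<lambda>t. f ((x + s *\<^sub>R axis i 1) + t *\<^sub>R axis i 1)) has_vector_derivative g (x + s *\<^sub>R axis i 1)) (at (s - s))"
    using assms by (simp add: has_pdiff_def)
  then have "((\<lambda>t. f ((x + s *\<^sub>R axis i 1) + (t - s) *\<^sub>R axis i 1)) has_vector_derivative 1 *\<^sub>R g (x + s *\<^sub>R axis i 1)) (at s)"
    by (intro vector_diff_chain_at[where g = "\<lambda>t. f ((x + s *\<^sub>R axis i 1) + t *\<^sub>R axis i 1)", unfolded o_def])
       (auto intro!: derivative_eq_intros)
  then show ?thesis by (simp add: algebra_simps has_vector_derivative_at_within)
qed

section \<open>Symmetry of mixed partial derivatives\<close>

text \<open>Both iterated integrals of the mixed partials over a small square equal the same
  second difference of \<open>f\<close>.\<close>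
lemma pdiff_commute:
  fixes f :: "real^'n::finite \<Rightarrow> complex"
  assumes f: "smooth_fun f"
  shows "pdiff i (pdiff j f) = pdiff j (pdiff i f)"
proof
  fix x :: "real^'n"
  define P where "P s t = x + s *\<^sub>R axis i 1 + t *\<^sub>R axis j 1" for s t :: real
  have P': "P s t = x + t *\<^sub>R axis j 1 + s *\<^sub>R axis i 1" for s t by (simp add: P_def)
  define A where "A = (\<lambda>p. pdiff i (pdiff j f) (case p of (s, t) \<Rightarrow> P s t))"
  define B where "B = (\<lambda>p. pdiff j (pdiff i f) (case p of (s, t) \<Rightarrow> P s t))"
  define C where "C p = A p - B p" for p
  have contP: "continuous_on S (\<lambda>p. case p of (s, t) \<Rightarrow> P s t)" for S
    unfolding P_def case_prod_unfold by (intro continuous_intros)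
  have contA: "continuous_on S A" and contB: "continuous_on S B" for S
    unfolding A_def B_def
    by (intro continuous_on_compose2[OF smooth_fun_continuous[where A = UNIV] contP] smooth_fun_pdiff f subset_UNIV)+
  then have contC: "continuous_on S C" for S unfolding C_def by (intro continuous_intros)
  have int0: "integral (cbox (0, 0) (h, h)) C = 0" if "h > 0" for h :: real
  proof -
    have A1: "integral (cbox 0 h) (\<lambda>s. A (s, t)) = pdiff j f (P h t) - pdiff j f (P 0 t)" for t
    proof (rule integral_unique)
      have "((\<lambda>s. pdiff i (pdiff j f) (x + t *\<^sub>R axis j 1 + s *\<^sub>R axis i 1)) has_integral
          pdiff j f (x + t *\<^sub>R axis j 1 + h *\<^sub>R axis i 1) - pdiff j f (x + t *\<^sub>R axis j 1 + 0 *\<^sub>R axis i 1)) {0..h}"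
        using that by (intro fundamental_theorem_of_calculus has_pdiff_line smooth_fun_has_pdiff smooth_fun_pdiff f) auto
      then show "((\<lambda>s. A (s, t)) has_integral pdiff j f (P h t) - pdiff j f (P 0 t)) (cbox 0 h)"
        unfolding A_def by (simp add: P')
    qed
    have B1: "integral (cbox 0 h) (\<lambda>t. B (s, t)) = pdiff i f (P s h) - pdiff i f (P s 0)" for s
    proof (rule integral_unique)
      have "((\<lambda>t. pdiff j (pdiff i f) (x + s *\<^sub>R axis i 1 + t *\<^sub>R axis j 1)) has_integral
          pdiff i f (x + s *\<^sub>R axis i 1 + h *\<^sub>R axis j 1) - pdiff i f (x + s *\<^sub>R axis i 1 + 0 *\<^sub>R axis j 1)) {0..h}"
        using that by (intro fundamental_theorem_of_calculus has_pdiff_line smooth_fun_has_pdiff smooth_fun_pdiff f) auto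
      then show "((\<lambda>t. B (s, t)) has_integral pdiff i f (P s h) - pdiff i f (P s 0)) (cbox 0 h)"
        unfolding B_def by (simp add: P_def)
    qed
    have fj: "((\<lambda>t. pdiff j f (P s t)) has_integral f (P s h) - f (P s 0)) {0..h}" for s
      unfolding P_def using that by (intro fundamental_theorem_of_calculus has_pdiff_line smooth_fun_has_pdiff f) auto
    have fi: "((\<lambda>s. pdiff i f (P s t)) has_integral f (P h t) - f (P 0 t)) {0..h}" for t
      unfolding P' using that by (intro fundamental_theorem_of_calculus has_pdiff_line smooth_fun_has_pdiff f) auto
    have A2: "integral (cbox (0,0) (h,h)) A = (f (P h h) - f (P h 0)) - (f (P 0 h) - f (P 0 0))"
    proof -
      have "integral (cbox (0,0) (h,h)) A = integral (cbox 0 h) (\<lambda>s. integral (cbox 0 h) (\<lambda>t. A (s, t)))"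
        by (rule integral_prod_continuous[OF contA])
      also have "\<dots> = integral (cbox 0 h) (\<lambda>t. integral (cbox 0 h) (\<lambda>s. A (s, t)))"
        by (rule integral_swap_continuous) (simp add: contA)
      also have "\<dots> = integral {0..h} (\<lambda>t. pdiff j f (P h t) - pdiff j f (P 0 t))"
        by (simp add: A1[simplified])
      also have "\<dots> = (f (P h h) - f (P h 0)) - (f (P 0 h) - f (P 0 0))"
        by (intro integral_unique has_integral_diff fj)
      finally show ?thesis .
    qed
    have B2: "integral (cbox (0,0) (h,h)) B = (f (P h h) - f (P 0 h)) - (f (P h 0) - f (P 0 0))"
    proof -
      have "integral (cbox (0,0) (h,h)) B = integral (cbox 0 h) (\<lambda>s. integral (cbox 0 h) (\<lambda>t. B (s, t)))"
        by (rule integral_prod_continuous[OF contB])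
      also have "\<dots> = integral {0..h} (\<lambda>s. pdiff i f (P s h) - pdiff i f (P s 0))"
        by (simp add: B1[simplified])
      also have "\<dots> = (f (P h h) - f (P 0 h)) - (f (P h 0) - f (P 0 0))"
        by (intro integral_unique has_integral_diff fi)
      finally show ?thesis .
    qed
    show ?thesis unfolding C_def
      by (subst integral_diff) (auto simp: A2 B2 intro!: integrable_continuous contA contB)
  qed
  \<comment> \<open>C, the difference of the two mixed partials, has integral zero over every small
    square at the corner. Since it is continuous there, its value at the corner is smaller than any
    bound.\<close>
  have "norm (C (0,0)) \<le> e" if e: "e > 0" for e
  proof -
    have "isCont C (0,0)" using contC[of UNIV] by (simp add: continuous_on_eq_continuous_at)
    then obtain d where d: "d > 0" "\<And>p. dist p (0,0) < d \<Longrightarrow> dist (C p) (C (0,0)) < e"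
      using e unfolding continuous_at_eps_delta by blast
    \<comment> \<open>A point (s, t) of the square has norm at most s + t \<le> 2 h, which is below
      d.\<close>
    define h where "h = d / 3"
    have h: "h > 0" using d by (simp add: h_def)
    have "norm (C p - C (0,0)) \<le> e" if "p \<in> cbox (0,0) (h,h)" for p
    proof -
      obtain s t where p: "p = (s, t)" by force
      have st: "0 \<le> s" "s \<le> h" "0 \<le> t" "t \<le> h" using that by (auto simp: p)
      have "norm p \<le> norm s + norm t" unfolding p by (rule norm_Pair_le)
      also have "\<dots> < d" using st d unfolding h_def by simp
      finally have "dist p (0, 0) < d"
        by (metis diff_zero dist_norm zero_prod_def)
      then have "norm (C p - C (0, 0)) < e" using d(2)[of p] unfolding dist_norm[of "C p"] by blast
      then show ?thesis by (rule less_imp_le)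
    qed
    then have "norm (integral (cbox (0,0) (h,h)) (\<lambda>p. C p - C (0,0))) \<le> e * measure lborel (cbox (0::real,0::real) (h,h))"
      using e by (intro has_integral_bound[OF _ integrable_integral] integrable_continuous continuous_intros contC) auto
    also have "integral (cbox (0,0) (h,h)) (\<lambda>p. C p - C (0,0)) = - (measure lborel (cbox (0::real,0::real) (h,h)) *\<^sub>R C (0,0))"
      by (subst integral_diff) (auto simp: int0[OF h] intro!: integrable_continuous contC)
    finally have "(h * h) * norm (C (0,0)) \<le> (h * h) * e"
      using h by (simp add: content_Pair mult.commute abs_mult)
    then show ?thesis using h by (subst (asm) mult_le_cancel_left_pos) auto
  qed
  then have "norm (C (0,0)) \<le> 0" by (meson dense_ge)
  then show "pdiff i (pdiff j f) x = pdiff j (pdiff i f) x"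
    by (simp add: C_def A_def B_def P_def)
qed

lemma iter_pdiff_move: "smooth_fun f \<Longrightarrow> iter_pdiff is (pdiff i f) = pdiff i (iter_pdiff is f)"
proof (induction "is")
  case (Cons j "is")
  then show ?case by (simp add: iter_pdiff_Cons pdiff_commute smooth_fun_iter)
qed simp

text \<open>Once derivatives commute, only the multiset of directions matters. The approximation
  argument later uses this to see every derivative of bounded order as a stage of one fixed long
  derivative.\<close>

lemma iter_pdiff_perm:
  "smooth_fun f \<Longrightarrow> mset is = mset js \<Longrightarrow> iter_pdiff is f = iter_pdiff js f"
proof (induction "is" arbitrary: js)
  case (Cons i "is")
  then have "i \<in> set js" by (metis list.set_intros(1) set_mset_mset)
  then obtain js1 js2 where js: "js = js1 @ i # js2" by (meson split_list)
  then have "mset is = mset (js1 @ js2)" using Cons.prems by simp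
  then have "iter_pdiff is f = iter_pdiff (js1 @ js2) f" using Cons by blast
  then show ?case
    using Cons.prems by (simp add: js iter_pdiff_Cons iter_pdiff_append iter_pdiff_move smooth_fun_iter)
qed simp

subsection \<open>Functions of one coordinate\<close>

text \<open>A smooth function of one variable is given together with all its derivatives, so that
  bounds can be attached to each order separately.\<close>

definition deriv_seq :: "(nat \<Rightarrow> real \<Rightarrow> real) \<Rightarrow> bool" where
  "deriv_seq G \<longleftrightarrow> (\<forall>j x. (G j has_real_derivative G (Suc j) x) (at x))"

definition smooth1 :: "(real \<Rightarrow> real) \<Rightarrow> bool" where
  "smooth1 g \<longleftrightarrow> (\<exists>G. deriv_seq G \<and> G 0 = g)"

definition coord_fun :: "'n::finite \<Rightarrow> (real \<Rightarrow> real) \<Rightarrow> real^'n \<Rightarrow> complex" where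
  "coord_fun i g x = complex_of_real (g (x $ i))"

lemma has_pdiff_coord_fun:
  assumes "\<And>t. (g has_real_derivative g' t) (at t)"
  shows "has_pdiff (coord_fun i g) j (if j = i then coord_fun i g' else (\<lambda>_. 0))"
proof (cases "j = i")
  case True
  have "((\<lambda>t. g (x $ i + t)) has_real_derivative g' (x $ i)) (at 0)" for x :: "real^'a"
  proof -
    have "(g has_real_derivative g' (x $ i)) (at (x $ i + 0))" using assms by simp
    then have "(g has_real_derivative g' (x $ i)) (at (0 + x $ i))" by (simp add: add.commute)
    from DERIV_shift[THEN iffD1, OF this] show ?thesis by (simp add: add.commute)
  qed
  from this[THEN has_vector_derivative_of_real] show ?thesis using True
    by (auto simp: has_pdiff_def coord_fun_def axis_def o_def)
qed (auto simp: has_pdiff_def coord_fun_def axis_def)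

lemma deriv_seq_continuous: "deriv_seq G \<Longrightarrow> continuous_on A (G j)"
  unfolding deriv_seq_def by (metis DERIV_isCont continuous_at_imp_continuous_on)

lemma smooth_coord_fun:
  assumes G: "deriv_seq G" shows "smooth_fun (coord_fun i (G j))"
proof (rule smooth_fun_coinduct[of _ "insert (\<lambda>_. 0) (range (\<lambda>j. coord_fun i (G j)))"])
  fix f assume f: "f \<in> insert (\<lambda>_. 0) (range (\<lambda>j. coord_fun i (G j)))"
  show "continuous_on UNIV f"
    using f unfolding coord_fun_def
    by (auto intro!: continuous_on_compose2[OF deriv_seq_continuous[OF G, of UNIV]] continuous_intros)
  show "\<exists>g\<in>insert (\<lambda>_. 0) (range (\<lambda>j. coord_fun i (G j))). has_pdiff f l g" for l
  proof -
    consider "f = (\<lambda>_. 0)" | m where "f = coord_fun i (G m)" using f by auto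
    then show ?thesis
    proof cases
      case 2
      then show ?thesis using has_pdiff_coord_fun[of "G m" "G (Suc m)" i l] G
        by (cases "l = i") (auto simp: deriv_seq_def)
    qed (use has_pdiff_const in auto)
  qed
qed auto

lemma iter_pdiff_coord_fun:
  assumes G: "deriv_seq G"
  shows "iter_pdiff is (coord_fun i (G j)) =
     (if set is \<subseteq> {i} then coord_fun i (G (j + length is)) else (\<lambda>_. 0))"
proof (induction "is")
  case (Cons l "is")
  have "pdiff l (coord_fun i (G m)) = (if l = i then coord_fun i (G (Suc m)) else (\<lambda>_. 0))" for m
    using G by (intro has_pdiff_imp has_pdiff_coord_fun) (auto simp: deriv_seq_def)
  then show ?case using Cons has_pdiff_imp[OF has_pdiff_const[where c = 0 and i = l]] by (auto simp: iter_pdiff_Cons)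
qed simp

section \<open>Closure properties of smooth functions of one real variable\<close>

lemma smooth1_coinduct:
  assumes "g \<in> S" "\<And>f. f \<in> S \<Longrightarrow> \<exists>f'\<in>S. \<forall>x. (f has_real_derivative f' x) (at x)"
  shows "smooth1 g"
proof -
  obtain D where D: "\<And>f. f \<in> S \<Longrightarrow> D f \<in> S" "\<And>f x. f \<in> S \<Longrightarrow> (f has_real_derivative D f x) (at x)"
    using assms(2) by metis
  have S: "(D ^^ j) g \<in> S" for j by (induction j) (auto simp: assms D)
  show ?thesis unfolding smooth1_def deriv_seq_def
    by (rule exI[of _ "\<lambda>j. (D ^^ j) g"]) (use S D in auto)
qed

lemma smooth1_deriv:
  assumes "smooth1 g" obtains g' where "smooth1 g'" "\<And>x. (g has_real_derivative g' x) (at x)"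
proof -
  obtain G where "deriv_seq G" "G 0 = g" using assms by (auto simp: smooth1_def)
  moreover have "smooth1 (G (Suc 0))" unfolding smooth1_def
    by (rule exI[of _ "\<lambda>j. G (Suc j)"]) (use calculation in \<open>auto simp: deriv_seq_def\<close>)
  ultimately show ?thesis using that[of "G (Suc 0)"] by (auto simp: deriv_seq_def)
qed

text \<open>The algebra generated by the smooth functions and 1/h is closed under differentiation
  because (1/h)' = -h' (1/h)^2. This yields sums, products and reciprocals of smooth functions from
  a single coinduction.\<close>

inductive alg :: "(real \<Rightarrow> real) \<Rightarrow> (real \<Rightarrow> real) \<Rightarrow> bool" for h where
  base: "smooth1 g \<Longrightarrow> alg h g"
| inv: "alg h (\<lambda>x. inverse (h x))"
| add: "alg h f \<Longrightarrow> alg h g \<Longrightarrow> alg h (\<lambda>x. f x + g x)"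
| mult: "alg h f \<Longrightarrow> alg h g \<Longrightarrow> alg h (\<lambda>x. f x * g x)"

lemma smooth1_const: "smooth1 (\<lambda>_. c)"
  by (rule smooth1_coinduct[of _ "range (\<lambda>c x. c)"]) (auto intro!: derivative_eq_intros)

lemma alg_smooth1:
  assumes h: "smooth1 h" "\<And>x. h x \<noteq> 0" and "alg h f" shows "smooth1 f"
proof (rule smooth1_coinduct[of _ "Collect (alg h)"])
  fix f assume "f \<in> Collect (alg h)"
  then have "alg h f" by simp
  then show "\<exists>f'\<in>Collect (alg h). \<forall>x. (f has_real_derivative f' x) (at x)"
  proof induction
    case (base g)
    then show ?case by (metis smooth1_deriv alg.base mem_Collect_eq)
  next
    case inv
    obtain h' where h': "smooth1 h'" "\<And>x. (h has_real_derivative h' x) (at x)"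
      using smooth1_deriv[OF h(1)] by blast
    have "alg h (\<lambda>x. (-1) * (h' x * (inverse (h x) * inverse (h x))))"
      by (intro alg.mult alg.inv alg.base h' smooth1_const)
    moreover have "((\<lambda>x. inverse (h x)) has_real_derivative (-1) * (h' x * (inverse (h x) * inverse (h x)))) (at x)" for x
      using h'(2)[of x] h(2)[of x] by (auto intro!: derivative_eq_intros simp: field_simps)
    ultimately show ?case
      by (intro bexI[of _ "\<lambda>x. (-1) * (h' x * (inverse (h x) * inverse (h x)))"]) auto
  next
    case (add f g)
    then obtain f' g' where "alg h f'" "\<And>x. (f has_real_derivative f' x) (at x)"
       "alg h g'" "\<And>x. (g has_real_derivative g' x) (at x)" by auto
    moreover from this have "alg h (\<lambda>x. f' x + g' x)" by (intro alg.add)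
    ultimately show ?case by (auto intro!: bexI[of _ "\<lambda>x. f' x + g' x"] derivative_eq_intros)
  next
    case (mult f g)
    then obtain f' g' where d: "alg h f'" "\<And>x. (f has_real_derivative f' x) (at x)"
       "alg h g'" "\<And>x. (g has_real_derivative g' x) (at x)" by auto
    moreover from this mult have "alg h (\<lambda>x. f' x * g x + f x * g' x)" by (intro alg.add alg.mult)
    ultimately show ?case by (intro bexI[of _ "\<lambda>x. f' x * g x + f x * g' x"]) (auto intro!: derivative_eq_intros)
  qed
qed (use assms in auto)

lemma smooth1_add: "smooth1 f \<Longrightarrow> smooth1 g \<Longrightarrow> smooth1 (\<lambda>x. f x + g x)"
  by (rule alg_smooth1[OF smooth1_const[of 1]]) (auto intro: alg.intros)

lemma smooth1_mult: "smooth1 f \<Longrightarrow> smooth1 g \<Longrightarrow> smooth1 (\<lambda>x. f x * g x)"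
  by (rule alg_smooth1[OF smooth1_const[of 1]]) (auto intro: alg.intros)

lemma smooth1_inverse: "smooth1 h \<Longrightarrow> (\<And>x. h x \<noteq> 0) \<Longrightarrow> smooth1 (\<lambda>x. inverse (h x))"
  by (rule alg_smooth1[of h]) (auto intro: alg.intros)

lemma deriv_seq_affine:
  assumes "deriv_seq G" shows "deriv_seq (\<lambda>j x. a ^ j * G j (a * x + b))"
  unfolding deriv_seq_def
proof (intro allI)
  fix j x
  have "((\<lambda>x. G j (a * x + b)) has_real_derivative G (Suc j) (a * x + b) * a) (at x)"
    using assms unfolding deriv_seq_def
    by (intro DERIV_chain'[where f = "\<lambda>x. a * x + b" and g = "G j"]) (auto intro!: derivative_eq_intros)
  from DERIV_cmult[OF this, of "a ^ j"]
  show "((\<lambda>x. a ^ j * G j (a * x + b)) has_real_derivative a ^ Suc j * G (Suc j) (a * x + b)) (at x)"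
    by (simp add: mult_ac)
qed

lemma smooth1_affine: "smooth1 g \<Longrightarrow> smooth1 (\<lambda>x. g (a * x + b))"
  unfolding smooth1_def using deriv_seq_affine[of _ a b] by fastforce

section \<open>A smooth step function with bounded derivatives\<close>

lemma tendsto_poly_mult_exp_0:
  fixes p :: "real poly"
  shows "((\<lambda>y. poly p y * exp (- y)) \<longlongrightarrow> 0) at_top"
proof -
  have "((\<lambda>y. \<Sum>i\<le>degree p. coeff p i * (y ^ i / exp y)) \<longlongrightarrow> (\<Sum>i\<le>degree p. coeff p i * 0)) at_top"
    by (intro tendsto_intros tendsto_power_div_exp_0)
  then show ?thesis
    by (simp add: poly_altdef sum_distrib_right sum_divide_distrib exp_minus field_simps)
qed

text \<open>The classical function exp(-1/x) extended by zero, with an arbitrary polynomial in 1/x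
  in front: it is these factors that make the family closed under differentiation.\<close>

definition flat :: "real poly \<Rightarrow> real \<Rightarrow> real" where
  "flat p x = (if x > 0 then poly p (1 / x) * exp (- (1 / x)) else 0)"

lemma flat_tendsto_0: "((\<lambda>x. flat p x) \<longlongrightarrow> 0) (at_right 0)"
proof -
  have "((\<lambda>x. poly p (1 / x) * exp (- (1 / x))) \<longlongrightarrow> 0) (at_right 0)"
    by (rule filterlim_compose[OF tendsto_poly_mult_exp_0])
       (simp add: divide_inverse filterlim_inverse_at_top_right)
  then show ?thesis
    by (rule Lim_transform_eventually) (auto simp: flat_def eventually_at_filter)
qed

lemma smooth1_flat: "smooth1 (flat p)"
proof (rule smooth1_coinduct[of _ "range flat"])
  fix f assume "f \<in> range flat"
  then obtain p where f: "f = flat p" by auto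
  \<comment> \<open>In the variable u = 1/x one has d/dx = -u^2 d/du, so p(u) exp(-u) has derivative
    u^2 (p - p')(u) exp(-u).\<close>
  define q where "q = (p - pderiv p) * [:0, 0, 1:]"
  have "(flat p has_real_derivative flat q x) (at x)" for x
  proof -
    consider "x > 0" | "x < 0" | "x = 0" by linarith
    then show ?thesis
    proof cases
      case 1
      have "((\<lambda>x. poly p (1 / x) * exp (- (1 / x))) has_real_derivative flat q x) (at x)"
        using 1 by (auto intro!: derivative_eq_intros simp: flat_def q_def field_simps power2_eq_square)
      then show ?thesis
        by (rule DERIV_cong_ev[THEN iffD1, rotated -1])
           (use 1 in \<open>auto simp: flat_def intro!: eventually_mono[OF eventually_gt_at_top] eventually_nhds_in_open[of "{0<..}" x, THEN eventually_mono]\<close>)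
    next
      case 2
      have "((\<lambda>x. 0) has_real_derivative flat q x) (at x)" using 2 by (simp add: flat_def)
      then show ?thesis
        by (rule DERIV_cong_ev[THEN iffD1, rotated -1])
           (use 2 in \<open>auto simp: flat_def intro!: eventually_nhds_in_open[of "{..<0}" x, THEN eventually_mono]\<close>)
    next
      case 3
      \<comment> \<open>At the origin the difference quotient from the right multiplies p by u =
        1/h, so it is again a member of the family and tends to 0.\<close>
      have eq: "flat (pCons 0 p) h = (flat p (0 + h) - flat p 0) / h" if "h > 0" for h
        using that by (simp add: flat_def)
      have "((\<lambda>h. (flat p (0 + h) - flat p 0) / h) \<longlongrightarrow> 0) (at_right 0)"
        by (rule Lim_transform_eventually[OF flat_tendsto_0[of "pCons 0 p"]])
           (auto simp: eventually_at_filter eq)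
      moreover have "((\<lambda>h. (flat p (0 + h) - flat p 0) / h) \<longlongrightarrow> 0) (at_left 0)"
        by (rule Lim_transform_eventually[OF tendsto_const[of 0]])
           (auto simp: eventually_at_filter flat_def)
      ultimately show ?thesis
        using 3 by (simp add: DERIV_def filterlim_split_at flat_def)
    qed
  qed
  then show "\<exists>f'\<in>range flat. \<forall>x. (f has_real_derivative f' x) (at x)" using f by blast
qed auto

text \<open>The quotient e(x) / (e(x) + e(1 - x)) with e = \<open>flat [:1:]\<close>, whose
  denominator is positive everywhere. It is constant to the left of 0 and to the right of 1, so its
  derivatives vanish there, and on [0, 1] they are bounded by continuity.\<close>

lemma ex_step:
  "\<exists>G. deriv_seq G \<and> (\<forall>x\<le>0. G 0 x = 0) \<and> (\<forall>x\<ge>1. G 0 x = 1) \<and> (\<forall>x>0. G 0 x > 0) \<and>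
     (\<forall>j. \<exists>B. \<forall>x. \<bar>G j x\<bar> \<le> B)"
proof -
  define h where "h x = flat [:1:] x + flat [:1:] ((-1) * x + 1)" for x
  have nn: "flat [:1:] x \<ge> 0" for x by (simp add: flat_def)
  have pos: "flat [:1:] x > 0" if "x > 0" for x using that by (simp add: flat_def)
  have hpos: "h x > 0" for x
    using nn[of x] pos[of x] nn[of "(-1) * x + 1"] pos[of "(-1) * x + 1"]
    by (cases "x > 0") (auto simp: h_def)
  have "smooth1 h" unfolding h_def by (intro smooth1_add smooth1_affine smooth1_flat)
  then have "smooth1 (\<lambda>x. flat [:1:] x * inverse (h x))"
    using hpos by (intro smooth1_mult smooth1_flat smooth1_inverse) (auto simp: less_imp_neq[symmetric])
  then obtain G where G: "deriv_seq G" "\<And>x. G 0 x = flat [:1:] x * inverse (h x)"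
    by (auto simp: smooth1_def)
  have 0: "G 0 x = 0" if "x \<le> 0" for x using that by (simp add: G flat_def)
  have 1: "G 0 x = 1" if "x \<ge> 1" for x
    using that hpos[of x] by (simp add: G h_def flat_def)
  have L: "G j x = 0" if "x < 0" for x j
    using that
  proof (induction j arbitrary: x)
    case (Suc j)
    have "(G j has_real_derivative G (Suc j) x) (at x)" using G by (simp add: deriv_seq_def)
    moreover have "(G j has_real_derivative 0) (at x)"
      by (rule DERIV_cong_ev[THEN iffD2, OF refl _ refl, of _ "\<lambda>_. 0"])
         (use Suc in \<open>auto intro!: eventually_nhds_in_open[of "{..<0}" x, THEN eventually_mono]\<close>)
    ultimately show ?case by (rule DERIV_unique)
  qed (simp add: 0)
  have R: "G j x = (if j = 0 then 1 else 0)" if "x > 1" for x j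
    using that
  proof (induction j arbitrary: x)
    case (Suc j)
    have "(G j has_real_derivative G (Suc j) x) (at x)" using G by (simp add: deriv_seq_def)
    moreover have "(G j has_real_derivative 0) (at x)"
      by (rule DERIV_cong_ev[THEN iffD2, OF refl _ refl, of _ "\<lambda>_. if j = 0 then 1 else 0"])
         (use Suc in \<open>auto intro!: eventually_nhds_in_open[of "{1<..}" x, THEN eventually_mono]\<close>)
    ultimately have "G (Suc j) x = 0" by (rule DERIV_unique)
    then show ?case by simp
  qed (simp add: 1)
  have "\<exists>B. \<forall>x. \<bar>G j x\<bar> \<le> B" for j
  proof -
    have "bounded (G j ` {0..1})"
      by (intro compact_imp_bounded compact_continuous_image deriv_seq_continuous G) auto
    then obtain B where "\<forall>x\<in>{0..1}. \<bar>G j x\<bar> \<le> B" by (auto simp: bounded_iff)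
    then have B: "\<And>x. x \<in> {0..1} \<Longrightarrow> \<bar>G j x\<bar> \<le> B" by blast
    have "\<bar>G j x\<bar> \<le> max B 1" for x
      using B[of x] L[of x j] R[of x j] by (cases "x < 0"; cases "x > 1") (auto simp: max_def)
    then show ?thesis by blast
  qed
  moreover have "G 0 x > 0" if "x > 0" for x using pos[OF that] hpos[of x] by (simp add: G)
  ultimately show ?thesis using G 0 1 by blast
qed

definition step_seq :: "nat \<Rightarrow> real \<Rightarrow> real" where
  "step_seq = (SOME G. deriv_seq G \<and> (\<forall>x\<le>0. G 0 x = 0) \<and> (\<forall>x\<ge>1. G 0 x = 1) \<and> (\<forall>x>0. G 0 x > 0) \<and>
     (\<forall>j. \<exists>B. \<forall>x. \<bar>G j x\<bar> \<le> B))"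

lemma step_seq:
  shows deriv_seq_step: "deriv_seq step_seq"
    and step_0: "\<And>x. x \<le> 0 \<Longrightarrow> step_seq 0 x = 0"
    and step_1: "\<And>x. x \<ge> 1 \<Longrightarrow> step_seq 0 x = 1"
    and step_pos: "\<And>x. x > 0 \<Longrightarrow> step_seq 0 x > 0"
    and step_bounded: "\<exists>B. \<forall>x. \<bar>step_seq j x\<bar> \<le> B"
  using someI_ex[OF ex_step] unfolding step_seq_def[symmetric] by blast+

text \<open>All derivatives are controlled by one weight w up to polynomial factors. The weight 1
  expresses polynomial growth, an exponential weight expresses exponential decay, and weights
  multiply under products.\<close>

definition dominated :: "(real^'n::finite \<Rightarrow> real) \<Rightarrow> (real^'n \<Rightarrow> complex) \<Rightarrow> bool" where
  "dominated w f \<longleftrightarrow> smooth_fun f \<and>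
     (\<forall>is. \<exists>C d. \<forall>x. norm (iter_pdiff is f x) \<le> C * (1 + norm x) ^ d * w x)"

lemma dominated_smooth: "dominated w f \<Longrightarrow> smooth_fun f"
  by (simp add: dominated_def)

text \<open>There are only finitely many lists of directions of length at most L, so their constants
  and degrees can be summed into common ones.\<close>

lemma dominated_uniform:
  fixes f :: "real^'n::finite \<Rightarrow> complex"
  assumes "dominated w f" "\<And>x. 0 \<le> w x"
  obtains C d where "C \<ge> 0"
    "\<And>is x. length is \<le> L \<Longrightarrow> norm (iter_pdiff is f x) \<le> C * (1 + norm x) ^ d * w x"
proof -
  from assms(1) obtain C d where Cd:
    "\<And>is x. norm (iter_pdiff is f x) \<le> C is * (1 + norm x) ^ d is * w x"
    unfolding dominated_def by metis
  define S where "S = {is::'n list. length is \<le> L}"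
  have fin: "finite S" unfolding S_def using finite_lists_length_le[of "UNIV :: 'n set" L] by simp
  have "norm (iter_pdiff is f x) \<le> (\<Sum>is\<in>S. \<bar>C is\<bar>) * (1 + norm x) ^ (\<Sum>is\<in>S. d is) * w x"
    if "length is \<le> L" for "is" x
  proof -
    have "is \<in> S" using that by (simp add: S_def)
    have "C is * (1 + norm x) ^ d is \<le> (\<Sum>is\<in>S. \<bar>C is\<bar>) * (1 + norm x) ^ (\<Sum>is\<in>S. d is)"
    proof (rule mult_mono)
      show "C is \<le> (\<Sum>is\<in>S. \<bar>C is\<bar>)"
        using member_le_sum[of "is" S "\<lambda>is. \<bar>C is\<bar>"] \<open>is \<in> S\<close> fin by fastforce
      show "(1 + norm x) ^ d is \<le> (1 + norm x) ^ (\<Sum>is\<in>S. d is)"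
        using member_le_sum[of "is" S d] \<open>is \<in> S\<close> fin by (intro power_increasing) auto
    qed (auto intro!: sum_nonneg)
    from order_trans[OF Cd mult_right_mono[OF this assms(2)]] show ?thesis .
  qed
  then show ?thesis using that[of "\<Sum>is\<in>S. \<bar>C is\<bar>"] by (auto intro!: sum_nonneg)
qed

lemma dominated_mult:
  assumes f: "dominated w f" "\<And>x. 0 \<le> w x" and g: "dominated v g" "\<And>x. 0 \<le> v x"
  shows "dominated (\<lambda>x. w x * v x) (\<lambda>x. f x * g x)"
  unfolding dominated_def
proof (intro conjI allI)
  show "smooth_fun (\<lambda>x. f x * g x)" using assms by (auto simp: dominated_def intro!: smooth_fun_mult)
  fix "is" :: "'a list"
  obtain C d where C: "C \<ge> 0" "\<And>js x. length js \<le> length is \<Longrightarrow> norm (iter_pdiff js f x) \<le> C * (1 + norm x) ^ d * w x"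
    using dominated_uniform[OF f] by metis
  obtain D e where D: "D \<ge> 0" "\<And>js x. length js \<le> length is \<Longrightarrow> norm (iter_pdiff js g x) \<le> D * (1 + norm x) ^ e * v x"
    using dominated_uniform[OF g] by metis
  have "norm (iter_pdiff is (\<lambda>x. f x * g x) x) \<le> (2 ^ length is * C * D) * (1 + norm x) ^ (d + e) * (w x * v x)" for x
  proof -
    have "norm (iter_pdiff is (\<lambda>x. f x * g x) x) \<le> 2 ^ length is * (C * (1 + norm x) ^ d * w x) * (D * (1 + norm x) ^ e * v x)"
      using assms by (intro iter_pdiff_mult_bound C D) (auto simp: dominated_def)
    then show ?thesis by (simp add: power_add mult_ac)
  qed
  then show "\<exists>C d. \<forall>x. norm (iter_pdiff is (\<lambda>x. f x * g x) x) \<le> C * (1 + norm x) ^ d * (w x * v x)"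
    by blast
qed

section \<open>Functions of polynomial growth\<close>

abbreviation "poly_growth \<equiv> dominated (\<lambda>_. 1)"

lemma poly_growth_mult: "poly_growth f \<Longrightarrow> poly_growth g \<Longrightarrow> poly_growth (\<lambda>x. f x * g x)"
  using dominated_mult[of "\<lambda>_. 1" f "\<lambda>_. 1" g] by simp

lemma poly_growth_const: "poly_growth (\<lambda>x. c)"
  unfolding dominated_def
proof (intro conjI allI)
  fix "is" :: "'a list"
  show "\<exists>C d. \<forall>x. norm (iter_pdiff is (\<lambda>x. c) x) \<le> C * (1 + norm x) ^ d * 1"
    by (rule exI[of _ "norm c"], rule exI[of _ 0]) (simp add: iter_pdiff_const)
qed (rule smooth_fun_const)

lemma poly_growth_add:
  assumes "poly_growth f" "poly_growth g" shows "poly_growth (\<lambda>x. f x + g x)"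
  unfolding dominated_def
proof (intro conjI allI)
  show "smooth_fun (\<lambda>x. f x + g x)" using assms by (auto simp: dominated_def intro!: smooth_fun_add)
  fix "is" :: "'a list"
  obtain C d where C: "C \<ge> 0" "\<And>js x. length js \<le> length is \<Longrightarrow> norm (iter_pdiff js f x) \<le> C * (1 + norm x) ^ d * 1"
    using dominated_uniform[OF assms(1), of "length is"] by (metis zero_le_one)
  obtain D e where D: "D \<ge> 0" "\<And>js x. length js \<le> length is \<Longrightarrow> norm (iter_pdiff js g x) \<le> D * (1 + norm x) ^ e * 1"
    using dominated_uniform[OF assms(2), of "length is"] by (metis zero_le_one)
  have "norm (iter_pdiff is (\<lambda>x. f x + g x) x) \<le> (C + D) * (1 + norm x) ^ (d + e) * 1" for x
  proof -
    have "norm (iter_pdiff is f x) \<le> C * (1 + norm x) ^ (d + e)"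
      using C(2)[of "is" x] C(1) mult_left_mono[OF power_increasing[of d "d + e" "1 + norm x"] C(1)] by simp
    moreover have "norm (iter_pdiff is g x) \<le> D * (1 + norm x) ^ (d + e)"
      using D(2)[of "is" x] D(1) mult_left_mono[OF power_increasing[of e "d + e" "1 + norm x"] D(1)] by simp
    ultimately show ?thesis using assms norm_triangle_ineq[of "iter_pdiff is f x" "iter_pdiff is g x"]
      by (simp add: dominated_def iter_pdiff_add algebra_simps)
  qed
  then show "\<exists>C d. \<forall>x. norm (iter_pdiff is (\<lambda>x. f x + g x) x) \<le> C * (1 + norm x) ^ d * 1"
    by blast
qed

lemma poly_growth_sum: "(\<And>a. a \<in> A \<Longrightarrow> poly_growth (f a)) \<Longrightarrow> poly_growth (\<lambda>x. \<Sum>a\<in>A. f a x)"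
  by (induction A rule: infinite_finite_induct) (auto intro!: poly_growth_const poly_growth_add)

lemma poly_growth_prod: "(\<And>a. a \<in> A \<Longrightarrow> poly_growth (f a)) \<Longrightarrow> poly_growth (\<lambda>x. \<Prod>a\<in>A. f a x)"
  by (induction A rule: infinite_finite_induct) (auto intro!: poly_growth_const poly_growth_mult)

lemma poly_growth_power: "poly_growth f \<Longrightarrow> poly_growth (\<lambda>x. f x ^ m)"
  by (induction m) (auto intro!: poly_growth_const poly_growth_mult)

lemma poly_growth_coord_fun:
  assumes G: "deriv_seq G" "\<And>j. \<exists>C d. \<forall>t. \<bar>G j t\<bar> \<le> C * (1 + \<bar>t\<bar>) ^ d"
  shows "poly_growth (coord_fun i (G 0))"
  unfolding dominated_def
proof (intro conjI allI)
  fix "is" :: "'a list"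
  obtain C d where C: "\<And>t. \<bar>G (length is) t\<bar> \<le> C * (1 + \<bar>t\<bar>) ^ d" using G(2) by blast
  have "0 \<le> C" using C[of 0] by simp
  have "norm (iter_pdiff is (coord_fun i (G 0)) x) \<le> C * (1 + norm x) ^ d * 1" for x
  proof -
    have "\<bar>G (length is) (x $ i)\<bar> \<le> C * (1 + norm x) ^ d"
      using C[of "x $ i"] mult_left_mono[OF power_mono[of "1 + \<bar>x $ i\<bar>" "1 + norm x" d] \<open>0 \<le> C\<close>]
        component_le_norm_cart[of x i] by simp
    then show ?thesis using \<open>0 \<le> C\<close> by (auto simp: iter_pdiff_coord_fun[OF G(1)] coord_fun_def)
  qed
  then show "\<exists>C d. \<forall>x. norm (iter_pdiff is (coord_fun i (G 0)) x) \<le> C * (1 + norm x) ^ d * 1" by blast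
qed (use smooth_coord_fun[OF G(1)] in auto)

lemma poly_growth_coord: "poly_growth (\<lambda>x. complex_of_real (x $ i))"
proof -
  define G where "G j = (if j = 0 then \<lambda>t. t else if j = 1 then \<lambda>_. 1 else (\<lambda>_. 0 :: real))" for j :: nat
  have "deriv_seq G" unfolding deriv_seq_def
  proof (intro allI)
    fix j x show "(G j has_real_derivative G (Suc j) x) (at x)"
      by (cases j) (auto simp: G_def)
  qed
  moreover have "\<exists>C d. \<forall>t. \<bar>G j t\<bar> \<le> C * (1 + \<bar>t\<bar>) ^ d" for j
    by (rule exI[of _ 1], rule exI[of _ 1]) (auto simp: G_def)
  ultimately have "poly_growth (coord_fun i (G 0))" by (rule poly_growth_coord_fun)
  then show ?thesis by (simp add: coord_fun_def[abs_def] G_def)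
qed

section \<open>Schwartz functions and continuous functionals on them\<close>

lemma schwartz_dominated:
  assumes f: "dominated w f" and w: "\<And>x. 0 \<le> w x" "\<And>d. \<exists>B. \<forall>x. (1 + norm x) ^ d * w x \<le> B"
  shows "schwartz f"
  unfolding schwartz_def
proof (intro conjI allI)
  fix "is" :: "'a list" and m
  obtain C d where C: "C \<ge> 0" "\<And>x. norm (iter_pdiff is f x) \<le> C * (1 + norm x) ^ d * w x"
    using dominated_uniform[OF f w(1)] by (metis order_refl)
  obtain B where B: "\<And>x. (1 + norm x) ^ (m + d) * w x \<le> B" using w(2) by blast
  have "(1 + norm x) ^ m * norm (iter_pdiff is f x) \<le> C * B" for x
  proof -
    have "(1 + norm x) ^ m * norm (iter_pdiff is f x) \<le> (1 + norm x) ^ m * (C * (1 + norm x) ^ d * w x)"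
      by (intro mult_left_mono C) auto
    also have "\<dots> = C * ((1 + norm x) ^ (m + d) * w x)" by (simp add: power_add mult_ac)
    also have "\<dots> \<le> C * B" by (intro mult_left_mono B C)
    finally show ?thesis .
  qed
  then show "\<exists>B. \<forall>x. (1 + norm x) ^ m * norm (iter_pdiff is f x) \<le> B" by blast
qed (use f in \<open>auto simp: dominated_def\<close>)

lemma schwartz_smooth: "schwartz f \<Longrightarrow> smooth_fun f"
  by (simp add: schwartz_def)

lemma schwartz_add:
  assumes "schwartz f" "schwartz g" shows "schwartz (\<lambda>x. f x + g x)"
  unfolding schwartz_def
proof (intro conjI allI)
  fix "is" :: "'a list" and m
  obtain B C where "\<And>x. (1 + norm x) ^ m * norm (iter_pdiff is f x) \<le> B" "\<And>x. (1 + norm x) ^ m * norm (iter_pdiff is g x) \<le> C"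
    using assms unfolding schwartz_def by metis
  note BC = this
  have "(1 + norm x) ^ m * norm (iter_pdiff is (\<lambda>x. f x + g x) x) \<le> B + C" for x
  proof -
    have "(1 + norm x) ^ m * norm (iter_pdiff is (\<lambda>x. f x + g x) x) \<le>
        (1 + norm x) ^ m * (norm (iter_pdiff is f x) + norm (iter_pdiff is g x))"
      using assms by (auto simp: schwartz_def iter_pdiff_add intro!: mult_left_mono norm_triangle_ineq)
    with BC[of x] show ?thesis by (simp add: distrib_left)
  qed
  then show "\<exists>B. \<forall>x. (1 + norm x) ^ m * norm (iter_pdiff is (\<lambda>x. f x + g x) x) \<le> B" by blast
qed (use assms in \<open>auto simp: schwartz_def intro!: smooth_fun_add\<close>)

lemma schwartz_mult:
  assumes "poly_growth g" "schwartz f" shows "schwartz (\<lambda>x. g x * f x)"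
  unfolding schwartz_def
proof (intro conjI allI)
  fix "is" :: "'a list" and m
  obtain C d where C: "C \<ge> 0" "\<And>js x. length js \<le> length is \<Longrightarrow> norm (iter_pdiff js g x) \<le> C * (1 + norm x) ^ d * 1"
    using dominated_uniform[OF assms(1), of "length is"] by (metis zero_le_one)
  obtain B where B: "\<And>js x. (1 + norm x) ^ (m + d) * norm (iter_pdiff js f x) \<le> B js"
  proof -
    have "\<forall>js. \<exists>B. \<forall>x. (1 + norm x) ^ (m + d) * norm (iter_pdiff js f x) \<le> B"
      using assms(2) unfolding schwartz_def by blast
    from choice[OF this] show ?thesis using that by blast
  qed
  define S where "S = {js::'a list. length js \<le> length is}"
  have fin: "finite S" unfolding S_def using finite_lists_length_le[of "UNIV :: 'a set" "length is"] by simp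
  have "(1 + norm x) ^ m * norm (iter_pdiff is (\<lambda>x. g x * f x) x) \<le> 2 ^ length is * C * (\<Sum>js\<in>S. \<bar>B js\<bar>)" for x
  proof -
    have p: "(1 + norm x) > 0" by (smt (verit) norm_ge_zero)
    have "norm (iter_pdiff js f x) \<le> (\<Sum>js\<in>S. \<bar>B js\<bar>) / (1 + norm x) ^ (m + d)" if "length js \<le> length is" for js
    proof -
      have "js \<in> S" using that by (simp add: S_def)
      have "(1 + norm x) ^ (m + d) * norm (iter_pdiff js f x) \<le> B js" by (rule B)
      also have "\<dots> \<le> (\<Sum>js\<in>S. \<bar>B js\<bar>)"
        using member_le_sum[of "js" S "\<lambda>js. \<bar>B js\<bar>"] \<open>js \<in> S\<close> fin by fastforce
      finally show ?thesis using p by (simp add: field_simps)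
    qed
    from iter_pdiff_mult_bound[OF _ _ C(2) this]
    have "norm (iter_pdiff is (\<lambda>x. g x * f x) x) \<le>
      2 ^ length is * (C * (1 + norm x) ^ d * 1) * ((\<Sum>js\<in>S. \<bar>B js\<bar>) / (1 + norm x) ^ (m + d))"
      using assms by (auto simp: schwartz_def dominated_def)
    also have "\<dots> = (2 ^ length is * C * (\<Sum>js\<in>S. \<bar>B js\<bar>)) / (1 + norm x) ^ m"
      using p by (simp add: power_add field_simps)
    finally show ?thesis using p by (simp add: field_simps)
  qed
  then show "\<exists>B. \<forall>x. (1 + norm x) ^ m * norm (iter_pdiff is (\<lambda>x. g x * f x) x) \<le> B" by blast
qed (use assms in \<open>auto simp: schwartz_def dominated_def intro!: smooth_fun_mult\<close>)

lemma schwartz_cmult: "schwartz f \<Longrightarrow> schwartz (\<lambda>x. c * f x)"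
  by (rule schwartz_mult[OF poly_growth_const])

lemma schwartz_diff: "schwartz f \<Longrightarrow> schwartz g \<Longrightarrow> schwartz (\<lambda>x. f x - g x)"
  using schwartz_add[of f "\<lambda>x. (-1) * g x"] schwartz_cmult[of g "-1"] by simp

lemma schwartz_0: "schwartz (\<lambda>x. 0)"
  by (rule schwartz_dominated[of "\<lambda>_. 0"]) (auto simp: dominated_def smooth_fun_const iter_pdiff_const)

lemma schwartz_sum: "(\<And>a. a \<in> A \<Longrightarrow> schwartz (f a)) \<Longrightarrow> schwartz (\<lambda>x. \<Sum>a\<in>A. f a x)"
  by (induction A rule: infinite_finite_induct) (auto intro!: schwartz_0 schwartz_add)

text \<open>A bound on the seminorm, stated pointwise. Estimates then avoid the supremum in
  \<open>schwartz_seminorm\<close>, which would demand a proof of boundedness at each use.\<close>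

definition seminorm_le :: "nat \<Rightarrow> (real^'n::finite \<Rightarrow> complex) \<Rightarrow> real \<Rightarrow> bool" where
  "seminorm_le N f B \<longleftrightarrow> (\<forall>is x. length is \<le> N \<longrightarrow> (1 + norm x) ^ N * norm (iter_pdiff is f x) \<le> B)"

definition cts_functional :: "((real^'n::finite \<Rightarrow> complex) \<Rightarrow> complex) \<Rightarrow> bool" where
  "cts_functional u \<longleftrightarrow>
     (\<forall>f g. schwartz f \<longrightarrow> schwartz g \<longrightarrow> u (\<lambda>x. f x + g x) = u f + u g) \<and>
     (\<forall>c f. schwartz f \<longrightarrow> u (\<lambda>x. c * f x) = c * u f) \<and>
     (\<exists>C N. 0 \<le> C \<and> (\<forall>f B. schwartz f \<longrightarrow> seminorm_le N f B \<longrightarrow> norm (u f) \<le> C * B))"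

lemma seminorm_le_mono:
  assumes "seminorm_le N f B" "M \<le> N" shows "seminorm_le M f B"
  unfolding seminorm_le_def
proof (intro allI impI)
  fix "is" x assume "length (is::'a list) \<le> M"
  have "(1 + norm x) ^ M * norm (iter_pdiff is f x) \<le> (1 + norm x) ^ N * norm (iter_pdiff is f x)"
    using assms(2) by (intro mult_right_mono power_increasing) auto
  also have "\<dots> \<le> B" using assms \<open>length is \<le> M\<close> by (auto simp: seminorm_le_def)
  finally show "(1 + norm x) ^ M * norm (iter_pdiff is f x) \<le> B" .
qed

lemma tempered_cts_functional:
  assumes "tempered u" shows "cts_functional u"
proof -
  obtain C N where C: "\<And>f. schwartz f \<Longrightarrow> norm (u f) \<le> C * schwartz_seminorm N f"
    using assms unfolding tempered_def by blast
  have "norm (u f) \<le> \<bar>C\<bar> * B" if "schwartz f" "seminorm_le N f B" for f B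
  proof -
    let ?S = "{(1 + norm x) ^ N * norm (iter_pdiff is f x) | x is. length is \<le> N}"
    have le: "s \<le> B" if "s \<in> ?S" for s using \<open>seminorm_le N f B\<close> that by (auto simp: seminorm_le_def)
    have ne: "(1 + norm 0) ^ N * norm (iter_pdiff [] f 0) \<in> ?S"
      by (intro CollectI exI[of _ 0] exI[of _ "[]"]) simp
    have "schwartz_seminorm N f \<le> B" unfolding schwartz_seminorm_def
      using ne le by (intro cSup_least) blast+
    \<comment> \<open>Nonnegativity of the seminorm permits replacing C, whose sign
      \<open>tempered\<close> leaves open, by its absolute value.\<close>
    moreover have "0 \<le> schwartz_seminorm N f" unfolding schwartz_seminorm_def
      by (rule cSup_upper2[OF ne]) (use le in \<open>auto simp: bdd_above_def\<close>)
    ultimately have "C * schwartz_seminorm N f \<le> \<bar>C\<bar> * B"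
      by (intro mult_mono) auto
    with C[OF that(1)] show ?thesis by simp
  qed
  then show ?thesis using assms unfolding cts_functional_def tempered_def
    by (auto intro!: exI[of _ "\<bar>C\<bar>"] exI[of _ N])
qed

lemma cts_functional_diff:
  assumes "cts_functional u" "cts_functional v"
  shows "cts_functional (\<lambda>f. u f - v f)"
proof -
  obtain C N where C: "0 \<le> C" "\<And>f B. schwartz f \<Longrightarrow> seminorm_le N f B \<Longrightarrow> norm (u f) \<le> C * B"
    using assms(1) unfolding cts_functional_def by blast
  obtain D M where D: "0 \<le> D" "\<And>f B. schwartz f \<Longrightarrow> seminorm_le M f B \<Longrightarrow> norm (v f) \<le> D * B"
    using assms(2) unfolding cts_functional_def by blast
  have "norm (u f - v f) \<le> (C + D) * B" if "schwartz f" "seminorm_le (max M N) f B" for f B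
    using C(2)[OF that(1) seminorm_le_mono[OF that(2)]] D(2)[OF that(1) seminorm_le_mono[OF that(2)]]
      norm_triangle_ineq4[of "u f" "v f"] by (simp add: algebra_simps)
  then show ?thesis using assms C D unfolding cts_functional_def
    by (auto simp: algebra_simps intro!: exI[of _ "C + D"] exI[of _ "max M N"])
qed

context
  fixes u :: "(real^'n::finite \<Rightarrow> complex) \<Rightarrow> complex"
  assumes u: "cts_functional u"
begin

lemma cts_functional_add: "schwartz f \<Longrightarrow> schwartz g \<Longrightarrow> u (\<lambda>x. f x + g x) = u f + u g"
  using u by (auto simp: cts_functional_def)

lemma cts_functional_cmult: "schwartz f \<Longrightarrow> u (\<lambda>x. c * f x) = c * u f"
  using u by (auto simp: cts_functional_def)

lemma cts_functional_minus: "schwartz f \<Longrightarrow> schwartz g \<Longrightarrow> u (\<lambda>x. f x - g x) = u f - u g"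
  using cts_functional_add[of f "\<lambda>x. (-1) * g x"] cts_functional_cmult[of g "-1"] schwartz_cmult[of g "-1"] by simp

lemma cts_functional_sum:
  "(\<And>a. a \<in> A \<Longrightarrow> schwartz (f a)) \<Longrightarrow> u (\<lambda>x. \<Sum>a\<in>A. f a x) = (\<Sum>a\<in>A. u (f a))"
proof (induction A rule: infinite_finite_induct)
  case (insert a A)
  then show ?case by (simp add: cts_functional_add schwartz_sum)
qed (use cts_functional_cmult[OF schwartz_0, of 0] in auto)

text \<open>A density principle without limits. The order N is dictated by u, so the approximation
  has to be available in every seminorm.\<close>

lemma cts_functional_eq_0:
  assumes f: "schwartz f"
    and approx: "\<And>N e. e > 0 \<Longrightarrow> \<exists>g. schwartz g \<and> u g = 0 \<and> seminorm_le N (\<lambda>x. f x - g x) e"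
  shows "u f = 0"
proof -
  obtain C N where C: "0 \<le> C" "\<And>f B. schwartz f \<Longrightarrow> seminorm_le N f B \<Longrightarrow> norm (u f) \<le> C * B"
    using u unfolding cts_functional_def by blast
  have "norm (u f) \<le> e" if "e > 0" for e
  proof -
    \<comment> \<open>The summand 1 keeps the denominator positive when C = 0.\<close>
    have "e / (C + 1) > 0" using that C by simp
    from approx[OF this, of N] obtain g where g: "schwartz g" "u g = 0" "seminorm_le N (\<lambda>x. f x - g x) (e / (C + 1))"
      by blast
    have "norm (u f) \<le> C * (e / (C + 1))"
      using C(2)[OF schwartz_diff[OF f g(1)] g(3)] g(2) cts_functional_minus[OF f g(1)] by simp
    also have "\<dots> \<le> e" using C that by (simp add: field_simps)
    finally show ?thesis .
  qed
  then have "norm (u f) \<le> 0" by (meson dense_ge)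
  then show ?thesis by simp
qed

end

subsection \<open>The Laguerre ensemble\<close>

abbreviation leb_Pi :: "'i set \<Rightarrow> ('i \<Rightarrow> real) measure" where
  "leb_Pi A \<equiv> PiM A (\<lambda>_. lborel)"

interpretation leb: product_sigma_finite "\<lambda>_. lborel :: real measure"
  by standard

section \<open>Changes of variable in the product Lebesgue measure\<close>

lemma measurable_leb_Pi_component:
  "i \<in> A \<Longrightarrow> (\<lambda>y. y i) \<in> borel_measurable (leb_Pi A)"
  using measurable_component_singleton[of i A "\<lambda>_. lborel"] by simp

text \<open>A substitution acting on each coordinate separately reduces by Fubini and induction on A
  to the one-dimensional rule, which is the hypothesis \<open>cv\<close>; w is the one-dimensional
  Jacobian. Restricting to A keeps the new point inside the space of extensional functions.\<close>

lemma nn_integral_leb_Pi_change: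
  fixes F :: "('i \<Rightarrow> real) \<Rightarrow> ennreal"
  assumes A: "finite A" and [measurable]: "f \<in> borel_measurable borel" "w \<in> borel_measurable borel" "S \<in> sets borel" "T \<in> sets borel"
    and cv: "\<And>h :: real \<Rightarrow> ennreal. h \<in> borel_measurable borel \<Longrightarrow>
       (\<integral>\<^sup>+x. h x * indicator T x \<partial>lborel) = (\<integral>\<^sup>+x. h (f x) * (w x * indicator S x) \<partial>lborel)"
    and F: "F \<in> borel_measurable (leb_Pi A)"
  shows "(\<integral>\<^sup>+y. F y * (\<Prod>i\<in>A. indicator T (y i)) \<partial>leb_Pi A) =
         (\<integral>\<^sup>+y. F (\<lambda>i\<in>A. f (y i)) * (\<Prod>i\<in>A. w (y i) * indicator S (y i)) \<partial>leb_Pi A)"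
  using A F
proof (induction A arbitrary: F)
  case empty
  show ?case by (subst (1 2) leb.nn_integral_empty) (auto simp: restrict_def)
next
  case (insert i B)
  note F[measurable] = insert.prems
  have Fm: "(\<lambda>p. F ((fst p)(i := snd p))) \<in> borel_measurable (leb_Pi B \<Otimes>\<^sub>M borel)"
    by (rule measurable_compose[OF _ F], rule measurable_fun_upd[where J = B], blast) measurable
  have "(\<lambda>p. (fst p, f (snd p))) \<in> leb_Pi B \<Otimes>\<^sub>M borel \<rightarrow>\<^sub>M leb_Pi B \<Otimes>\<^sub>M borel" by measurable
  from measurable_compose[OF this Fm]
  have Ffm: "(\<lambda>p. F ((fst p)(i := f (snd p)))) \<in> borel_measurable (leb_Pi B \<Otimes>\<^sub>M borel)" by simp
  note [measurable] = Fm Ffm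
  have ne: "j \<noteq> i" if "j \<in> B" for j using that insert by auto
  define G where "G x = (\<integral>\<^sup>+y. F (x(i := f y)) * (w y * indicator S y) \<partial>lborel)" for x
  have [measurable]: "G \<in> borel_measurable (leb_Pi B)" unfolding G_def by measurable
  have m1: "(\<lambda>y. F (x(i := y))) \<in> borel_measurable borel" if "x \<in> space (leb_Pi B)" for x
    using measurable_compose[OF measurable_component_update[OF that insert.hyps(2)] F] by (simp del: fun_upd_apply)
  have "(\<integral>\<^sup>+y. F y * (\<Prod>j\<in>insert i B. indicator T (y j)) \<partial>leb_Pi (insert i B)) =
    (\<integral>\<^sup>+x. (\<integral>\<^sup>+y. F (x(i := y)) * (\<Prod>j\<in>insert i B. indicator T ((x(i := y)) j)) \<partial>lborel) \<partial>leb_Pi B)"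
    by (rule leb.product_nn_integral_insert) (use insert.hyps in measurable)
  also have "\<dots> = (\<integral>\<^sup>+x. G x * (\<Prod>j\<in>B. indicator T (x j)) \<partial>leb_Pi B)"
  proof (rule nn_integral_cong)
    fix x assume x: "x \<in> space (leb_Pi B)"
    note [measurable] = m1[OF x]
    have "(\<integral>\<^sup>+y. F (x(i := y)) * (\<Prod>j\<in>insert i B. indicator T ((x(i := y)) j)) \<partial>lborel) =
      (\<integral>\<^sup>+y. (F (x(i := y)) * indicator T y) * (\<Prod>j\<in>B. indicator T (x j)) \<partial>lborel)"
      using insert.hyps ne by (intro nn_integral_cong) (auto simp: mult_ac intro!: prod.cong)
    also have "\<dots> = (\<integral>\<^sup>+y. F (x(i := y)) * indicator T y \<partial>lborel) * (\<Prod>j\<in>B. indicator T (x j))"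
      by (rule nn_integral_multc) measurable
    also have "(\<integral>\<^sup>+y. F (x(i := y)) * indicator T y \<partial>lborel) = G x"
      unfolding G_def by (rule cv) measurable
    finally show "(\<integral>\<^sup>+y. F (x(i := y)) * (\<Prod>j\<in>insert i B. indicator T ((x(i := y)) j)) \<partial>lborel) =
      G x * (\<Prod>j\<in>B. indicator T (x j))" .
  qed
  also have "\<dots> = (\<integral>\<^sup>+x. G (\<lambda>j\<in>B. f (x j)) * (\<Prod>j\<in>B. w (x j) * indicator S (x j)) \<partial>leb_Pi B)"
    by (rule insert.IH) measurable
  also have "\<dots> = (\<integral>\<^sup>+x. (\<integral>\<^sup>+y. F (\<lambda>j\<in>insert i B. f ((x(i := y)) j)) *
      (\<Prod>j\<in>insert i B. w ((x(i := y)) j) * indicator S ((x(i := y)) j)) \<partial>lborel) \<partial>leb_Pi B)"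
  proof (rule nn_integral_cong)
    fix x assume x: "x \<in> space (leb_Pi B)"
    have "(\<lambda>j\<in>B. f (x j)) \<in> space (leb_Pi B)" by (auto simp: space_PiM)
    from m1[OF this] have [measurable]: "(\<lambda>y. F ((\<lambda>j\<in>B. f (x j))(i := y))) \<in> borel_measurable borel" .
    have eq: "(\<lambda>j\<in>insert i B. f ((x(i := y)) j)) = (\<lambda>j\<in>B. f (x j))(i := f y)" for y
      using ne by (auto simp: fun_eq_iff)
    have "G (\<lambda>j\<in>B. f (x j)) * (\<Prod>j\<in>B. w (x j) * indicator S (x j)) =
      (\<integral>\<^sup>+y. (F ((\<lambda>j\<in>B. f (x j))(i := f y)) * (w y * indicator S y)) * (\<Prod>j\<in>B. w (x j) * indicator S (x j)) \<partial>lborel)"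
      unfolding G_def by (rule nn_integral_multc[symmetric]) measurable
    also have "\<dots> = (\<integral>\<^sup>+y. F (\<lambda>j\<in>insert i B. f ((x(i := y)) j)) *
      (\<Prod>j\<in>insert i B. w ((x(i := y)) j) * indicator S ((x(i := y)) j)) \<partial>lborel)"
      unfolding eq using insert.hyps ne by (intro nn_integral_cong) (auto simp: mult_ac intro!: prod.cong)
    finally show "G (\<lambda>j\<in>B. f (x j)) * (\<Prod>j\<in>B. w (x j) * indicator S (x j)) = (\<integral>\<^sup>+y. F (\<lambda>j\<in>insert i B. f ((x(i := y)) j)) *
      (\<Prod>j\<in>insert i B. w ((x(i := y)) j) * indicator S ((x(i := y)) j)) \<partial>lborel)" .
  qed
  also have "\<dots> = (\<integral>\<^sup>+y. F (\<lambda>j\<in>insert i B. f (y j)) * (\<Prod>j\<in>insert i B. w (y j) * indicator S (y j)) \<partial>leb_Pi (insert i B))"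
    by (rule leb.product_nn_integral_insert[symmetric]) (use insert.hyps in measurable)
  finally show ?case .
qed

definition pos_on :: "'i set \<Rightarrow> ('i \<Rightarrow> real) \<Rightarrow> bool" where
  "pos_on A y \<longleftrightarrow> (\<forall>i\<in>A. 0 < y i)"

lemma SUP_mult_indicator:
  "(SUP m::nat. c * indicator (X m) x :: ennreal) = c * indicator (\<Union>m. X m) x"
proof (rule antisym)
  show "(SUP m::nat. c * indicator (X m) x :: ennreal) \<le> c * indicator (\<Union>m. X m) x"
    by (rule SUP_least) (auto simp: indicator_def)
  show "c * indicator (\<Union>m. X m) x \<le> (SUP m::nat. c * indicator (X m) x :: ennreal)"
  proof (cases "x \<in> (\<Union>m. X m)")
    case True
    then obtain m where "x \<in> X m" by auto
    then show ?thesis by (intro SUP_upper2[of m]) (auto simp: indicator_def)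
  qed simp
qed

text \<open>The substitution rule on [0, m] passes to the half line by monotone convergence. The
  assumption g x \<ge> g 0 + x guarantees that the images [g 0, g m] exhaust the target.\<close>

lemma nn_integral_halfline_subst:
  fixes g g' :: "real \<Rightarrow> real" and h :: "real \<Rightarrow> ennreal"
  assumes h[measurable]: "h \<in> borel_measurable borel"
    and g': "\<And>x. x \<ge> 0 \<Longrightarrow> (g has_real_derivative g' x) (at x)"
    and nn: "\<And>x. x \<ge> 0 \<Longrightarrow> g' x \<ge> 0"
    and cont: "continuous_on {0..} g'"
    and g: "\<And>x. x \<ge> 0 \<Longrightarrow> g x \<ge> g 0 + x"
  shows "(\<integral>\<^sup>+x. h x * indicator {g 0<..} x \<partial>lborel) = (\<integral>\<^sup>+x. h (g x) * (ennreal (g' x) * indicator {0<..} x) \<partial>lborel)"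
proof -
  have mono: "g x \<le> g y" if "0 \<le> x" "x \<le> y" for x y
  proof (rule DERIV_nonneg_imp_nondecreasing[OF that(2)])
    fix z assume "x \<le> z" "z \<le> y"
    with that have "z \<ge> 0" by simp
    with g' nn show "\<exists>w. (g has_real_derivative w) (at z) \<and> 0 \<le> w" by blast
  qed
  have contg: "continuous_on {0..} g"
  proof (rule continuous_at_imp_continuous_on, rule ballI)
    fix z :: real assume "z \<in> {0..}"
    then have "(g has_real_derivative g' z) (at z)" by (intro g') simp
    then show "isCont g z" by (rule DERIV_isCont)
  qed
  \<comment> \<open>g and g' are known to be continuous only for x \<ge> 0; extending them by zero
    makes them measurable on the whole line.\<close>
  define gi where "gi x = (if x \<in> {0..} then g x else 0)" for x
  define di where "di x = (if x \<in> {0..} then g' x else 0)" for x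
  have [measurable]: "gi \<in> borel_measurable borel" "di \<in> borel_measurable borel"
    unfolding gi_def di_def
    by (intro borel_measurable_continuous_on_if contg cont continuous_on_const; simp)+
  have U1: "(\<Union>m::nat. {g 0..g (real m)}) = {g 0..}"
  proof (intro equalityI subsetI)
    fix x assume x: "x \<in> {g 0..}"
    obtain m :: nat where "x - g 0 \<le> real m" using real_arch_simple by blast
    then have "x \<le> g (real m)" using g[of "real m"] by simp
    with x show "x \<in> (\<Union>m::nat. {g 0..g (real m)})" by auto
  qed auto
  have U2: "(\<Union>m::nat. {0..real m}) = {0..}" using real_arch_simple by (auto simp: set_eq_iff)
  have gm: "g (real m) \<le> g (real n)" if "m \<le> n" for m n using that by (intro mono) auto
  have i1: "incseq (\<lambda>m::nat. {g 0..g (real m)})" and i2: "incseq (\<lambda>m::nat. {0..real m})"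
    by (auto simp: incseq_def intro: order_trans[OF _ gm])
  have "(\<integral>\<^sup>+x. h x * indicator {g 0<..} x \<partial>lborel) = (\<integral>\<^sup>+x. h x * indicator {g 0..} x \<partial>lborel)"
    using AE_lborel_singleton[of "g 0"]
    by (intro nn_integral_cong_AE) (auto elim!: eventually_mono simp: indicator_def)
  also have "\<dots> = (\<integral>\<^sup>+x. (SUP m::nat. h x * indicator {g 0..g (real m)} x) \<partial>lborel)"
    unfolding SUP_mult_indicator U1 ..
  also have "\<dots> = (SUP m::nat. \<integral>\<^sup>+x. h x * indicator {g 0..g (real m)} x \<partial>lborel)"
    using i1 by (intro nn_integral_monotone_convergence_SUP)
      (auto simp: incseq_def le_fun_def indicator_def subset_eq)
  also have "\<dots> = (SUP m::nat. \<integral>\<^sup>+x. h (gi x) * di x * indicator {0..real m} x \<partial>lborel)"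
  proof (rule SUP_cong[OF refl])
    fix m :: nat
    show "(\<integral>\<^sup>+x. h x * indicator {g 0..g (real m)} x \<partial>lborel) = (\<integral>\<^sup>+x. h (gi x) * di x * indicator {0..real m} x \<partial>lborel)"
    proof (cases "m = 0")
      case True
      have "(\<integral>\<^sup>+x. h x * indicator {g 0..g 0} x \<partial>lborel) = 0" 
        using AE_lborel_singleton[of "g 0"]
        by (subst nn_integral_0_iff_AE) (auto elim!: eventually_mono simp: indicator_def)
      moreover have "(\<integral>\<^sup>+x. h (gi x) * di x * indicator {0..real 0} x \<partial>lborel) = 0"
        using AE_lborel_singleton[of "0"]
        by (subst nn_integral_0_iff_AE) (auto elim!: eventually_mono simp: indicator_def)
      ultimately show ?thesis using True by simp
    next
      case False
      have "(\<integral>\<^sup>+x. h x * indicator {g 0..g (real m)} x \<partial>lborel) = (\<integral>\<^sup>+x. h (g x) * g' x * indicator {0..real m} x \<partial>lborel)"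
        using False g' nn by (intro nn_integral_substitution_aux h continuous_on_subset[OF cont]) auto
      also have "\<dots> = (\<integral>\<^sup>+x. h (gi x) * di x * indicator {0..real m} x \<partial>lborel)"
        by (intro nn_integral_cong) (auto simp: gi_def di_def indicator_def)
      finally show ?thesis .
    qed
  qed
  also have "\<dots> = (\<integral>\<^sup>+x. (SUP m::nat. h (gi x) * di x * indicator {0..real m} x) \<partial>lborel)"
    using i2 by (intro nn_integral_monotone_convergence_SUP[symmetric])
      (auto simp: incseq_def le_fun_def indicator_def subset_eq)
  also have "\<dots> = (\<integral>\<^sup>+x. h (gi x) * di x * indicator {0..} x \<partial>lborel)"
    unfolding SUP_mult_indicator U2 ..
  also have "\<dots> = (\<integral>\<^sup>+x. h (g x) * (ennreal (g' x) * indicator {0<..} x) \<partial>lborel)"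
    using AE_lborel_singleton[of 0]
    by (intro nn_integral_cong_AE) (auto elim!: eventually_mono simp: indicator_def gi_def di_def)
  finally show ?thesis .
qed

section \<open>Weights on the positive orthant and their integrability\<close>

definition mult_wt :: "'i set \<Rightarrow> ('i \<Rightarrow> real) \<Rightarrow> real" where
  "mult_wt A y = (\<Prod>i\<in>A. 1 + y i)"

definition pairs_on :: "('i::linorder) set \<Rightarrow> ('i \<times> 'i) set" where
  "pairs_on A = {(i, j). i \<in> A \<and> j \<in> A \<and> i < j}"

lemma finite_pairs_on [simp]: "finite A \<Longrightarrow> finite (pairs_on A)"
  by (rule finite_subset[of _ "A \<times> A"]) (auto simp: pairs_on_def)

lemma omega_on_pairs: "omega_on k A y = (\<Prod>p\<in>pairs_on A. \<bar>y (fst p) - y (snd p)\<bar> powr (2 * k))"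
  by (simp add: omega_on_def pairs_on_def)

lemma measurable_D_on [measurable]: "(\<lambda>y. D_on A y) \<in> borel_measurable (leb_Pi A)"
  unfolding D_on_def by measurable

lemma measurable_omega_on [measurable]: "(\<lambda>y. omega_on k A y) \<in> borel_measurable (leb_Pi A)"
  unfolding omega_on_pairs
proof (rule borel_measurable_prod)
  fix p assume "p \<in> pairs_on A"
  then have [measurable]: "fst p \<in> A" "snd p \<in> A" by (auto simp: pairs_on_def)
  show "(\<lambda>y. \<bar>y (fst p) - y (snd p)\<bar> powr (2 * k)) \<in> borel_measurable (leb_Pi A)" by measurable
qed

lemma measurable_mult_wt [measurable]: "(\<lambda>y. mult_wt A y) \<in> borel_measurable (leb_Pi A)"
  unfolding mult_wt_def by measurable

lemma measurable_pos_on [measurable]: "finite A \<Longrightarrow> Measurable.pred (leb_Pi A) (pos_on A)"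
  unfolding pos_on_def by measurable

lemma D_on_pos: "pos_on A y \<Longrightarrow> 0 < D_on A y"
  by (auto simp: D_on_def pos_on_def intro!: prod_pos)

lemma omega_on_nonneg: "0 \<le> omega_on k A y"
  by (auto simp: omega_on_def intro!: prod_nonneg)

lemma mult_wt_ge1: "pos_on A y \<Longrightarrow> 1 \<le> mult_wt A y"
  unfolding mult_wt_def by (rule prod_ge_1) (simp add: pos_on_def less_imp_le)

text \<open>\<open>mult_wt\<close> serves as the gauge of growth: it dominates every single
  coordinate, hence every difference of two, and being a product it lets integrals factor over the
  coordinates, which a norm would not.\<close>

lemma mult_wt_ge_component:
  assumes "finite A" "pos_on A y" "i \<in> A" shows "1 + y i \<le> mult_wt A y"
proof -
  have "mult_wt A y = (1 + y i) * (\<Prod>j\<in>A - {i}. 1 + y j)"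
    using assms by (simp add: mult_wt_def prod.remove)
  moreover have "(\<Prod>j\<in>A - {i}. 1 + y j) \<ge> 1"
    using assms by (intro prod_ge_1) (auto simp: pos_on_def less_imp_le)
  moreover have "1 + y i \<ge> 0" using assms by (auto simp: pos_on_def add_nonneg_nonneg less_imp_le)
  ultimately show ?thesis using mult_left_mono[of 1 "\<Prod>j\<in>A - {i}. 1 + y j" "1 + y i"] by simp
qed

lemma omega_on_le:
  assumes "finite A" "pos_on A y" "k \<ge> 0"
  shows "omega_on k A y \<le> mult_wt A y powr (2 * k * card (pairs_on A))"
proof -
  have "omega_on k A y \<le> (\<Prod>p\<in>pairs_on A. mult_wt A y powr (2 * k))"
    unfolding omega_on_pairs
  proof (intro prod_mono conjI powr_mono2)
    fix p assume "p \<in> pairs_on A"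
    then have "fst p \<in> A" "snd p \<in> A" by (auto simp: pairs_on_def)
    then show "\<bar>y (fst p) - y (snd p)\<bar> \<le> mult_wt A y"
      using mult_wt_ge_component[OF assms(1,2), of "fst p"] mult_wt_ge_component[OF assms(1,2), of "snd p"] assms(2)
      unfolding pos_on_def by (smt (verit))
  qed (use assms in auto)
  also have "\<dots> = mult_wt A y powr (2 * k * card (pairs_on A))"
    using mult_wt_ge1[OF assms(2)] by (simp add: powr_realpow[symmetric] powr_powr)
  finally show ?thesis .
qed

text \<open>Split at 1: near zero x^(s - 1) is integrable as s > 0, and beyond 1 the integrand is at
  most x^(s - 1 - c) \<le> x^(-2).\<close>

lemma nn_integral_powr_weight_finite:
  fixes s c :: real
  assumes s: "s > 0" and c: "c \<ge> s + 1"
  shows "(\<integral>\<^sup>+x. ennreal (x powr (s - 1) * (1 + x) powr (- c)) * indicator {0<..} x \<partial>lborel) < \<infinity>"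
proof -
  define g where "g x = (if x \<in> {0..1} then x powr (s - 1) else 0) + (if x \<in> {1..} then x powr (-2) else 0)" for x :: real
  have hi: "(g has_integral (1 powr (s - 1 + 1) / (s - 1 + 1)) + (-(1 powr (-2 + 1)) / (-2 + 1))) UNIV"
    unfolding g_def
  proof (rule has_integral_add)
    show "((\<lambda>x. if x \<in> {0..1} then x powr (s - 1) else 0) has_integral (1 powr (s - 1 + 1) / (s - 1 + 1))) UNIV"
      by (subst has_integral_restrict_UNIV) (use s in \<open>intro has_integral_powr_from_0, auto\<close>)
    show "((\<lambda>x. if x \<in> {1..} then x powr (-2) else 0) has_integral (-(1 powr (-2 + 1)) / (-2 + 1))) (UNIV :: real set)"
      by (subst has_integral_restrict_UNIV) (intro has_integral_powr_to_inf, auto)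
  qed
  have [measurable]: "g \<in> borel_measurable borel" unfolding g_def by measurable
  have "integral\<^sup>N lborel g < \<infinity>"
    using nn_integral_has_integral_lborel[OF _ _ hi] by (simp add: g_def)
  moreover have "(\<integral>\<^sup>+x. ennreal (x powr (s - 1) * (1 + x) powr (- c)) * indicator {0<..} x \<partial>lborel) \<le> integral\<^sup>N lborel g"
  proof (rule nn_integral_mono)
    fix x :: real
    show "ennreal (x powr (s - 1) * (1 + x) powr (- c)) * indicator {0<..} x \<le> ennreal (g x)"
    proof (cases "x > 0")
      case True
      have "x powr (s - 1) * (1 + x) powr (- c) \<le> g x"
      proof (cases "x \<le> 1")
        case x: True
        have "(1 + x) powr (- c) \<le> 1 powr (-c)" using True c s by (intro powr_mono2') auto
        then show ?thesis using True x mult_left_mono[of "(1 + x) powr (- c)" 1 "x powr (s - 1)"] by (auto simp: g_def)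
      next
        case x: False
        have "(1 + x) powr (- c) \<le> x powr (- c)" using True c s by (intro powr_mono2') auto
        then have "x powr (s - 1) * (1 + x) powr (- c) \<le> x powr (s - 1) * x powr (- c)"
          by (intro mult_left_mono) auto
        also have "\<dots> = x powr (s - 1 - c)" by (simp add: powr_add[symmetric])
        also have "\<dots> \<le> x powr (-2)" using x c by (intro powr_mono) auto
        finally show ?thesis using x by (simp add: g_def)
      qed
      then show ?thesis using True by (simp add: ennreal_leI)
    qed simp
  qed
  ultimately show ?thesis by (rule le_less_trans[rotated])
qed

text \<open>\<open>omega_on_le\<close> trades the interaction for the power 2 k |pairs| of
  \<open>mult_wt\<close>. What remains of c is at least s + 1, and the integral factors into
  one-dimensional ones.\<close>

lemma nn_integral_base_finite:
  fixes s c k :: real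
  assumes A: "finite A" and s: "s > 0" and k: "k \<ge> 0" and c: "c \<ge> s + 1 + 2 * k * card (pairs_on A)"
  shows "(\<integral>\<^sup>+y. (if pos_on A y then ennreal (D_on A y powr (s - 1) * omega_on k A y * mult_wt A y powr (- c)) else 0) \<partial>leb_Pi A) < \<infinity>"
proof -
  define c' where "c' = c - 2 * k * card (pairs_on A)"
  have "(\<integral>\<^sup>+y. (if pos_on A y then ennreal (D_on A y powr (s - 1) * omega_on k A y * mult_wt A y powr (- c)) else 0) \<partial>leb_Pi A)
    \<le> (\<integral>\<^sup>+y. (\<Prod>i\<in>A. ennreal (y i powr (s - 1) * (1 + y i) powr (- c')) * indicator {0<..} (y i)) \<partial>leb_Pi A)"
  proof (rule nn_integral_mono)
    fix y
    show "(if pos_on A y then ennreal (D_on A y powr (s - 1) * omega_on k A y * mult_wt A y powr (- c)) else 0)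
       \<le> (\<Prod>i\<in>A. ennreal (y i powr (s - 1) * (1 + y i) powr (- c')) * indicator {0<..} (y i))"
    proof (cases "pos_on A y")
      case True
      have "D_on A y powr (s - 1) * omega_on k A y * mult_wt A y powr (- c) \<le>
         D_on A y powr (s - 1) * mult_wt A y powr (2 * k * card (pairs_on A)) * mult_wt A y powr (- c)"
        by (intro mult_right_mono mult_left_mono omega_on_le True A k) auto
      also have "\<dots> = D_on A y powr (s - 1) * mult_wt A y powr (- c')"
        by (simp add: c'_def powr_add[symmetric])
      also have "\<dots> = (\<Prod>i\<in>A. y i powr (s - 1) * (1 + y i) powr (- c'))"
        using True unfolding D_on_def mult_wt_def pos_on_def
        by (subst (1 2) prod_powr_distrib) (auto simp: prod.distrib less_imp_le add_nonneg_nonneg)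
      finally have "ennreal (D_on A y powr (s - 1) * omega_on k A y * mult_wt A y powr (- c)) \<le> 
          ennreal (\<Prod>i\<in>A. y i powr (s - 1) * (1 + y i) powr (- c'))" by (rule ennreal_leI)
      also have "\<dots> = (\<Prod>i\<in>A. ennreal (y i powr (s - 1) * (1 + y i) powr (- c')) * indicator {0<..} (y i))"
        using True by (subst prod_ennreal[symmetric]) (auto simp: pos_on_def intro!: prod.cong)
      finally show ?thesis using True by simp
    qed simp
  qed
  also have "\<dots> = (\<Prod>i\<in>A. (\<integral>\<^sup>+x. ennreal (x powr (s - 1) * (1 + x) powr (- c')) * indicator {0<..} x \<partial>lborel))"
    by (rule leb.product_nn_integral_prod) (use A in auto)
  also have "\<dots> < \<infinity>"
    using nn_integral_powr_weight_finite[of s c'] s c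
    by (simp add: c'_def less_top[symmetric] ennreal_prod_eq_top power_eq_top_ennreal)
  finally show ?thesis .
qed

lemma power_le_fact_exp:
  fixes x :: real assumes "x \<ge> 0" shows "x ^ m \<le> fact m * exp x"
proof -
  have "x ^ m /\<^sub>R fact m \<le> (\<Sum>n. x ^ n /\<^sub>R fact n)"
    using assms summable_exp_generic[of x]
    by (intro order_trans[OF _ sum_le_suminf[of _ "{m}"]]) auto
  then show ?thesis by (simp add: exp_def field_simps)
qed

text \<open>The unnormalised joint density of the beta-Laguerre ensemble with beta = 2 k. With s =
  mu - k (|A| - 1) the exponent s - 1 is the one of the Riesz measure at mu.\<close>

definition lag_dens :: "real \<Rightarrow> real \<Rightarrow> ('i::linorder) set \<Rightarrow> ('i \<Rightarrow> real) \<Rightarrow> real" where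
  "lag_dens k s A y = (if pos_on A y then D_on A y powr (s - 1) * omega_on k A y * exp (- (\<Sum>i\<in>A. y i)) else 0)"

definition lag :: "real \<Rightarrow> real \<Rightarrow> ('i::linorder) set \<Rightarrow> ('i \<Rightarrow> real) measure" where
  "lag k s A = density (leb_Pi A) (lag_dens k s A)"

lemma measurable_lag_dens [measurable]: "finite A \<Longrightarrow> lag_dens k s A \<in> borel_measurable (leb_Pi A)"
  unfolding lag_dens_def[abs_def] by measurable

lemma lag_dens_nonneg: "0 \<le> lag_dens k s A y"
  by (simp add: lag_dens_def omega_on_nonneg)

lemma sets_lag [measurable_cong]: "sets (lag k s A) = sets (leb_Pi A)"
  by (simp add: lag_def)

lemma nn_integral_lag:
  "finite A \<Longrightarrow> f \<in> borel_measurable (leb_Pi A) \<Longrightarrow>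
    (\<integral>\<^sup>+y. f y \<partial>lag k s A) = (\<integral>\<^sup>+y. f y * lag_dens k s A y \<partial>leb_Pi A)"
  unfolding lag_def by (subst nn_integral_density) (auto simp: mult.commute)

lemma nn_integral_lag_mult_wt_finite:
  assumes A: "finite A" and s: "s > 0" and k: "k \<ge> 0"
  shows "(\<integral>\<^sup>+y. ennreal (mult_wt A y ^ d) \<partial>lag k s A) < \<infinity>"
proof -
  define c where "c = s + 1 + 2 * k * card (pairs_on A)"
  have c0: "c \<ge> 0" using s k by (simp add: c_def)
  \<comment> \<open>A power e beyond c + d leaves the decay \<open>mult_wt\<close> to the -c after d
    factors are spent. The exponential pays for the power e: x^e \<le> e! exp x is applied to each x
    = 1 + y_i, whence the factor e! exp 1 per coordinate in K.\<close>
  obtain e :: nat where e: "c + d \<le> real e" using real_arch_simple by blast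
  define K :: real where "K = (fact e * exp 1) ^ card A"
  have "(\<integral>\<^sup>+y. ennreal (mult_wt A y ^ d) \<partial>lag k s A) = (\<integral>\<^sup>+y. ennreal (mult_wt A y ^ d) * lag_dens k s A y \<partial>leb_Pi A)"
    by (rule nn_integral_lag) (use A in measurable)
  also have "\<dots> \<le> (\<integral>\<^sup>+y. ennreal K * (if pos_on A y then ennreal (D_on A y powr (s - 1) * omega_on k A y * mult_wt A y powr (- c)) else 0) \<partial>leb_Pi A)"
  proof (rule nn_integral_mono)
    fix y
    show "ennreal (mult_wt A y ^ d) * lag_dens k s A y \<le> ennreal K * (if pos_on A y then ennreal (D_on A y powr (s - 1) * omega_on k A y * mult_wt A y powr (- c)) else 0)"
    proof (cases "pos_on A y")
      case True
      note w1 = mult_wt_ge1[OF True]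
      have "mult_wt A y ^ e \<le> (\<Prod>i\<in>A. fact e * exp (1 + y i))"
        unfolding mult_wt_def prod_power_distrib
        using True by (intro prod_mono conjI power_le_fact_exp) (auto simp: pos_on_def add_nonneg_nonneg less_imp_le)
      also have "\<dots> = K * exp (\<Sum>i\<in>A. y i)"
        using A by (simp add: K_def exp_add prod.distrib exp_sum power_mult_distrib)
      finally have 1: "mult_wt A y ^ e * exp (- (\<Sum>i\<in>A. y i)) \<le> K"
        by (simp add: exp_minus field_simps)
      have "mult_wt A y ^ d = mult_wt A y powr (c + d) * mult_wt A y powr (- c)"
        using w1 by (simp add: powr_add[symmetric] powr_realpow)
      also have "\<dots> \<le> mult_wt A y powr e * mult_wt A y powr (- c)"
        using w1 e by (intro mult_right_mono powr_mono) auto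
      also have "\<dots> = mult_wt A y ^ e * mult_wt A y powr (- c)"
        using w1 by (simp add: powr_realpow)
      finally have "mult_wt A y ^ d * exp (- (\<Sum>i\<in>A. y i)) \<le> (mult_wt A y ^ e * exp (- (\<Sum>i\<in>A. y i))) * mult_wt A y powr (- c)"
        by (simp add: mult_right_mono mult_ac)
      also have "\<dots> \<le> K * mult_wt A y powr (- c)"
        by (intro mult_right_mono 1) auto
      finally have "(D_on A y powr (s - 1) * omega_on k A y) * (mult_wt A y ^ d * exp (- (\<Sum>i\<in>A. y i))) \<le>
          (D_on A y powr (s - 1) * omega_on k A y) * (K * mult_wt A y powr (- c))"
        by (intro mult_left_mono) (auto simp: omega_on_nonneg)
      then show ?thesis using True w1
        by (simp add: lag_dens_def ennreal_mult'[symmetric] K_def omega_on_nonneg mult_ac ennreal_leI)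
    qed (simp add: lag_dens_def)
  qed
  also have "\<dots> = ennreal K * (\<integral>\<^sup>+y. (if pos_on A y then ennreal (D_on A y powr (s - 1) * omega_on k A y * mult_wt A y powr (- c)) else 0) \<partial>leb_Pi A)"
    by (rule nn_integral_cmult) (use A in measurable)
  also have "\<dots> < \<infinity>"
    using nn_integral_base_finite[OF A s k, of c] by (simp add: c_def[symmetric] ennreal_mult_less_top)
  finally show ?thesis .
qed

lemma AE_lag_pos: "finite A \<Longrightarrow> AE y in lag k s A. pos_on A y"
  unfolding lag_def by (subst AE_density) (auto simp: lag_dens_def)

lemma integrable_lag:
  assumes A: "finite A" and s: "s > 0" and k: "k \<ge> 0"
    and f: "f \<in> borel_measurable (leb_Pi A)" and bound: "\<And>y. pos_on A y \<Longrightarrow> norm (f y) \<le> C * mult_wt A y ^ d"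
  shows "integrable (lag k s A) (f :: _ \<Rightarrow> 'b::{banach, second_countable_topology})"
proof (rule Bochner_Integration.integrable_bound)
  show "integrable (lag k s A) (\<lambda>y. C * mult_wt A y ^ d)"
  proof (rule integrable_mult_right, rule integrableI_bounded)
    have "(\<integral>\<^sup>+y. ennreal (norm (mult_wt A y ^ d)) \<partial>lag k s A) = (\<integral>\<^sup>+y. ennreal (mult_wt A y ^ d) \<partial>lag k s A)"
      by (rule nn_integral_cong_AE) (use AE_lag_pos[OF A, of k s] in \<open>eventually_elim, auto dest!: mult_wt_ge1\<close>)
    then show "(\<integral>\<^sup>+y. ennreal (norm (mult_wt A y ^ d)) \<partial>lag k s A) < \<infinity>"
      using nn_integral_lag_mult_wt_finite[OF A s k] by simp
  qed measurable
  show "f \<in> borel_measurable (lag k s A)" using f by measurable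
  show "AE y in lag k s A. norm (f y) \<le> norm (C * mult_wt A y ^ d)"
    using AE_lag_pos[OF A, of k s] by eventually_elim (use bound in fastforce)
qed

section \<open>Integrands of polynomial growth on the positive orthant\<close>

definition poly_bounded :: "'i set \<Rightarrow> (('i \<Rightarrow> real) \<Rightarrow> real) \<Rightarrow> bool" where
  "poly_bounded A f \<longleftrightarrow> f \<in> borel_measurable (leb_Pi A) \<and>
     (\<exists>C n. \<forall>y. pos_on A y \<longrightarrow> \<bar>f y\<bar> \<le> C * mult_wt A y ^ n)"

lemma poly_boundedI:
  "f \<in> borel_measurable (leb_Pi A) \<Longrightarrow> (\<And>y. pos_on A y \<Longrightarrow> \<bar>f y\<bar> \<le> C * mult_wt A y ^ n) \<Longrightarrow> poly_bounded A f"
  by (auto simp: poly_bounded_def)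

lemma poly_bounded_measurable [measurable_dest]: "poly_bounded A f \<Longrightarrow> f \<in> borel_measurable (leb_Pi A)"
  by (simp add: poly_bounded_def)

lemma poly_boundedE:
  assumes "poly_bounded A f"
  obtains C n where "C \<ge> 0" "\<And>y m. pos_on A y \<Longrightarrow> n \<le> m \<Longrightarrow> \<bar>f y\<bar> \<le> C * mult_wt A y ^ m"
proof -
  from assms obtain C n where C: "\<And>y. pos_on A y \<Longrightarrow> \<bar>f y\<bar> \<le> C * mult_wt A y ^ n"
    by (auto simp: poly_bounded_def)
  have "\<bar>f y\<bar> \<le> \<bar>C\<bar> * mult_wt A y ^ m" if "pos_on A y" "n \<le> m" for y m
  proof -
    have "\<bar>f y\<bar> \<le> C * mult_wt A y ^ n" by (rule C[OF that(1)])
    also have "\<dots> \<le> \<bar>C\<bar> * mult_wt A y ^ m"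
      using mult_wt_ge1[OF that(1)] that(2) by (intro mult_mono power_increasing) auto
    finally show ?thesis .
  qed
  then show ?thesis using that[of "\<bar>C\<bar>"] by auto
qed

lemma poly_bounded_const [intro!]: "poly_bounded A (\<lambda>_. c)"
  by (rule poly_boundedI[where C = "\<bar>c\<bar>" and n = 0]) auto

lemma poly_bounded_add [intro!]:
  assumes f: "poly_bounded A f" and g: "poly_bounded A g" shows "poly_bounded A (\<lambda>y. f y + g y)"
proof -
  note [measurable] = poly_bounded_measurable[OF f] poly_bounded_measurable[OF g]
  obtain C n where C: "C \<ge> 0" "\<And>y m. pos_on A y \<Longrightarrow> n \<le> m \<Longrightarrow> \<bar>f y\<bar> \<le> C * mult_wt A y ^ m"
    using poly_boundedE[OF f] by blast
  obtain D m where D: "D \<ge> 0" "\<And>y l. pos_on A y \<Longrightarrow> m \<le> l \<Longrightarrow> \<bar>g y\<bar> \<le> D * mult_wt A y ^ l"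
    using poly_boundedE[OF g] by blast
  show ?thesis
  proof (rule poly_boundedI[where C = "C + D" and n = "n + m"])
    fix y assume y: "pos_on A y"
    show "\<bar>f y + g y\<bar> \<le> (C + D) * mult_wt A y ^ (n + m)"
      using C(2)[OF y, of "n + m"] D(2)[OF y, of "n + m"] by (simp add: distrib_right)
  qed measurable
qed

lemma poly_bounded_mult [intro!]:
  assumes f: "poly_bounded A f" and g: "poly_bounded A g" shows "poly_bounded A (\<lambda>y. f y * g y)"
proof -
  note [measurable] = poly_bounded_measurable[OF f] poly_bounded_measurable[OF g]
  obtain C n where C: "C \<ge> 0" "\<And>y m. pos_on A y \<Longrightarrow> n \<le> m \<Longrightarrow> \<bar>f y\<bar> \<le> C * mult_wt A y ^ m"
    using poly_boundedE[OF f] by blast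
  obtain D m where D: "D \<ge> 0" "\<And>y l. pos_on A y \<Longrightarrow> m \<le> l \<Longrightarrow> \<bar>g y\<bar> \<le> D * mult_wt A y ^ l"
    using poly_boundedE[OF g] by blast
  show ?thesis
  proof (rule poly_boundedI[where C = "C * D" and n = "n + m"])
    fix y assume y: "pos_on A y"
    have "\<bar>f y\<bar> * \<bar>g y\<bar> \<le> (C * mult_wt A y ^ n) * (D * mult_wt A y ^ m)"
      using C(2)[OF y order_refl] D(2)[OF y order_refl] by (intro mult_mono) auto
    then show "\<bar>f y * g y\<bar> \<le> (C * D) * mult_wt A y ^ (n + m)"
      by (simp add: abs_mult power_add mult_ac)
  qed measurable
qed

lemma poly_bounded_uminus [intro!]: "poly_bounded A f \<Longrightarrow> poly_bounded A (\<lambda>y. - f y)"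
  using poly_bounded_mult[OF poly_bounded_const[of A "-1"], of f] by simp

lemma poly_bounded_diff [intro!]: "poly_bounded A f \<Longrightarrow> poly_bounded A g \<Longrightarrow> poly_bounded A (\<lambda>y. f y - g y)"
  using poly_bounded_add[OF _ poly_bounded_uminus] by fastforce

lemma poly_bounded_sum [intro!]: "(\<And>i. i \<in> I \<Longrightarrow> poly_bounded A (f i)) \<Longrightarrow> poly_bounded A (\<lambda>y. \<Sum>i\<in>I. f i y)"
  by (induction I rule: infinite_finite_induct) auto

lemma poly_bounded_prod [intro!]: "(\<And>i. i \<in> I \<Longrightarrow> poly_bounded A (f i)) \<Longrightarrow> poly_bounded A (\<lambda>y. \<Prod>i\<in>I. f i y)"
  by (induction I rule: infinite_finite_induct) auto

lemma poly_bounded_power [intro!]: "poly_bounded A f \<Longrightarrow> poly_bounded A (\<lambda>y. f y ^ m)"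
  by (induction m) auto

lemma poly_bounded_comp [intro]:
  assumes A: "finite A" "i \<in> A" and g[measurable]: "g \<in> borel_measurable borel"
    and bound: "\<And>x. x > 0 \<Longrightarrow> \<bar>g x\<bar> \<le> C * (1 + x) ^ n"
  shows "poly_bounded A (\<lambda>y. g (y i))"
proof (rule poly_boundedI[where C = "\<bar>C\<bar>" and n = n])
  show "(\<lambda>y. g (y i)) \<in> borel_measurable (leb_Pi A)"
    by (rule measurable_compose[OF measurable_leb_Pi_component[OF A(2)] g])
  fix y assume y: "pos_on A y"
  have yi: "y i > 0" using y A by (auto simp: pos_on_def)
  have "\<bar>g (y i)\<bar> \<le> C * (1 + y i) ^ n" by (rule bound[OF yi])
  also have "\<dots> \<le> \<bar>C\<bar> * mult_wt A y ^ n"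
    using mult_wt_ge_component[OF A(1) y A(2)] yi by (intro mult_mono power_mono) auto
  finally show "\<bar>g (y i)\<bar> \<le> \<bar>C\<bar> * mult_wt A y ^ n" .
qed

lemma poly_bounded_component [intro]: "finite A \<Longrightarrow> i \<in> A \<Longrightarrow> poly_bounded A (\<lambda>y. y i)"
  by (rule poly_bounded_comp[where g = "\<lambda>x. x" and C = 1 and n = 1]) auto

lemma integrable_lag_poly_bounded:
  assumes "finite A" "s > 0" "k \<ge> 0" "poly_bounded A f"
  shows "integrable (lag k s A) f"
proof -
  obtain C n where C: "C \<ge> 0" "\<And>y m. pos_on A y \<Longrightarrow> n \<le> m \<Longrightarrow> \<bar>f y\<bar> \<le> C * mult_wt A y ^ m"
    using poly_boundedE[OF assms(4)] by blast
  show ?thesis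
    by (rule integrable_lag[where C = C and d = n]) (use assms C in \<open>auto intro: poly_bounded_measurable\<close>)
qed

section \<open>Differentiation under the integral sign\<close>

text \<open>The polynomial bounds are uniform in \<open>\<epsilon>\<close>, which permits differentiation at \<open>\<epsilon> = 0\<close> under the
  integral against the Laguerre weight.\<close>
definition diff_family :: "'i set \<Rightarrow> (real \<Rightarrow> ('i \<Rightarrow> real) \<Rightarrow> real) \<Rightarrow> (('i \<Rightarrow> real) \<Rightarrow> real) \<Rightarrow> bool" where
  "diff_family A \<Phi> d \<longleftrightarrow> (\<forall>e\<in>{0..1}. \<Phi> e \<in> borel_measurable (leb_Pi A)) \<and>
     (\<exists>\<Phi>' C n. \<forall>y. pos_on A y \<longrightarrow> \<Phi>' 0 y = d y \<and>
        (\<forall>e\<in>{0..1}. ((\<lambda>e. \<Phi> e y) has_real_derivative \<Phi>' e y) (at e within {0..1}) \<and>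
           \<bar>\<Phi> e y\<bar> \<le> C * mult_wt A y ^ n \<and> \<bar>\<Phi>' e y\<bar> \<le> C * mult_wt A y ^ n))"

lemma diff_familyI:
  assumes "\<And>e. 0 \<le> e \<Longrightarrow> e \<le> 1 \<Longrightarrow> \<Phi> e \<in> borel_measurable (leb_Pi A)"
    and "poly_bounded A B" "poly_bounded A B'"
    and "\<And>y. pos_on A y \<Longrightarrow> \<Phi>' 0 y = d y"
    and "\<And>y e. pos_on A y \<Longrightarrow> 0 \<le> e \<Longrightarrow> e \<le> 1 \<Longrightarrow> ((\<lambda>e. \<Phi> e y) has_real_derivative \<Phi>' e y) (at e within {0..1})"
    and "\<And>y e. pos_on A y \<Longrightarrow> 0 \<le> e \<Longrightarrow> e \<le> 1 \<Longrightarrow> \<bar>\<Phi> e y\<bar> \<le> B y"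
    and "\<And>y e. pos_on A y \<Longrightarrow> 0 \<le> e \<Longrightarrow> e \<le> 1 \<Longrightarrow> \<bar>\<Phi>' e y\<bar> \<le> B' y"
  shows "diff_family A \<Phi> d"
proof -
  obtain C n where C: "C \<ge> 0" "\<And>y m. pos_on A y \<Longrightarrow> n \<le> m \<Longrightarrow> \<bar>B y\<bar> \<le> C * mult_wt A y ^ m"
    using poly_boundedE[OF assms(2)] by blast
  obtain D m where D: "D \<ge> 0" "\<And>y l. pos_on A y \<Longrightarrow> m \<le> l \<Longrightarrow> \<bar>B' y\<bar> \<le> D * mult_wt A y ^ l"
    using poly_boundedE[OF assms(3)] by blast
  have "\<bar>\<Phi> e y\<bar> \<le> (C + D) * mult_wt A y ^ (n + m) \<and> \<bar>\<Phi>' e y\<bar> \<le> (C + D) * mult_wt A y ^ (n + m)"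
    if "pos_on A y" "e \<in> {0..1}" for e y
  proof -
    have "0 \<le> C * mult_wt A y ^ (n + m)" "0 \<le> D * mult_wt A y ^ (n + m)"
      using C(1) D(1) mult_wt_ge1[OF that(1)] by auto
    moreover have "\<bar>\<Phi> e y\<bar> \<le> C * mult_wt A y ^ (n + m)"
      using assms(6)[OF that(1), of e] C(2)[OF that(1), of "n + m"] that by auto
    moreover have "\<bar>\<Phi>' e y\<bar> \<le> D * mult_wt A y ^ (n + m)"
      using assms(7)[OF that(1), of e] D(2)[OF that(1), of "n + m"] that by auto
    ultimately show ?thesis by (simp add: distrib_right)
  qed
  then show ?thesis unfolding diff_family_def using assms(1,4,5)
    by (intro conjI exI[of _ \<Phi>'] exI[of _ "C + D"] exI[of _ "n + m"]) auto
qed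

lemma diff_familyE:
  assumes "diff_family A \<Phi> d"
  obtains B \<Phi>' where "poly_bounded A B" "\<And>e. 0 \<le> e \<Longrightarrow> e \<le> 1 \<Longrightarrow> \<Phi> e \<in> borel_measurable (leb_Pi A)"
    and "\<And>y. pos_on A y \<Longrightarrow> \<Phi>' 0 y = d y"
    and "\<And>y e. pos_on A y \<Longrightarrow> 0 \<le> e \<Longrightarrow> e \<le> 1 \<Longrightarrow> ((\<lambda>e. \<Phi> e y) has_real_derivative \<Phi>' e y) (at e within {0..1})"
    and "\<And>y e. pos_on A y \<Longrightarrow> 0 \<le> e \<Longrightarrow> e \<le> 1 \<Longrightarrow> \<bar>\<Phi> e y\<bar> \<le> B y"
    and "\<And>y e. pos_on A y \<Longrightarrow> 0 \<le> e \<Longrightarrow> e \<le> 1 \<Longrightarrow> \<bar>\<Phi>' e y\<bar> \<le> B y"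
proof -
  from assms obtain \<Phi>' C n where *: "\<forall>y. pos_on A y \<longrightarrow> \<Phi>' 0 y = d y \<and>
        (\<forall>e\<in>{0..1}. ((\<lambda>e. \<Phi> e y) has_real_derivative \<Phi>' e y) (at e within {0..1}) \<and>
           \<bar>\<Phi> e y\<bar> \<le> C * mult_wt A y ^ n \<and> \<bar>\<Phi>' e y\<bar> \<le> C * mult_wt A y ^ n)"
    unfolding diff_family_def by auto
  have "poly_bounded A (\<lambda>y. C * mult_wt A y ^ n)"
  proof (rule poly_boundedI[where C = "\<bar>C\<bar>" and n = n])
    fix y assume "pos_on A y"
    then show "\<bar>C * mult_wt A y ^ n\<bar> \<le> \<bar>C\<bar> * mult_wt A y ^ n"
      using mult_wt_ge1[of A y] by (simp add: abs_mult)
  qed measurable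
  then show ?thesis using that[of "\<lambda>y. C * mult_wt A y ^ n" \<Phi>'] * assms unfolding diff_family_def by auto
qed

lemma diff_family_cong:
  assumes "diff_family A \<Phi> d" "\<And>y. pos_on A y \<Longrightarrow> d y = d' y" shows "diff_family A \<Phi> d'"
proof -
  from assms(1) obtain B \<Phi>' where "poly_bounded A B" "\<And>e. 0 \<le> e \<Longrightarrow> e \<le> 1 \<Longrightarrow> \<Phi> e \<in> borel_measurable (leb_Pi A)"
    and "\<And>y. pos_on A y \<Longrightarrow> \<Phi>' 0 y = d y"
    and "\<And>y e. pos_on A y \<Longrightarrow> 0 \<le> e \<Longrightarrow> e \<le> 1 \<Longrightarrow> ((\<lambda>e. \<Phi> e y) has_real_derivative \<Phi>' e y) (at e within {0..1})"
    and "\<And>y e. pos_on A y \<Longrightarrow> 0 \<le> e \<Longrightarrow> e \<le> 1 \<Longrightarrow> \<bar>\<Phi> e y\<bar> \<le> B y"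
    and "\<And>y e. pos_on A y \<Longrightarrow> 0 \<le> e \<Longrightarrow> e \<le> 1 \<Longrightarrow> \<bar>\<Phi>' e y\<bar> \<le> B y"
    by (rule diff_familyE) (rule that)
  then show ?thesis using assms(2) by (intro diff_familyI[of \<Phi> A B B \<Phi>']) auto
qed

lemma diff_family_cong_pos:
  assumes "diff_family A \<Phi> d" "\<And>e y. pos_on A y \<Longrightarrow> \<Phi> e y = \<Psi> e y"
    and "\<And>e. \<Psi> e \<in> borel_measurable (leb_Pi A)"
  shows "diff_family A \<Psi> d"
proof -
  from assms(1) obtain B \<Phi>' where 1: "poly_bounded A B" "\<And>e. 0 \<le> e \<Longrightarrow> e \<le> 1 \<Longrightarrow> \<Phi> e \<in> borel_measurable (leb_Pi A)"
    "\<And>y. pos_on A y \<Longrightarrow> \<Phi>' 0 y = d y"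
    "\<And>y e. pos_on A y \<Longrightarrow> 0 \<le> e \<Longrightarrow> e \<le> 1 \<Longrightarrow> ((\<lambda>e. \<Phi> e y) has_real_derivative \<Phi>' e y) (at e within {0..1})"
    "\<And>y e. pos_on A y \<Longrightarrow> 0 \<le> e \<Longrightarrow> e \<le> 1 \<Longrightarrow> \<bar>\<Phi> e y\<bar> \<le> B y"
    "\<And>y e. pos_on A y \<Longrightarrow> 0 \<le> e \<Longrightarrow> e \<le> 1 \<Longrightarrow> \<bar>\<Phi>' e y\<bar> \<le> B y"
    by (rule diff_familyE) (rule that)
  show ?thesis
  proof (rule diff_familyI[where \<Phi>' = \<Phi>' and B = B and B' = B, OF assms(3) 1(1) 1(1) 1(3)])
    fix y e assume *: "pos_on A y" "0 \<le> e" "e \<le> (1 :: real)"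
    have eq: "(\<lambda>e. \<Psi> e y) = (\<lambda>e. \<Phi> e y)" using assms(2)[OF *(1)] by simp
    show "((\<lambda>e. \<Psi> e y) has_real_derivative \<Phi>' e y) (at e within {0..1})"
      unfolding eq by (rule 1(4)[OF *])
    show "\<bar>\<Psi> e y\<bar> \<le> B y" using 1(5)[OF *] assms(2)[OF *(1)] by simp
    show "\<bar>\<Phi>' e y\<bar> \<le> B y" by (rule 1(6)[OF *])
  qed
qed

lemma diff_family_lin:
  assumes f: "poly_bounded A f" and g: "poly_bounded A g"
  shows "diff_family A (\<lambda>e y. f y + e * g y) g"
proof -
  note [measurable] = poly_bounded_measurable[OF f] poly_bounded_measurable[OF g]
  obtain C n where C: "C \<ge> 0" "\<And>y m. pos_on A y \<Longrightarrow> n \<le> m \<Longrightarrow> \<bar>f y\<bar> \<le> C * mult_wt A y ^ m"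
    using poly_boundedE[OF f] by blast
  obtain D m where D: "D \<ge> 0" "\<And>y l. pos_on A y \<Longrightarrow> m \<le> l \<Longrightarrow> \<bar>g y\<bar> \<le> D * mult_wt A y ^ l"
    using poly_boundedE[OF g] by blast
  have pw: "poly_bounded A (\<lambda>y. c * mult_wt A y ^ j)" for c j
  proof (rule poly_boundedI[where C = "\<bar>c\<bar>" and n = j])
    fix y assume "pos_on A y"
    then show "\<bar>c * mult_wt A y ^ j\<bar> \<le> \<bar>c\<bar> * mult_wt A y ^ j"
      using mult_wt_ge1[of A y] by (simp add: abs_mult)
  qed measurable
  show ?thesis
  proof (rule diff_familyI[where B = "\<lambda>y. C * mult_wt A y ^ n + D * mult_wt A y ^ m" and B' = "\<lambda>y. D * mult_wt A y ^ m" and \<Phi>' = "\<lambda>_. g"])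
    fix e :: real and y assume y: "pos_on A y" "0 \<le> e" "e \<le> 1"
    show "\<bar>f y + e * g y\<bar> \<le> C * mult_wt A y ^ n + D * mult_wt A y ^ m"
      using C(2)[OF y(1) order_refl] D(2)[OF y(1) order_refl] y(2,3) mult_right_mono[of e 1 "\<bar>g y\<bar>"]
        abs_triangle_ineq[of "f y" "e * g y"] by (simp add: abs_mult)
    show "\<bar>g y\<bar> \<le> D * mult_wt A y ^ m" by (rule D(2)[OF y(1) order_refl])
  qed (auto intro!: pw derivative_eq_intros)
qed

lemma diff_family_static: "poly_bounded A f \<Longrightarrow> diff_family A (\<lambda>e. f) (\<lambda>_. 0)"
  using diff_family_lin[of A f "\<lambda>_. 0"] by auto

lemma diff_family_add:
  assumes "diff_family A \<Phi> d" "diff_family A \<Psi> d'"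
  shows "diff_family A (\<lambda>e y. \<Phi> e y + \<Psi> e y) (\<lambda>y. d y + d' y)"
proof -
  from assms(1) obtain B \<Phi>' where 1: "poly_bounded A B" "\<And>e. 0 \<le> e \<Longrightarrow> e \<le> 1 \<Longrightarrow> \<Phi> e \<in> borel_measurable (leb_Pi A)"
    "\<And>y. pos_on A y \<Longrightarrow> \<Phi>' 0 y = d y"
    "\<And>y e. pos_on A y \<Longrightarrow> 0 \<le> e \<Longrightarrow> e \<le> 1 \<Longrightarrow> ((\<lambda>e. \<Phi> e y) has_real_derivative \<Phi>' e y) (at e within {0..1})"
    "\<And>y e. pos_on A y \<Longrightarrow> 0 \<le> e \<Longrightarrow> e \<le> 1 \<Longrightarrow> \<bar>\<Phi> e y\<bar> \<le> B y"
    "\<And>y e. pos_on A y \<Longrightarrow> 0 \<le> e \<Longrightarrow> e \<le> 1 \<Longrightarrow> \<bar>\<Phi>' e y\<bar> \<le> B y"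
    by (rule diff_familyE) (rule that)
  from assms(2) obtain D \<Psi>' where 2: "poly_bounded A D" "\<And>e. 0 \<le> e \<Longrightarrow> e \<le> 1 \<Longrightarrow> \<Psi> e \<in> borel_measurable (leb_Pi A)"
    "\<And>y. pos_on A y \<Longrightarrow> \<Psi>' 0 y = d' y"
    "\<And>y e. pos_on A y \<Longrightarrow> 0 \<le> e \<Longrightarrow> e \<le> 1 \<Longrightarrow> ((\<lambda>e. \<Psi> e y) has_real_derivative \<Psi>' e y) (at e within {0..1})"
    "\<And>y e. pos_on A y \<Longrightarrow> 0 \<le> e \<Longrightarrow> e \<le> 1 \<Longrightarrow> \<bar>\<Psi> e y\<bar> \<le> D y"
    "\<And>y e. pos_on A y \<Longrightarrow> 0 \<le> e \<Longrightarrow> e \<le> 1 \<Longrightarrow> \<bar>\<Psi>' e y\<bar> \<le> D y"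
    by (rule diff_familyE) (rule that)
  show ?thesis
  proof (rule diff_familyI[where B = "\<lambda>y. B y + D y" and B' = "\<lambda>y. B y + D y" and \<Phi>' = "\<lambda>e y. \<Phi>' e y + \<Psi>' e y"])
    fix e y assume *: "pos_on A y" "0 \<le> e" "e \<le> (1 :: real)"
    show "((\<lambda>e. \<Phi> e y + \<Psi> e y) has_real_derivative \<Phi>' e y + \<Psi>' e y) (at e within {0..1})"
      by (intro derivative_intros 1 2 *)
    show "\<bar>\<Phi> e y + \<Psi> e y\<bar> \<le> B y + D y"
      using 1(5)[OF *] 2(5)[OF *] by linarith
    show "\<bar>\<Phi>' e y + \<Psi>' e y\<bar> \<le> B y + D y"
      using 1(6)[OF *] 2(6)[OF *] by linarith
  qed (use 1 2 in auto)
qed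

lemma diff_family_mult:
  assumes "diff_family A \<Phi> d" "diff_family A \<Psi> d'"
  shows "diff_family A (\<lambda>e y. \<Phi> e y * \<Psi> e y) (\<lambda>y. d y * \<Psi> 0 y + \<Phi> 0 y * d' y)"
proof -
  from assms(1) obtain B \<Phi>' where 1: "poly_bounded A B" "\<And>e. 0 \<le> e \<Longrightarrow> e \<le> 1 \<Longrightarrow> \<Phi> e \<in> borel_measurable (leb_Pi A)"
    "\<And>y. pos_on A y \<Longrightarrow> \<Phi>' 0 y = d y"
    "\<And>y e. pos_on A y \<Longrightarrow> 0 \<le> e \<Longrightarrow> e \<le> 1 \<Longrightarrow> ((\<lambda>e. \<Phi> e y) has_real_derivative \<Phi>' e y) (at e within {0..1})"
    "\<And>y e. pos_on A y \<Longrightarrow> 0 \<le> e \<Longrightarrow> e \<le> 1 \<Longrightarrow> \<bar>\<Phi> e y\<bar> \<le> B y"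
    "\<And>y e. pos_on A y \<Longrightarrow> 0 \<le> e \<Longrightarrow> e \<le> 1 \<Longrightarrow> \<bar>\<Phi>' e y\<bar> \<le> B y"
    by (rule diff_familyE) (rule that)
  from assms(2) obtain D \<Psi>' where 2: "poly_bounded A D" "\<And>e. 0 \<le> e \<Longrightarrow> e \<le> 1 \<Longrightarrow> \<Psi> e \<in> borel_measurable (leb_Pi A)"
    "\<And>y. pos_on A y \<Longrightarrow> \<Psi>' 0 y = d' y"
    "\<And>y e. pos_on A y \<Longrightarrow> 0 \<le> e \<Longrightarrow> e \<le> 1 \<Longrightarrow> ((\<lambda>e. \<Psi> e y) has_real_derivative \<Psi>' e y) (at e within {0..1})"
    "\<And>y e. pos_on A y \<Longrightarrow> 0 \<le> e \<Longrightarrow> e \<le> 1 \<Longrightarrow> \<bar>\<Psi> e y\<bar> \<le> D y"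
    "\<And>y e. pos_on A y \<Longrightarrow> 0 \<le> e \<Longrightarrow> e \<le> 1 \<Longrightarrow> \<bar>\<Psi>' e y\<bar> \<le> D y"
    by (rule diff_familyE) (rule that)
  show ?thesis
  proof (rule diff_familyI[where B = "\<lambda>y. B y * D y" and B' = "\<lambda>y. B y * D y + B y * D y" and \<Phi>' = "\<lambda>e y. \<Phi>' e y * \<Psi> e y + \<Phi> e y * \<Psi>' e y"])
    fix e y assume *: "pos_on A y" "0 \<le> e" "e \<le> (1 :: real)"
    show "((\<lambda>e. \<Phi> e y * \<Psi> e y) has_real_derivative \<Phi>' e y * \<Psi> e y + \<Phi> e y * \<Psi>' e y) (at e within {0..1})"
      by (rule DERIV_cong[OF DERIV_mult[OF 1(4)[OF *] 2(4)[OF *]]]) simp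
    have BD: "0 \<le> B y" using 1(5)[OF *] by linarith
    show "\<bar>\<Phi> e y * \<Psi> e y\<bar> \<le> B y * D y"
      unfolding abs_mult using 1(5)[OF *] 2(5)[OF *] BD by (intro mult_mono) auto
    have "\<bar>\<Phi>' e y\<bar> * \<bar>\<Psi> e y\<bar> \<le> B y * D y" "\<bar>\<Phi> e y\<bar> * \<bar>\<Psi>' e y\<bar> \<le> B y * D y"
      using 1(5,6)[OF *] 2(5,6)[OF *] BD by (auto intro!: mult_mono)
    then show "\<bar>\<Phi>' e y * \<Psi> e y + \<Phi> e y * \<Psi>' e y\<bar> \<le> B y * D y + B y * D y"
      using abs_triangle_ineq[of "\<Phi>' e y * \<Psi> e y" "\<Phi> e y * \<Psi>' e y"] by (simp add: abs_mult)
  qed (use 1 2 in auto)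
qed

lemma diff_family_sum:
  "finite I \<Longrightarrow> (\<And>i. i \<in> I \<Longrightarrow> diff_family A (\<Phi> i) (d i)) \<Longrightarrow>
    diff_family A (\<lambda>e y. \<Sum>i\<in>I. \<Phi> i e y) (\<lambda>y. \<Sum>i\<in>I. d i y)"
proof (induction I rule: finite_induct)
  case empty then show ?case using diff_family_static[of A "\<lambda>_. 0"] by auto
next
  case (insert i I) then show ?case using diff_family_add[of A "\<Phi> i" "d i"] by simp
qed

text \<open>Requiring every factor to be 1 at parameter 0 turns the derivative of the product into
  the plain sum of the derivatives; the factors of a Jacobian are of this kind.\<close>

lemma diff_family_prod:
  "finite I \<Longrightarrow> (\<And>i. i \<in> I \<Longrightarrow> diff_family A (\<Phi> i) (d i)) \<Longrightarrow> (\<And>i y. i \<in> I \<Longrightarrow> \<Phi> i 0 y = 1) \<Longrightarrow>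
    diff_family A (\<lambda>e y. \<Prod>i\<in>I. \<Phi> i e y) (\<lambda>y. \<Sum>i\<in>I. d i y)"
proof (induction I rule: finite_induct)
  case empty then show ?case using diff_family_static[of A "\<lambda>_. 1"] by auto
next
  case (insert i I)
  then show ?case
    using diff_family_mult[of A "\<Phi> i" "d i" "\<lambda>e y. \<Prod>i\<in>I. \<Phi> i e y" "\<lambda>y. \<Sum>i\<in>I. d i y"] by simp
qed

lemma diff_family_power:
  assumes "diff_family A \<Phi> d" shows "diff_family A (\<lambda>e y. \<Phi> e y ^ m) (\<lambda>y. real m * \<Phi> 0 y ^ (m - 1) * d y)"
proof (induction m)
  case 0 then show ?case using diff_family_static[of A "\<lambda>_. 1"] by auto
next
  case (Suc m)
  show ?case
    by (rule diff_family_cong[OF diff_family_mult[OF assms Suc, folded power_Suc]])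
       (cases m; simp add: algebra_simps)
qed

lemma diff_family_powr:
  assumes g: "poly_bounded A g" and g0: "\<And>y. pos_on A y \<Longrightarrow> g y \<ge> 0"
  shows "diff_family A (\<lambda>e y. (1 + e * g y) powr c) (\<lambda>y. c * g y)"
proof -
  note [measurable] = poly_bounded_measurable[OF g]
  \<comment> \<open>One integer exponent above both c and c - 1 bounds the function and its
    derivative. As g is nonnegative the base 1 + e g is at least 1, so powers increase with the
    exponent.\<close>
  obtain m :: nat where m: "\<bar>c\<bar> + 1 \<le> real m" using real_arch_simple by blast
  have bound: "(1 + e * g y) powr b \<le> (1 + g y) ^ m" if "b \<le> real m" "pos_on A y" "0 \<le> e" "e \<le> 1" for b e y
  proof -
    have gy: "g y \<ge> 0" by (rule g0[OF that(2)])
    then have e: "0 \<le> e * g y" "e * g y \<le> g y" using that mult_right_mono[of e 1 "g y"] by auto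
    have "(1 + e * g y) powr b \<le> (1 + e * g y) powr real m" using e that by (intro powr_mono) auto
    also have "\<dots> \<le> (1 + g y) powr real m" using e by (intro powr_mono2) auto
    also have "\<dots> = (1 + g y) ^ m" using gy by (simp add: powr_realpow)
    finally show ?thesis .
  qed
  show ?thesis
  proof (rule diff_familyI[where B = "\<lambda>y. (1 + g y) ^ m" and B' = "\<lambda>y. \<bar>c\<bar> * (1 + g y) ^ m * g y"
         and \<Phi>' = "\<lambda>e y. c * (1 + e * g y) powr (c - 1) * g y"])
    fix e y assume *: "pos_on A y" "0 \<le> e" "e \<le> (1 :: real)"
    have pos: "1 + e * g y > 0" using g0[OF *(1)] * by (simp add: add_pos_nonneg)
    show "((\<lambda>e. (1 + e * g y) powr c) has_real_derivative c * (1 + e * g y) powr (c - 1) * g y) (at e within {0..1})"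
      using pos by (auto intro!: derivative_eq_intros simp: powr_diff)
    show "\<bar>(1 + e * g y) powr c\<bar> \<le> (1 + g y) ^ m" using bound[OF _ *, of c] m by simp
    show "\<bar>c * (1 + e * g y) powr (c - 1) * g y\<bar> \<le> \<bar>c\<bar> * (1 + g y) ^ m * g y"
      using bound[OF _ *, of "c - 1"] m g0[OF *(1)]
      by (auto simp: abs_mult intro!: mult_right_mono mult_left_mono)
  qed (use g in auto)
qed

lemma diff_family_exp:
  assumes g: "poly_bounded A g" and g0: "\<And>y. pos_on A y \<Longrightarrow> g y \<ge> 0"
  shows "diff_family A (\<lambda>e y. exp (- (e * g y))) (\<lambda>y. - g y)"
proof -
  note [measurable] = poly_bounded_measurable[OF g]
  show ?thesis
  proof (rule diff_familyI[where B = "\<lambda>y. 1" and B' = g and \<Phi>' = "\<lambda>e y. - g y * exp (- (e * g y))"])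
    fix e y assume *: "pos_on A y" "0 \<le> e" "e \<le> (1 :: real)"
    show "((\<lambda>e. exp (- (e * g y))) has_real_derivative - g y * exp (- (e * g y))) (at e within {0..1})"
      by (auto intro!: derivative_eq_intros)
    have 1: "exp (- (e * g y)) \<le> 1" using * g0[OF *(1)] by simp
    show "\<bar>exp (- (e * g y))\<bar> \<le> 1" using 1 by simp
    show "\<bar>- g y * exp (- (e * g y))\<bar> \<le> g y"
      using mult_left_mono[OF 1 g0[OF *(1)]] g0[OF *(1)] by (simp add: abs_mult)
  qed (use g in auto)
qed

text \<open>The difference quotients at 0 along 1/(m + 1) have integral zero when the integral does
  not depend on the parameter. By the mean value inequality they are dominated by B, so dominated
  convergence gives the claim.\<close>

lemma diff_family_integral:
  assumes A: "finite A" and s: "s > 0" and k: "k \<ge> 0" and \<Phi>: "diff_family A \<Phi> d"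
    and d[measurable]: "d \<in> borel_measurable (leb_Pi A)"
    and const: "\<And>e. 0 \<le> e \<Longrightarrow> e \<le> 1 \<Longrightarrow> (\<integral>y. \<Phi> e y \<partial>lag k s A) = c"
  shows "(\<integral>y. d y \<partial>lag k s A) = 0"
proof -
  from \<Phi> obtain B \<Phi>' where 1: "poly_bounded A B" "\<And>e. 0 \<le> e \<Longrightarrow> e \<le> 1 \<Longrightarrow> \<Phi> e \<in> borel_measurable (leb_Pi A)"
    "\<And>y. pos_on A y \<Longrightarrow> \<Phi>' 0 y = d y"
    "\<And>y e. pos_on A y \<Longrightarrow> 0 \<le> e \<Longrightarrow> e \<le> 1 \<Longrightarrow> ((\<lambda>e. \<Phi> e y) has_real_derivative \<Phi>' e y) (at e within {0..1})"
    "\<And>y e. pos_on A y \<Longrightarrow> 0 \<le> e \<Longrightarrow> e \<le> 1 \<Longrightarrow> \<bar>\<Phi> e y\<bar> \<le> B y"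
    "\<And>y e. pos_on A y \<Longrightarrow> 0 \<le> e \<Longrightarrow> e \<le> 1 \<Longrightarrow> \<bar>\<Phi>' e y\<bar> \<le> B y"
    by (rule diff_familyE) (rule that)
  define h where "h m = 1 / (real m + 1)" for m
  have h: "0 < h m" "h m \<le> 1" for m by (auto simp: h_def)
  note [measurable] = 1(2)[OF less_imp_le[OF h(1)] h(2)] 1(2)[of 0, simplified]
  have intB: "integrable (lag k s A) B" by (rule integrable_lag_poly_bounded[OF A s k 1(1)])
  have int: "integrable (lag k s A) (\<Phi> e)" if "0 \<le> e" "e \<le> 1" for e
  proof (rule Bochner_Integration.integrable_bound[OF intB])
    show "\<Phi> e \<in> borel_measurable (lag k s A)" using 1(2)[OF that] by measurable
    show "AE y in lag k s A. norm (\<Phi> e y) \<le> norm (B y)"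
      using AE_lag_pos[OF A, of k s] by eventually_elim (use 1(5) that in fastforce)
  qed
  have "(\<lambda>m. \<integral>y. (\<Phi> (h m) y - \<Phi> 0 y) / h m \<partial>lag k s A) \<longlonglongrightarrow> (\<integral>y. d y \<partial>lag k s A)"
  proof (rule integral_dominated_convergence[where w = B])
    show "AE y in lag k s A. (\<lambda>m. (\<Phi> (h m) y - \<Phi> 0 y) / h m) \<longlonglongrightarrow> d y"
      using AE_lag_pos[OF A, of k s]
    proof eventually_elim
      case (elim y)
      have "((\<lambda>e. \<Phi> e y) has_real_derivative d y) (at 0 within {0..1})"
        using 1(4)[OF elim, of 0] 1(3)[OF elim] by simp
      then have lim: "((\<lambda>e. (\<Phi> e y - \<Phi> 0 y) / (e - 0)) \<longlongrightarrow> d y) (at 0 within {0..1})"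
        by (simp add: has_field_derivative_iff)
      have "filterlim h (at 0 within {0..1}) sequentially"
        unfolding filterlim_at
      proof
        show "\<forall>\<^sub>F x in sequentially. h x \<in> {0..1} \<and> h x \<noteq> 0"
          using h by (intro always_eventually) (auto simp: less_imp_le less_imp_neq[symmetric])
        show "h \<longlonglongrightarrow> 0" using LIMSEQ_inverse_real_of_nat unfolding h_def
          by (simp add: inverse_eq_divide add.commute)
      qed
      from filterlim_compose[OF lim this] show ?case by simp
    qed
    show "AE y in lag k s A. norm ((\<Phi> (h m) y - \<Phi> 0 y) / h m) \<le> B y" for m
      using AE_lag_pos[OF A, of k s]
    proof eventually_elim
      case (elim y)
      have "norm (\<Phi> (h m) y - \<Phi> 0 y) \<le> B y * norm (h m - 0)"
        using 1(4,6)[OF elim] h[of m]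
        by (intro field_differentiable_bound[where S = "{0..1}" and f' = "\<lambda>e. \<Phi>' e y"]) auto
      then show ?case using h[of m] by (simp add: field_simps)
    qed
  qed (use intB in measurable)
  moreover have "(\<integral>y. (\<Phi> (h m) y - \<Phi> 0 y) / h m \<partial>lag k s A) = 0" for m
    using h[of m] by (simp add: int const less_imp_le)
  ultimately have "(\<lambda>m::nat. 0) \<longlonglongrightarrow> (\<integral>y. d y \<partial>lag k s A)" by (simp only:)
  then show ?thesis by (simp add: LIMSEQ_const_iff)
qed

section \<open>Coordinatewise flows and integration by parts\<close>

text \<open>\<open>v\<close> generates the coordinatewise maps \<open>y \<mapsto> y + \<epsilon> v y\<close>; the divided difference \<open>dd\<close> describes
  their effect on the factors \<open>\<bar>y\<^sub>i - y\<^sub>j\<bar>\<close> of the weight.\<close>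
locale flow_field =
  fixes v b v' :: "real \<Rightarrow> real" and dd :: "real \<Rightarrow> real \<Rightarrow> real"
  assumes v_eq: "\<And>x. x \<ge> 0 \<Longrightarrow> v x = x * b x"
    and b_nonneg: "\<And>x. x \<ge> 0 \<Longrightarrow> b x \<ge> 0"
    and v'_nonneg: "\<And>x. x \<ge> 0 \<Longrightarrow> v' x \<ge> 0"
    and v_deriv: "\<And>x. x \<ge> 0 \<Longrightarrow> (v has_real_derivative v' x) (at x)"
    and v'_cont: "continuous_on {0..} v'"
    and dd_nonneg: "\<And>x y. x > 0 \<Longrightarrow> y > 0 \<Longrightarrow> dd x y \<ge> 0"
    and v_diff: "\<And>x y. x > 0 \<Longrightarrow> y > 0 \<Longrightarrow> v x - v y = (x - y) * dd x y"
    and v_meas [measurable]: "v \<in> borel_measurable borel" and b_meas [measurable]: "b \<in> borel_measurable borel"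
    and v'_meas [measurable]: "v' \<in> borel_measurable borel"
    and v_bound: "\<exists>C n. \<forall>x>0. \<bar>v x\<bar> \<le> C * (1 + x) ^ n"
    and b_bound: "\<exists>C n. \<forall>x>0. \<bar>b x\<bar> \<le> C * (1 + x) ^ n"
    and v'_bound: "\<exists>C n. \<forall>x>0. \<bar>v' x\<bar> \<le> C * (1 + x) ^ n"
begin

text \<open>The transformed Laguerre density times the Jacobian determinant, divided by the original
  density. The four factors come from D^(s - 1), from the differences, from dy and from the
  exponential. The trivial power 1 gives the third the shape handled by
  \<open>diff_family_powr\<close>.\<close>

definition jac :: "real \<Rightarrow> real \<Rightarrow> ('i::linorder) set \<Rightarrow> real \<Rightarrow> ('i \<Rightarrow> real) \<Rightarrow> real" where
  "jac k s A e y = (\<Prod>i\<in>A. (1 + e * b (y i)) powr (s - 1)) *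
     ((\<Prod>p\<in>pairs_on A. (1 + e * dd (y (fst p)) (y (snd p))) powr (2 * k)) *
     ((\<Prod>i\<in>A. (1 + e * v' (y i)) powr 1) * exp (- (e * (\<Sum>i\<in>A. v (y i))))))"

lemma poly_bounded_fields:
  assumes "finite A" "i \<in> A"
  shows "poly_bounded A (\<lambda>y. v (y i))" "poly_bounded A (\<lambda>y. b (y i))" "poly_bounded A (\<lambda>y. v' (y i))"
  using v_bound b_bound v'_bound poly_bounded_comp[OF assms v_meas]
    poly_bounded_comp[OF assms b_meas] poly_bounded_comp[OF assms v'_meas] by metis+

end

locale lag_flow = flow_field v b v' dd for v b v' and dd :: "real \<Rightarrow> real \<Rightarrow> real" and A :: "('i::linorder) set" +
  fixes k s :: real
  assumes finA: "finite A" and s: "s > 0" and k: "k > 0"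
    and dd_bd: "\<And>i j. i \<in> A \<Longrightarrow> j \<in> A \<Longrightarrow> poly_bounded A (\<lambda>y. dd (y i) (y j))"
begin

lemma poly_bounded_pairs: "p \<in> pairs_on A \<Longrightarrow> poly_bounded A (\<lambda>y. dd (y (fst p)) (y (snd p)))"
  by (rule dd_bd) (auto simp: pairs_on_def)

lemma diff_family_jac:
  "diff_family A (jac k s A) (\<lambda>y. (\<Sum>i\<in>A. (s - 1) * b (y i)) +
     ((\<Sum>p\<in>pairs_on A. 2 * k * dd (y (fst p)) (y (snd p))) +
     ((\<Sum>i\<in>A. 1 * v' (y i)) - (\<Sum>i\<in>A. v (y i)))))"
proof -
  have 1: "diff_family A (\<lambda>e y. \<Prod>i\<in>A. (1 + e * b (y i)) powr (s - 1)) (\<lambda>y. \<Sum>i\<in>A. (s - 1) * b (y i))"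
    using poly_bounded_fields(2)[OF finA] b_nonneg
    by (intro diff_family_prod diff_family_powr finA) (auto simp: pos_on_def less_imp_le)
  have 2: "diff_family A (\<lambda>e y. \<Prod>p\<in>pairs_on A. (1 + e * dd (y (fst p)) (y (snd p))) powr (2 * k))
     (\<lambda>y. \<Sum>p\<in>pairs_on A. 2 * k * dd (y (fst p)) (y (snd p)))"
    using poly_bounded_pairs dd_nonneg
    by (intro diff_family_prod diff_family_powr finite_pairs_on finA) (auto simp: pos_on_def pairs_on_def)
  have 3: "diff_family A (\<lambda>e y. \<Prod>i\<in>A. (1 + e * v' (y i)) powr 1) (\<lambda>y. \<Sum>i\<in>A. 1 * v' (y i))"
    using poly_bounded_fields(3)[OF finA] v'_nonneg
    by (intro diff_family_prod diff_family_powr finA) (auto simp: pos_on_def less_imp_le)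
  have 4: "diff_family A (\<lambda>e y. exp (- (e * (\<Sum>i\<in>A. v (y i))))) (\<lambda>y. - (\<Sum>i\<in>A. v (y i)))"
    using poly_bounded_fields(1)[OF finA] v_eq b_nonneg
    by (intro diff_family_exp poly_bounded_sum sum_nonneg) (auto simp: pos_on_def less_imp_le)
  show ?thesis
    unfolding jac_def[abs_def]
    by (rule diff_family_cong[OF diff_family_mult[OF 1 diff_family_mult[OF 2 diff_family_mult[OF 3 4]]]]) simp
qed

text \<open>Each coordinate map x + e v(x) fixes 0 and satisfies x + e v(x) \<ge> x, so it carries
  the half line onto itself and no boundary terms arise. Then v(x) = x b(x) and the divided
  difference let the density at the new point split off the old density.\<close>

lemma lag_flow_invariance:
  assumes q[measurable]: "q \<in> borel_measurable (leb_Pi A)" and q0: "\<And>y. pos_on A y \<Longrightarrow> q y \<ge> 0" and e: "0 \<le> e"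
  shows "(\<integral>\<^sup>+y. ennreal (q y) \<partial>lag k s A) =
    (\<integral>\<^sup>+y. ennreal (q (\<lambda>i\<in>A. y i + e * v (y i)) * jac k s A e y) \<partial>lag k s A)"
proof -
  note [measurable] = finA
  define g where "g x = x + e * v x" for x
  have [measurable]: "g \<in> borel_measurable borel" unfolding g_def by measurable
  define F where "F y = ennreal (q y * (D_on A y powr (s - 1) * omega_on k A y * exp (- (\<Sum>i\<in>A. y i))))" for y
  have [measurable]: "F \<in> borel_measurable (leb_Pi A)" unfolding F_def by measurable
  have gm: "(\<lambda>y. \<lambda>i\<in>A. g (y i)) \<in> leb_Pi A \<rightarrow>\<^sub>M leb_Pi A" by measurable
  have qg: "(\<lambda>y. q (\<lambda>i\<in>A. g (y i))) \<in> borel_measurable (leb_Pi A)"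
    by (rule measurable_compose[OF gm q])
  have jm: "jac k s A e \<in> borel_measurable (leb_Pi A)"
  proof -
    note [measurable] = poly_bounded_measurable[OF poly_bounded_pairs]
    show ?thesis unfolding jac_def by measurable
  qed
  have indp: "(\<Prod>i\<in>A. indicator {0<..} (y i) :: ennreal) = (if pos_on A y then 1 else 0)" for y
    using finA by (auto simp: pos_on_def indicator_def prod_zero_iff intro!: prod.neutral)
  have g0: "g 0 = 0" by (simp add: g_def v_eq)
  have "(\<integral>\<^sup>+y. ennreal (q y) \<partial>lag k s A) = (\<integral>\<^sup>+y. ennreal (q y) * lag_dens k s A y \<partial>leb_Pi A)"
    by (rule nn_integral_lag[OF finA]) measurable
  also have "\<dots> = (\<integral>\<^sup>+y. F y * (\<Prod>i\<in>A. indicator {0<..} (y i)) \<partial>leb_Pi A)"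
    unfolding indp F_def by (intro nn_integral_cong) (simp add: lag_dens_def ennreal_mult'' omega_on_nonneg)
  also have "\<dots> = (\<integral>\<^sup>+y. F (\<lambda>i\<in>A. g (y i)) * (\<Prod>i\<in>A. ennreal (1 + e * v' (y i)) * indicator {0<..} (y i)) \<partial>leb_Pi A)"
  proof (rule nn_integral_leb_Pi_change[OF finA])
    fix h :: "real \<Rightarrow> ennreal" assume h: "h \<in> borel_measurable borel"
    have "(\<integral>\<^sup>+x. h x * indicator {g 0<..} x \<partial>lborel) = (\<integral>\<^sup>+x. h (g x) * (ennreal (1 + e * v' x) * indicator {0<..} x) \<partial>lborel)"
    proof (rule nn_integral_halfline_subst[OF h])
      fix x :: real assume x: "x \<ge> 0"
      show "(g has_real_derivative 1 + e * v' x) (at x)"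
        unfolding g_def using v_deriv[OF x] by (auto intro!: derivative_eq_intros)
      show "0 \<le> 1 + e * v' x" using v'_nonneg[OF x] e by simp
      show "g 0 + x \<le> g x" using e x v_eq[OF x] b_nonneg[OF x] unfolding g0 by (simp add: g_def)
    qed (intro continuous_intros v'_cont)
    then show "(\<integral>\<^sup>+x. h x * indicator {0<..} x \<partial>lborel) = (\<integral>\<^sup>+x. h (g x) * (ennreal (1 + e * v' x) * indicator {0<..} x) \<partial>lborel)"
      by (simp add: g0)
  qed measurable
  also have "\<dots> = (\<integral>\<^sup>+y. ennreal (q (\<lambda>i\<in>A. g (y i)) * jac k s A e y) * lag_dens k s A y \<partial>leb_Pi A)"
  proof (rule nn_integral_cong)
    fix y
    show "F (\<lambda>i\<in>A. g (y i)) * (\<Prod>i\<in>A. ennreal (1 + e * v' (y i)) * indicator {0<..} (y i)) =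
      ennreal (q (\<lambda>i\<in>A. g (y i)) * jac k s A e y) * lag_dens k s A y"
    proof (cases "pos_on A y")
      case False
      then have "(\<Prod>i\<in>A. ennreal (1 + e * v' (y i)) * indicator {0<..} (y i)) = 0"
        using indp[of y] by (simp add: prod.distrib)
      then show ?thesis using False by (simp add: lag_dens_def)
    next
      case True
      then have yp: "y i > 0" if "i \<in> A" for i using that by (simp add: pos_on_def)
      have gy: "g (y i) = y i * (1 + e * b (y i))" if "i \<in> A" for i
        using v_eq[of "y i"] yp[OF that] by (simp add: g_def algebra_simps)
      have b1: "1 + e * b (y i) > 0" if "i \<in> A" for i
        using b_nonneg[of "y i"] yp[OF that] e by (simp add: add_pos_nonneg)
      have v1: "1 + e * v' (y i) > 0" if "i \<in> A" for i
        using v'_nonneg[of "y i"] yp[OF that] e by (simp add: add_pos_nonneg)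
      let ?z = "\<lambda>i\<in>A. g (y i)"
      have z: "pos_on A ?z" using gy b1 yp by (auto simp: pos_on_def)
      have D: "D_on A ?z powr (s - 1) = D_on A y powr (s - 1) * (\<Prod>i\<in>A. (1 + e * b (y i)) powr (s - 1))"
      proof -
        have "D_on A ?z = D_on A y * (\<Prod>i\<in>A. 1 + e * b (y i))"
          by (simp add: D_on_def gy prod.distrib)
        then show ?thesis using D_on_pos[OF True] b1
          by (simp add: powr_mult prod_nonneg less_imp_le prod_powr_distrib)
      qed
      have om: "omega_on k A ?z = omega_on k A y * (\<Prod>p\<in>pairs_on A. (1 + e * dd (y (fst p)) (y (snd p))) powr (2 * k))"
        unfolding omega_on_pairs prod.distrib[symmetric]
      proof (rule prod.cong[OF refl])
        fix p assume "p \<in> pairs_on A"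
        then have p: "fst p \<in> A" "snd p \<in> A" by (auto simp: pairs_on_def)
        have dn: "dd (y (fst p)) (y (snd p)) \<ge> 0" by (intro dd_nonneg yp p)
        have "?z (fst p) - ?z (snd p) = (y (fst p) - y (snd p)) + e * (v (y (fst p)) - v (y (snd p)))"
          using p by (simp add: g_def algebra_simps)
        also have "\<dots> = (y (fst p) - y (snd p)) * (1 + e * dd (y (fst p)) (y (snd p)))"
          by (subst v_diff) (auto intro!: yp p simp: algebra_simps)
        finally show "\<bar>?z (fst p) - ?z (snd p)\<bar> powr (2 * k) =
           \<bar>y (fst p) - y (snd p)\<bar> powr (2 * k) * (1 + e * dd (y (fst p)) (y (snd p))) powr (2 * k)"
          using e dn by (simp add: abs_mult powr_mult)
      qed
      have ex: "exp (- (\<Sum>i\<in>A. ?z i)) = exp (- (\<Sum>i\<in>A. y i)) * exp (- (e * (\<Sum>i\<in>A. v (y i))))"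
        by (simp add: g_def sum.distrib sum_distrib_left exp_add[symmetric])
      have "(\<Prod>i\<in>A. ennreal (1 + e * v' (y i)) * indicator {0<..} (y i)) = ennreal (\<Prod>i\<in>A. (1 + e * v' (y i)) powr 1)"
        using yp v1 by (subst prod_ennreal[symmetric]) (auto intro!: prod.cong simp: less_imp_le)
      then have "F ?z * (\<Prod>i\<in>A. ennreal (1 + e * v' (y i)) * indicator {0<..} (y i)) =
         ennreal (q ?z * (D_on A ?z powr (s - 1) * omega_on k A ?z * exp (- (\<Sum>i\<in>A. ?z i))) * (\<Prod>i\<in>A. (1 + e * v' (y i)) powr 1))"
        unfolding F_def by (simp add: ennreal_mult'' prod_nonneg)
      also have "\<dots> = ennreal ((q ?z * jac k s A e y) * lag_dens k s A y)"
        unfolding D om ex jac_def lag_dens_def using True by (simp add: mult_ac)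
      also have "\<dots> = ennreal (q ?z * jac k s A e y) * lag_dens k s A y"
        by (simp add: ennreal_mult'' lag_dens_nonneg)
      finally show ?thesis .
    qed
  qed
  also have "\<dots> = (\<integral>\<^sup>+y. ennreal (q (\<lambda>i\<in>A. g (y i)) * jac k s A e y) \<partial>lag k s A)"
    by (rule nn_integral_lag[OF finA, symmetric]) (use qg jm in measurable)
  finally show ?thesis by (simp add: g_def)
qed

lemma jac_nonneg: "pos_on A y \<Longrightarrow> 0 \<le> jac k s A e y"
  by (auto simp: jac_def intro!: mult_nonneg_nonneg prod_nonneg)

text \<open>Integration by parts obtained from a change of variables: the transformed integral does
  not depend on e, hence its derivative at e = 0 vanishes. At e = 0 the flow yields
  \<open>restrict y A\<close> and not y itself, which is why q must ignore coordinates outside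
  A.\<close>

theorem lag_flow_identity:
  assumes q: "q \<in> borel_measurable (leb_Pi A)" and q0: "\<And>y. pos_on A y \<Longrightarrow> q y \<ge> 0"
    and q_ext: "\<And>y. q (restrict y A) = q y"
    and dq: "diff_family A (\<lambda>e y. q (\<lambda>i\<in>A. y i + e * v (y i))) dq" and dq_meas: "dq \<in> borel_measurable (leb_Pi A)"
  shows "(\<integral>y. dq y + q y * ((\<Sum>i\<in>A. (s - 1) * b (y i)) +
     ((\<Sum>p\<in>pairs_on A. 2 * k * dd (y (fst p)) (y (snd p))) +
     ((\<Sum>i\<in>A. v' (y i)) - (\<Sum>i\<in>A. v (y i))))) \<partial>lag k s A) = 0"
proof -
  have k0: "k \<ge> 0" using k by simp
  define \<Phi> where "\<Phi> e y = q (\<lambda>i\<in>A. y i + e * v (y i)) * jac k s A e y" for e y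
  have fam: "diff_family A \<Phi> (\<lambda>y. dq y + q y * ((\<Sum>i\<in>A. (s - 1) * b (y i)) +
     ((\<Sum>p\<in>pairs_on A. 2 * k * dd (y (fst p)) (y (snd p))) +
     ((\<Sum>i\<in>A. v' (y i)) - (\<Sum>i\<in>A. v (y i))))))"
    unfolding \<Phi>_def[abs_def]
    by (rule diff_family_cong[OF diff_family_mult[OF dq diff_family_jac]])
       (use q_ext in \<open>auto simp: jac_def restrict_def[symmetric]\<close>)
  show ?thesis
  proof (rule diff_family_integral[OF finA s k0 fam])
    note [measurable] = q dq_meas poly_bounded_measurable[OF poly_bounded_pairs]
    show "(\<lambda>y. dq y + q y * ((\<Sum>i\<in>A. (s - 1) * b (y i)) +
     ((\<Sum>p\<in>pairs_on A. 2 * k * dd (y (fst p)) (y (snd p))) +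
     ((\<Sum>i\<in>A. v' (y i)) - (\<Sum>i\<in>A. v (y i)))))) \<in> borel_measurable (leb_Pi A)" by measurable
    fix e :: real assume e: "0 \<le> e" "e \<le> 1"
    have meas: "\<Phi> e \<in> borel_measurable (lag k s A)"
      using fam e unfolding diff_family_def by (auto simp: measurable_cong_sets[OF sets_lag refl])
    have "AE y in lag k s A. 0 \<le> \<Phi> e y"
      using AE_lag_pos[OF finA, of k s]
    proof eventually_elim
      case (elim y)
      have "0 \<le> v (y i)" if "i \<in> A" for i
        using elim that v_eq[of "y i"] b_nonneg[of "y i"] by (simp add: pos_on_def less_imp_le)
      then have "pos_on A (\<lambda>i\<in>A. y i + e * v (y i))" using elim e by (auto simp: pos_on_def add_pos_nonneg)
      then show ?case unfolding \<Phi>_def by (intro mult_nonneg_nonneg q0 jac_nonneg elim)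
    qed
    then have "(\<integral>y. \<Phi> e y \<partial>lag k s A) = enn2real (\<integral>\<^sup>+y. ennreal (\<Phi> e y) \<partial>lag k s A)"
      by (rule integral_eq_nn_integral[OF meas])
    then show "(\<integral>y. \<Phi> e y \<partial>lag k s A) = enn2real (\<integral>\<^sup>+y. ennreal (q y) \<partial>lag k s A)"
      using lag_flow_invariance[OF q q0 e(1)] by (simp add: \<Phi>_def)
  qed
qed

end

subsection \<open>Loop equations\<close>

text \<open>The factor 2 in the exponent 2 k is absorbed by passing from pairs i < j to ordered
  pairs of distinct indices.\<close>

lemma sum_pairs_on_symmetric:
  fixes f :: "'i::linorder \<Rightarrow> 'i \<Rightarrow> real"
  assumes A: "finite A" and sym: "\<And>i j. f i j = f j i"
  shows "(\<Sum>p\<in>pairs_on A. 2 * f (fst p) (snd p)) = (\<Sum>i\<in>A. \<Sum>j\<in>A - {i}. f i j)"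
proof -
  have "(\<Sum>i\<in>A. \<Sum>j\<in>A - {i}. f i j) = (\<Sum>p\<in>(SIGMA i:A. A - {i}). f (fst p) (snd p))"
    using A by (simp add: sum.Sigma case_prod_unfold)
  also have "(SIGMA i:A. A - {i}) = pairs_on A \<union> prod.swap ` pairs_on A"
    by (auto simp: pairs_on_def image_iff not_less less_le)
  also have "(\<Sum>p\<in>\<dots>. f (fst p) (snd p)) = (\<Sum>p\<in>pairs_on A. f (fst p) (snd p)) + (\<Sum>p\<in>prod.swap ` pairs_on A. f (fst p) (snd p))"
    by (intro sum.union_disjoint finite_imageI finite_pairs_on A) (auto simp: pairs_on_def)
  also have "(\<Sum>p\<in>prod.swap ` pairs_on A. f (fst p) (snd p)) = (\<Sum>p\<in>pairs_on A. f (fst p) (snd p))"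
    by (subst sum.reindex) (auto intro!: inj_onI sum.cong sym)
  finally show ?thesis by (simp add: sum_distrib_left[symmetric])
qed

definition psum :: "'i set \<Rightarrow> nat \<Rightarrow> ('i \<Rightarrow> real) \<Rightarrow> real" where
  "psum A b y = (\<Sum>i\<in>A. y i ^ b)"

primrec psums :: "'i set \<Rightarrow> nat list \<Rightarrow> ('i \<Rightarrow> real) \<Rightarrow> real" where
  "psums A [] y = 1"
| "psums A (b # bs) y = psum A b y * psums A bs y"

text \<open>The derivative of \<open>psums A bs\<close> along \<open>\<Sum>\<^sub>i x\<^sub>i\<^sup>a\<^sup>+\<^sup>1 \<partial>\<^sub>i\<close>, as a list of coefficients and index lists.\<close>
primrec shifts :: "nat \<Rightarrow> nat list \<Rightarrow> (nat \<times> nat list) list" where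
  "shifts a [] = []"
| "shifts a (b # bs) = (b, (a + b) # bs) # map (\<lambda>(c, l). (c, b # l)) (shifts a bs)"

lemma shifts_sum_list: "(c, l) \<in> set (shifts a bs) \<Longrightarrow> sum_list l = a + sum_list bs"
  by (induction bs arbitrary: c l) auto

lemma shifts_pos: "(c, l) \<in> set (shifts a bs) \<Longrightarrow> \<forall>b\<in>set bs. 0 < b \<Longrightarrow> \<forall>b\<in>set l. 0 < b"
  by (induction bs arbitrary: c l) auto

definition dpsums :: "'i set \<Rightarrow> nat \<Rightarrow> nat list \<Rightarrow> ('i \<Rightarrow> real) \<Rightarrow> real" where
  "dpsums A a bs y = (\<Sum>(c, l)\<leftarrow>shifts a bs. real c * psums A l y)"

lemma dpsums_Nil: "dpsums A a [] y = 0"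
  by (simp add: dpsums_def)

lemma dpsums_Cons: "dpsums A a (b # bs) y = real b * psum A (a + b) y * psums A bs y + psum A b y * dpsums A a bs y"
  by (simp add: dpsums_def o_def case_prod_unfold sum_list_const_mult[symmetric] mult_ac)

lemma poly_bounded_psum: "finite A \<Longrightarrow> poly_bounded A (psum A b)"
  unfolding psum_def[abs_def] by auto

lemma poly_bounded_psums: "finite A \<Longrightarrow> poly_bounded A (psums A bs)"
proof (induction bs)
  case (Cons b bs)
  then have "poly_bounded A (\<lambda>y. psum A b y * psums A bs y)" by (auto intro!: poly_bounded_psum)
  then show ?case by simp
next
  case Nil
  have "psums A [] = (\<lambda>_. 1)" by (simp add: fun_eq_iff)
  then show ?case by (simp add: poly_bounded_const)
qed

lemma poly_bounded_dpsums: "finite A \<Longrightarrow> poly_bounded A (dpsums A a bs)"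
proof (induction bs)
  case (Cons b bs)
  then have "poly_bounded A (\<lambda>y. real b * psum A (a + b) y * psums A bs y + psum A b y * dpsums A a bs y)"
    by (auto intro!: poly_bounded_psum poly_bounded_psums)
  then show ?case by (simp add: dpsums_Cons[abs_def])
next
  case Nil
  have "dpsums A a [] = (\<lambda>_. 0)" by (simp add: fun_eq_iff dpsums_Nil)
  then show ?case by (simp add: poly_bounded_const)
qed

lemma psums_nonneg: "pos_on A y \<Longrightarrow> psums A bs y \<ge> 0"
  by (induction bs) (auto simp: psum_def pos_on_def less_imp_le intro!: mult_nonneg_nonneg sum_nonneg)

lemma psums_cong: "(\<And>i. i \<in> A \<Longrightarrow> y i = z i) \<Longrightarrow> psums A bs y = psums A bs z"
  by (induction bs) (auto simp: psum_def)

lemma diff_family_psum: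
  assumes "finite A"
  shows "diff_family A (\<lambda>e y. psum A b (\<lambda>i\<in>A. y i + e * y i ^ Suc a)) (\<lambda>y. real b * psum A (a + b) y)"
proof -
  have 1: "diff_family A (\<lambda>e y. \<Sum>i\<in>A. (y i + e * y i ^ Suc a) ^ b)
     (\<lambda>y. \<Sum>i\<in>A. real b * (y i + 0 * y i ^ Suc a) ^ (b - 1) * y i ^ Suc a)"
    using assms by (intro diff_family_sum diff_family_power diff_family_lin) auto
  have 2: "(\<Sum>i\<in>A. real b * (y i + 0 * y i ^ Suc a) ^ (b - 1) * y i ^ Suc a) = real b * psum A (a + b) y" for y
    unfolding psum_def sum_distrib_left
    by (intro sum.cong refl) (cases b; simp add: power_add mult_ac)
  show ?thesis using diff_family_cong[OF 1 2] by (simp add: psum_def)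
qed

lemma diff_family_psums:
  assumes "finite A"
  shows "diff_family A (\<lambda>e y. psums A bs (\<lambda>i\<in>A. y i + e * y i ^ Suc a)) (dpsums A a bs)"
proof (induction bs)
  case Nil
  then show ?case using diff_family_static[OF poly_bounded_const[of A 1]] by (simp add: dpsums_Nil[abs_def])
next
  case (Cons b bs)
  note F = diff_family_mult[OF diff_family_psum[OF assms, of b a] Cons]
  have r: "psums A bs (\<lambda>i\<in>A. y i + 0 * y i ^ Suc a) = psums A bs y"
      "psum A b (\<lambda>i\<in>A. y i + 0 * y i ^ Suc a) = psum A b y" for y
    by (auto simp: psum_def intro: psums_cong)
  show ?case unfolding psums.simps(2)
    by (rule diff_family_cong[OF F]) (simp only: r dpsums_Cons)
qed

locale lag_setup =
  fixes A :: "('i::linorder) set" and k s :: real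
  assumes finA: "finite A" and s: "s > 0" and k: "k > 0"
begin

definition moment :: "nat list \<Rightarrow> real" where
  "moment bs = (\<integral>y. psums A bs y \<partial>lag k s A)"

lemma integrable_poly_bounded: "poly_bounded A f \<Longrightarrow> integrable (lag k s A) f"
  using integrable_lag_poly_bounded[OF finA s] k by simp

text \<open>The flow along x^(a + 1) has b = x^a and derivative (a + 1) x^a, so the one-particle
  terms add up to (s - 1) + (a + 1) = s + a. The exponential contributes the power sum of index a +
  1, which is solved for; the sum over \<open>shifts\<close> is the derivative of the remaining
  power sums.\<close>

lemma moment_recursion:
  "moment (Suc a # bs) = (s + real a) * moment (a # bs)
     + k * ((\<Sum>c\<le>a. moment (c # (a - c) # bs)) - (real a + 1) * moment (a # bs))
     + (\<Sum>(c, l)\<leftarrow>shifts a bs. real c * moment l)"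
proof -
  \<comment> \<open>The divided difference of x^(a + 1).\<close>
  define h where "h x y = (\<Sum>c\<le>a. x ^ c * y ^ (a - c))" for x y :: real
  have hsym: "h x y = h y x" for x y
    unfolding h_def using sum.nat_diff_reindex[of "\<lambda>c. x ^ c * y ^ (a - c)" "Suc a"]
    by (simp add: lessThan_Suc_atMost mult.commute)
  interpret lag_flow "\<lambda>x. x ^ Suc a" "\<lambda>x. x ^ a" "\<lambda>x. real (Suc a) * x ^ a" h A k s
  proof (unfold_locales; (rule finA s k)?)
    fix x y :: real assume "x > 0" "y > 0"
    then show "h x y \<ge> 0" by (auto simp: h_def intro!: sum_nonneg)
    show "x ^ Suc a - y ^ Suc a = (x - y) * h x y"
      by (simp only: power_diff_sumr2 h_def lessThan_Suc_atMost diff_Suc_Suc mult.commute)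
  next
    fix x :: real
    show "((\<lambda>x. x ^ Suc a) has_real_derivative real (Suc a) * x ^ a) (at x)"
      using DERIV_pow[of "Suc a" x] by simp
  next
    show "\<exists>C n. \<forall>x>0. \<bar>x ^ Suc a\<bar> \<le> C * (1 + x :: real) ^ n"
      by (rule exI[of _ 1], rule exI[of _ "Suc a"]) (auto intro!: mult_mono power_mono)
    show "\<exists>C n. \<forall>x>0. \<bar>x ^ a\<bar> \<le> C * (1 + x :: real) ^ n"
      by (rule exI[of _ 1], rule exI[of _ "a"]) (auto intro!: power_mono)
    show "\<exists>C n. \<forall>x>0. \<bar>real (Suc a) * x ^ a\<bar> \<le> C * (1 + x :: real) ^ n"
      by (rule exI[of _ "real (Suc a)"], rule exI[of _ "a"]) (auto simp: abs_mult intro!: mult_left_mono power_mono)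
  next
    fix i j assume "i \<in> A" "j \<in> A"
    then show "poly_bounded A (\<lambda>y. h (y i) (y j))" unfolding h_def using finA by auto
  qed (auto intro!: continuous_intros)
  note pb = poly_bounded_psums[OF finA] poly_bounded_psum[OF finA] poly_bounded_dpsums[OF finA]
  \<comment> \<open>Summed over all i and j the divided difference factors into products of two
    power sums. Removing the diagonal i = j costs (a + 1) times the power sum of index a.\<close>
  have hs: "(\<Sum>p\<in>pairs_on A. 2 * k * h (y (fst p)) (y (snd p))) =
      k * ((\<Sum>c\<le>a. psum A c y * psum A (a - c) y) - (real a + 1) * psum A a y)" for y
  proof -
    have d: "h x x = (real a + 1) * x ^ a" for x
      by (simp add: h_def power_add[symmetric])
    have "(\<Sum>p\<in>pairs_on A. 2 * k * h (y (fst p)) (y (snd p))) = k * (\<Sum>p\<in>pairs_on A. 2 * h (y (fst p)) (y (snd p)))"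
      by (simp add: sum_distrib_left mult_ac)
    also have "(\<Sum>p\<in>pairs_on A. 2 * h (y (fst p)) (y (snd p))) = (\<Sum>i\<in>A. \<Sum>j\<in>A - {i}. h (y i) (y j))"
      by (rule sum_pairs_on_symmetric[OF finA hsym])
    also have "\<dots> = (\<Sum>i\<in>A. (\<Sum>j\<in>A. h (y i) (y j)) - h (y i) (y i))"
      using finA by (intro sum.cong refl) (simp add: sum_diff1)
    also have "\<dots> = (\<Sum>i\<in>A. \<Sum>j\<in>A. h (y i) (y j)) - (real a + 1) * psum A a y"
      by (simp add: sum_subtractf d psum_def sum_distrib_left)
    also have "(\<Sum>i\<in>A. \<Sum>j\<in>A. h (y i) (y j)) = (\<Sum>i\<in>A. \<Sum>c\<le>a. \<Sum>j\<in>A. y i ^ c * y j ^ (a - c))"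
      unfolding h_def by (intro sum.cong refl sum.swap)
    also have "\<dots> = (\<Sum>c\<le>a. \<Sum>i\<in>A. \<Sum>j\<in>A. y i ^ c * y j ^ (a - c))" by (rule sum.swap)
    also have "\<dots> = (\<Sum>c\<le>a. psum A c y * psum A (a - c) y)"
      by (simp add: psum_def sum_product)
    finally show ?thesis .
  qed
  have "(\<integral>y. dpsums A a bs y + psums A bs y * ((\<Sum>i\<in>A. (s - 1) * y i ^ a) +
     ((\<Sum>p\<in>pairs_on A. 2 * k * h (y (fst p)) (y (snd p))) +
     ((\<Sum>i\<in>A. real (Suc a) * y i ^ a) - (\<Sum>i\<in>A. y i ^ Suc a)))) \<partial>lag k s A) = 0"
    by (rule lag_flow_identity[OF poly_bounded_measurable[OF pb(1)] psums_nonneg _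
          diff_family_psums[OF finA] poly_bounded_measurable[OF pb(3)]])
       (auto intro: psums_cong)
  also have "(\<lambda>y. dpsums A a bs y + psums A bs y * ((\<Sum>i\<in>A. (s - 1) * y i ^ a) +
     ((\<Sum>p\<in>pairs_on A. 2 * k * h (y (fst p)) (y (snd p))) +
     ((\<Sum>i\<in>A. real (Suc a) * y i ^ a) - (\<Sum>i\<in>A. y i ^ Suc a))))) =
    (\<lambda>y. (\<Sum>(c, l)\<leftarrow>shifts a bs. real c * psums A l y) + ((s + real a) * psums A (a # bs) y
       + k * ((\<Sum>c\<le>a. psums A (c # (a - c) # bs) y) - (real a + 1) * psums A (a # bs) y) - psums A (Suc a # bs) y))"
  proof
    fix y
    have e: "(\<Sum>i\<in>A. (s - 1) * y i ^ a) = (s - 1) * psum A a y" "(\<Sum>i\<in>A. real (Suc a) * y i ^ a) = real (Suc a) * psum A a y"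
      "(\<Sum>i\<in>A. y i ^ Suc a) = psum A (Suc a) y"
      "(\<Sum>c\<le>a. psums A (c # (a - c) # bs) y) = (\<Sum>c\<le>a. psum A c y * psum A (a - c) y) * psums A bs y"
      by (simp_all add: psum_def sum_distrib_left sum_distrib_right mult_ac)
    show "dpsums A a bs y + psums A bs y * ((\<Sum>i\<in>A. (s - 1) * y i ^ a) +
       ((\<Sum>p\<in>pairs_on A. 2 * k * h (y (fst p)) (y (snd p))) +
       ((\<Sum>i\<in>A. real (Suc a) * y i ^ a) - (\<Sum>i\<in>A. y i ^ Suc a)))) =
      (\<Sum>(c, l)\<leftarrow>shifts a bs. real c * psums A l y) + ((s + real a) * psums A (a # bs) y
       + k * ((\<Sum>c\<le>a. psums A (c # (a - c) # bs) y) - (real a + 1) * psums A (a # bs) y) - psums A (Suc a # bs) y)"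
      unfolding hs e unfolding psums.simps(2) dpsums_def by (simp add: algebra_simps)
  qed
  finally have 0: "(\<integral>y. (\<Sum>(c, l)\<leftarrow>shifts a bs. real c * psums A l y) + ((s + real a) * psums A (a # bs) y
       + k * ((\<Sum>c\<le>a. psums A (c # (a - c) # bs) y) - (real a + 1) * psums A (a # bs) y) - psums A (Suc a # bs) y) \<partial>lag k s A) = 0" .
  have i[simp]: "integrable (lag k s A) (\<lambda>y. psums A l y)" for l
    by (intro integrable_poly_bounded pb)
  have L: "integrable (lag k s A) (\<lambda>y. \<Sum>(c, l)\<leftarrow>L. real c * psums A l y) \<and>
     (\<integral>y. (\<Sum>(c, l)\<leftarrow>L. real c * psums A l y) \<partial>lag k s A) = (\<Sum>(c, l)\<leftarrow>L. real c * moment l)" for L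
    by (induction L) (auto simp: moment_def)
  show ?thesis
    using 0 L[of "shifts a bs"] by (simp add: moment_def del: psums.simps)
qed

end

subsection \<open>The Selberg--Laguerre integral\<close>

text \<open>The coefficients of \<open>gen_poly A y\<close> are the elementary symmetric polynomials.\<close>
definition gen_poly :: "'i set \<Rightarrow> ('i \<Rightarrow> real) \<Rightarrow> real poly" where
  "gen_poly A y = (\<Prod>i\<in>A. [:1, y i:])"

lemma poly_gen_poly: "poly (gen_poly A y) t = (\<Prod>i\<in>A. 1 + t * y i)"
  by (simp add: gen_poly_def poly_prod)

lemma gen_poly_remove:
  "finite A \<Longrightarrow> i \<in> A \<Longrightarrow> gen_poly A y = gen_poly (A - {i}) y + pCons 0 (smult (y i) (gen_poly (A - {i}) y))"
  by (simp add: gen_poly_def prod.remove)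

lemma degree_gen_poly: "degree (gen_poly A y) \<le> card A"
proof (cases "finite A")
  case True
  have "degree (gen_poly A y) \<le> (\<Sum>i\<in>A. degree [:1, y i:])"
    unfolding gen_poly_def using degree_prod_sum_le[OF True, of "\<lambda>i. [:1, y i:]"] by (simp add: o_def)
  also have "\<dots> \<le> (\<Sum>i\<in>A. 1)" by (intro sum_mono) auto
  finally show ?thesis by simp
qed (simp add: gen_poly_def)

lemma pderiv_gen_poly: "finite A \<Longrightarrow> pderiv (gen_poly A y) = (\<Sum>i\<in>A. smult (y i) (gen_poly (A - {i}) y))"
  unfolding gen_poly_def by (simp add: pderiv_prod pderiv_pCons)

lemma sum_pCons_0: "(\<Sum>i\<in>A. pCons 0 (f i)) = pCons 0 (\<Sum>i\<in>A. f i)"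
  by (induction A rule: infinite_finite_induct) auto

text \<open>For the generating polynomial E(t) each factor gives E_(A - i) = E - t y_i E_(A - i).
  Since the sum of y_i E_(A - i) is E', the total is |A| E - t E', whose coefficients are as
  claimed.\<close>

lemma coeff_sum_gen_poly_remove:
  assumes "finite A"
  shows "(\<Sum>i\<in>A. coeff (gen_poly (A - {i}) y) j) = (real (card A) - real j) * coeff (gen_poly A y) j"
proof -
  have "(\<Sum>i\<in>A. gen_poly (A - {i}) y) = (\<Sum>i\<in>A. gen_poly A y - pCons 0 (smult (y i) (gen_poly (A - {i}) y)))"
    using gen_poly_remove[OF assms, of _ y] by (intro sum.cong refl) (metis add_diff_cancel_right')
  also have "\<dots> = smult (real (card A)) (gen_poly A y) - pCons 0 (pderiv (gen_poly A y))"
    by (simp add: sum_subtractf pderiv_gen_poly[OF assms] of_nat_poly sum_pCons_0)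
  finally have "coeff (\<Sum>i\<in>A. gen_poly (A - {i}) y) j = coeff (smult (real (card A)) (gen_poly A y) - pCons 0 (pderiv (gen_poly A y))) j"
    by simp
  then show ?thesis by (cases j) (simp_all add: coeff_sum coeff_pderiv algebra_simps)
qed

lemma coeff_gen_poly_0: "coeff (gen_poly A y) 0 = 1"
  using poly_gen_poly[of A y 0] by (simp add: poly_0_coeff_0)

lemma coeff_gen_poly_card: "finite A \<Longrightarrow> coeff (gen_poly A y) (card A) = (\<Prod>i\<in>A. y i)"
proof (induction A rule: finite_induct)
  case empty then show ?case by (simp add: gen_poly_def)
next
  case (insert i A)
  have "coeff (gen_poly A y) (Suc (card A)) = 0"
    using degree_gen_poly[of A y] by (intro coeff_eq_0) simp
  then show ?case using insert gen_poly_remove[of "insert i A" i y] by simp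
qed

lemma poly_bounded_coeff_gen_poly:
  assumes "finite A" "B \<subseteq> A" shows "poly_bounded A (\<lambda>y. coeff (gen_poly B y) j)"
proof -
  have "finite B" using assms finite_subset by blast
  then show ?thesis using assms(2)
  proof (induction B arbitrary: j rule: finite_induct)
    case empty then show ?case by (auto simp: gen_poly_def)
  next
    case (insert i B)
    have eq: "coeff (gen_poly (insert i B) y) j = coeff (gen_poly B y) j + (if j = 0 then 0 else y i * coeff (gen_poly B y) (j - 1))" for y
      using insert gen_poly_remove[of "insert i B" i y] by (cases j) simp_all
    show ?case unfolding eq using insert assms(1) by (cases "j = 0") auto
  qed
qed

lemma poly_bounded_gen_prod: "finite A \<Longrightarrow> B \<subseteq> A \<Longrightarrow> poly_bounded A (\<lambda>y. \<Prod>i\<in>B. 1 + t * y i)"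
  by (intro poly_bounded_prod poly_bounded_add poly_bounded_mult poly_bounded_const poly_bounded_component) auto

context lag_setup
begin

definition esym_moment :: "nat \<Rightarrow> real" where
  "esym_moment j = (\<integral>y. coeff (gen_poly A y) j \<partial>lag k s A)"

lemma inverse_comp_poly_bounded:
  assumes "t > 0" "i \<in> A" shows "poly_bounded A (\<lambda>y. 1 / (1 + t * y i))"
proof (rule poly_bounded_comp[OF finA assms(2), where C = 1 and n = 0])
  fix x :: real assume "x > 0"
  then show "\<bar>1 / (1 + t * x)\<bar> \<le> 1 * (1 + x) ^ 0" using assms by (simp add: divide_le_eq_1 add_pos_pos)
qed measurable

text \<open>The field x / (1 + t x) has divided difference 1 / ((1 + t x)(1 + t y)). Against the
  test function \<Prod>(1 + t y_i) all denominators cancel, and what remains is a polynomial in t: a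
  generating function for Aomoto's recursion, covering all elementary symmetric polynomials at
  once.\<close>

lemma aomoto_identity:
  assumes t: "t > 0"
  shows "(\<integral>y. (\<Sum>i\<in>A. (s - y i) * (\<Prod>j\<in>A - {i}. 1 + t * y j)) +
     k * (\<Sum>i\<in>A. \<Sum>j\<in>A - {i}. \<Prod>l\<in>A - {i} - {j}. 1 + t * y l) \<partial>lag k s A) = 0"
proof -
  interpret lag_flow "\<lambda>x. x / (1 + t * x)" "\<lambda>x. 1 / (1 + t * x)" "\<lambda>x. 1 / (1 + t * x)^2"
    "\<lambda>x y. 1 / (1 + t * x) * (1 / (1 + t * y))" A k s
  proof (unfold_locales; (rule finA s k)?)
    fix x y :: real assume xy: "x > 0" "y > 0"
    then have p: "1 + t * x > 0" "1 + t * y > 0" using t by (auto intro!: add_pos_pos)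
    show "1 / (1 + t * x) * (1 / (1 + t * y)) \<ge> 0" using p by simp
    show "x / (1 + t * x) - y / (1 + t * y) = (x - y) * (1 / (1 + t * x) * (1 / (1 + t * y)))"
      using p by (simp add: divide_simps) algebra
  next
    fix x :: real assume x: "x \<ge> 0"
    then have p: "1 + t * x > 0" using t by (auto intro!: add_pos_nonneg)
    show "x / (1 + t * x) = x * (1 / (1 + t * x))" by simp
    show "0 \<le> 1 / (1 + t * x)" using p by simp
    show "0 \<le> 1 / (1 + t * x)^2" by simp
    show "((\<lambda>x. x / (1 + t * x)) has_real_derivative 1 / (1 + t * x)^2) (at x)"
      using p by (auto intro!: derivative_eq_intros simp: power2_eq_square divide_simps)
  next
    have p: "1 + t * x > 0" if "x \<ge> 0" for x using t that by (auto intro!: add_pos_nonneg)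
    show "continuous_on {0..} (\<lambda>x. 1 / (1 + t * x)^2)"
      by (intro continuous_intros) (use p in \<open>auto dest!: p\<close>)
    have p1: "1 + t * x \<ge> 1" if "x > 0" for x using t that by auto
    have b: "\<bar>1 / (1 + t * x)\<bar> \<le> 1" if "x > 0" for x using p1[OF that] by (simp add: divide_le_eq_1)
    show "\<exists>C n. \<forall>x>0. \<bar>1 / (1 + t * x)\<bar> \<le> C * (1 + x) ^ n"
      by (rule exI[of _ 1], rule exI[of _ 0]) (use b in simp)
    show "\<exists>C n. \<forall>x>0. \<bar>1 / (1 + t * x)^2\<bar> \<le> C * (1 + x) ^ n"
      by (rule exI[of _ 1], rule exI[of _ 0]) (use p1 in \<open>simp add: divide_le_eq_1\<close>)
    show "\<exists>C n. \<forall>x>0. \<bar>x / (1 + t * x)\<bar> \<le> C * (1 + x) ^ n"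
    proof (rule exI[of _ 1], rule exI[of _ 1], intro allI impI)
      fix x :: real assume x: "x > 0"
      have "\<bar>x / (1 + t * x)\<bar> = x * \<bar>1 / (1 + t * x)\<bar>" using x by (simp add: abs_mult)
      also have "\<dots> \<le> x * 1" using b[OF x] x by (intro mult_left_mono) auto
      finally show "\<bar>x / (1 + t * x)\<bar> \<le> 1 * (1 + x) ^ 1" by simp
    qed
  next
    fix i j assume "i \<in> A" "j \<in> A"
    then show "poly_bounded A (\<lambda>y. 1 / (1 + t * y i) * (1 / (1 + t * y j)))"
      by (intro poly_bounded_mult inverse_comp_poly_bounded t)
  qed measurable
  define q where "q y = (\<Prod>i\<in>A. 1 + t * y i)" for y :: "'i \<Rightarrow> real"
  \<comment> \<open>Moving x by e x / (1 + t x) multiplies 1 + t x by 1 + e t x / (1 + t x)^2, so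
    the logarithmic derivative of q at e = 0 is the sum of these terms.\<close>
  define dq where "dq y = q y * (\<Sum>i\<in>A. t * y i * (1 / (1 + t * y i)) * (1 / (1 + t * y i)))" for y :: "'i \<Rightarrow> real"
  have qb: "poly_bounded A q" unfolding q_def by (rule poly_bounded_gen_prod[OF finA order_refl])
  have gb: "poly_bounded A (\<lambda>y. t * y i * (1 / (1 + t * y i)) * (1 / (1 + t * y i)))" if "i \<in> A" for i
    using that by (intro poly_bounded_mult inverse_comp_poly_bounded t poly_bounded_const poly_bounded_component finA)
  have dqb: "poly_bounded A dq" unfolding dq_def by (intro poly_bounded_mult qb poly_bounded_sum gb)
  have fam0: "diff_family A (\<lambda>e y. q y * (\<Prod>i\<in>A. 1 + e * (t * y i * (1 / (1 + t * y i)) * (1 / (1 + t * y i))))) (\<lambda>y. 0 * 1 + q y * (\<Sum>i\<in>A. t * y i * (1 / (1 + t * y i)) * (1 / (1 + t * y i))))"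
    using diff_family_mult[OF diff_family_static[OF qb] diff_family_prod[OF finA diff_family_lin[OF poly_bounded_const[of A 1] gb]]]
    by simp
  have I: "(\<integral>y. dq y + q y * ((\<Sum>i\<in>A. (s - 1) * (1 / (1 + t * y i))) +
     ((\<Sum>p\<in>pairs_on A. 2 * k * (1 / (1 + t * y (fst p)) * (1 / (1 + t * y (snd p))))) +
     ((\<Sum>i\<in>A. 1 / (1 + t * y i)^2) - (\<Sum>i\<in>A. y i / (1 + t * y i))))) \<partial>lag k s A) = 0"
  proof (rule lag_flow_identity[OF poly_bounded_measurable[OF qb] _ _ _ poly_bounded_measurable[OF dqb]])
    show "0 \<le> q y" if "pos_on A y" for y
      unfolding q_def using that t by (intro prod_nonneg) (auto simp: pos_on_def less_imp_le)
    show "q (restrict y A) = q y" for y by (simp add: q_def)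
    show "diff_family A (\<lambda>e y. q (\<lambda>i\<in>A. y i + e * (y i / (1 + t * y i)))) dq"
    proof -
      have "diff_family A (\<lambda>e y. q (\<lambda>i\<in>A. y i + e * (y i / (1 + t * y i)))) (\<lambda>y. 0 * 1 + q y * (\<Sum>i\<in>A. t * y i * (1 / (1 + t * y i)) * (1 / (1 + t * y i))))"
      proof (rule diff_family_cong_pos[OF fam0])
        fix e y assume y: "pos_on A y"
        show "q y * (\<Prod>i\<in>A. 1 + e * (t * y i * (1 / (1 + t * y i)) * (1 / (1 + t * y i)))) = q (\<lambda>i\<in>A. y i + e * (y i / (1 + t * y i)))"
          unfolding q_def prod.distrib[symmetric]
        proof (rule prod.cong[OF refl])
          fix i assume "i \<in> A"
          then have "1 + t * y i > 0" using y t by (auto simp: pos_on_def intro!: add_pos_pos)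
          then show "(1 + t * y i) * (1 + e * (t * y i * (1 / (1 + t * y i)) * (1 / (1 + t * y i)))) =
            1 + t * (\<lambda>i\<in>A. y i + e * (y i / (1 + t * y i))) i"
            using \<open>i \<in> A\<close> by (simp add: divide_simps) algebra
        qed
      next
        fix e :: real
        have "(\<lambda>y. \<lambda>i\<in>A. y i + e * (y i / (1 + t * y i))) \<in> leb_Pi A \<rightarrow>\<^sub>M leb_Pi A" by measurable
        from measurable_compose[OF this poly_bounded_measurable[OF qb]]
        show "(\<lambda>y. q (\<lambda>i\<in>A. y i + e * (y i / (1 + t * y i)))) \<in> borel_measurable (leb_Pi A)" .
      qed
      then show ?thesis by (rule diff_family_cong) (simp add: dq_def)
    qed
  qed
  have eq: "dq y + q y * ((\<Sum>i\<in>A. (s - 1) * (1 / (1 + t * y i))) +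
     ((\<Sum>p\<in>pairs_on A. 2 * k * (1 / (1 + t * y (fst p)) * (1 / (1 + t * y (snd p))))) +
     ((\<Sum>i\<in>A. 1 / (1 + t * y i)^2) - (\<Sum>i\<in>A. y i / (1 + t * y i))))) =
     (\<Sum>i\<in>A. (s - y i) * (\<Prod>j\<in>A - {i}. 1 + t * y j)) +
     k * (\<Sum>i\<in>A. \<Sum>j\<in>A - {i}. \<Prod>l\<in>A - {i} - {j}. 1 + t * y l)" if y: "pos_on A y" for y
  proof -
    have p: "1 + t * y i > 0" if "i \<in> A" for i using y t that by (auto simp: pos_on_def intro!: add_pos_pos)
    have q1: "(\<Prod>j\<in>A - {i}. 1 + t * y j) = q y / (1 + t * y i)" if "i \<in> A" for i
      using p[OF that] that finA unfolding q_def by (subst prod.remove[of A i]) (auto simp: field_simps)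
    have q2: "(\<Prod>l\<in>A - {i} - {j}. 1 + t * y l) = q y * (1 / (1 + t * y i) * (1 / (1 + t * y j)))" if "i \<in> A" "j \<in> A - {i}" for i j
    proof -
      have "(\<Prod>j\<in>A - {i}. 1 + t * y j) = (1 + t * y j) * (\<Prod>l\<in>A - {i} - {j}. 1 + t * y l)"
        using that finA by (intro prod.remove) auto
      then have "(\<Prod>l\<in>A - {i} - {j}. 1 + t * y l) = (q y / (1 + t * y i)) / (1 + t * y j)"
        using p[of j] that q1[OF that(1)] by (simp add: nonzero_eq_divide_eq mult.commute)
      then show ?thesis by simp
    qed
    have pairs: "q y * (\<Sum>p\<in>pairs_on A. 2 * k * (1 / (1 + t * y (fst p)) * (1 / (1 + t * y (snd p))))) =
       k * (\<Sum>i\<in>A. \<Sum>j\<in>A - {i}. \<Prod>l\<in>A - {i} - {j}. 1 + t * y l)"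
      using sum_pairs_on_symmetric[OF finA, of "\<lambda>i j. k * (1 / (1 + t * y i) * (1 / (1 + t * y j)))"] q2
      by (simp add: sum_distrib_left mult_ac)
    have single: "dq y + q y * ((\<Sum>i\<in>A. (s - 1) * (1 / (1 + t * y i))) + ((\<Sum>i\<in>A. 1 / (1 + t * y i)^2) - (\<Sum>i\<in>A. y i / (1 + t * y i)))) =
       (\<Sum>i\<in>A. (s - y i) * (\<Prod>j\<in>A - {i}. 1 + t * y j))"
      unfolding dq_def sum_distrib_left sum.distrib[symmetric] sum_subtractf[symmetric]
    proof (rule sum.cong[OF refl])
      fix i assume i: "i \<in> A"
      show "q y * (t * y i * (1 / (1 + t * y i)) * (1 / (1 + t * y i))) + q y * ((s - 1) * (1 / (1 + t * y i)) + (1 / (1 + t * y i)^2 - y i / (1 + t * y i))) =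
         (s - y i) * (\<Prod>j\<in>A - {i}. 1 + t * y j)"
        unfolding q1[OF i] using p[OF i] by (simp add: divide_simps power2_eq_square) algebra
    qed
    show ?thesis unfolding single[symmetric] pairs[symmetric] by (simp add: algebra_simps)
  qed
  have "(\<integral>y. (\<Sum>i\<in>A. (s - y i) * (\<Prod>j\<in>A - {i}. 1 + t * y j)) +
     k * (\<Sum>i\<in>A. \<Sum>j\<in>A - {i}. \<Prod>l\<in>A - {i} - {j}. 1 + t * y l) \<partial>lag k s A) = 
    (\<integral>y. dq y + q y * ((\<Sum>i\<in>A. (s - 1) * (1 / (1 + t * y i))) +
     ((\<Sum>p\<in>pairs_on A. 2 * k * (1 / (1 + t * y (fst p)) * (1 / (1 + t * y (snd p))))) +
     ((\<Sum>i\<in>A. 1 / (1 + t * y i)^2) - (\<Sum>i\<in>A. y i / (1 + t * y i))))) \<partial>lag k s A)"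
  proof (rule integral_cong_AE)
    have "poly_bounded A (\<lambda>y. (\<Sum>i\<in>A. (s - y i) * (\<Prod>j\<in>A - {i}. 1 + t * y j)) +
     k * (\<Sum>i\<in>A. \<Sum>j\<in>A - {i}. \<Prod>l\<in>A - {i} - {j}. 1 + t * y l))"
      by (intro poly_bounded_add poly_bounded_mult poly_bounded_sum poly_bounded_diff poly_bounded_const
        poly_bounded_component poly_bounded_gen_prod finA) auto
    from poly_bounded_measurable[OF this] show "(\<lambda>y. (\<Sum>i\<in>A. (s - y i) * (\<Prod>j\<in>A - {i}. 1 + t * y j)) +
     k * (\<Sum>i\<in>A. \<Sum>j\<in>A - {i}. \<Prod>l\<in>A - {i} - {j}. 1 + t * y l)) \<in> borel_measurable (lag k s A)" by measurable
    note [measurable] = poly_bounded_measurable[OF qb] poly_bounded_measurable[OF dqb] poly_bounded_measurable[OF poly_bounded_pairs]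
    show "(\<lambda>y. dq y + q y * ((\<Sum>i\<in>A. (s - 1) * (1 / (1 + t * y i))) +
     ((\<Sum>p\<in>pairs_on A. 2 * k * (1 / (1 + t * y (fst p)) * (1 / (1 + t * y (snd p))))) +
     ((\<Sum>i\<in>A. 1 / (1 + t * y i)^2) - (\<Sum>i\<in>A. y i / (1 + t * y i)))))) \<in> borel_measurable (lag k s A)" by measurable
  qed (use AE_lag_pos[OF finA, of k s] in \<open>eventually_elim, simp only: eq\<close>)
  with I show ?thesis by simp
qed

text \<open>Comparison of the coefficients of t^j in \<open>aomoto_identity\<close>. Removing one
  variable contributes the factor n - j, removing a second one the factor n - 1 - j, and the terms
  with y_i add up to the derivative of the generating polynomial.\<close>

lemma esym_recursion:
  "real (Suc j) * esym_moment (Suc j) = (real (card A) - real j) * (s + k * (real (card A) - 1 - real j)) * esym_moment j"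
proof -
  define n where "n = card A"
  define c where "c j = (real n - real j) * (s + k * (real n - 1 - real j)) * esym_moment j - real (Suc j) * esym_moment (Suc j)" for j
  define f where "f j y = (real n - real j) * (s + k * (real n - 1 - real j)) * coeff (gen_poly A y) j - real (Suc j) * coeff (gen_poly A y) (Suc j)" for j y
  have int: "integrable (lag k s A) (\<lambda>y. coeff (gen_poly A y) j)" for j
    by (intro integrable_poly_bounded poly_bounded_coeff_gen_poly finA order_refl)
  have f0: "f j y = 0" if "j > n" for j y
    using degree_gen_poly[of A y] that by (auto simp: f_def n_def coeff_eq_0)
  have pt: "(\<Sum>i\<in>A. (s - y i) * (\<Prod>j\<in>A - {i}. 1 + t * y j)) + k * (\<Sum>i\<in>A. \<Sum>j\<in>A - {i}. \<Prod>l\<in>A - {i} - {j}. 1 + t * y l) =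
     (\<Sum>j\<le>n. f j y * t ^ j)" for t y
  proof -
    define T where "T = smult s (\<Sum>i\<in>A. gen_poly (A - {i}) y) - (\<Sum>i\<in>A. smult (y i) (gen_poly (A - {i}) y))
       + smult k (\<Sum>i\<in>A. \<Sum>j\<in>A - {i}. gen_poly (A - {i} - {j}) y)"
    have "coeff T j = f j y" for j
    proof -
      have "(\<Sum>i\<in>A. \<Sum>l\<in>A - {i}. coeff (gen_poly (A - {i} - {l}) y) j) =
          (\<Sum>i\<in>A. (real n - 1 - real j) * coeff (gen_poly (A - {i}) y) j)"
      proof (rule sum.cong[OF refl])
        fix i assume i: "i \<in> A"
        then have "card A > 0" using finA by (auto simp: card_gt_0_iff)
        then have "real (card (A - {i})) = real n - 1" using i finA by (simp add: n_def card_Diff_singleton of_nat_diff)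
        then show "(\<Sum>l\<in>A - {i}. coeff (gen_poly (A - {i} - {l}) y) j) = (real n - 1 - real j) * coeff (gen_poly (A - {i}) y) j"
          using finA by (simp add: coeff_sum_gen_poly_remove)
      qed
      also have "\<dots> = (real n - 1 - real j) * ((real n - real j) * coeff (gen_poly A y) j)"
        unfolding sum_distrib_left[symmetric] coeff_sum_gen_poly_remove[OF finA] n_def ..
      finally have dbl: "(\<Sum>i\<in>A. \<Sum>l\<in>A - {i}. coeff (gen_poly (A - {i} - {l}) y) j) =
          (real n - 1 - real j) * ((real n - real j) * coeff (gen_poly A y) j)" .
      have "coeff T j = s * (\<Sum>i\<in>A. coeff (gen_poly (A - {i}) y) j) - coeff (pderiv (gen_poly A y)) j
          + k * (\<Sum>i\<in>A. \<Sum>l\<in>A - {i}. coeff (gen_poly (A - {i} - {l}) y) j)"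
        unfolding T_def pderiv_gen_poly[OF finA, symmetric] by (simp add: coeff_sum)
      then show ?thesis
        unfolding dbl coeff_sum_gen_poly_remove[OF finA] coeff_pderiv f_def n_def by (simp add: algebra_simps)
    qed
    note co = this
    have deg: "degree T \<le> n" by (rule degree_le) (use f0 in \<open>auto simp: co\<close>)
    have "poly T t = (\<Sum>j\<le>n. coeff T j * t ^ j)"
      unfolding poly_altdef using deg by (intro sum.mono_neutral_left) (auto simp: coeff_eq_0)
    moreover have "poly T t = (\<Sum>i\<in>A. (s - y i) * (\<Prod>j\<in>A - {i}. 1 + t * y j)) + k * (\<Sum>i\<in>A. \<Sum>j\<in>A - {i}. \<Prod>l\<in>A - {i} - {j}. 1 + t * y l)"
      unfolding T_def by (simp add: poly_sum poly_gen_poly left_diff_distrib sum_subtractf sum_distrib_left)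
    ultimately show ?thesis by (simp add: co)
  qed
  define p where "p = (\<Sum>j\<le>n. monom (c j) j)"
  have "poly p t = 0" if t: "t > 0" for t
  proof -
    have "0 = (\<integral>y. (\<Sum>j\<le>n. f j y * t ^ j) \<partial>lag k s A)"
      using aomoto_identity[OF t] unfolding pt by simp
    also have "\<dots> = (\<Sum>j\<le>n. c j * t ^ j)"
      using int by (subst Bochner_Integration.integral_sum) (auto simp: f_def c_def esym_moment_def)
    also have "\<dots> = poly p t" by (simp add: p_def poly_sum poly_monom)
    finally show ?thesis by simp
  qed
  \<comment> \<open>The identity is known only for t > 0, but a polynomial with infinitely many
    roots is zero.\<close>
  then have "{0<..} \<subseteq> {t. poly p t = 0}" by auto
  then have "infinite {t. poly p t = 0}" using infinite_Ioi infinite_super by blast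
  then have "p = 0" using poly_roots_finite by blast
  moreover have "coeff p j = (if j \<le> n then c j else 0)" for j
    by (simp add: p_def coeff_sum)
  ultimately have "c j = 0" if "j \<le> n" for j using that by (metis coeff_0)
  moreover have "c j = 0" if "j > n"
  proof -
    have "coeff (gen_poly A y) j = 0" "coeff (gen_poly A y) (Suc j) = 0" for y
      using degree_gen_poly[of A y] that by (auto simp: n_def coeff_eq_0)
    then show ?thesis by (simp add: c_def esym_moment_def)
  qed
  ultimately have "c j = 0" by (cases "j \<le> n") auto
  then show ?thesis by (simp add: c_def n_def)
qed

definition Z where "Z = (\<integral>y. 1 \<partial>lag k s A)"

lemma esym_moment_eq:
  "fact j * esym_moment j = (\<Prod>i<j. (real (card A) - real i) * (s + k * (real (card A) - 1 - real i))) * Z"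
proof (induction j)
  case 0
  then show ?case by (simp add: esym_moment_def Z_def coeff_gen_poly_0)
next
  case (Suc j)
  have "fact (Suc j) * esym_moment (Suc j) = fact j * (real (Suc j) * esym_moment (Suc j))" by simp
  also have "\<dots> = (real (card A) - real j) * (s + k * (real (card A) - 1 - real j)) * (fact j * esym_moment j)"
    unfolding esym_recursion by simp
  finally show ?case by (simp add: Suc)
qed

text \<open>The top elementary symmetric polynomial is the product of all coordinates. For it the
  factors n - i multiply to n!, which cancels.\<close>

lemma integral_prod_eq: "(\<integral>y. (\<Prod>i\<in>A. y i) \<partial>lag k s A) = (\<Prod>i<card A. s + k * real i) * Z"
proof -
  let ?n = "card A"
  have "fact ?n * esym_moment ?n = ((\<Prod>i<?n. (real ?n - real i)) * (\<Prod>i<?n. (s + k * (real ?n - 1 - real i)))) * Z"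
    by (simp add: esym_moment_eq prod.distrib)
  also have "(\<Prod>i<?n. (real ?n - real i)) = (\<Prod>i<?n. real (Suc i))"
    using prod.nat_diff_reindex[of "\<lambda>i. real (Suc i)" ?n]
    by (simp add: of_nat_diff Suc_leI algebra_simps cong: prod.cong_simp)
  also have "\<dots> = fact ?n" by (simp add: fact_prod_Suc lessThan_atLeast0)
  also have "(\<Prod>i<?n. (s + k * (real ?n - 1 - real i))) = (\<Prod>i<?n. s + k * real i)"
    using prod.nat_diff_reindex[of "\<lambda>i. s + k * real i" ?n]
    by (simp add: of_nat_diff Suc_leI algebra_simps cong: prod.cong_simp)
  finally show ?thesis by (simp add: esym_moment_def coeff_gen_poly_card[OF finA])
qed

end

section \<open>Positivity and finiteness of the normalisation\<close>

lemma emeasure_leb_Pi_diagonal: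
  assumes A: "finite A" and ij: "i \<in> A" "j \<in> A" "i \<noteq> j"
  shows "AE y in leb_Pi A. y i \<noteq> y j"
proof -
  define B where "B = A - {i}"
  have B: "finite B" "i \<notin> B" "A = insert i B" "j \<in> B" using assms by (auto simp: B_def)
  have [measurable]: "(\<lambda>y. y i) \<in> borel_measurable (leb_Pi A)" "(\<lambda>y. y j) \<in> borel_measurable (leb_Pi A)"
    using ij by (auto intro: measurable_leb_Pi_component)
  have "(\<integral>\<^sup>+y. (if y i = y j then 1 else 0) \<partial>leb_Pi A) = (\<integral>\<^sup>+x. (\<integral>\<^sup>+z. (if (x(i := z)) i = (x(i := z)) j then 1 else 0) \<partial>lborel) \<partial>leb_Pi B)"
    unfolding B(3) by (rule leb.product_nn_integral_insert[OF B(1,2)]) (unfold B(3)[symmetric], measurable)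
  also have "\<dots> = (\<integral>\<^sup>+x. 0 \<partial>leb_Pi B)"
  proof (rule nn_integral_cong)
    fix x :: "'a \<Rightarrow> real"
    have "(\<integral>\<^sup>+z. (if (x(i := z)) i = (x(i := z)) j then 1 else 0) \<partial>lborel) = (\<integral>\<^sup>+z. indicator {x j} z \<partial>lborel)"
      using ij by (intro nn_integral_cong) (auto simp: indicator_def)
    then show "(\<integral>\<^sup>+z. (if (x(i := z)) i = (x(i := z)) j then 1 else 0) \<partial>lborel) = 0" by simp
  qed
  finally have "(\<integral>\<^sup>+y. (if y i = y j then 1 else 0) \<partial>leb_Pi A) = 0" by simp
  then have "AE y in leb_Pi A. (if y i = y j then 1 else 0 :: ennreal) = 0"
    by (subst (asm) nn_integral_0_iff_AE) auto
  then show ?thesis by eventually_elim (auto split: if_splits)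
qed

lemma AE_leb_Pi_weight_pos:
  assumes A: "finite A"
  shows "AE y in leb_Pi A. pos_on A y \<longrightarrow> 0 < D_on A y \<and> 0 < omega_on k A y"
proof -
  have "AE y in leb_Pi A. \<forall>p\<in>pairs_on A. y (fst p) \<noteq> y (snd p)"
    by (rule AE_finite_allI[OF finite_pairs_on[OF A]])
       (auto simp: pairs_on_def intro!: emeasure_leb_Pi_diagonal[OF A])
  then show ?thesis
    by eventually_elim (auto simp: omega_on_pairs D_on_pos intro!: prod_pos)
qed

lemma emeasure_leb_Pi_box:
  "finite A \<Longrightarrow> emeasure (leb_Pi A) (Pi\<^sub>E A (\<lambda>i. {a i<..<b i})) = (\<Prod>i\<in>A. ennreal (max 0 (b i - a i)))"
  by (subst leb.emeasure_PiM) (auto simp: max_def intro!: prod.cong)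

lemma nn_integral_lag_const:
  assumes "finite A" shows "(\<integral>\<^sup>+y. 1 \<partial>lag k s A) = (\<integral>\<^sup>+y. lag_dens k s A y \<partial>leb_Pi A)"
  using nn_integral_lag[OF assms, of "\<lambda>_. 1" k s] by simp

lemma nn_integral_lag_dens_pos:
  assumes A: "finite A" shows "0 < (\<integral>\<^sup>+y. lag_dens k s A y \<partial>leb_Pi A)"
proof (rule ccontr)
  assume "\<not> ?thesis"
  then have "(\<integral>\<^sup>+y. lag_dens k s A y \<partial>leb_Pi A) = 0" by simp
  then have "AE y in leb_Pi A. lag_dens k s A y \<le> 0"
    using A by (subst (asm) nn_integral_0_iff_AE) (auto simp: ennreal_eq_0_iff)
  with AE_leb_Pi_weight_pos[OF A, of k] have "AE y in leb_Pi A. \<not> pos_on A y"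
    by eventually_elim (auto simp: lag_dens_def mult_le_0_iff not_le)
  then have "AE y in leb_Pi A. y \<notin> Pi\<^sub>E A (\<lambda>i. {0<..<1})"
    by eventually_elim (auto simp: pos_on_def)
  then have "emeasure (leb_Pi A) (Pi\<^sub>E A (\<lambda>i. {0<..<1})) = 0"
  proof -
    assume "AE y in leb_Pi A. y \<notin> Pi\<^sub>E A (\<lambda>i. {0<..<1})"
    then have "emeasure (leb_Pi A) {y \<in> space (leb_Pi A). y \<in> Pi\<^sub>E A (\<lambda>i. {0<..<1})} = 0"
      by (rule emeasure_eq_0_AE)
    also have "{y \<in> space (leb_Pi A). y \<in> Pi\<^sub>E A (\<lambda>i. {0<..<1})} = Pi\<^sub>E A (\<lambda>i. {0<..<1})"
      by (auto simp: space_PiM PiE_def)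
    finally show ?thesis .
  qed
  then show False using emeasure_leb_Pi_box[OF A, of "\<lambda>_. 0" "\<lambda>_. 1"] by simp
qed

definition lag_Z :: "real \<Rightarrow> real \<Rightarrow> ('i::linorder) set \<Rightarrow> real" where
  "lag_Z k s A = (\<integral>y. 1 \<partial>lag k s A)"

lemma ennreal_lag_Z:
  assumes A: "finite A" and s: "s > 0" and k: "k > 0"
  shows "ennreal (lag_Z k s A) = (\<integral>\<^sup>+y. lag_dens k s A y \<partial>leb_Pi A)"
proof -
  have "integrable (lag k s A) (\<lambda>_. 1 :: real)"
    using integrable_lag_poly_bounded[OF A s _ poly_bounded_const] k by simp
  from nn_integral_eq_integral[OF this] show ?thesis
    using nn_integral_lag_const[OF A, of k s] by (simp add: lag_Z_def)
qed

lemma lag_Z_pos: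
  assumes A: "finite A" and s: "s > 0" and k: "k > 0" shows "lag_Z k s A > 0"
proof -
  have "0 < ennreal (lag_Z k s A)"
    unfolding ennreal_lag_Z[OF assms] by (rule nn_integral_lag_dens_pos[OF A])
  then show ?thesis by (simp add: ennreal_less_zero_iff)
qed

lemma lag_Z_finite_nn: "finite A \<Longrightarrow> s > 0 \<Longrightarrow> k > 0 \<Longrightarrow> (\<integral>\<^sup>+y. lag_dens k s A y \<partial>leb_Pi A) < \<infinity>"
  by (simp add: ennreal_lag_Z[symmetric])

lemma integrable_lag_dens:
  assumes "finite A" "s > 0" "k > 0" shows "integrable (leb_Pi A) (lag_dens k s A)"
  by (rule integrableI_nonneg) (use assms lag_Z_finite_nn[OF assms] in \<open>auto simp: lag_dens_nonneg\<close>)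

lemma lag_Z_eq_integral:
  assumes "finite A" "s > 0" "k > 0" shows "lag_Z k s A = (\<integral>y. lag_dens k s A y \<partial>leb_Pi A)"
  using ennreal_lag_Z[OF assms] nn_integral_eq_integral[OF integrable_lag_dens[OF assms]] lag_Z_pos[OF assms]
  by (simp add: lag_dens_nonneg integral_nonneg_AE)

section \<open>Dependence of the normalisation on the exponent\<close>

definition sel_P :: "real \<Rightarrow> nat \<Rightarrow> real \<Rightarrow> real" where
  "sel_P k n s = (\<Prod>i<n. s + k * real i)"

lemma sel_P_pos: "s > 0 \<Longrightarrow> k > 0 \<Longrightarrow> sel_P k n s > 0"
  unfolding sel_P_def by (intro prod_pos) (auto intro!: add_pos_nonneg)

text \<open>Raising s by one inserts the product of the coordinates into the integral, and its
  integral is supplied by Aomoto's recursion. This is the functional equation also satisfied by the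
  product of Gamma functions.\<close>

lemma lag_Z_Suc:
  assumes A: "finite A" and s: "s > 0" and k: "k > 0"
  shows "lag_Z k (s + 1) A = sel_P k (card A) s * lag_Z k s A"
proof -
  interpret lag_setup A k s by unfold_locales (rule assms)+
  have [measurable]: "(\<lambda>y. \<Prod>i\<in>A. y i) \<in> borel_measurable (leb_Pi A)"
    by (intro borel_measurable_prod measurable_leb_Pi_component)
  have "lag_Z k (s + 1) A = (\<integral>y. lag_dens k s A y * (\<Prod>i\<in>A. y i) \<partial>leb_Pi A)"
    unfolding lag_Z_eq_integral[OF A add_pos_pos[OF s zero_less_one] k]
  proof (rule Bochner_Integration.integral_cong[OF refl])
    fix y
    show "lag_dens k (s + 1) A y = lag_dens k s A y * (\<Prod>i\<in>A. y i)"
    proof (cases "pos_on A y")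
      case True
      have "D_on A y powr s = D_on A y powr (s - 1) * D_on A y"
        using D_on_pos[OF True] powr_add[of "D_on A y" "s - 1" 1] by simp
      then show ?thesis using True by (simp add: lag_dens_def D_on_def)
    qed (simp add: lag_dens_def)
  qed
  also have "\<dots> = (\<integral>y. (\<Prod>i\<in>A. y i) \<partial>lag k s A)"
    unfolding lag_def by (subst integral_density) (auto simp: lag_dens_nonneg A)
  finally show ?thesis unfolding integral_prod_eq Z_def lag_Z_def[symmetric] sel_P_def .
qed

text \<open>Bernoulli's inequality gives the half of log-convexity needed for the Bohr--Mollerup argument.\<close>
lemma lag_Z_powr_le:
  assumes A: "finite A" and s: "s > 0" and k: "k > 0" and t: "0 \<le> t" "t \<le> 1"
  shows "lag_Z k (s + t) A \<le> sel_P k (card A) s powr t * lag_Z k s A"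
proof -
  define L where "L = sel_P k (card A) s"
  have L: "L > 0" unfolding L_def by (rule sel_P_pos[OF s k])
  have st: "s + t > 0" "s + 1 > 0" using s t by auto
  have "lag_Z k (s + t) A \<le> (\<integral>y. L powr t * (t / L * lag_dens k (s + 1) A y + (1 - t) * lag_dens k s A y) \<partial>leb_Pi A)"
    unfolding lag_Z_eq_integral[OF A st(1) k]
  proof (rule integral_mono)
    fix y
    show "lag_dens k (s + t) A y \<le> L powr t * (t / L * lag_dens k (s + 1) A y + (1 - t) * lag_dens k s A y)"
    proof (cases "pos_on A y")
      case True
      let ?D = "D_on A y"
      have D: "?D > 0" by (rule D_on_pos[OF True])
      \<comment> \<open>Young's inequality u^t \<le> t u + (1 - t) at u = D / L. With L equal to the
        ratio of the normalisations at s + 1 and s, the right side integrates to exactly the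
        normalisation at s.\<close>
      have "(?D / L) powr t * 1 powr (1 - t) \<le> t * (?D / L) + (1 - t) * 1"
        using D L t by (intro Youngs_inequality_0) auto
      then have "L powr t * (?D / L) powr t \<le> L powr t * (t * (?D / L) + (1 - t))"
        by (intro mult_left_mono) auto
      then have "?D powr t \<le> L powr t * (t * (?D / L) + (1 - t))"
        using D L by (simp add: powr_mult[symmetric])
      then have le: "?D powr t * lag_dens k s A y \<le> L powr t * (t * (?D / L) + (1 - t)) * lag_dens k s A y"
        by (rule mult_right_mono) (rule lag_dens_nonneg)
      have e1: "?D powr t * lag_dens k s A y = lag_dens k (s + t) A y"
        using True D powr_add[of ?D "s - 1" t] by (simp add: lag_dens_def algebra_simps)
      have e2: "?D * lag_dens k s A y = lag_dens k (s + 1) A y"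
        using True D powr_add[of ?D "s - 1" 1] by (simp add: lag_dens_def algebra_simps)
      have eq: "L powr t * (t * (?D / L) + (1 - t)) * lag_dens k s A y =
          L powr t * (t / L * (?D * lag_dens k s A y) + (1 - t) * lag_dens k s A y)"
        by (simp add: algebra_simps)
      show ?thesis using le unfolding e1 eq e2 .
    qed (simp add: lag_dens_def)
  qed (intro integrable_mult_right Bochner_Integration.integrable_add integrable_lag_dens A k st s)+
  also have "\<dots> = L powr t * (t / L * lag_Z k (s + 1) A + (1 - t) * lag_Z k s A)"
    using A k st s by (simp add: lag_Z_eq_integral integrable_lag_dens)
  also have "\<dots> = L powr t * lag_Z k s A"
    unfolding lag_Z_Suc[OF A s k] L_def[symmetric] using L by (simp add: algebra_simps)
  finally show ?thesis by (simp add: L_def)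
qed

definition sel_G :: "real \<Rightarrow> nat \<Rightarrow> real \<Rightarrow> real" where
  "sel_G k n s = (\<Prod>i<n. Gamma (s + k * real i))"

lemma sel_G_pos: "s > 0 \<Longrightarrow> k > 0 \<Longrightarrow> sel_G k n s > 0"
  unfolding sel_G_def by (intro prod_pos) (auto intro!: add_pos_nonneg Gamma_real_pos)

text \<open>Log-convexity on the segment from x to x + 1, combined with Gamma(x + 1) = x
  Gamma(x).\<close>

lemma Gamma_powr_le:
  fixes x :: real
  assumes x: "x > 0" and t: "0 \<le> t" "t \<le> 1" shows "Gamma (x + t) \<le> x powr t * Gamma x"
proof -
  have "(ln \<circ> Gamma) ((1 - t) *\<^sub>R x + t *\<^sub>R (x + 1)) \<le> (1 - t) * (ln \<circ> Gamma) x + t * (ln \<circ> Gamma) (x + 1)"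
    using t x by (intro convex_onD[OF log_convex_Gamma_real]) (simp_all del: o_apply)
  moreover have "ln (Gamma (x + 1)) = ln x + ln (Gamma x)"
  proof -
    have "Gamma (x + 1) = x * Gamma x" using x by (intro Gamma_plus1) auto
    then show ?thesis using x Gamma_real_pos[OF x] by (simp add: ln_mult_pos)
  qed
  ultimately have "ln (Gamma (x + t)) \<le> t * ln x + ln (Gamma x)" by (simp add: algebra_simps)
  also have "\<dots> = ln (x powr t * Gamma x)" using x Gamma_real_pos[OF x] by (simp add: ln_mult_pos ln_powr)
  finally show ?thesis using x t Gamma_real_pos[of "x + t"] Gamma_real_pos[of x] by simp
qed

lemma sel_G_Suc: "s > 0 \<Longrightarrow> k > 0 \<Longrightarrow> sel_G k n (s + 1) = sel_P k n s * sel_G k n s"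
proof -
  assume s: "s > 0" "k > 0"
  have "Gamma (s + 1 + k * real i) = (s + k * real i) * Gamma (s + k * real i)" for i
  proof -
    have "s + k * real i > 0" using s by (auto intro!: add_pos_nonneg)
    then have "Gamma (s + k * real i + 1) = (s + k * real i) * Gamma (s + k * real i)"
      by (intro Gamma_plus1) auto
    then show ?thesis by (simp add: add_ac)
  qed
  then show ?thesis by (simp add: sel_G_def sel_P_def prod.distrib)
qed

lemma sel_G_powr_le:
  assumes s: "s > 0" and k: "k > 0" and t: "0 \<le> t" "t \<le> 1"
  shows "sel_G k n (s + t) \<le> sel_P k n s powr t * sel_G k n s"
proof -
  have p: "s + k * real i > 0" for i using s k by (auto intro!: add_pos_nonneg)
  have "sel_G k n (s + t) \<le> (\<Prod>i<n. (s + k * real i) powr t * Gamma (s + k * real i))"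
    unfolding sel_G_def
  proof (intro prod_mono conjI)
    fix i
    have "s + t + k * real i > 0" using p[of i] t by simp
    then show "0 \<le> Gamma (s + t + k * real i)" by (intro less_imp_le Gamma_real_pos)
    show "Gamma (s + t + k * real i) \<le> (s + k * real i) powr t * Gamma (s + k * real i)"
      using Gamma_powr_le[OF p[of i] t] by (simp add: add_ac)
  qed
  also have "\<dots> = sel_P k n s powr t * sel_G k n s"
    unfolding sel_G_def sel_P_def by (simp add: prod.distrib prod_powr_distrib less_imp_le p)
  finally show ?thesis .
qed

lemma sel_P_ratio_tendsto:
  assumes s: "s > 0" and k: "k > 0"
  shows "(\<lambda>m. sel_P k n (s + real m + t) / sel_P k n (s + real m)) \<longlonglongrightarrow> 1"
proof -
  have "(\<lambda>m. \<Prod>i<n. (s + real m + t + k * real i) / (s + real m + k * real i)) \<longlonglongrightarrow> (\<Prod>i<n. 1)"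
  proof (rule tendsto_prod)
    fix i
    show "(\<lambda>m. (s + real m + t + k * real i) / (s + real m + k * real i)) \<longlonglongrightarrow> 1"
      by real_asymp
  qed
  then show ?thesis by (simp add: sel_P_def prod_dividef)
qed

text \<open>Z / G has period 1 because both satisfy the same functional equation. The inequality at
  s carries the error factor (P(s + t) / P(s))^(1 - t); moving s to s + m leaves the quotients
  unchanged and sends the factor to 1. The hypotheses are symmetric in Z and G, so exchanging the
  two gives the reverse inequality.\<close>

lemma bohr_mollerup_quotient:
  fixes P Z G :: "real \<Rightarrow> real"
  assumes P: "\<And>s. s > 0 \<Longrightarrow> P s > 0" and Z: "\<And>s. s > 0 \<Longrightarrow> Z s > 0" and G: "\<And>s. s > 0 \<Longrightarrow> G s > 0"
    and Z1: "\<And>s. s > 0 \<Longrightarrow> Z (s + 1) = P s * Z s" and G1: "\<And>s. s > 0 \<Longrightarrow> G (s + 1) = P s * G s"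
    and Zt: "\<And>s t. s > 0 \<Longrightarrow> 0 \<le> t \<Longrightarrow> t \<le> 1 \<Longrightarrow> Z (s + t) \<le> P s powr t * Z s"
    and Gt: "\<And>s t. s > 0 \<Longrightarrow> 0 \<le> t \<Longrightarrow> t \<le> 1 \<Longrightarrow> G (s + t) \<le> P s powr t * G s"
    and lim: "\<And>s t. s > 0 \<Longrightarrow> (\<lambda>m. P (s + real m + t) / P (s + real m)) \<longlonglongrightarrow> 1"
    and s: "s > 0" and t: "0 \<le> t" "t \<le> 1"
  shows "Z (s + t) / G (s + t) \<le> Z s / G s"
proof -
  have per: "Z (s + real m) / G (s + real m) = Z s / G s" if "s > 0" for s m
  proof (induction m)
    case (Suc m)
    have "s + real m > 0" using that by simp
    then have "Z (s + real m + 1) / G (s + real m + 1) = Z (s + real m) / G (s + real m)"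
      using P[of "s + real m"] by (simp add: Z1 G1)
    then show ?case using Suc by (simp add: add_ac)
  qed simp
  have step: "Z (s + t) / G (s + t) \<le> Z s / G s * (P (s + t) / P s) powr (1 - t)" if s: "s > 0" for s
  proof -
    have st: "s + t > 0" using s t by simp
    \<comment> \<open>A lower bound on G(s + t) comes from the upper bound at base point s + t with
      step 1 - t, since that reaches s + 1.\<close>
    have "P s * G s \<le> P (s + t) powr (1 - t) * G (s + t)"
      using Gt[of "s + t" "1 - t"] st t G1[OF s] by simp
    then have "1 / G (s + t) \<le> P (s + t) powr (1 - t) / (P s * G s)"
      using G[OF st] G[OF s] P[OF s] by (simp add: field_simps)
    then have "Z (s + t) * (1 / G (s + t)) \<le> (P s powr t * Z s) * (P (s + t) powr (1 - t) / (P s * G s))"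
      using Zt[OF s t] Z[OF st] Z[OF s] G[OF st] by (intro mult_mono) auto
    also have "\<dots> = Z s / G s * (P (s + t) / P s) powr (1 - t)"
      using P[OF s] P[OF st] by (simp add: powr_divide powr_diff field_simps)
    finally show ?thesis by simp
  qed
  have "(\<lambda>m. Z s / G s * (P (s + real m + t) / P (s + real m)) powr (1 - t)) \<longlonglongrightarrow> Z s / G s * 1 powr (1 - t)"
    by (intro tendsto_mult tendsto_const tendsto_powr lim s) auto
  then have "(\<lambda>m. Z s / G s * (P (s + real m + t) / P (s + real m)) powr (1 - t)) \<longlonglongrightarrow> Z s / G s" by simp
  then show ?thesis
  proof (rule LIMSEQ_le_const, intro exI allI impI)
    fix m :: nat
    have st: "s + t > 0" using s t by simp
    have "Z (s + t) / G (s + t) = Z (s + real m + t) / G (s + real m + t)"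
      using per[OF st, of m] by (simp add: add_ac)
    also have "\<dots> \<le> Z (s + real m) / G (s + real m) * (P (s + real m + t) / P (s + real m)) powr (1 - t)"
      using s by (intro step) simp
    finally show "Z (s + t) / G (s + t) \<le> Z s / G s * (P (s + real m + t) / P (s + real m)) powr (1 - t)"
      using per[OF s, of m] by simp
  qed
qed

text \<open>Both inequalities together make the quotient constant on intervals of length 1 and
  periodic, hence constant on the positive axis.\<close>

lemma lag_Z_sel_G_const:
  fixes A :: "('i::linorder) set"
  assumes A: "finite A" and s: "s > 0" and k: "k > 0"
  shows "lag_Z k s A / sel_G k (card A) s = lag_Z k 1 A / sel_G k (card A) 1"
proof -
  let ?Z = "\<lambda>s. lag_Z k s A" and ?G = "sel_G k (card A)"
  have le1: "?Z (s + t) / ?G (s + t) \<le> ?Z s / ?G s" if "s > 0" "0 \<le> t" "t \<le> 1" for s t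
    by (rule bohr_mollerup_quotient[where P = "sel_P k (card A)"])
       (auto intro!: that sel_P_pos lag_Z_pos sel_G_pos A k lag_Z_Suc sel_G_Suc lag_Z_powr_le sel_G_powr_le sel_P_ratio_tendsto)
  have le2: "?G (s + t) / ?Z (s + t) \<le> ?G s / ?Z s" if "s > 0" "0 \<le> t" "t \<le> 1" for s t
    by (rule bohr_mollerup_quotient[where P = "sel_P k (card A)"])
       (auto intro!: that sel_P_pos lag_Z_pos sel_G_pos A k lag_Z_Suc sel_G_Suc lag_Z_powr_le sel_G_powr_le sel_P_ratio_tendsto)
  have eq: "?Z (s + t) / ?G (s + t) = ?Z s / ?G s" if "s > 0" "0 \<le> t" "t \<le> 1" for s t
  proof (rule antisym[OF le1[OF that]])
    have "s + t > 0" using that by simp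
    note pos = lag_Z_pos[OF A this k] sel_G_pos[OF this k, of "card A"] lag_Z_pos[OF A that(1) k] sel_G_pos[OF that(1) k, of "card A"]
    show "?Z s / ?G s \<le> ?Z (s + t) / ?G (s + t)" using le2[OF that] pos by (simp add: field_simps)
  qed
  have ind: "?Z (u + real m) / ?G (u + real m) = ?Z u / ?G u" if "u > 0" for u m
  proof (induction m)
    case (Suc m)
    then show ?case using eq[of "u + real m" 1] that by (simp add: add_ac)
  qed simp
  \<comment> \<open>Chosen so that u = s - m falls into the half-open interval (0, 1] and stays
    positive.\<close>
  define m where "m = nat (\<lceil>s\<rceil> - 1)"
  define u where "u = s - real m"
  have "\<lceil>s\<rceil> \<ge> 1" using s by simp
  then have m: "real m = of_int \<lceil>s\<rceil> - 1" by (simp add: m_def)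
  have u: "u > 0" "u \<le> 1" unfolding u_def m by linarith+
  have "?Z s / ?G s = ?Z u / ?G u" using ind[OF u(1), of m] by (simp add: u_def)
  also have "\<dots> = ?Z 1 / ?G 1" using eq[OF u(1), of "1 - u"] u by simp
  finally show ?thesis .
qed

section \<open>Reduction of the number of variables at s = 1\<close>

lemma nn_integral_exp_halfline:
  assumes "n > (0 :: nat)"
  shows "(\<integral>\<^sup>+x. ennreal (exp (- (real n * x))) * indicator {0<..} x \<partial>lborel) = ennreal (1 / real n)"
proof -
  have "((\<lambda>x. exp (- real n * x)) has_integral exp (- real n * 0) / real n) {0..}"
    using assms by (intro has_integral_exp_minus_to_infinity) auto
  then have "((\<lambda>x. if x \<in> {0..} then exp (- real n * x) else 0) has_integral 1 / real n) UNIV"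
    by (subst has_integral_restrict_UNIV) simp
  then have "(\<integral>\<^sup>+x. ennreal (if x \<in> {0..} then exp (- real n * x) else 0) \<partial>lborel) = ennreal (1 / real n)"
    by (intro nn_integral_has_integral_lborel) auto
  also have "(\<integral>\<^sup>+x. ennreal (if x \<in> {0..} then exp (- real n * x) else 0) \<partial>lborel) =
    (\<integral>\<^sup>+x. ennreal (exp (- (real n * x))) * indicator {0<..} x \<partial>lborel)"
    using AE_lborel_singleton[of 0] by (intro nn_integral_cong_AE) (auto elim!: eventually_mono simp: indicator_def)
  finally show ?thesis .
qed

lemma omega_on_insert:
  assumes "finite B" "i \<notin> B"
  shows "omega_on k (insert i B) y = omega_on k B y * (\<Prod>j\<in>B. \<bar>y j - y i\<bar> powr (2 * k))"
proof -
  have eq: "pairs_on (insert i B) = pairs_on B \<union> ((\<lambda>j. if j < i then (j, i) else (i, j)) ` B)"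
    using assms by (auto simp: pairs_on_def image_iff) (metis linorder_neqE)+
  have "(\<Prod>p\<in>(\<lambda>j. if j < i then (j, i) else (i, j)) ` B. \<bar>y (fst p) - y (snd p)\<bar> powr (2 * k)) =
     (\<Prod>j\<in>B. \<bar>y j - y i\<bar> powr (2 * k))"
    by (subst prod.reindex) (auto simp: inj_on_def abs_minus_commute intro!: prod.cong split: if_splits)
  then show ?thesis unfolding omega_on_pairs eq using assms
    by (subst prod.union_disjoint) (auto simp: pairs_on_def[of B] intro: finite_pairs_on[OF assms(1), unfolded pairs_on_def])
qed

text \<open>The part of the ensemble where the coordinate \<open>i\<close> is smallest: translating by it decouples it
  from the others.\<close>
lemma nn_integral_min_part:
  fixes B :: "('i::linorder) set"
  assumes B: "finite B" "i \<notin> B" and k: "k > 0"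
  shows "(\<integral>\<^sup>+y. (if \<forall>j\<in>B. y i < y j then lag_dens k 1 (insert i B) y else 0) \<partial>leb_Pi (insert i B)) =
     ennreal (1 / real (card (insert i B))) * ennreal (lag_Z k (2 * k + 1) B)"
proof -
  have [measurable]: "finite B" "finite (insert i B)" using B by auto
  let ?n = "card (insert i B)"
  have n: "?n = Suc (card B)" using B by simp
  have Y: "(\<lambda>y. y j) \<in> borel_measurable (leb_Pi (insert i B))" if "j \<in> insert i B" for j
    by (rule measurable_leb_Pi_component[OF that])
  have M: "(\<lambda>y. if \<forall>j\<in>B. y i < y j then lag_dens k 1 (insert i B) y else 0) \<in> borel_measurable (leb_Pi (insert i B))"
    using Y by measurable
  have "(\<integral>\<^sup>+y. (if \<forall>j\<in>B. y i < y j then lag_dens k 1 (insert i B) y else 0) \<partial>leb_Pi (insert i B)) =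
     (\<integral>\<^sup>+z. (\<integral>\<^sup>+x. (if \<forall>j\<in>B. (x(i := z)) i < (x(i := z)) j then lag_dens k 1 (insert i B) (x(i := z)) else 0) \<partial>leb_Pi B) \<partial>lborel)"
    by (rule leb.product_nn_integral_insert_rev[OF B]) (use M in simp)
  also have "\<dots> = (\<integral>\<^sup>+z. ennreal (exp (- (real ?n * z))) * indicator {0<..} z * ennreal (lag_Z k (2 * k + 1) B) \<partial>lborel)"
  proof (rule nn_integral_cong)
    fix z :: real
    show "(\<integral>\<^sup>+x. (if \<forall>j\<in>B. (x(i := z)) i < (x(i := z)) j then lag_dens k 1 (insert i B) (x(i := z)) else 0) \<partial>leb_Pi B) =
      ennreal (exp (- (real ?n * z))) * indicator {0<..} z * ennreal (lag_Z k (2 * k + 1) B)"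
    proof (cases "z > 0")
      case False
      then have "\<not> pos_on (insert i B) (x(i := z))" for x by (simp add: pos_on_def)
      then have "(if \<forall>j\<in>B. (x(i := z)) i < (x(i := z)) j then lag_dens k 1 (insert i B) (x(i := z)) else 0) = 0" for x
        by (simp add: lag_dens_def)
      then have "(\<integral>\<^sup>+x. (if \<forall>j\<in>B. (x(i := z)) i < (x(i := z)) j then lag_dens k 1 (insert i B) (x(i := z)) else 0) \<partial>leb_Pi B) = 0"
        by simp
      then show ?thesis using False by simp
    next
      case True
      define F where "F x = ennreal ((\<Prod>j\<in>B. \<bar>x j - z\<bar> powr (2 * k)) * omega_on k B x * exp (- z) * exp (- (\<Sum>j\<in>B. x j)))" for x :: "'i \<Rightarrow> real"
      have [measurable]: "(\<lambda>x. \<Prod>j\<in>B. \<bar>x j - z\<bar> powr (2 * k)) \<in> borel_measurable (leb_Pi B)"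
        by measurable
      have [measurable]: "F \<in> borel_measurable (leb_Pi B)" unfolding F_def by measurable
      have ind: "(\<Prod>j\<in>B. indicator {c<..} (x j) :: ennreal) = (if \<forall>j\<in>B. c < x j then 1 else 0)" for c x
        using B by (auto simp: indicator_def prod_zero_iff intro!: prod.neutral)
      have "(\<integral>\<^sup>+x. (if \<forall>j\<in>B. (x(i := z)) i < (x(i := z)) j then lag_dens k 1 (insert i B) (x(i := z)) else 0) \<partial>leb_Pi B) =
        (\<integral>\<^sup>+x. F x * (\<Prod>j\<in>B. indicator {z<..} (x j)) \<partial>leb_Pi B)"
      proof (rule nn_integral_cong)
        fix x :: "'i \<Rightarrow> real"
        have ne: "(x(i := z)) j = x j" if "j \<in> B" for j using that B by auto
        show "(if \<forall>j\<in>B. (x(i := z)) i < (x(i := z)) j then lag_dens k 1 (insert i B) (x(i := z)) else 0) =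
          F x * (\<Prod>j\<in>B. indicator {z<..} (x j))"
        proof (cases "\<forall>j\<in>B. z < x j")
          case c: True
          then have p: "pos_on (insert i B) (x(i := z))" using True by (auto simp: pos_on_def dest: bspec)
          have om: "omega_on k B (x(i := z)) = omega_on k B x"
            unfolding omega_on_pairs using B(2) by (intro prod.cong refl) (auto simp: pairs_on_def)
          have pr: "(\<Prod>j\<in>B. \<bar>(x(i := z)) j - (x(i := z)) i\<bar> powr (2 * k)) = (\<Prod>j\<in>B. \<bar>x j - z\<bar> powr (2 * k))"
            using B by (intro prod.cong refl) auto
          have su: "(\<Sum>j\<in>insert i B. (x(i := z)) j) = z + (\<Sum>j\<in>B. x j)"
          proof -
            have "(\<Sum>j\<in>B. (x(i := z)) j) = (\<Sum>j\<in>B. x j)" using B by (intro sum.cong refl) auto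
            then show ?thesis using B by simp
          qed
          have "lag_dens k 1 (insert i B) (x(i := z)) = (\<Prod>j\<in>B. \<bar>x j - z\<bar> powr (2 * k)) * omega_on k B x * exp (- z) * exp (- (\<Sum>j\<in>B. x j))"
            using p D_on_pos[OF p] unfolding lag_dens_def omega_on_insert[OF B] om pr su
            by (simp add: exp_diff exp_minus divide_inverse mult_ac)
          then show ?thesis using c B by (simp add: F_def ind)
        next
          case False
          then show ?thesis using ne by (auto simp: ind)
        qed
      qed
      also have "\<dots> = (\<integral>\<^sup>+x. F (\<lambda>j\<in>B. z + x j) * (\<Prod>j\<in>B. ennreal 1 * indicator {0<..} (x j)) \<partial>leb_Pi B)"
      proof (rule nn_integral_leb_Pi_change[OF B(1)])
        fix h :: "real \<Rightarrow> ennreal" assume h: "h \<in> borel_measurable borel"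
        have "(\<integral>\<^sup>+x. h x * indicator {z + 0<..} x \<partial>lborel) = (\<integral>\<^sup>+x. h (z + x) * (ennreal 1 * indicator {0<..} x) \<partial>lborel)"
          by (rule nn_integral_halfline_subst[OF h]) (auto intro!: derivative_eq_intros)
        then show "(\<integral>\<^sup>+x. h x * indicator {z<..} x \<partial>lborel) = (\<integral>\<^sup>+x. h (z + x) * (ennreal 1 * indicator {0<..} x) \<partial>lborel)"
          by simp
      qed measurable
      also have "\<dots> = (\<integral>\<^sup>+x. ennreal (exp (- (real ?n * z))) * lag_dens k (2 * k + 1) B x \<partial>leb_Pi B)"
      proof (rule nn_integral_cong)
        fix x :: "'i \<Rightarrow> real"
        show "F (\<lambda>j\<in>B. z + x j) * (\<Prod>j\<in>B. ennreal 1 * indicator {0<..} (x j)) = ennreal (exp (- (real ?n * z))) * lag_dens k (2 * k + 1) B x"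
        proof (cases "pos_on B x")
          case c: True
          have om: "omega_on k B (\<lambda>j\<in>B. z + x j) = omega_on k B x"
            unfolding omega_on_pairs by (intro prod.cong refl) (auto simp: pairs_on_def)
          \<comment> \<open>After the shift the differences from the smallest coordinate become the
            coordinates themselves. Their powers form D^(2 k), so s = 1 with i present turns into s
            = 2 k + 1 without it.\<close>
          have pr: "(\<Prod>j\<in>B. \<bar>(\<lambda>j\<in>B. z + x j) j - z\<bar> powr (2 * k)) = D_on B x powr (2 * k)"
            unfolding D_on_def using c by (subst prod_powr_distrib) (auto simp: pos_on_def less_imp_le intro!: prod.cong)
          have su: "(\<Sum>j\<in>B. (\<lambda>j\<in>B. z + x j) j) = real (card B) * z + (\<Sum>j\<in>B. x j)"
            by (simp add: sum.distrib)
          have "F (\<lambda>j\<in>B. z + x j) = ennreal (exp (- (real ?n * z)) * lag_dens k (2 * k + 1) B x)"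
          proof -
            have ex: "exp (- z) * exp (- (real (card B) * z + (\<Sum>j\<in>B. x j))) = exp (- (real (Suc (card B)) * z)) * exp (- (\<Sum>j\<in>B. x j))"
              by (simp add: exp_add[symmetric] algebra_simps)
            show ?thesis unfolding F_def pr om su n mult.assoc ex using c by (simp add: lag_dens_def mult_ac)
          qed
          moreover have "(\<Prod>j\<in>B. ennreal 1 * indicator {0<..} (x j)) = 1" using c ind[of 0 x] by (simp add: pos_on_def)
          ultimately show ?thesis by (simp add: ennreal_mult lag_dens_nonneg)
        next
          case False
          then have "(\<Prod>j\<in>B. ennreal 1 * indicator {0<..} (x j)) = 0" using ind[of 0 x] by (simp add: pos_on_def)
          then show ?thesis using False by (simp add: lag_dens_def)
        qed
      qed
      also have "\<dots> = ennreal (exp (- (real ?n * z))) * ennreal (lag_Z k (2 * k + 1) B)"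
        using k by (subst nn_integral_cmult) (auto simp: ennreal_lag_Z[OF B(1)])
      finally show ?thesis using True by simp
    qed
  qed
  also have "\<dots> = (\<integral>\<^sup>+z. ennreal (exp (- (real ?n * z))) * indicator {0<..} z \<partial>lborel) * ennreal (lag_Z k (2 * k + 1) B)"
    by (rule nn_integral_multc) measurable
  also have "\<dots> = ennreal (1 / real ?n) * ennreal (lag_Z k (2 * k + 1) B)"
    by (subst nn_integral_exp_halfline) (use n in auto)
  finally show ?thesis .
qed

text \<open>The integral is decomposed according to which coordinate is strictly smallest. Ties
  contribute nothing since the density vanishes when two coordinates agree, so the decomposition
  holds pointwise.\<close>

lemma lag_Z_1:
  fixes A :: "('i::linorder) set"
  assumes A: "finite A" "A \<noteq> {}" and k: "k > 0"
  shows "lag_Z k 1 A = (\<Sum>i\<in>A. 1 / real (card A) * lag_Z k (2 * k + 1) (A - {i}))"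
proof -
  note [measurable] = A(1)
  have split: "ennreal (lag_dens k 1 A y) = (\<Sum>i\<in>A. ennreal (if \<forall>j\<in>A - {i}. y i < y j then lag_dens k 1 A y else 0))" for y
  proof (cases "inj_on y A")
    case True
    define m where "m = Min (y ` A)"
    have "m \<in> y ` A" unfolding m_def using A by (intro Min_in) auto
    then obtain i where i: "i \<in> A" "m = y i" by auto
    have min: "y i \<le> y j" if "j \<in> A" for j
    proof -
      have "Min (y ` A) \<le> y j" by (rule Min_le) (use A that in auto)
      then show ?thesis using i(2) by (simp add: m_def)
    qed
    have iff: "(\<forall>l\<in>A - {j}. y j < y l) \<longleftrightarrow> j = i" if "j \<in> A" for j
    proof
      assume *: "\<forall>l\<in>A - {j}. y j < y l"
      show "j = i"
      proof (rule ccontr)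
        assume "j \<noteq> i"
        then have "y j < y i" using * i(1) by auto
        then show False using min[OF that] by simp
      qed
    next
      assume "j = i"
      moreover have "y i < y l" if "l \<in> A - {i}" for l
        using min[of l] inj_onD[OF True, of i l] that i(1) by fastforce
      ultimately show "\<forall>l\<in>A - {j}. y j < y l" by blast
    qed
    have "(\<Sum>j\<in>A. (if \<forall>l\<in>A - {j}. y j < y l then ennreal (lag_dens k 1 A y) else 0)) = (\<Sum>j\<in>A. if j = i then ennreal (lag_dens k 1 A y) else 0)"
      by (intro sum.cong refl) (simp add: iff)
    also have "\<dots> = ennreal (lag_dens k 1 A y)" using A i by simp
    finally show ?thesis by (simp add: if_distrib cong: if_cong)
  next
    case False
    then obtain i j where ij: "i \<in> A" "j \<in> A" "i < j" "y i = y j" by (auto simp: inj_on_def) (metis linorder_neqE)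
    then have "omega_on k A y = 0" unfolding omega_on_pairs
      using k by (intro prod_zero bexI[of _ "(i, j)"] finite_pairs_on A) (auto simp: pairs_on_def)
    then have "lag_dens k 1 A y = 0" by (simp add: lag_dens_def)
    then show ?thesis by (simp only: if_cancel ennreal_0 sum.neutral_const)
  qed
  have nn: "0 \<le> lag_Z k (2 * k + 1) (A - {i})" for i
    using A k by (intro less_imp_le lag_Z_pos) auto
  have "ennreal (lag_Z k 1 A) = (\<integral>\<^sup>+y. lag_dens k 1 A y \<partial>leb_Pi A)"
    using A k by (intro ennreal_lag_Z) auto
  also have "\<dots> = (\<Sum>i\<in>A. (\<integral>\<^sup>+y. (if \<forall>j\<in>A - {i}. y i < y j then lag_dens k 1 A y else 0) \<partial>leb_Pi A))"
    unfolding split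
  proof (rule nn_integral_sum)
    fix i assume i: "i \<in> A"
    have Y: "(\<lambda>y. y j) \<in> borel_measurable (leb_Pi A)" if "j \<in> A" for j
      by (rule measurable_leb_Pi_component[OF that])
    have [measurable]: "finite (A - {i})" using A by simp
    show "(\<lambda>y. ennreal (if \<forall>j\<in>A - {i}. y i < y j then lag_dens k 1 A y else 0)) \<in> borel_measurable (leb_Pi A)"
      using Y i by measurable
  qed
  also have "\<dots> = (\<Sum>i\<in>A. ennreal (1 / real (card A)) * ennreal (lag_Z k (2 * k + 1) (A - {i})))"
  proof (rule sum.cong[OF refl])
    fix i assume i: "i \<in> A"
    then have eq: "insert i (A - {i}) = A" by auto
    from nn_integral_min_part[of "A - {i}" i k, unfolded eq] A k
    show "(\<integral>\<^sup>+y. (if \<forall>j\<in>A - {i}. y i < y j then lag_dens k 1 A y else 0) \<partial>leb_Pi A) =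
      ennreal (1 / real (card A)) * ennreal (lag_Z k (2 * k + 1) (A - {i}))" by simp
  qed
  also have "\<dots> = (\<Sum>i\<in>A. ennreal (1 / real (card A) * lag_Z k (2 * k + 1) (A - {i})))"
    by (intro sum.cong refl ennreal_mult[symmetric] nn) auto
  also have "\<dots> = ennreal (\<Sum>i\<in>A. 1 / real (card A) * lag_Z k (2 * k + 1) (A - {i}))"
    by (intro sum_ennreal mult_nonneg_nonneg nn) auto
  finally have "ennreal (lag_Z k 1 A) = ennreal (\<Sum>i\<in>A. 1 / real (card A) * lag_Z k (2 * k + 1) (A - {i}))" .
  moreover have "0 \<le> lag_Z k 1 A" using A k by (intro less_imp_le lag_Z_pos) auto
  moreover have "0 \<le> (\<Sum>i\<in>A. 1 / real (card A) * lag_Z k (2 * k + 1) (A - {i}))"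
    by (intro sum_nonneg mult_nonneg_nonneg nn) auto
  ultimately show ?thesis by (simp only: ennreal_inj)
qed

text \<open>The quotient by the Gamma product is independent of s, so it may be read off at s = 1.
  There the normalisation equals the one with one variable fewer at 2 k + 1, and each step adds one
  factor of \<open>d_const\<close>.\<close>

theorem selberg_laguerre:
  fixes A :: "('i::linorder) set"
  assumes "finite A" "s > 0" and k: "k > 0"
  shows "lag_Z k s A = d_const (card A) k * sel_G k (card A) s"
  using assms(1,2)
proof (induction "card A" arbitrary: A s)
  case 0
  then have [simp]: "A = {}" by simp
  have "ennreal (lag_Z k s A) = ennreal (lag_dens k s A (\<lambda>_. undefined))"
    using ennreal_lag_Z[OF _ 0(3) k, of A] leb.nn_integral_empty[of "\<lambda>y. ennreal (lag_dens k s {} y)"] by simp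
  then have "ennreal (lag_Z k s A) = 1"
    by (simp add: lag_dens_def pos_on_def D_on_def omega_on_def)
  then show ?case by (simp add: d_const_def sel_G_def)
next
  case (Suc n)
  have A: "A \<noteq> {}" "card A = Suc n" "finite A" using Suc by auto
  have IH: "lag_Z k (2 * k + 1) (A - {i}) = d_const n k * sel_G k n (2 * k + 1)" if "i \<in> A" for i
    using Suc.hyps(1)[of "A - {i}" "2 * k + 1"] A that k by simp
  have "lag_Z k 1 A = (\<Sum>i\<in>A. 1 / real (card A) * (d_const n k * sel_G k n (2 * k + 1)))"
    unfolding lag_Z_1[OF A(3,1) k] by (intro sum.cong refl) (simp add: IH)
  also have "\<dots> = d_const n k * sel_G k n (2 * k + 1)" by (simp add: A)
  finally have Z1: "lag_Z k 1 A = d_const n k * sel_G k n (2 * k + 1)" .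
  \<comment> \<open>At 2 k + 1 the Gamma factors are those at 1 shifted by two places. Aligning the
    products drops the factors of index 0 and 1, namely 1 and Gamma(1 + k), and adds Gamma(1 + (n +
    1) k).\<close>
  have g: "sel_G k n (2 * k + 1) * Gamma (1 + k) = sel_G k (Suc n) 1 * Gamma (1 + real (Suc n) * k)"
  proof -
    define f where "f i = Gamma (1 + k * real i)" for i
    have "sel_G k n (2 * k + 1) = (\<Prod>i<n. f (Suc (Suc i)))"
      unfolding sel_G_def f_def by (intro prod.cong refl arg_cong[where f = Gamma]) (simp add: algebra_simps)
    moreover have "sel_G k (Suc n) 1 = (\<Prod>i<Suc n. f i)" by (simp add: sel_G_def f_def)
    moreover have "(\<Prod>i<Suc (Suc n). f i) = (\<Prod>i<Suc n. f i) * f (Suc n)" by simp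
    moreover have "(\<Prod>i<Suc (Suc n). f i) = f 0 * (f 1 * (\<Prod>i<n. f (Suc (Suc i))))"
      by (simp only: prod.lessThan_Suc_shift One_nat_def)
    moreover have "f 0 = 1" "f 1 = Gamma (1 + k)" "f (Suc n) = Gamma (1 + real (Suc n) * k)"
      by (simp_all add: f_def mult.commute)
    ultimately show ?thesis by (simp add: mult.commute)
  qed
  have G1: "Gamma (1 + k) \<noteq> 0" using Gamma_real_pos[of "1 + k"] k by linarith
  have "lag_Z k s A / sel_G k (Suc n) s = lag_Z k 1 A / sel_G k (Suc n) 1"
    using lag_Z_sel_G_const[OF A(3) Suc.prems(2) k] by (simp add: A)
  also have "\<dots> = d_const n k * (Gamma (1 + real (Suc n) * k) / Gamma (1 + k))"
  proof -
    have "sel_G k n (2 * k + 1) / sel_G k (Suc n) 1 = Gamma (1 + real (Suc n) * k) / Gamma (1 + k)"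
      using g G1 sel_G_pos[of 1 k "Suc n"] k by (subst frac_eq_eq) (auto simp: mult.commute simp del: of_nat_Suc)
    then show ?thesis unfolding Z1 by (metis times_divide_eq_right)
  qed
  also have "\<dots> = d_const (Suc n) k" by (simp add: d_const_def)
  finally show ?case using sel_G_pos[OF Suc.prems(2) k, of "Suc n"] by (simp add: A field_simps)
qed

subsection \<open>Density of the truncated exponentials\<close>

text \<open>The step moved so that its transition lies in [-1, 0]: the cutoff is then exactly 1 on
  the closed orthant. The trivial factors 1 match \<open>deriv_seq_affine\<close>.\<close>

definition cut_seq :: "nat \<Rightarrow> real \<Rightarrow> real" where
  "cut_seq = (\<lambda>j x. 1 ^ j * step_seq j (1 * x + 1))"

definition cutoff :: "real^'n::finite \<Rightarrow> complex" where
  "cutoff x = (\<Prod>i\<in>UNIV. coord_fun i (cut_seq 0) x)"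

definition tail_cutoff :: "real \<Rightarrow> real^'n::finite \<Rightarrow> complex" where
  "tail_cutoff L x = (\<Prod>i\<in>UNIV. coord_fun i (\<lambda>t. step_seq 0 ((-1) * t + (L + 1))) x)"

definition expo :: "('n \<Rightarrow> real) \<Rightarrow> real^'n::finite \<Rightarrow> complex" where
  "expo c x = exp (- complex_of_real (\<Sum>i\<in>UNIV. c i * x $ i))"

definition mono_fun :: "('n \<Rightarrow> nat) \<Rightarrow> real^'n::finite \<Rightarrow> complex" where
  "mono_fun a x = (\<Prod>i\<in>UNIV. complex_of_real (x $ i) ^ a i)"

text \<open>The cutoff vanishes as soon as some coordinate is at most -1. The margin down to -2
  makes it vanish in a whole neighbourhood of every point outside this set, so its derivatives
  vanish there too.\<close>

definition shifted_orthant :: "(real^'n::finite) set" where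
  "shifted_orthant = {x. \<forall>i. - 2 < x $ i}"

lemma deriv_seq_cut: "deriv_seq cut_seq"
  unfolding cut_seq_def by (rule deriv_seq_affine[OF deriv_seq_step])

lemma cutoff_eq_1: "(\<And>i. 0 \<le> x $ i) \<Longrightarrow> cutoff x = 1"
  unfolding cutoff_def coord_fun_def cut_seq_def by (intro prod.neutral) (simp add: step_1)

lemma cutoff_eq_0: "x $ i \<le> -1 \<Longrightarrow> cutoff x = 0"
  unfolding cutoff_def coord_fun_def cut_seq_def by (rule prod_zero) (auto intro!: exI[of _ i] simp: step_0)

lemma iter_pdiff_zero_of_coord:
  fixes f :: "real^'n::finite \<Rightarrow> complex"
  assumes f: "\<And>x. x $ i \<le> a \<Longrightarrow> f x = 0" and x: "x $ i < a"
  shows "iter_pdiff is f x = 0"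
  by (rule iter_pdiff_zero[of "{x. x $ i < a}"])
     (use assms in \<open>auto intro!: open_Collect_less continuous_intros\<close>)

lemma iter_pdiff_cutoff_outside:
  assumes "x \<notin> shifted_orthant" shows "iter_pdiff is (\<lambda>x. cutoff x * f x) x = 0"
proof -
  obtain i where "x $ i \<le> - 2" using assms by (auto simp: shifted_orthant_def not_less)
  then show ?thesis
    by (intro iter_pdiff_zero_of_coord[where i = i and a = "-1"]) (auto simp: cutoff_eq_0)
qed

text \<open>The bound depends on the order of the derivative alone. Together with the explicit
  \<open>cmult_bound\<close> for products this keeps constants uniform over families such as
  \<open>tail_cutoff L\<close>.\<close>

definition bounded_derivs :: "(real^'n::finite \<Rightarrow> complex) \<Rightarrow> (nat \<Rightarrow> real) \<Rightarrow> bool" where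
  "bounded_derivs f B \<longleftrightarrow> smooth_fun f \<and> (\<forall>is x. norm (iter_pdiff is f x) \<le> B (length is))"

lemma bounded_derivs_coord_fun:
  assumes G: "deriv_seq G" and b: "\<And>j t. \<bar>G j t\<bar> \<le> B j"
  shows "bounded_derivs (coord_fun i (G 0)) B"
proof -
  have "0 \<le> B j" for j using b[of j 0] by linarith
  then show ?thesis unfolding bounded_derivs_def
    using b by (auto simp: smooth_coord_fun[OF G] iter_pdiff_coord_fun[OF G] coord_fun_def)
qed

lemma bounded_derivs_const: "bounded_derivs (\<lambda>_. 1) (\<lambda>_. 1)"
  by (auto simp: bounded_derivs_def smooth_fun_const iter_pdiff_const)

definition cmult_bound :: "(nat \<Rightarrow> real) \<Rightarrow> (nat \<Rightarrow> real) \<Rightarrow> nat \<Rightarrow> real" where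
  "cmult_bound B C m = 2 ^ m * (\<Sum>j\<le>m. B j) * (\<Sum>j\<le>m. C j)"

lemma bounded_derivs_mult:
  assumes f: "bounded_derivs f B" and g: "bounded_derivs g C"
  shows "bounded_derivs (\<lambda>x. f x * g x) (cmult_bound B C)"
  unfolding bounded_derivs_def
proof (intro conjI allI)
  show "smooth_fun (\<lambda>x. f x * g x)" using assms by (auto simp: bounded_derivs_def intro!: smooth_fun_mult)
  fix "is" :: "'a list" and x
  have B0: "0 \<le> B j" and C0: "0 \<le> C j" for j
    using f g order_trans[OF norm_ge_zero] length_replicate[of j undefined] unfolding bounded_derivs_def by metis+
  show "norm (iter_pdiff is (\<lambda>x. f x * g x) x) \<le> cmult_bound B C (length is)"
    unfolding cmult_bound_def
  proof (rule iter_pdiff_mult_bound)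
    fix js :: "'a list" assume "length js \<le> length is"
    then have "B (length js) \<le> (\<Sum>j\<le>length is. B j)" "C (length js) \<le> (\<Sum>j\<le>length is. C j)"
      using member_le_sum[of "length js" "{..length is}" B] member_le_sum[of "length js" "{..length is}" C] B0 C0 by auto
    then show "norm (iter_pdiff js f x) \<le> (\<Sum>j\<le>length is. B j)" "norm (iter_pdiff js g x) \<le> (\<Sum>j\<le>length is. C j)"
      using f g unfolding bounded_derivs_def by (meson order_trans)+
  qed (use assms in \<open>auto simp: bounded_derivs_def\<close>)
qed

primrec prod_bound :: "(nat \<Rightarrow> real) \<Rightarrow> nat \<Rightarrow> nat \<Rightarrow> real" where
  "prod_bound B 0 = (\<lambda>_. 1)"
| "prod_bound B (Suc n) = cmult_bound B (prod_bound B n)"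

lemma bounded_derivs_prod:
  "finite I \<Longrightarrow> (\<And>i. i \<in> I \<Longrightarrow> bounded_derivs (f i) B) \<Longrightarrow>
    bounded_derivs (\<lambda>x. \<Prod>i\<in>I. f i x) (prod_bound B (card I))"
  by (induction I rule: finite_induct) (simp_all add: bounded_derivs_const bounded_derivs_mult)

lemma step_bound:
  obtains B where "\<forall>j x. \<bar>step_seq j x\<bar> \<le> B j"
proof -
  have "\<forall>j. \<exists>B. \<forall>x. \<bar>step_seq j x\<bar> \<le> B" using step_bounded by blast
  from choice[OF this] show ?thesis using that by blast
qed

lemma cutoff_bounded_derivs:
  obtains B where "bounded_derivs (cutoff :: real^'n::finite \<Rightarrow> complex) B"
proof -
  obtain B where B: "\<forall>j x. \<bar>step_seq j x\<bar> \<le> B j" by (rule step_bound)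
  have "bounded_derivs (coord_fun i (cut_seq 0)) B" for i :: 'n
    by (rule bounded_derivs_coord_fun[OF deriv_seq_cut]) (simp add: cut_seq_def B)
  then have "bounded_derivs (cutoff :: real^'n \<Rightarrow> complex) (prod_bound B CARD('n))"
    unfolding cutoff_def[abs_def] by (intro bounded_derivs_prod) auto
  then show ?thesis by (rule that)
qed

text \<open>The bound is independent of \<open>L\<close>, as \<open>tail_cutoff L\<close> arises by translation.\<close>
lemma tail_cutoff_bounded_derivs:
  obtains B where "\<And>L. bounded_derivs (tail_cutoff L :: real^'n::finite \<Rightarrow> complex) B"
proof -
  obtain B where B: "\<forall>j x. \<bar>step_seq j x\<bar> \<le> B j" by (rule step_bound)
  have "bounded_derivs (coord_fun i (\<lambda>t. step_seq 0 ((-1) * t + (L + 1)))) B" for i :: 'n and L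
  proof -
    define G where "G = (\<lambda>j x. (-1) ^ j * step_seq j ((-1) * x + (L + 1)))"
    have "deriv_seq G" unfolding G_def by (rule deriv_seq_affine[OF deriv_seq_step])
    then have "bounded_derivs (coord_fun i (G 0)) B"
      by (rule bounded_derivs_coord_fun) (use B in \<open>simp add: G_def abs_mult power_abs\<close>)
    then show ?thesis by (simp add: G_def)
  qed
  then have "bounded_derivs (tail_cutoff L :: real^'n \<Rightarrow> complex) (prod_bound B CARD('n))" for L
    unfolding tail_cutoff_def[abs_def] by (intro bounded_derivs_prod) auto
  then show ?thesis by (rule that)
qed

lemma bounded_derivs_poly_growth: "bounded_derivs f B \<Longrightarrow> poly_growth f"
  unfolding dominated_def bounded_derivs_def
proof (intro conjI allI)
  fix "is" :: "'a list"
  assume f: "smooth_fun f \<and> (\<forall>is x. norm (iter_pdiff is f x) \<le> B (length is))"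
  show "\<exists>C d. \<forall>x. norm (iter_pdiff is f x) \<le> C * (1 + norm x) ^ d * 1"
    by (rule exI[of _ "B (length is)"], rule exI[of _ 0]) (use f in simp)
qed simp

lemma poly_growth_cutoff: "poly_growth cutoff"
  by (rule cutoff_bounded_derivs) (rule bounded_derivs_poly_growth)

lemma poly_growth_mono_fun: "poly_growth (mono_fun a)"
  unfolding mono_fun_def[abs_def] by (intro poly_growth_prod poly_growth_power poly_growth_coord)

section \<open>Exponentials cut off to the orthant\<close>

lemma has_pdiff_expo: "has_pdiff (expo c) i (\<lambda>x. - complex_of_real (c i) * expo c x)"
  unfolding has_pdiff_def
proof
  fix x
  have eq: "expo c (x + t *\<^sub>R axis i 1) = exp (- complex_of_real (c i) * complex_of_real t) * expo c x" for t
  proof -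
    have "(\<Sum>j\<in>UNIV. c j * (x + t *\<^sub>R axis i 1) $ j) = (\<Sum>j\<in>UNIV. c j * x $ j) + (\<Sum>j\<in>UNIV. if j = i then c j * t else 0)"
      unfolding sum.distrib[symmetric] by (intro sum.cong refl) (auto simp: axis_def algebra_simps)
    then show ?thesis by (simp add: expo_def exp_add[symmetric] algebra_simps)
  qed
  have "((\<lambda>t. exp (- complex_of_real (c i) * complex_of_real t) * expo c x) has_vector_derivative - complex_of_real (c i) * expo c x) (at 0)"
    by (auto intro!: derivative_eq_intros has_vector_derivative_real_field)
  then show "((\<lambda>t. expo c (x + t *\<^sub>R axis i 1)) has_vector_derivative - complex_of_real (c i) * expo c x) (at 0)"
    unfolding eq .
qed

lemma smooth_expo: "smooth_fun (\<lambda>x. d * expo c x)"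
proof (rule smooth_fun_coinduct[of _ "range (\<lambda>d x. d * expo c x)"])
  fix f assume "f \<in> range (\<lambda>d x. d * expo c x)"
  then obtain d where f: "f = (\<lambda>x. d * expo c x)" by auto
  show "continuous_on UNIV f" unfolding f expo_def by (intro continuous_intros)
  fix i
  have "has_pdiff f i (\<lambda>x. 0 * expo c x + d * (- complex_of_real (c i) * expo c x))"
    unfolding f by (rule has_pdiff_mult[OF has_pdiff_const has_pdiff_expo])
  moreover have "(\<lambda>x. 0 * expo c x + d * (- complex_of_real (c i) * expo c x)) = (\<lambda>x. (- d * complex_of_real (c i)) * expo c x)"
    by (simp add: fun_eq_iff)
  ultimately have "has_pdiff f i (\<lambda>x. (- d * complex_of_real (c i)) * expo c x)" by (simp only:)
  then show "\<exists>g\<in>range (\<lambda>d x. d * expo c x). has_pdiff f i g" by blast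
qed auto

lemma smooth_fun_expo: "smooth_fun (expo c)"
  using smooth_expo[of 1 c] by simp

lemma iter_pdiff_expo: "iter_pdiff is (expo c) = (\<lambda>x. (\<Prod>i\<leftarrow>is. - complex_of_real (c i)) * expo c x)"
proof (induction "is")
  case (Cons i "is")
  have "pdiff i (\<lambda>x. d * expo c x) = (\<lambda>x. - complex_of_real (c i) * d * expo c x)" for d
    using has_pdiff_imp[OF has_pdiff_mult[OF has_pdiff_const[of d] has_pdiff_expo]] by (simp add: mult_ac)
  then show ?case by (simp add: iter_pdiff_Cons Cons)
qed simp

definition rexpo :: "('n \<Rightarrow> real) \<Rightarrow> real^'n::finite \<Rightarrow> real" where
  "rexpo c x = exp (- (\<Sum>i\<in>UNIV. c i * x $ i))"

lemma norm_expo: "norm (expo c x) = rexpo c x"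
  by (simp add: expo_def rexpo_def)

lemma expo_eq_rexpo: "expo c x = complex_of_real (rexpo c x)"
  by (simp add: expo_def rexpo_def exp_of_real[symmetric])

lemma dominated_expo: "dominated (rexpo c) (expo c)"
  unfolding dominated_def
proof (intro conjI allI smooth_fun_expo)
  fix "is"
  show "\<exists>C d. \<forall>x. norm (iter_pdiff is (expo c) x) \<le> C * (1 + norm x) ^ d * rexpo c x"
    by (rule exI[of _ "norm (\<Prod>i\<leftarrow>is. - complex_of_real (c i))"], rule exI[of _ 0])
       (simp add: iter_pdiff_expo norm_mult norm_expo)
qed

lemma rexpo_nonneg [simp]: "0 \<le> rexpo c x"
  by (simp add: rexpo_def)

text \<open>On the shifted orthant the norm is controlled by w, the sum of the positive numbers x_i
  + 2. With \<delta> the least coefficient, the polynomial is at most a constant times exp(\<delta>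
  w), the exponential at most a constant times exp(-\<delta> w); K accounts for the shift by
  2.\<close>

lemma poly_times_rexpo_bounded:
  fixes c :: "'n::finite \<Rightarrow> real"
  assumes c: "\<And>i. c i > 0"
  shows "\<exists>B. \<forall>x\<in>shifted_orthant. (1 + norm x) ^ d * rexpo c x \<le> B"
proof -
  define \<delta> where "\<delta> = Min (range c)"
  have \<delta>: "\<delta> > 0" unfolding \<delta>_def using c by (subst Min_gr_iff) auto
  have \<delta>c: "\<delta> \<le> c i" for i unfolding \<delta>_def by simp
  define n where "n = real CARD('n)"
  define K where "K = exp (2 * (\<Sum>i\<in>UNIV. c i))"
  define B where "B = (fact d / \<delta> ^ d) * exp (\<delta> * (1 + 2 * n)) * K"
  have "(1 + norm x) ^ d * rexpo c x \<le> B" if x: "x \<in> shifted_orthant" for x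
  proof -
    define w where "w = (\<Sum>i\<in>UNIV. x $ i + 2)"
    have xi: "x $ i + 2 > 0" for i using x by (auto simp: shifted_orthant_def) (smt (verit))
    have w0: "w \<ge> 0" unfolding w_def using xi by (intro sum_nonneg less_imp_le)
    have "norm x \<le> (\<Sum>i\<in>UNIV. \<bar>x $ i\<bar>)" by (rule norm_le_l1_cart)
    also have "\<dots> \<le> (\<Sum>i\<in>UNIV. (x $ i + 2) + 2)"
    proof (rule sum_mono)
      fix i show "\<bar>x $ i\<bar> \<le> (x $ i + 2) + 2" using xi[of i] by linarith
    qed
    also have "\<dots> = w + 2 * n" by (simp add: w_def n_def sum.distrib)
    finally have nx: "1 + norm x \<le> 1 + 2 * n + w" by simp
    have "(1 + norm x) ^ d \<le> (1 + 2 * n + w) ^ d" using nx by (intro power_mono) auto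
    also have "\<dots> = (\<delta> * (1 + 2 * n + w)) ^ d / \<delta> ^ d" using \<delta> by (simp add: power_mult_distrib)
    also have "\<dots> \<le> fact d * exp (\<delta> * (1 + 2 * n + w)) / \<delta> ^ d"
      using \<delta> w0 by (intro divide_right_mono power_le_fact_exp) (auto simp: n_def)
    finally have 1: "(1 + norm x) ^ d \<le> fact d / \<delta> ^ d * exp (\<delta> * (1 + 2 * n)) * exp (\<delta> * w)"
      by (simp add: exp_add[symmetric] algebra_simps)
    have "(\<Sum>i\<in>UNIV. c i * x $ i) = (\<Sum>i\<in>UNIV. c i * (x $ i + 2)) - 2 * (\<Sum>i\<in>UNIV. c i)"
      by (simp add: distrib_left sum.distrib sum_distrib_right[symmetric])
    moreover have "\<delta> * w \<le> (\<Sum>i\<in>UNIV. c i * (x $ i + 2))"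
      unfolding w_def sum_distrib_left by (intro sum_mono mult_right_mono \<delta>c less_imp_le[OF xi])
    ultimately have "- (\<Sum>i\<in>UNIV. c i * x $ i) \<le> - (\<delta> * w) + 2 * (\<Sum>i\<in>UNIV. c i)" by linarith
    then have "rexpo c x \<le> exp (- (\<delta> * w) + 2 * (\<Sum>i\<in>UNIV. c i))" by (simp add: rexpo_def)
    then have 2: "rexpo c x \<le> exp (- (\<delta> * w)) * K" by (simp only: K_def exp_add)
    have "(1 + norm x) ^ d * rexpo c x \<le> (fact d / \<delta> ^ d * exp (\<delta> * (1 + 2 * n)) * exp (\<delta> * w)) * (exp (- (\<delta> * w)) * K)"
      using 1 2 \<delta> by (intro mult_mono) auto
    also have "\<dots> = B" by (simp add: B_def exp_minus field_simps)
    finally show ?thesis .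
  qed
  then show ?thesis by blast
qed

lemma schwartz_cutoff_expo:
  fixes c :: "'n::finite \<Rightarrow> real"
  assumes c: "\<And>i. c i > 0" and g: "poly_growth g"
  shows "schwartz (\<lambda>x. cutoff x * (g x * expo c x))"
proof (rule schwartz_dominated)
  \<comment> \<open>Off the shifted orthant the exponential is unbounded but the cut-off function
    has vanishing derivatives, so the weight may be set to zero there.\<close>
  let ?w = "\<lambda>x. if x \<in> shifted_orthant then rexpo c x else 0"
  have "dominated (\<lambda>x. 1 * rexpo c x) (\<lambda>x. (cutoff x * g x) * expo c x)"
    by (intro dominated_mult poly_growth_mult poly_growth_cutoff g dominated_expo) auto
  then have d: "dominated (rexpo c) (\<lambda>x. cutoff x * (g x * expo c x))" by (simp add: mult.assoc)
  show "dominated ?w (\<lambda>x. cutoff x * (g x * expo c x))"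
    unfolding dominated_def
  proof (intro conjI allI dominated_smooth[OF d])
    fix "is"
    obtain C d where "\<And>x. norm (iter_pdiff is (\<lambda>x. cutoff x * (g x * expo c x)) x) \<le> C * (1 + norm x) ^ d * rexpo c x"
      using d unfolding dominated_def by blast
    then show "\<exists>C d. \<forall>x. norm (iter_pdiff is (\<lambda>x. cutoff x * (g x * expo c x)) x) \<le> C * (1 + norm x) ^ d * ?w x"
      by (intro exI[of _ C] exI[of _ d]) (auto simp: iter_pdiff_cutoff_outside)
  qed
  fix d
  obtain B where B: "\<forall>x\<in>shifted_orthant. (1 + norm x) ^ d * rexpo c x \<le> B"
    using poly_times_rexpo_bounded[of c d, OF c] by blast
  show "\<exists>B. \<forall>x. (1 + norm x) ^ d * ?w x \<le> B"
    by (rule exI[of _ "max B 0"]) (use B in \<open>auto simp: le_max_iff_disj\<close>)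
qed auto

section \<open>Taylor remainders and the raising of exponents\<close>

definition exp_rem :: "nat \<Rightarrow> real \<Rightarrow> real" where
  "exp_rem m y = exp (- (y / 4)) - (\<Sum>j<m. (- (y / 4)) ^ j / fact j)"

text \<open>Differentiation turns the remainder of order m into the one of order m - 1. Truncated
  subtraction is right at m = 0, where the remainder is the exponential itself.\<close>

lemma deriv_exp_rem: "(exp_rem m has_real_derivative (- 1 / 4) * exp_rem (m - 1) y) (at y)"
proof (cases m)
  case 0
  then show ?thesis unfolding exp_rem_def by (auto intro!: derivative_eq_intros)
next
  case (Suc n)
  have "((\<lambda>y. exp (- (y / 4)) - (\<Sum>j<Suc n. (- (y / 4)) ^ j / fact j)) has_real_derivative
     exp (- (y / 4)) * (- (1 / 4)) - (\<Sum>j<Suc n. real j * ((- (y / 4)) ^ (j - Suc 0) * (- (1 / 4))) / fact j)) (at y)"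
    by (auto intro!: derivative_eq_intros sum.cong)
  also have "(\<Sum>j<Suc n. real j * ((- (y / 4)) ^ (j - Suc 0) * (- (1 / 4))) / fact j) = (\<Sum>j<n. (- (y / 4)) ^ j * (- (1 / 4)) / fact j)"
    by (subst sum.lessThan_Suc_shift) (simp add: field_simps del: of_nat_Suc)
  also have "exp (- (y / 4)) * (- (1 / 4)) - (\<Sum>j<n. (- (y / 4)) ^ j * (- (1 / 4)) / fact j) = (- 1 / 4) * exp_rem (m - 1) y"
    by (simp add: exp_rem_def Suc sum_distrib_left right_diff_distrib sum_divide_distrib algebra_simps sum_negf)
  finally show ?thesis unfolding exp_rem_def Suc by simp
qed

lemma deriv_seq_exp_rem: "deriv_seq (\<lambda>l y. (- 1 / 4) ^ l * exp_rem (m - l) y)"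
  unfolding deriv_seq_def
proof (intro allI)
  fix l x
  have "((\<lambda>y. (- 1 / 4) ^ l * exp_rem (m - l) y) has_real_derivative (- 1 / 4) ^ l * ((- 1 / 4) * exp_rem (m - l - 1) x)) (at x)"
    by (rule DERIV_cmult[OF deriv_exp_rem])
  then show "((\<lambda>y. (- 1 / 4) ^ l * exp_rem (m - l) y) has_real_derivative (- 1 / 4) ^ Suc l * exp_rem (m - Suc l) x) (at x)"
    by (simp add: mult_ac)
qed

text \<open>Half of the factor 4^(-m) gives the geometric decay, the other half lets the factorial
  absorb |y|^m at the price of exp(|y| / 2). With exp(|y| / 4) from the Lagrange form the growth is
  exp(3 |y| / 4), and |y| \<le> y + 4 for y > -2 produces the constant exp 3.\<close>

lemma exp_rem_bound:
  assumes y: "y > - 2"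
  shows "\<bar>exp_rem m y\<bar> \<le> (1 / 2) ^ m * (exp 3 * exp (3 / 4 * y))"
proof -
  obtain t where t: "\<bar>t\<bar> \<le> \<bar>- (y / 4)\<bar>" "exp (- (y / 4)) = (\<Sum>j<m. (- (y / 4)) ^ j / fact j) + exp t / fact m * (- (y / 4)) ^ m"
    using Maclaurin_exp_le[of "- (y / 4)" m] by blast
  have "\<bar>exp_rem m y\<bar> = exp t * (\<bar>y\<bar> / 4) ^ m / fact m"
    by (simp add: exp_rem_def t(2) abs_mult power_abs)
  also have "(\<bar>y\<bar> / 4) ^ m = (1 / 2) ^ m * (\<bar>y\<bar> / 2) ^ m"
    by (simp add: power_mult_distrib[symmetric])
  also have "exp t * ((1 / 2) ^ m * (\<bar>y\<bar> / 2) ^ m) / fact m \<le> exp (\<bar>y\<bar> / 4) * ((1 / 2) ^ m * (fact m * exp (\<bar>y\<bar> / 2))) / fact m"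
    using t(1) by (intro divide_right_mono mult_mono power_le_fact_exp) auto
  also have "\<dots> = (1 / 2) ^ m * exp (3 / 4 * \<bar>y\<bar>)"
    by (simp add: exp_add[symmetric] mult.left_commute)
  also have "\<dots> \<le> (1 / 2) ^ m * exp (3 + 3 / 4 * y)"
    using y by (intro mult_left_mono) auto
  finally show ?thesis by (simp add: exp_add)
qed

lemma rexpo_update:
  "rexpo (c(i := c i + d)) x = rexpo c x * exp (- (d * x $ i))"
proof -
  have "(\<Sum>j\<in>UNIV. (c(i := c i + d)) j * x $ j) = (\<Sum>j\<in>UNIV. c j * x $ j) + (\<Sum>j\<in>UNIV. if j = i then d * x $ j else 0)"
    unfolding sum.distrib[symmetric] by (intro sum.cong refl) (auto simp: algebra_simps)
  then show ?thesis by (simp add: rexpo_def exp_add[symmetric])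
qed

lemma mono_fun_update: "mono_fun (a(i := a i + j)) x = mono_fun a x * complex_of_real (x $ i) ^ j"
proof -
  have "mono_fun (a(i := a i + j)) x = (\<Prod>l\<in>UNIV. complex_of_real (x $ l) ^ a l * (if l = i then complex_of_real (x $ i) ^ j else 1))"
    unfolding mono_fun_def by (intro prod.cong refl) (auto simp: power_add)
  then show ?thesis by (simp add: prod.distrib mono_fun_def)
qed

text \<open>Expanding \<open>exp (- x\<^sub>i / 4)\<close> as a power series raises one exponent by a quarter.\<close>
lemma annihilates_expo_step:
  fixes u :: "(real^'n::finite \<Rightarrow> complex) \<Rightarrow> complex"
  assumes u: "cts_functional u" and c: "\<And>i. c i \<ge> 1"
    and ann: "\<And>a. u (\<lambda>x. cutoff x * (mono_fun a x * expo c x)) = 0"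
  shows "u (\<lambda>x. cutoff x * (mono_fun a x * expo (c(i := c i + 1 / 4)) x)) = 0"
proof (rule cts_functional_eq_0[OF u])
  have c0: "c j > 0" for j using c[of j] by linarith
  define f where "f = (\<lambda>x :: real^'n. cutoff x * (mono_fun a x * expo (c(i := c i + 1 / 4)) x))"
  show "schwartz (\<lambda>x. cutoff x * (mono_fun a x * expo (c(i := c i + 1 / 4)) x))"
    by (rule schwartz_cutoff_expo[OF _ poly_growth_mono_fun]) (use c0 in \<open>auto intro: add_pos_pos\<close>)
  fix N :: nat and e :: real assume e: "e > 0"
  define F where "F = (\<lambda>x :: real^'n. cutoff x * (mono_fun a x * expo c x))"
  define g where "g J = (\<lambda>x :: real^'n. \<Sum>j<J. complex_of_real ((- 1 / 4) ^ j / fact j) * (cutoff x * (mono_fun (a(i := a i + j)) x * expo c x)))" for J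
  have sF: "schwartz (\<lambda>x. cutoff x * (mono_fun b x * expo c x))" for b
    by (rule schwartz_cutoff_expo[OF c0 poly_growth_mono_fun])
  have sg: "schwartz (g J)" for J unfolding g_def by (intro schwartz_sum schwartz_cmult sF)
  have ug: "u (g J) = 0" for J unfolding g_def
    by (simp only: cts_functional_sum[OF u schwartz_cmult[OF sF]] cts_functional_cmult[OF u sF] ann
        mult_zero_right sum.neutral_const)
  have diff: "f x - g J x = F x * coord_fun i (exp_rem J) x" for x J
  proof -
    have "g J x = (\<Sum>j<J. F x * complex_of_real ((- (x $ i / 4)) ^ j / fact j))"
      unfolding g_def F_def
    proof (rule sum.cong[OF refl])
      fix j
      have "(- 1 / 4 :: complex) ^ j * complex_of_real (x $ i) ^ j = complex_of_real ((- (x $ i / 4)) ^ j)"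
        by (simp add: power_mult_distrib[symmetric])
      then show "complex_of_real ((- 1 / 4) ^ j / fact j) * (cutoff x * (mono_fun (a(i := a i + j)) x * expo c x)) =
        cutoff x * (mono_fun a x * expo c x) * complex_of_real ((- (x $ i / 4)) ^ j / fact j)"
        unfolding mono_fun_update by (simp add: field_simps)
    qed
    moreover have "f x = F x * complex_of_real (exp (- (x $ i / 4)))"
      unfolding f_def F_def expo_eq_rexpo rexpo_update by (simp add: mult_ac)
    ultimately show ?thesis
      by (simp add: coord_fun_def exp_rem_def sum_distrib_left right_diff_distrib)
  qed
  have dF: "dominated (\<lambda>x. 1 * rexpo c x) (\<lambda>x. (cutoff x * mono_fun a x) * expo c x)"
    by (intro dominated_mult poly_growth_mult poly_growth_cutoff poly_growth_mono_fun dominated_expo) auto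
  have Feq: "F = (\<lambda>x. (cutoff x * mono_fun a x) * expo c x)" by (simp add: F_def mult.assoc)
  obtain C d where C: "C \<ge> 0" "\<And>js x. length js \<le> N \<Longrightarrow> norm (iter_pdiff js F x) \<le> C * (1 + norm x) ^ d * rexpo c x"
    using dominated_uniform[OF dF, of N] unfolding Feq by auto
  \<comment> \<open>The decay left in direction i after the remainder has grown like exp(3 x_i / 4).
    It is positive because c_i \<ge> 1.\<close>
  define c' where "c' = c(i := c i + (- 3 / 4))"
  have "c' j > 0" for j unfolding c'_def using c[of j] c0[of j] by auto
  then obtain B where B: "\<forall>x\<in>shifted_orthant. (1 + norm x) ^ (N + d) * rexpo c' x \<le> B"
    using poly_times_rexpo_bounded[of c' "N + d"] by blast
  \<comment> \<open>One factor 2^N counts the Leibniz terms. The other covers the up to N powers of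
    1/2 lost when derivatives lower the order of the remainder.\<close>
  define K where "K = 2 ^ N * C * 2 ^ N * exp 3 * max B 0"
  have bound: "(1 + norm x) ^ N * norm (iter_pdiff is (\<lambda>x. f x - g J x) x) \<le> K * (1 / 2) ^ J"
    if l: "length is \<le> N" and J: "N \<le> J" for "is" x J
  proof (cases "x \<in> shifted_orthant")
    case False
    have "(\<lambda>x. f x - g J x) = (\<lambda>x. cutoff x * (mono_fun a x * expo c x * coord_fun i (exp_rem J) x))"
      unfolding diff by (simp add: F_def mult.assoc)
    then have "iter_pdiff is (\<lambda>x. f x - g J x) x = 0" using iter_pdiff_cutoff_outside[OF False] by simp
    moreover have "0 \<le> K * (1 / 2) ^ J" using C by (auto simp: K_def)
    ultimately show ?thesis by simp
  next
    case True
    then have xi: "x $ i > - 2" by (auto simp: shifted_orthant_def)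
    have cf: "coord_fun i (exp_rem J) = coord_fun i ((\<lambda>l y. (- 1 / 4) ^ l * exp_rem (J - l) y) 0)" by simp
    have b: "norm (iter_pdiff js (coord_fun i (exp_rem J)) x) \<le> 2 ^ N * (1 / 2) ^ J * (exp 3 * exp (3 / 4 * x $ i))"
      if "length js \<le> length is" for js
    proof -
      have "norm (iter_pdiff js (coord_fun i (exp_rem J)) x) \<le> \<bar>(- 1 / 4) ^ length js * exp_rem (J - length js) (x $ i)\<bar>"
        unfolding cf by (subst iter_pdiff_coord_fun[OF deriv_seq_exp_rem]) (auto simp: coord_fun_def norm_mult norm_power abs_mult power_abs)
      also have "\<dots> \<le> 1 * \<bar>exp_rem (J - length js) (x $ i)\<bar>"
        unfolding abs_mult by (intro mult_right_mono) (auto simp: power_abs intro!: power_le_one)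
      also have "\<dots> \<le> (1 / 2) ^ (J - length js) * (exp 3 * exp (3 / 4 * x $ i))"
        using exp_rem_bound[OF xi] by simp
      also have "\<dots> \<le> (2 ^ N * (1 / 2) ^ J) * (exp 3 * exp (3 / 4 * x $ i))"
      proof (intro mult_right_mono)
        have "(1 / 2 :: real) ^ (J - length js) = 2 ^ length js * (1 / 2) ^ J"
          using that l J by (simp add: power_diff power_divide)
        also have "\<dots> \<le> 2 ^ N * (1 / 2) ^ J" using that l by (intro mult_right_mono power_increasing) auto
        finally show "(1 / 2 :: real) ^ (J - length js) \<le> 2 ^ N * (1 / 2) ^ J" .
      qed auto
      finally show ?thesis .
    qed
    have smF: "smooth_fun F" unfolding Feq by (rule dominated_smooth[OF dF])
    have sme: "smooth_fun (coord_fun i (exp_rem J))" unfolding cf by (rule smooth_coord_fun[OF deriv_seq_exp_rem])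
    have "norm (iter_pdiff is (\<lambda>x. F x * coord_fun i (exp_rem J) x) x) \<le>
      2 ^ length is * (C * (1 + norm x) ^ d * rexpo c x) * (2 ^ N * (1 / 2) ^ J * (exp 3 * exp (3 / 4 * x $ i)))"
      using l by (intro iter_pdiff_mult_bound smF sme C(2) b) auto
    also have "\<dots> \<le> 2 ^ N * (C * (1 + norm x) ^ d * rexpo c x) * (2 ^ N * (1 / 2) ^ J * (exp 3 * exp (3 / 4 * x $ i)))"
      using l C(1) by (intro mult_right_mono power_increasing mult_nonneg_nonneg) auto
    also have "\<dots> = (2 ^ N * C * 2 ^ N * exp 3) * (1 / 2) ^ J * ((1 + norm x) ^ d * (rexpo c x * exp (3 / 4 * x $ i)))"
      by (simp add: mult_ac)
    also have "rexpo c x * exp (3 / 4 * x $ i) = rexpo c' x" unfolding c'_def rexpo_update by simp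
    finally have "(1 + norm x) ^ N * norm (iter_pdiff is (\<lambda>x. f x - g J x) x) \<le>
       (1 + norm x) ^ N * ((2 ^ N * C * 2 ^ N * exp 3) * (1 / 2) ^ J * ((1 + norm x) ^ d * rexpo c' x))"
      unfolding diff by (intro mult_left_mono) auto
    also have "\<dots> = (2 ^ N * C * 2 ^ N * exp 3) * (1 / 2) ^ J * ((1 + norm x) ^ (N + d) * rexpo c' x)"
      by (simp add: power_add mult_ac)
    also have "\<dots> \<le> (2 ^ N * C * 2 ^ N * exp 3) * (1 / 2) ^ J * max B 0"
      using B True C(1) by (intro mult_left_mono) (auto simp: le_max_iff_disj)
    finally show ?thesis by (simp add: K_def mult_ac)
  qed
  have "(\<lambda>J. K * (1 / 2) ^ J) \<longlonglongrightarrow> K * 0" by (intro tendsto_intros LIMSEQ_power_zero) auto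
  then have "\<forall>\<^sub>F J in sequentially. K * (1 / 2) ^ J < e" using e by (intro order_tendstoD(2)[where y = "K * 0"]) auto
  then obtain J where J: "N \<le> J" "K * (1 / 2) ^ J < e"
    using eventually_happens'[OF sequentially_bot eventually_conj[OF eventually_ge_at_top[of N]]] by blast
  have "seminorm_le N (\<lambda>x. f x - g J x) e"
    unfolding seminorm_le_def using bound[OF _ J(1)] J(2) by (meson less_imp_le order_trans)
  then show "\<exists>g. schwartz g \<and> u g = 0 \<and> seminorm_le N (\<lambda>x. cutoff x * (mono_fun a x * expo (c(i := c i + 1 / 4)) x) - g x) e"
    using sg ug unfolding f_def by blast
qed

text \<open>Induction on the total number of quarter steps, with all monomials carried along since
  each step consumes infinitely many of them. Four steps per unit reach every integer
  exponent.\<close>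

lemma annihilates_expo:
  fixes u :: "(real^'n::finite \<Rightarrow> complex) \<Rightarrow> complex"
  assumes u: "cts_functional u"
    and ann: "\<And>a. u (\<lambda>x. cutoff x * (mono_fun a x * expo (\<lambda>_. 1) x)) = 0"
  shows "u (\<lambda>x. cutoff x * (mono_fun a x * expo (\<lambda>i. 1 + real (m i) / 4) x)) = 0"
proof (induction "\<Sum>i\<in>UNIV. m i" arbitrary: m a)
  case 0
  then show ?case using ann by simp
next
  case (Suc n)
  have "\<exists>i. m i > 0"
  proof (rule ccontr)
    assume "\<not> ?thesis"
    then have "(\<Sum>i\<in>UNIV. m i) = 0" by simp
    with Suc.hyps(2) show False by simp
  qed
  then obtain i where i: "m i > 0" by blast
  define m' where "m' = m(i := m i - 1)"
  have "(\<Sum>j\<in>UNIV. m j) = (\<Sum>j\<in>UNIV. m' j + (if j = i then 1 else 0))"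
    using i by (intro sum.cong refl) (auto simp: m'_def)
  then have "n = (\<Sum>j\<in>UNIV. m' j)" using Suc.hyps(2) by (simp add: sum.distrib)
  then have IH: "u (\<lambda>x. cutoff x * (mono_fun a x * expo (\<lambda>i. 1 + real (m' i) / 4) x)) = 0" for a by (rule Suc.hyps(1))
  have eq: "(\<lambda>j. 1 + real (m j) / 4) = (\<lambda>j. 1 + real (m' j) / 4)(i := (1 + real (m' i) / 4) + 1 / 4)"
    using i by (auto simp: m'_def fun_eq_iff of_nat_diff field_simps)
  show ?case unfolding eq by (rule annihilates_expo_step[OF u _ IH]) simp
qed

section \<open>Polynomials as explicit sums of monomials\<close>

definition mono_sum :: "(real \<times> ('n \<Rightarrow> nat)) list \<Rightarrow> real^'n::finite \<Rightarrow> real" where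
  "mono_sum L t = (\<Sum>(c, m)\<leftarrow>L. c * (\<Prod>i\<in>UNIV. (t $ i) ^ m i))"

lemma mono_sum_append: "mono_sum (L @ M) t = mono_sum L t + mono_sum M t"
  by (simp add: mono_sum_def)

lemma mono_sum_mult: "\<exists>N. \<forall>t. mono_sum N t = mono_sum L t * mono_sum M t"
proof (induction L)
  case Nil
  show ?case by (rule exI[of _ "[]"]) (simp add: mono_sum_def)
next
  case (Cons p L)
  obtain c m where p: "p = (c, m)" by force
  from Cons obtain N where N: "\<And>t. mono_sum N t = mono_sum L t * mono_sum M t" by blast
  define Q where "Q = map (\<lambda>(d, l). (c * d, \<lambda>i. m i + l i)) M"
  have "mono_sum Q t = c * (\<Prod>i\<in>UNIV. (t $ i) ^ m i) * mono_sum M t" for t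
    unfolding Q_def mono_sum_def
    by (induction M) (auto simp: power_add prod.distrib algebra_simps)
  then have "\<forall>t. mono_sum (Q @ N) t = mono_sum (p # L) t * mono_sum M t"
    by (simp add: mono_sum_append N) (simp add: mono_sum_def p algebra_simps)
  then show ?case by blast
qed

lemma mono_sum_sum: "finite I \<Longrightarrow> (\<And>i. i \<in> I \<Longrightarrow> \<exists>L. \<forall>t. f i t = mono_sum L t) \<Longrightarrow> \<exists>L. \<forall>t. (\<Sum>i\<in>I. f i t) = mono_sum L t"
proof (induction I rule: finite_induct)
  case empty
  show ?case by (rule exI[of _ "[]"]) (simp add: mono_sum_def)
next
  case (insert i I)
  then obtain L M where "\<forall>t. f i t = mono_sum L t" "\<forall>t. (\<Sum>i\<in>I. f i t) = mono_sum M t" by blast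
  then show ?case using insert.hyps by (intro exI[of _ "L @ M"]) (simp add: mono_sum_append)
qed

text \<open>Stone--Weierstrass delivers an abstract polynomial function. Explicit monomials are
  wanted because under t_i = exp(-x_i) each of them becomes one exponential.\<close>

lemma real_polynomial_function_mono_sum:
  fixes q :: "real^'n::finite \<Rightarrow> real"
  assumes "real_polynomial_function q" shows "\<exists>L. \<forall>t. q t = mono_sum L t"
  using assms
proof induction
  case (linear f)
  have 1: "\<exists>L. \<forall>t. f (axis i 1) * t $ i = mono_sum L t" for i :: 'n
  proof (rule exI[of _ "[(f (axis i 1), \<lambda>j. if j = i then 1 else 0)]"], rule allI)
    fix t :: "real^'n"
    have "(\<Prod>j\<in>UNIV. (t $ j) ^ (if j = i then 1 else 0)) = (\<Prod>j\<in>UNIV. if j = i then t $ j else 1)"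
      by (intro prod.cong refl) auto
    then show "f (axis i 1) * t $ i = mono_sum [(f (axis i 1), \<lambda>j. if j = i then 1 else 0)] t"
      by (simp add: mono_sum_def)
  qed
  have feq: "f t = (\<Sum>i\<in>UNIV. f (axis i 1) * t $ i)" for t
  proof -
    have lin: "linear f" by (rule bounded_linear.linear[OF linear])
    have ex: "(\<Sum>i\<in>UNIV. t $ i *\<^sub>R axis i 1) = t"
      using basis_expansion[of t] by (simp only: scalar_mult_eq_scaleR)
    have "f (\<Sum>i\<in>UNIV. t $ i *\<^sub>R axis i 1) = (\<Sum>i\<in>UNIV. f (t $ i *\<^sub>R axis i 1))"
      by (rule linear_sum[OF lin])
    also have "\<dots> = (\<Sum>i\<in>UNIV. f (axis i 1) * t $ i)"
      by (simp only: linear_cmul[OF lin] real_scaleR_def mult.commute)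
    finally show ?thesis unfolding ex .
  qed
  obtain L where L: "\<And>t. (\<Sum>i\<in>UNIV. f (axis i 1) * t $ i) = mono_sum L t"
    using mono_sum_sum[of UNIV "\<lambda>i t. f (axis i 1) * t $ i", OF finite 1] by blast
  show ?case by (rule exI[of _ L], rule allI, rule trans[OF feq], rule L)
next
  case (const c)
  show ?case by (rule exI[of _ "[(c, \<lambda>_. 0)]"]) (simp add: mono_sum_def)
next
  case (add f g)
  then obtain L M where "\<forall>t. f t = mono_sum L t" "\<forall>t. g t = mono_sum M t" by blast
  then show ?case by (intro exI[of _ "L @ M"]) (simp add: mono_sum_append)
next
  case (mult f g)
  then obtain L M where L: "\<forall>t. f t = mono_sum L t" "\<forall>t. g t = mono_sum M t" by blast
  obtain N where "\<forall>t. mono_sum N t = mono_sum L t * mono_sum M t" using mono_sum_mult by blast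
  then show ?case using L by (intro exI[of _ N]) simp
qed

section \<open>Approximation of derivatives by exponential sums\<close>

abbreviation "unit_expo \<equiv> (\<lambda>_. 1 :: real)"

lemma rexpo_line: "rexpo c (x + t *\<^sub>R axis i 1) = rexpo c x * exp (- (c i * t))"
proof -
  have "(\<Sum>j\<in>UNIV. c j * (x + t *\<^sub>R axis i 1) $ j) = (\<Sum>j\<in>UNIV. c j * x $ j) + (\<Sum>j\<in>UNIV. if j = i then c j * t else 0)"
    unfolding sum.distrib[symmetric] by (intro sum.cong refl) (auto simp: axis_def algebra_simps)
  then show ?thesis by (simp add: rexpo_def exp_add[symmetric])
qed

text \<open>A function vanishing at infinity is the integral of its derivative from infinity. Along
  each axis the weight decays like exp(-t), whose integral is 1, so the bound returns with the same
  constant. Moving in positive directions does not leave the shifted orthant.\<close>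

lemma integrate_from_infinity_bound:
  fixes f :: "real^'n::finite \<Rightarrow> complex"
  assumes f: "smooth_fun f"
    and bound: "\<And>x. x \<in> shifted_orthant \<Longrightarrow> norm (pdiff i f x) \<le> e * rexpo unit_expo x"
    and lim: "\<And>x. ((\<lambda>t. f (x + t *\<^sub>R axis i 1)) \<longlongrightarrow> 0) at_top"
    and x: "x \<in> shifted_orthant"
  shows "norm (f x) \<le> e * rexpo unit_expo x"
proof -
  let ?K = "e * rexpo unit_expo x"
  have in_orth: "x + t *\<^sub>R axis i 1 \<in> shifted_orthant" if "t \<ge> 0" for t
  proof -
    have "- 2 < x $ j + t * axis i 1 $ j" for j
      using x that by (auto simp: shifted_orthant_def axis_def) (smt (verit))
    then show ?thesis by (simp add: shifted_orthant_def)
  qed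
  have K0: "0 \<le> ?K" using bound[OF x] norm_ge_zero order_trans by blast
  have step: "norm (f (x + T *\<^sub>R axis i 1) - f x) \<le> ?K" if T: "T > 0" for T
  proof -
    have "norm (f (x + T *\<^sub>R axis i 1) - f (x + 0 *\<^sub>R axis i 1)) \<le> (- ?K * exp (- T)) - (- ?K * exp (- 0))"
    proof (rule differentiable_bound_general[where f = "\<lambda>t. f (x + t *\<^sub>R axis i 1)" and \<phi> = "\<lambda>t. - ?K * exp (- t)"
          and f' = "\<lambda>t. pdiff i f (x + t *\<^sub>R axis i 1)" and \<phi>' = "\<lambda>t. ?K * exp (- t)", OF T])
      show "continuous_on {0..T} (\<lambda>t. f (x + t *\<^sub>R axis i 1))"
        by (intro continuous_on_compose2[OF smooth_fun_continuous[OF f, of UNIV]] continuous_intros) auto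
      show "continuous_on {0..T} (\<lambda>t. - ?K * exp (- t))" by (intro continuous_intros)
      fix t assume t: "0 < t" "t < T"
      show "((\<lambda>t. f (x + t *\<^sub>R axis i 1)) has_vector_derivative pdiff i f (x + t *\<^sub>R axis i 1)) (at t)"
        by (rule has_pdiff_line[OF smooth_fun_has_pdiff[OF f]])
      show "((\<lambda>t. - ?K * exp (- t)) has_vector_derivative ?K * exp (- t)) (at t)"
        unfolding has_real_derivative_iff_has_vector_derivative[symmetric] by (auto intro!: derivative_eq_intros)
      show "norm (pdiff i f (x + t *\<^sub>R axis i 1)) \<le> ?K * exp (- t)"
        using bound[OF in_orth[of t]] t by (simp add: rexpo_line mult.assoc)
    qed
    also have "\<dots> \<le> ?K" using K0 by simp
    finally show ?thesis by simp
  qed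
  have "((\<lambda>T. norm (f (x + T *\<^sub>R axis i 1) - f x)) \<longlongrightarrow> norm (0 - f x)) at_top"
    by (intro tendsto_intros lim)
  moreover have "\<forall>\<^sub>F T in at_top. norm (f (x + T *\<^sub>R axis i 1) - f x) \<le> ?K"
    using eventually_gt_at_top[of 0] by eventually_elim (rule step)
  ultimately have "norm (0 - f x) \<le> ?K" by (intro tendsto_upperbound) auto
  then show ?thesis by simp
qed

lemma iterated_integrate_from_infinity_bound:
  fixes h :: "real^'n::finite \<Rightarrow> complex"
  assumes h: "smooth_fun h"
    and lim: "\<And>is i x. ((\<lambda>t. iter_pdiff is h (x + t *\<^sub>R axis i 1)) \<longlongrightarrow> 0) at_top"
    and bound: "\<And>x. x \<in> shifted_orthant \<Longrightarrow> norm (iter_pdiff (js @ is) h x) \<le> e * rexpo unit_expo x"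
    and x: "x \<in> shifted_orthant"
  shows "norm (iter_pdiff is h x) \<le> e * rexpo unit_expo x"
  using bound x
proof (induction js arbitrary: x)
  case (Cons i js)
  have "norm (iter_pdiff (js @ is) h x) \<le> e * rexpo unit_expo x" if "x \<in> shifted_orthant" for x
    by (rule integrate_from_infinity_bound[OF smooth_fun_iter[OF h] _ lim that])
       (use Cons.prems in \<open>simp add: iter_pdiff_Cons\<close>)
  then show ?case using Cons.IH Cons.prems(2) by blast
qed simp

lemma expo_line_tendsto:
  assumes "c i > 0" shows "((\<lambda>t. d * expo c (x + t *\<^sub>R axis i 1)) \<longlongrightarrow> 0) at_top"
proof -
  have "((\<lambda>t. exp (- (c i * t))) \<longlongrightarrow> 0) at_top"
    using assms by real_asymp
  then have "((\<lambda>t. d * complex_of_real (rexpo c x * exp (- (c i * t)))) \<longlongrightarrow> d * complex_of_real (rexpo c x * 0)) at_top"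
    by (intro tendsto_intros)
  then show ?thesis by (simp add: expo_eq_rexpo rexpo_line)
qed

text \<open>All exponents are at least 1, so every term contains the factor
  \<open>rexpo unit_expo\<close> relative to which errors are measured.\<close>

definition expo_sum :: "(complex \<times> ('n \<Rightarrow> nat)) list \<Rightarrow> real^'n::finite \<Rightarrow> complex" where
  "expo_sum L x = (\<Sum>(c, m)\<leftarrow>L. c * expo (\<lambda>i. 1 + real (m i)) x)"

lemma expo_sum_Nil: "expo_sum [] = (\<lambda>_. 0)"
  by (simp add: expo_sum_def fun_eq_iff)

lemma expo_sum_Cons: "expo_sum ((c, m) # L) = (\<lambda>x. c * expo (\<lambda>i. 1 + real (m i)) x + expo_sum L x)"
  by (simp add: expo_sum_def fun_eq_iff)

lemma smooth_expo_sum: "smooth_fun (expo_sum L)"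
  by (induction L) (auto simp: expo_sum_Nil expo_sum_Cons smooth_fun_const intro!: smooth_fun_add smooth_expo)

lemma iter_pdiff_expo_sum:
  "iter_pdiff is (expo_sum L) = expo_sum (map (\<lambda>(c, m). (c * (\<Prod>i\<leftarrow>is. - complex_of_real (1 + real (m i))), m)) L)"
proof (induction L)
  case Nil
  show ?case by (simp add: expo_sum_Nil iter_pdiff_const)
next
  case (Cons p L)
  obtain c m where p: "p = (c, m)" by force
  have "iter_pdiff is (expo_sum (p # L)) = (\<lambda>x. c * ((\<Prod>i\<leftarrow>is. - complex_of_real (1 + real (m i))) * expo (\<lambda>i. 1 + real (m i)) x) + iter_pdiff is (expo_sum L) x)"
    unfolding p expo_sum_Cons
    by (simp only: iter_pdiff_add[OF smooth_expo smooth_expo_sum] iter_pdiff_cmult[OF smooth_fun_expo] iter_pdiff_expo)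
  then show ?case unfolding Cons by (simp add: p expo_sum_Cons mult.assoc)
qed

lemma expo_sum_line_tendsto: "((\<lambda>t. expo_sum L (x + t *\<^sub>R axis i 1)) \<longlongrightarrow> 0) at_top"
proof (induction L)
  case (Cons p L)
  obtain c m where p: "p = (c, m)" by force
  have "((\<lambda>t. c * expo (\<lambda>i. 1 + real (m i)) (x + t *\<^sub>R axis i 1) + expo_sum L (x + t *\<^sub>R axis i 1)) \<longlongrightarrow> 0 + 0) at_top"
    by (intro tendsto_add expo_line_tendsto Cons) simp
  then show ?case by (simp add: p expo_sum_Cons)
qed (simp add: expo_sum_Nil)

text \<open>Stone--Weierstrass in the variables \<open>t\<^sub>i = exp (- x\<^sub>i)\<close>.\<close>
lemma expo_sum_uniform_approx:
  fixes \<Psi> :: "real^'n::finite \<Rightarrow> complex"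
  assumes cont: "continuous_on UNIV \<Psi>" and supp: "\<And>x i. x $ i \<ge> L \<Longrightarrow> \<Psi> x = 0" and e: "e > 0"
  shows "\<exists>M. \<forall>x\<in>shifted_orthant. norm (\<Psi> x - expo_sum M x) \<le> e * rexpo unit_expo x"
proof -
  define \<eta> where "\<eta> = exp (- L)"
  have \<eta>: "\<eta> > 0" by (simp add: \<eta>_def)
  \<comment> \<open>The inverse of t_i = exp(-x_i), with t_i clipped at \<eta> = exp(-L) so that it
    is continuous everywhere. Clipping is harmless since \<Psi> vanishes as soon as a coordinate
    reaches L.\<close>
  define X where "X t = (\<chi> i. - ln (max (t $ i) \<eta>))" for t :: "real^'n"
  define w where "w t = (\<Prod>i\<in>UNIV. max (t $ i) \<eta>)" for t :: "real^'n"
  \<comment> \<open>Dividing by w, the product of the clipped t_i, makes a uniform error in t an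
    error relative to the weight in x.\<close>
  define g where "g t = \<Psi> (X t) / complex_of_real (w t)" for t
  have w0: "w t > 0" for t unfolding w_def using \<eta> by (intro prod_pos) auto
  have mx: "max (t $ i) \<eta> > 0" for t :: "real^'n" and i using \<eta> by auto
  have contX: "continuous_on S X" for S
    unfolding X_def by (intro continuous_intros ballI) (metis less_irrefl mx)
  have contg: "continuous_on S g" for S
    unfolding g_def
  proof (intro continuous_intros)
    show "continuous_on S (\<lambda>t. \<Psi> (X t))" by (rule continuous_on_compose2[OF cont contX]) auto
    show "continuous_on S w" unfolding w_def by (intro continuous_intros)
    show "\<forall>t\<in>S. complex_of_real (w t) \<noteq> 0" by (metis less_irrefl w0 of_real_eq_0_iff)
  qed
  define T where "T x = (\<chi> i. exp (- (x $ i)))" for x :: "real^'n"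
  \<comment> \<open>A compact box containing the image of the shifted orthant, as x_i > -2 means
    exp(-x_i) < exp 2.\<close>
  define K :: "(real^'n) set" where "K = cbox 0 (\<chi> i. exp 2)"
  have TK: "T x \<in> K" if "x \<in> shifted_orthant" for x
    using that by (auto simp: K_def T_def mem_box_cart shifted_orthant_def less_imp_le minus_less_iff)
  have wT: "rexpo unit_expo x = (\<Prod>i\<in>UNIV. T x $ i)" for x
    by (simp add: rexpo_def T_def exp_sum[symmetric] sum_negf)
  have gT: "g (T x) * complex_of_real (rexpo unit_expo x) = \<Psi> x" for x
  proof (cases "\<forall>i. x $ i \<le> L")
    case True
    then have m: "max (T x $ i) \<eta> = T x $ i" for i by (simp add: T_def \<eta>_def)
    have "X (T x) = x" unfolding X_def m by (simp add: T_def vec_eq_iff)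
    moreover have "w (T x) = rexpo unit_expo x" unfolding w_def m wT ..
    ultimately show ?thesis using w0[of "T x"] by (simp add: g_def)
  next
    case False
    then obtain i where i: "x $ i > L" by (auto simp: not_le)
    then have "T x $ i < \<eta>" by (simp add: T_def \<eta>_def)
    then have "X (T x) $ i = L" by (simp add: X_def \<eta>_def max_def)
    then have "\<Psi> (X (T x)) = 0" using supp[of "X (T x)" i] by simp
    moreover have "\<Psi> x = 0" using supp[of x i] i by simp
    ultimately show ?thesis by (simp add: g_def)
  qed
  have "compact K" by (simp add: K_def)
  have e2: "e / 2 > 0" using e by simp
  obtain q1 where q1: "real_polynomial_function q1" "\<And>t. t \<in> K \<Longrightarrow> \<bar>Re (g t) - q1 t\<bar> < e / 2"
    using Stone_Weierstrass_real_polynomial_function[OF \<open>compact K\<close> _ e2, of "\<lambda>t. Re (g t)"] contg by (metis continuous_on_Re)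
  obtain q2 where q2: "real_polynomial_function q2" "\<And>t. t \<in> K \<Longrightarrow> \<bar>Im (g t) - q2 t\<bar> < e / 2"
    using Stone_Weierstrass_real_polynomial_function[OF \<open>compact K\<close> _ e2, of "\<lambda>t. Im (g t)"] contg by (metis continuous_on_Im)
  obtain L1 where L1: "\<And>t. q1 t = mono_sum L1 t" using real_polynomial_function_mono_sum[OF q1(1)] by blast
  obtain L2 where L2: "\<And>t. q2 t = mono_sum L2 t" using real_polynomial_function_mono_sum[OF q2(1)] by blast
  define M where "M = map (\<lambda>(c, m). (complex_of_real c, m)) L1 @ map (\<lambda>(c, m). (\<i> * complex_of_real c, m)) L2"
  have ex: "expo (\<lambda>i. 1 + real (m i)) x = complex_of_real ((\<Prod>i\<in>UNIV. (T x $ i) ^ m i) * rexpo unit_expo x)" for m x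
  proof -
    have "(\<Prod>i\<in>UNIV. (T x $ i) ^ m i) * rexpo unit_expo x = (\<Prod>i\<in>UNIV. exp (- ((1 + real (m i)) * x $ i)))"
      unfolding wT prod.distrib[symmetric] T_def by (intro prod.cong refl) (simp add: exp_of_nat_mult[symmetric] exp_add[symmetric] algebra_simps)
    then show ?thesis by (simp add: expo_eq_rexpo rexpo_def exp_sum[symmetric] sum_negf)
  qed
  have s1: "expo_sum (map (\<lambda>(c, m). (z * complex_of_real c, m)) L) x = z * complex_of_real (mono_sum L (T x) * rexpo unit_expo x)" for z L x
    by (induction L) (auto simp: expo_sum_Nil expo_sum_Cons mono_sum_def ex algebra_simps)
  have sM: "expo_sum M x = (complex_of_real (q1 (T x)) + \<i> * complex_of_real (q2 (T x))) * complex_of_real (rexpo unit_expo x)" for x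
  proof -
    have "expo_sum (A @ B) x = expo_sum A x + expo_sum B x" for A B by (simp add: expo_sum_def)
    then show ?thesis unfolding M_def using s1[of 1 L1 x] s1[of \<i> L2 x] by (simp add: L1 L2 algebra_simps)
  qed
  have "norm (\<Psi> x - expo_sum M x) \<le> e * rexpo unit_expo x" if x: "x \<in> shifted_orthant" for x
  proof -
    have "norm (g (T x) - (complex_of_real (q1 (T x)) + \<i> * complex_of_real (q2 (T x)))) \<le>
      \<bar>Re (g (T x)) - q1 (T x)\<bar> + \<bar>Im (g (T x)) - q2 (T x)\<bar>"
      using cmod_le[of "g (T x) - (complex_of_real (q1 (T x)) + \<i> * complex_of_real (q2 (T x)))"] by simp
    also have "\<dots> \<le> e" using q1(2)[OF TK[OF x]] q2(2)[OF TK[OF x]] by linarith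
    finally have "norm (g (T x) - (complex_of_real (q1 (T x)) + \<i> * complex_of_real (q2 (T x)))) * rexpo unit_expo x \<le> e * rexpo unit_expo x"
      by (rule mult_right_mono) simp
    then show ?thesis unfolding sM gT[of x, symmetric] left_diff_distrib[symmetric] norm_mult by simp
  qed
  then show ?thesis by blast
qed

text \<open>Only one derivative is approximated, the one taking every direction N times. Any
  derivative of order at most N can be continued to it, so integrating back from infinity transfers
  the bound to all of them without loss.\<close>

lemma expo_sum_approx:
  fixes \<psi> :: "real^'n::finite \<Rightarrow> complex"
  assumes \<psi>: "smooth_fun \<psi>" and supp: "\<And>x i. x $ i \<ge> L \<Longrightarrow> \<psi> x = 0" and e: "e > 0"
  shows "\<exists>M. \<forall>is x. length is \<le> N \<longrightarrow> x \<in> shifted_orthant \<longrightarrow>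
     norm (iter_pdiff is (\<lambda>x. \<psi> x - expo_sum M x) x) \<le> e * rexpo unit_expo x"
proof -
  obtain idx :: "'n list" where idx: "set idx = UNIV" "distinct idx" using finite_distinct_list[OF finite] by blast
  define full where "full = concat (replicate N idx)"
  have cnt: "count (mset full) i = N" for i
  proof -
    have "count (mset (concat (replicate n idx))) i = n" for n
      using idx by (induction n) (auto simp: distinct_count_atmost_1)
    then show ?thesis by (simp add: full_def)
  qed
  have s: "iter_pdiff js \<psi> x = 0" if "x $ i \<ge> L + 1" for js x i
  proof (rule iter_pdiff_zero[of "{x. x $ i > L}"])
    show "open {x :: real^'n. x $ i > L}" by (intro open_Collect_less continuous_intros)
  qed (use that supp less_imp_le in auto)
  have "\<exists>M. \<forall>x\<in>shifted_orthant. norm (iter_pdiff full \<psi> x - expo_sum M x) \<le> e * rexpo unit_expo x"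
  proof (rule expo_sum_uniform_approx[where L = "L + 1"])
    show "continuous_on UNIV (iter_pdiff full \<psi>)" by (rule smooth_fun_continuous[OF smooth_fun_iter[OF \<psi>]])
  qed (use s e in auto)
  then obtain M0 where M0: "\<forall>x\<in>shifted_orthant. norm (iter_pdiff full \<psi> x - expo_sum M0 x) \<le> e * rexpo unit_expo x"
    by blast
  \<comment> \<open>Each derivative multiplies the coefficient of an exponential by -(1 + m_i),
    which is never zero. An exponential sum is therefore the full derivative of another one,
    obtained by dividing coefficients.\<close>
  define M where "M = map (\<lambda>(c, m). (c / (\<Prod>i\<leftarrow>full. - complex_of_real (1 + real (m i))), m)) M0"
  have "(\<Prod>i\<leftarrow>js. - complex_of_real (1 + real (m i))) \<noteq> 0" for js :: "'n list" and m
  proof (induction js)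
    case (Cons i js)
    have "1 + real (m i) > 0" by simp
    then have "complex_of_real (1 + real (m i)) \<noteq> 0" by (metis less_irrefl of_real_eq_0_iff)
    then show ?case
      using Cons by (simp only: list.map prod_list.Cons mult_eq_0_iff neg_equal_0_iff_equal) simp
  qed simp
  then have "map (\<lambda>(c, m). (c * (\<Prod>i\<leftarrow>full. - complex_of_real (1 + real (m i))), m)) M = M0"
    unfolding M_def by (simp add: o_def case_prod_unfold)
  then have iM: "iter_pdiff full (expo_sum M) = expo_sum M0" by (simp add: iter_pdiff_expo_sum)
  define h where "h = (\<lambda>x. \<psi> x - expo_sum M x)"
  have h: "smooth_fun h" unfolding h_def by (intro smooth_fun_diff \<psi> smooth_expo_sum)
  have ih: "iter_pdiff js h x = iter_pdiff js \<psi> x - iter_pdiff js (expo_sum M) x" for js x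
    unfolding h_def by (simp add: iter_pdiff_diff[OF \<psi> smooth_expo_sum])
  have lim: "((\<lambda>t. iter_pdiff js h (x + t *\<^sub>R axis i 1)) \<longlongrightarrow> 0) at_top" for js i x
  proof -
    have "\<forall>\<^sub>F t in at_top. t \<ge> L + 1 - x $ i" by (rule eventually_ge_at_top)
    then have "\<forall>\<^sub>F t in at_top. iter_pdiff js \<psi> (x + t *\<^sub>R axis i 1) = 0"
      by eventually_elim (rule s[where i = i], simp add: axis_def)
    then have "((\<lambda>t. iter_pdiff js \<psi> (x + t *\<^sub>R axis i 1)) \<longlongrightarrow> 0) at_top" by (rule tendsto_eventually)
    moreover have "((\<lambda>t. iter_pdiff js (expo_sum M) (x + t *\<^sub>R axis i 1)) \<longlongrightarrow> 0) at_top"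
      unfolding iter_pdiff_expo_sum by (rule expo_sum_line_tendsto)
    ultimately show ?thesis unfolding ih using tendsto_diff by fastforce
  qed
  have "norm (iter_pdiff is h x) \<le> e * rexpo unit_expo x" if l: "length is \<le> N" and x: "x \<in> shifted_orthant" for "is" x
  proof -
    have "mset is \<subseteq># mset full"
    proof (rule mset_subset_eqI)
      fix i
      have "count (mset is) i \<le> length is" by (metis count_le_size size_mset)
      then show "count (mset is) i \<le> count (mset full) i" using l cnt by simp
    qed
    then obtain R where "mset full = mset is + R" by (metis subset_mset.le_iff_add)
    moreover obtain js where "mset js = R" using ex_mset by blast
    ultimately have "mset full = mset (js @ is)" by simp
    then have eq: "iter_pdiff (js @ is) h = iter_pdiff full h" using iter_pdiff_perm[OF h] by metis
    show ?thesis
      by (rule iterated_integrate_from_infinity_bound[OF h lim _ x, of js]) (use M0 in \<open>simp add: eq ih iM\<close>)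
  qed
  then show ?thesis unfolding h_def by blast
qed

section \<open>Truncation at infinity and the vanishing criterion\<close>

lemma tail_cutoff_eq_1: "(\<And>i. x $ i \<le> L) \<Longrightarrow> tail_cutoff L x = 1"
  unfolding tail_cutoff_def coord_fun_def by (intro prod.neutral) (simp add: step_1)

lemma tail_cutoff_eq_0: "x $ i \<ge> L + 1 \<Longrightarrow> tail_cutoff L x = 0"
  unfolding tail_cutoff_def coord_fun_def by (rule prod_zero) (auto intro!: exI[of _ i] simp: step_0)

lemma poly_growth_tail_cutoff: "poly_growth (tail_cutoff L)"
  by (rule tail_cutoff_bounded_derivs) (rule bounded_derivs_poly_growth)

lemma bounded_derivs_nonneg:
  fixes f :: "real^'n::finite \<Rightarrow> complex"
  assumes "bounded_derivs f B" shows "0 \<le> B m"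
proof -
  have "norm (iter_pdiff (replicate m undefined) f 0) \<le> B (length (replicate m (undefined :: 'n)))"
    using assms unfolding bounded_derivs_def by blast
  then show ?thesis by (simp add: order_trans[OF norm_ge_zero])
qed

lemma bounded_derivs_le:
  fixes f :: "real^'n::finite \<Rightarrow> complex"
  assumes "bounded_derivs f B" "length is \<le> N" shows "norm (iter_pdiff is f x) \<le> (\<Sum>j\<le>N. B j)"
proof -
  have "norm (iter_pdiff is f x) \<le> B (length is)" using assms by (auto simp: bounded_derivs_def)
  also have "\<dots> \<le> (\<Sum>j\<le>N. B j)"
    using assms bounded_derivs_nonneg[OF assms(1)] by (intro member_le_sum) auto
  finally show ?thesis .
qed

lemma schwartz_uniform:
  fixes f :: "real^'n::finite \<Rightarrow> complex"
  assumes "schwartz f"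
  obtains B where "B \<ge> 0" "\<And>is x. length is \<le> N \<Longrightarrow> (1 + norm x) ^ m * norm (iter_pdiff is f x) \<le> B"
proof -
  have "\<forall>is. \<exists>B. \<forall>x. (1 + norm x) ^ m * norm (iter_pdiff is f x) \<le> B"
    using assms unfolding schwartz_def by blast
  from choice[OF this] obtain B where B: "\<And>is x. (1 + norm x) ^ m * norm (iter_pdiff is f x) \<le> B is" by blast
  define S where "S = {is :: 'n list. length is \<le> N}"
  have fin: "finite S" unfolding S_def using finite_lists_length_le[of "UNIV :: 'n set" N] by simp
  have "(1 + norm x) ^ m * norm (iter_pdiff is f x) \<le> (\<Sum>is\<in>S. \<bar>B is\<bar>)" if "length is \<le> N" for "is" x
  proof -
    have "is \<in> S" using that by (simp add: S_def)
    then have "\<bar>B is\<bar> \<le> (\<Sum>is\<in>S. \<bar>B is\<bar>)" using fin by (intro member_le_sum) auto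
    moreover have "(1 + norm x) ^ m * norm (iter_pdiff is f x) \<le> B is" by (rule B)
    ultimately show ?thesis by linarith
  qed
  then show ?thesis by (intro that[of "\<Sum>is\<in>S. \<bar>B is\<bar>"] sum_nonneg) auto
qed

text \<open>The truncation changes f only where some coordinate is at least L, hence where the norm
  is at least L. One spare power of 1 + |x| in the decay of f makes the change small there, and the
  derivative bounds of the truncation do not depend on L, so L can be chosen last.\<close>

lemma tail_truncation:
  fixes f :: "real^'n::finite \<Rightarrow> complex"
  assumes f: "schwartz f" and e: "e > 0"
  shows "\<exists>L. seminorm_le N (\<lambda>x. f x - tail_cutoff L x * f x) e"
proof -
  obtain B where B: "\<And>L. bounded_derivs (tail_cutoff L :: real^'n \<Rightarrow> complex) B" by (rule tail_cutoff_bounded_derivs) (rule that)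
  obtain F where F: "F \<ge> 0" "\<And>is x. length is \<le> N \<Longrightarrow> (1 + norm x) ^ Suc N * norm (iter_pdiff is f x) \<le> F"
    using schwartz_uniform[OF f, of N "Suc N"] by blast
  define S where "S = (\<Sum>j\<le>N. B j)"
  have S0: "S \<ge> 0" unfolding S_def using bounded_derivs_nonneg[OF B[of 0]] by (intro sum_nonneg)
  define K where "K = 2 ^ N * (1 + S) * F"
  have K0: "K \<ge> 0" using S0 F by (simp add: K_def)
  \<comment> \<open>This makes the final error K / (1 + L) at most e.\<close>
  define L where "L = K / e"
  have L0: "L \<ge> 0" using K0 e by (simp add: L_def)
  let ?h = "\<lambda>x :: real^'n. 1 - tail_cutoff L x"
  have smt: "smooth_fun (tail_cutoff L :: real^'n \<Rightarrow> complex)" by (rule dominated_smooth[OF poly_growth_tail_cutoff])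
  have smh: "smooth_fun ?h" by (intro smooth_fun_diff smooth_fun_const smt)
  have eq: "(\<lambda>x. f x - tail_cutoff L x * f x) = (\<lambda>x. ?h x * f x)" by (simp add: fun_eq_iff algebra_simps)
  have hb: "norm (iter_pdiff js ?h x) \<le> 1 + S" if "length js \<le> N" for js x
  proof -
    have "norm (iter_pdiff js ?h x) \<le> norm (iter_pdiff js (\<lambda>x :: real^'n. 1) x) + norm (iter_pdiff js (tail_cutoff L) x)"
      unfolding iter_pdiff_diff[OF smooth_fun_const smt] by (rule norm_triangle_ineq4)
    also have "\<dots> \<le> 1 + S"
      using bounded_derivs_le[OF B that] unfolding S_def by (intro add_mono) (auto simp: iter_pdiff_const)
    finally show ?thesis .
  qed
  have "(1 + norm x) ^ N * norm (iter_pdiff is (\<lambda>x. ?h x * f x) x) \<le> e" if l: "length is \<le> N" for "is" x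
  proof (cases "\<forall>i. x $ i < L")
    case True
    have "iter_pdiff is (\<lambda>x. ?h x * f x) x = 0"
    proof (rule iter_pdiff_zero[of "{x. \<forall>i. x $ i < L}"])
      have "{x :: real^'n. \<forall>i. x $ i < L} = (\<Inter>i. {x. x $ i < L})" by auto
      then show "open {x :: real^'n. \<forall>i. x $ i < L}"
        by (simp only:) (intro open_INT ballI open_Collect_less continuous_intros, auto)
    qed (use True in \<open>auto simp: tail_cutoff_eq_1 less_imp_le\<close>)
    then show ?thesis using e by simp
  next
    case False
    then obtain i where "x $ i \<ge> L" by (auto simp: not_less)
    then have nx: "norm x \<ge> L" using component_le_norm_cart[of x i] by linarith
    have p: "1 + norm x > 0" using norm_ge_zero[of x] by linarith
    have fb: "norm (iter_pdiff js f x) \<le> F / (1 + norm x) ^ Suc N" if "length js \<le> length is" for js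
      using F(2)[of js x] that l p
      by (subst pos_le_divide_eq) (auto simp: mult.commute simp del: power_Suc)
    have "norm (iter_pdiff is (\<lambda>x. ?h x * f x) x) \<le> 2 ^ length is * (1 + S) * (F / (1 + norm x) ^ Suc N)"
      using l by (intro iter_pdiff_mult_bound smh schwartz_smooth[OF f] hb fb) auto
    also have "\<dots> \<le> 2 ^ N * (1 + S) * (F / (1 + norm x) ^ Suc N)"
      using l S0 F(1) p by (intro mult_right_mono power_increasing divide_nonneg_pos zero_less_power) auto
    also have "\<dots> = K / (1 + norm x) ^ Suc N" by (simp add: K_def)
    finally have "(1 + norm x) ^ N * norm (iter_pdiff is (\<lambda>x. ?h x * f x) x) \<le> (1 + norm x) ^ N * (K / (1 + norm x) ^ Suc N)"
      using p by (intro mult_left_mono) auto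
    also have "\<dots> = K / (1 + norm x)" using p by simp
    also have "\<dots> \<le> K / (1 + L)" using nx L0 K0 by (intro divide_left_mono) auto
    also have "\<dots> \<le> e" using L0 K0 e by (simp add: L_def field_simps)
    finally show ?thesis .
  qed
  then show ?thesis unfolding seminorm_le_def by (intro exI[of _ L]) (simp add: eq)
qed

lemma seminorm_le_add:
  assumes "seminorm_le N f a" "seminorm_le N g b" "smooth_fun f" "smooth_fun g"
  shows "seminorm_le N (\<lambda>x. f x + g x) (a + b)"
  unfolding seminorm_le_def
proof (intro allI impI)
  fix "is" :: "'a list" and x assume l: "length is \<le> N"
  have "(1 + norm x) ^ N * norm (iter_pdiff is (\<lambda>x. f x + g x) x) \<le>
     (1 + norm x) ^ N * (norm (iter_pdiff is f x) + norm (iter_pdiff is g x))"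
    unfolding iter_pdiff_add[OF assms(3,4)] by (intro mult_left_mono norm_triangle_ineq) auto
  also have "\<dots> \<le> a + b" using assms(1,2) l unfolding seminorm_le_def distrib_left by (intro add_mono) auto
  finally show "(1 + norm x) ^ N * norm (iter_pdiff is (\<lambda>x. f x + g x) x) \<le> a + b" .
qed

text \<open>Negative directions are handled by the cutoff and large positive ones by tail
  truncation. On the shifted orthant the truncated function is approximated by exponential sums
  relative to exp(-\<Sum> x_i), which absorbs the polynomial weight of the seminorm.\<close>

theorem cts_functional_zero:
  fixes u :: "(real^'n::finite \<Rightarrow> complex) \<Rightarrow> complex"
  assumes u: "cts_functional u"
    and supp: "\<And>\<phi>. schwartz \<phi> \<Longrightarrow> u (\<lambda>x. cutoff x * \<phi> x) = u \<phi>"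
    and ann: "\<And>a. u (\<lambda>x. cutoff x * (mono_fun a x * expo (\<lambda>_. 1) x)) = 0"
    and \<phi>: "schwartz \<phi>"
  shows "u \<phi> = 0"
proof -
  have sc: "schwartz (\<lambda>x. cutoff x * \<phi> x)" by (rule schwartz_mult[OF poly_growth_cutoff \<phi>])
  have ce: "u (\<lambda>x. cutoff x * expo (\<lambda>i. 1 + real (m i)) x) = 0" for m
    \<comment> \<open>4 m_i quarter steps raise the exponent from 1 to 1 + m_i; the monomial with
      all exponents 0 is the constant 1.\<close>
    using annihilates_expo[OF u ann, of "\<lambda>_. 0" "\<lambda>i. 4 * m i"] by (simp add: mono_fun_def)
  have sce: "schwartz (\<lambda>x. cutoff x * expo (\<lambda>i. 1 + real (m i)) x)" for m :: "'n \<Rightarrow> nat"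
    using schwartz_cutoff_expo[of "\<lambda>i. 1 + real (m i)" "\<lambda>_. 1"] poly_growth_const[of 1] by (simp add: add_pos_nonneg)
  have ces: "schwartz (\<lambda>x. cutoff x * expo_sum M x) \<and> u (\<lambda>x. cutoff x * expo_sum M x) = 0" for M
  proof (induction M)
    case Nil
    then show ?case using schwartz_0 cts_functional_cmult[OF u schwartz_0, of 0] by (simp add: expo_sum_Nil)
  next
    case (Cons p M)
    obtain c m where p: "p = (c, m)" by force
    have eq: "(\<lambda>x. cutoff x * expo_sum (p # M) x) = (\<lambda>x. c * (cutoff x * expo (\<lambda>i. 1 + real (m i)) x) + cutoff x * expo_sum M x)"
      by (simp add: p expo_sum_Cons fun_eq_iff algebra_simps)
    have "u (\<lambda>x. c * (cutoff x * expo (\<lambda>i. 1 + real (m i)) x) + cutoff x * expo_sum M x) = 0"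
      using Cons by (simp only: cts_functional_add[OF u schwartz_cmult[OF sce]] cts_functional_cmult[OF u sce] ce) simp
    then show ?case unfolding eq using Cons by (auto intro!: schwartz_add schwartz_cmult sce)
  qed
  have "u (\<lambda>x. cutoff x * \<phi> x) = 0"
  proof (rule cts_functional_eq_0[OF u sc])
    fix N :: nat and e :: real assume e: "e > 0"
    then have e2: "e / 2 > 0" by simp
    obtain L where L: "seminorm_le N (\<lambda>x. cutoff x * \<phi> x - tail_cutoff L x * (cutoff x * \<phi> x)) (e / 2)"
      using tail_truncation[OF sc e2] by blast
    define \<psi> where "\<psi> = (\<lambda>x. tail_cutoff L x * \<phi> x)"
    have sm\<psi>: "smooth_fun \<psi>" unfolding \<psi>_def
      by (intro smooth_fun_mult schwartz_smooth[OF \<phi>] dominated_smooth[OF poly_growth_tail_cutoff])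
    obtain B where B: "bounded_derivs (cutoff :: real^'n \<Rightarrow> complex) B" by (rule cutoff_bounded_derivs)
    define S where "S = (\<Sum>j\<le>N. B j)"
    have S0: "S \<ge> 0" unfolding S_def using bounded_derivs_nonneg[OF B] by (intro sum_nonneg)
    obtain D where D: "\<forall>x\<in>shifted_orthant. (1 + norm x) ^ N * rexpo unit_expo (x :: real^'n) \<le> D"
      using poly_times_rexpo_bounded[of "unit_expo :: 'n \<Rightarrow> real" N] by auto
    \<comment> \<open>The Leibniz count, the bounds of the cutoff and the polynomial weight; the
      summand 1 makes division by K legitimate.\<close>
    define K where "K = 2 ^ N * S * max D 0 + 1"
    have K0: "K > 0" using S0 by (simp add: K_def add_nonneg_pos)
    have "e / 2 / K > 0" using e2 K0 by simp
    then obtain M where M: "\<And>is x. length is \<le> N \<Longrightarrow> x \<in> shifted_orthant \<Longrightarrow>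
        norm (iter_pdiff is (\<lambda>x. \<psi> x - expo_sum M x) x) \<le> e / 2 / K * rexpo unit_expo x"
      using expo_sum_approx[OF sm\<psi>, of "L + 1" "e / 2 / K" N] by (auto simp: \<psi>_def tail_cutoff_eq_0)
    have smd: "smooth_fun (\<lambda>x. \<psi> x - expo_sum M x)" by (intro smooth_fun_diff sm\<psi> smooth_expo_sum)
    have smc: "smooth_fun (cutoff :: real^'n \<Rightarrow> complex)" by (rule dominated_smooth[OF poly_growth_cutoff])
    have "seminorm_le N (\<lambda>x. cutoff x * (\<psi> x - expo_sum M x)) (e / 2)"
      unfolding seminorm_le_def
    proof (intro allI impI)
      fix "is" :: "'n list" and x assume l: "length is \<le> N"
      show "(1 + norm x) ^ N * norm (iter_pdiff is (\<lambda>x. cutoff x * (\<psi> x - expo_sum M x)) x) \<le> e / 2"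
      proof (cases "x \<in> shifted_orthant")
        case False
        then show ?thesis using iter_pdiff_cutoff_outside[OF False] e by simp
      next
        case True
        have "norm (iter_pdiff is (\<lambda>x. cutoff x * (\<psi> x - expo_sum M x)) x) \<le> 2 ^ length is * S * (e / 2 / K * rexpo unit_expo x)"
          unfolding S_def using l by (intro iter_pdiff_mult_bound smc smd M True bounded_derivs_le[OF B]) auto
        also have "\<dots> \<le> 2 ^ N * S * (e / 2 / K * rexpo unit_expo x)"
          using l S0 e K0 by (intro mult_right_mono power_increasing mult_nonneg_nonneg) auto
        finally have "(1 + norm x) ^ N * norm (iter_pdiff is (\<lambda>x. cutoff x * (\<psi> x - expo_sum M x)) x) \<le>
          (1 + norm x) ^ N * (2 ^ N * S * (e / 2 / K * rexpo unit_expo x))" by (intro mult_left_mono) auto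
        also have "\<dots> = (2 ^ N * S * (e / 2 / K)) * ((1 + norm x) ^ N * rexpo unit_expo x)" by (simp add: mult_ac)
        also have "\<dots> \<le> (2 ^ N * S * (e / 2 / K)) * max D 0"
          using D True S0 e K0 by (intro mult_left_mono) (auto simp: le_max_iff_disj)
        also have "\<dots> = e / 2 * ((2 ^ N * S * max D 0) / K)" by simp
        also have "\<dots> \<le> e / 2 * 1" using e K0 by (intro mult_left_mono) (auto simp: K_def)
        finally show ?thesis by simp
      qed
    qed
    moreover have "smooth_fun (\<lambda>x. cutoff x * \<phi> x - tail_cutoff L x * (cutoff x * \<phi> x))" "smooth_fun (\<lambda>x. cutoff x * (\<psi> x - expo_sum M x))"
      by (intro smooth_fun_diff smooth_fun_mult smc smd schwartz_smooth[OF \<phi>] dominated_smooth[OF poly_growth_tail_cutoff] sm\<psi> smooth_expo_sum)+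
    ultimately have "seminorm_le N (\<lambda>x. (cutoff x * \<phi> x - tail_cutoff L x * (cutoff x * \<phi> x)) + cutoff x * (\<psi> x - expo_sum M x)) (e / 2 + e / 2)"
      by (rule seminorm_le_add[OF L])
    also have "(\<lambda>x. (cutoff x * \<phi> x - tail_cutoff L x * (cutoff x * \<phi> x)) + cutoff x * (\<psi> x - expo_sum M x)) =
       (\<lambda>x. cutoff x * \<phi> x - cutoff x * expo_sum M x)"
      by (simp add: fun_eq_iff \<psi>_def algebra_simps)
    finally have "seminorm_le N (\<lambda>x. cutoff x * \<phi> x - cutoff x * expo_sum M x) e" by simp
    then show "\<exists>g. schwartz g \<and> u g = 0 \<and> seminorm_le N (\<lambda>x. cutoff x * \<phi> x - g x) e"
      using ces[of M] by blast
  qed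
  then show ?thesis using supp[OF \<phi>] by simp
qed

subsection \<open>Riesz distributions\<close>

lemma borel_measurable_embed_vec [measurable]:
  fixes A :: "'n::finite set"
  shows "embed_vec A \<in> borel_measurable (leb_Pi A)"
proof -
  have "(\<lambda>y. embed_vec A y \<bullet> b) \<in> borel_measurable (leb_Pi A)" if b': "b \<in> Basis" for b :: "(real, 'n) vec"
  proof -
    obtain i where b: "b = axis i 1" using b' unfolding Basis_vec_def Basis_real_def by blast
    show ?thesis
      by (cases "i \<in> A") (auto simp: b inner_axis embed_vec_def intro: measurable_leb_Pi_component)
  qed
  then show ?thesis by (subst borel_measurable_euclidean_space) blast
qed

text \<open>The Riesz integral runs over vectors, the lower-dimensional one over functions on an
  index set. This identification lets both be instances of one integral.\<close>

lemma lborel_eq_leb_Pi: "lborel = distr (leb_Pi (UNIV :: 'n::finite set)) borel (embed_vec UNIV)"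
proof (rule lborel_eqI)
  fix l u :: "(real, 'n) vec" assume lu: "\<And>b. b \<in> Basis \<Longrightarrow> l \<bullet> b \<le> u \<bullet> b"
  have le: "l $ i \<le> u $ i" for i using lu[of "axis i 1"] by (simp add: inner_axis axis_in_Basis_iff)
  have "emeasure (distr (leb_Pi UNIV) borel (embed_vec UNIV)) (box l u) =
      emeasure (leb_Pi UNIV) (embed_vec UNIV -` box l u \<inter> space (leb_Pi UNIV))"
    by (rule emeasure_distr) auto
  also have "embed_vec UNIV -` box l u \<inter> space (leb_Pi UNIV) = Pi\<^sub>E UNIV (\<lambda>i. {l $ i<..<u $ i})"
    by (auto simp: space_PiM embed_vec_def mem_box_cart PiE_def Pi_iff)
  also have "emeasure (leb_Pi UNIV) \<dots> = (\<Prod>i\<in>UNIV. ennreal (max 0 (u $ i - l $ i)))"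
    by (rule emeasure_leb_Pi_box) simp
  also have "\<dots> = (\<Prod>i\<in>UNIV. ennreal (u $ i - l $ i))" using le by (intro prod.cong refl) (simp add: max_def)
  also have "\<dots> = ennreal (\<Prod>i\<in>UNIV. u $ i - l $ i)" using le by (intro prod_ennreal) simp
  also have "(\<Prod>i\<in>UNIV. u $ i - l $ i) = (\<Prod>b\<in>Basis. (u - l) \<bullet> b)"
  proof -
    have B: "(Basis :: ((real, 'n) vec) set) = (\<lambda>i. axis i 1) ` UNIV" by (auto simp: Basis_vec_def)
    have "inj (\<lambda>i :: 'n. axis i (1::real))" by (auto simp: inj_on_def axis_eq_axis)
    then show ?thesis unfolding B by (subst prod.reindex) (auto simp: inner_axis)
  qed
  finally show "emeasure (distr (leb_Pi UNIV) borel (embed_vec UNIV)) (box l u) = ennreal (\<Prod>b\<in>Basis. (u - l) \<bullet> b)" .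
qed simp

definition rdens :: "real \<Rightarrow> real \<Rightarrow> ('i::linorder) set \<Rightarrow> ('i \<Rightarrow> real) \<Rightarrow> real" where
  "rdens k s A y = (if pos_on A y then D_on A y powr (s - 1) * omega_on k A y else 0)"

lemma measurable_rdens [measurable]: "finite A \<Longrightarrow> rdens k s A \<in> borel_measurable (leb_Pi A)"
  unfolding rdens_def[abs_def] by measurable

lemma rdens_nonneg: "0 \<le> rdens k s A y"
  by (simp add: rdens_def omega_on_nonneg)

text \<open>Both the Riesz integral and the measure \<open>R' \<otimes> \<delta>\<^sub>0\<close> of the theorem are instances of this
  normalised integral over an index set \<open>A\<close>, with exponent \<open>s = \<mu> - k (|A| - 1)\<close>.\<close>
definition rint :: "real \<Rightarrow> real \<Rightarrow> 'n set \<Rightarrow> (real^'n::{finite,linorder} \<Rightarrow> complex) \<Rightarrow> complex" where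
  "rint k s A \<phi> = 1 / complex_of_real (d_const (card A) k * sel_G k (card A) s) *
     (\<integral>y. \<phi> (embed_vec A y) * complex_of_real (rdens k s A y) \<partial>leb_Pi A)"

text \<open>Reversing the product: at mu = s + k (m - 1) the factor of index j has argument s + k (m
  - j).\<close>

lemma Gamma_m_eq_sel_G:
  "Gamma_m m (complex_of_real (s + k * (real m - 1))) k = complex_of_real (sel_G k m s)"
proof -
  have "Gamma_m m (complex_of_real (s + k * (real m - 1))) k = (\<Prod>j=1..m. complex_of_real (Gamma (s + k * (real m - real j))))"
    unfolding Gamma_m_def
    by (intro prod.cong refl) (simp add: Gamma_complex_of_real[symmetric] algebra_simps del: Gamma_complex_of_real)
  also have "\<dots> = (\<Prod>i<m. complex_of_real (Gamma (s + k * real i)))"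
    by (rule prod.reindex_bij_witness[of _ "\<lambda>i. m - i" "\<lambda>j. m - j"]) (auto simp: of_nat_diff)
  finally show ?thesis by (simp add: sel_G_def)
qed

lemma riesz_int_eq_rint:
  fixes \<phi> :: "real^'n::{finite,linorder} \<Rightarrow> complex"
  assumes \<phi>: "\<phi> \<in> borel_measurable borel" and s: "s > 0"
  shows "riesz_int k (complex_of_real (s + k * (real CARD('n) - 1))) \<phi> = rint k s UNIV \<phi>"
proof -
  let ?f = "\<lambda>x :: (real, 'n) vec. indicator {x. \<forall>i. 0 < x $ i} x *\<^sub>R (\<phi> x * complex_of_real (D_on UNIV (vec_nth x)) powr
     (complex_of_real (s + k * (real CARD('n) - 1)) - complex_of_real (k * (real CARD('n) - 1)) - 1) * complex_of_real (omega_on k UNIV (vec_nth x)))"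
  let ?g = "\<lambda>x :: (real, 'n) vec. \<phi> x * complex_of_real (if \<forall>i. 0 < x $ i then D_on UNIV (vec_nth x) powr (s - 1) * omega_on k UNIV (vec_nth x) else 0)"
  have exponent: "complex_of_real (s + k * (real CARD('n) - 1)) - complex_of_real (k * (real CARD('n) - 1)) - 1 = complex_of_real (s - 1)"
    by simp
  have fg: "?f x = ?g x" for x
  proof (cases "\<forall>i. 0 < x $ i")
    case True
    then have "D_on UNIV (vec_nth x) > 0" by (intro D_on_pos) (simp add: pos_on_def)
    then have "complex_of_real (D_on UNIV (vec_nth x)) powr complex_of_real (s - 1) = complex_of_real (D_on UNIV (vec_nth x) powr (s - 1))"
      by (intro powr_of_real) auto
    then show ?thesis using True unfolding exponent by simp
  qed auto
  have comp: "(\<lambda>x :: (real, 'n) vec. x $ i) \<in> borel_measurable borel" for i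
    by (intro borel_measurable_continuous_onI continuous_intros)
  have D: "(\<lambda>x :: (real, 'n) vec. D_on UNIV (vec_nth x)) \<in> borel_measurable borel"
    unfolding D_on_def using comp by measurable
  have om: "(\<lambda>x :: (real, 'n) vec. omega_on k UNIV (vec_nth x)) \<in> borel_measurable borel"
    unfolding omega_on_pairs using comp by measurable
  have P: "Measurable.pred borel (\<lambda>x :: (real, 'n) vec. \<forall>i. 0 < x $ i)" using comp by measurable
  have gm: "?g \<in> borel_measurable borel" using D om P \<phi> by measurable
  have ev: "vec_nth (embed_vec UNIV y) = y" for y :: "'n \<Rightarrow> real" by (simp add: embed_vec_def fun_eq_iff)
  have "(\<integral>x. ?g x \<partial>lborel) = (\<integral>y. ?g (embed_vec UNIV y) \<partial>leb_Pi UNIV)"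
    by (subst lborel_eq_leb_Pi, rule integral_distr) (use gm in auto)
  also have "\<dots> = (\<integral>y. \<phi> (embed_vec UNIV y) * complex_of_real (rdens k s UNIV y) \<partial>leb_Pi UNIV)"
    by (intro Bochner_Integration.integral_cong refl) (simp add: ev rdens_def pos_on_def)
  finally show ?thesis
    unfolding riesz_int_def set_lebesgue_integral_def rint_def fg Gamma_m_eq_sel_G by simp
qed

lemma Rprime_delta_eq_rint:
  fixes \<psi> :: "real^'n::{finite,linorder} \<Rightarrow> complex"
  assumes card: "card (first_idx r :: 'n set) = r"
  shows "Rprime_delta k r \<psi> = rint k (k * real CARD('n) - k * (real r - 1)) (first_idx r) \<psi>"
proof -
  define s where "s = k * real CARD('n) - k * (real r - 1)"
  have e: "k * real CARD('n) = s + k * (real r - 1)" by (simp add: s_def)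
  show ?thesis
    unfolding Rprime_delta_def Let_def rint_def card set_lebesgue_integral_def s_def[symmetric]
    unfolding e Gamma_m_eq_sel_G
    by (auto intro!: arg_cong2[where f = "(*)"] Bochner_Integration.integral_cong
        simp: rdens_def pos_on_def indicator_def)
qed

text \<open>The rank, counting the smaller indices, is strictly increasing, hence a bijection onto
  the numbers below n; the set consists of the ranks below r.\<close>

lemma card_first_idx:
  assumes "r \<le> CARD('n::{finite,linorder})" shows "card (first_idx r :: 'n set) = r"
proof -
  define f where "f i = card {j :: 'n. j < i}" for i
  have lt: "f i < f j" if "i < j" for i j
    unfolding f_def using that by (intro psubset_card_mono) auto
  have inj: "inj f" by (rule linorder_injI) (use lt in \<open>auto dest: less_imp_neq\<close>)
  have "f i < CARD('n)" for i unfolding f_def by (intro psubset_card_mono) auto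
  then have "range f \<subseteq> {..<CARD('n)}" by auto
  moreover have "card (range f) = CARD('n)" using inj by (simp add: card_image)
  ultimately have range: "range f = {..<CARD('n)}" by (intro card_subset_eq) auto
  have "f ` (first_idx r :: 'n set) = {..<r}"
  proof (intro equalityI subsetI)
    fix m assume "m \<in> {..<r}"
    then have "m \<in> range f" using range assms by auto
    then show "m \<in> f ` (first_idx r :: 'n set)" using \<open>m \<in> {..<r}\<close> by (auto simp: first_idx_def f_def)
  qed (auto simp: first_idx_def f_def)
  then have "card (f ` (first_idx r :: 'n set)) = r" by simp
  then show ?thesis using inj by (simp add: card_image inj_on_subset)
qed

lemma mult_wt_le_norm:
  fixes A :: "'n::finite set"
  assumes "pos_on A y" shows "mult_wt A y \<le> (1 + norm (embed_vec A y)) ^ card A"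
proof -
  have "mult_wt A y \<le> (\<Prod>i\<in>A. 1 + norm (embed_vec A y))"
    unfolding mult_wt_def
  proof (intro prod_mono conjI)
    fix i assume i: "i \<in> A"
    have "y i > 0" using assms i by (simp add: pos_on_def)
    moreover have "y i \<le> norm (embed_vec A y)"
      using component_le_norm_cart[of "embed_vec A y" i] i by (simp add: embed_vec_def)
    ultimately show "0 \<le> 1 + y i" "1 + y i \<le> 1 + norm (embed_vec A y)" by auto
  qed
  then show ?thesis by simp
qed

text \<open>Formulated for measurable functions of a fixed decay order, so that one pair N, W yields
  continuity, integrability and later the local finiteness of the measure. N carries the factor |A|
  because \<open>mult_wt\<close> is compared with a power of 1 + |x|.\<close>

lemma rdens_integral_bound:
  fixes A :: "'n::{finite,linorder} set"
  assumes s: "s > 0" and k: "k > 0"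
  obtains N W where "W \<ge> 0"
    "\<forall>(\<phi> :: (real, 'n) vec \<Rightarrow> complex) B. \<phi> \<in> borel_measurable borel \<longrightarrow> (\<forall>x. (1 + norm x) ^ N * norm (\<phi> x) \<le> B) \<longrightarrow>
       integrable (leb_Pi A) (\<lambda>y. \<phi> (embed_vec A y) * complex_of_real (rdens k s A y)) \<and>
       norm (\<integral>y. \<phi> (embed_vec A y) * complex_of_real (rdens k s A y) \<partial>leb_Pi A) \<le> W * B"
proof -
  have A: "finite A" by simp
  define c where "c = s + 1 + 2 * k * card (pairs_on A)"
  have c0: "c \<ge> 0" using s k by (simp add: c_def)
  obtain m :: nat where m: "c \<le> real m" using real_arch_simple by blast
  define N where "N = card A * m"
  define w where "w y = (if pos_on A y then D_on A y powr (s - 1) * omega_on k A y * mult_wt A y powr (- c) else 0)" for y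
  have w0: "0 \<le> w y" for y by (simp add: w_def omega_on_nonneg)
  have [measurable]: "w \<in> borel_measurable (leb_Pi A)" unfolding w_def[abs_def] using A by measurable
  have "(\<integral>\<^sup>+y. ennreal (w y) \<partial>leb_Pi A) = (\<integral>\<^sup>+y. (if pos_on A y then ennreal (D_on A y powr (s - 1) * omega_on k A y * mult_wt A y powr (- c)) else 0) \<partial>leb_Pi A)"
    by (intro nn_integral_cong) (simp add: w_def)
  also have "\<dots> < \<infinity>" using nn_integral_base_finite[OF A s, of k c] k by (simp add: c_def)
  finally have wi: "integrable (leb_Pi A) w" by (intro integrableI_nonneg) (auto simp: w0)
  define W where "W = (\<integral>y. w y \<partial>leb_Pi A)"
  have W0: "W \<ge> 0" unfolding W_def using w0 by (intro integral_nonneg_AE) auto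
  show ?thesis
  proof (rule that[OF W0], intro allI impI)
    fix \<phi> :: "(real, 'n) vec \<Rightarrow> complex" and B
    assume \<phi>[measurable]: "\<phi> \<in> borel_measurable borel" and B: "\<forall>x. (1 + norm x) ^ N * norm (\<phi> x) \<le> B"
    have m\<phi>: "(\<lambda>y. \<phi> (embed_vec A y) * complex_of_real (rdens k s A y)) \<in> borel_measurable (leb_Pi A)"
      using A by measurable
    have bound: "norm (\<phi> (embed_vec A y) * complex_of_real (rdens k s A y)) \<le> B * w y" for y
    proof (cases "pos_on A y")
      case True
      let ?x = "embed_vec A y"
      have w1: "mult_wt A y \<ge> 1" by (rule mult_wt_ge1[OF True])
      have "mult_wt A y powr c \<le> mult_wt A y powr real m" using w1 m by (intro powr_mono) auto
      also have "\<dots> = mult_wt A y ^ m" using w1 by (simp add: powr_realpow)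
      also have "\<dots> \<le> ((1 + norm ?x) ^ card A) ^ m"
        using w1 mult_wt_le_norm[OF True] by (intro power_mono) auto
      also have "\<dots> = (1 + norm ?x) ^ N" by (simp add: N_def power_mult)
      finally have "mult_wt A y powr c * norm (\<phi> ?x) \<le> (1 + norm ?x) ^ N * norm (\<phi> ?x)"
        by (intro mult_right_mono) auto
      also have "\<dots> \<le> B" using B by blast
      finally have "norm (\<phi> ?x) \<le> B * mult_wt A y powr (- c)"
        using w1 by (simp add: powr_minus field_simps)
      then have "norm (\<phi> ?x) * rdens k s A y \<le> (B * mult_wt A y powr (- c)) * rdens k s A y"
        by (intro mult_right_mono rdens_nonneg)
      then show ?thesis using True by (simp add: norm_mult rdens_def w_def mult_ac omega_on_nonneg)
    qed (simp add: rdens_def w_def)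
    have int: "integrable (leb_Pi A) (\<lambda>y. \<phi> (embed_vec A y) * complex_of_real (rdens k s A y))"
    proof (rule Bochner_Integration.integrable_bound[OF integrable_mult_right[OF wi, of B] m\<phi>])
      show "AE y in leb_Pi A. norm (\<phi> (embed_vec A y) * complex_of_real (rdens k s A y)) \<le> norm (B * w y)"
        using bound by (auto intro: order_trans[OF _ abs_ge_self])
    qed
    have "norm (\<integral>y. \<phi> (embed_vec A y) * complex_of_real (rdens k s A y) \<partial>leb_Pi A) \<le> (\<integral>y. B * w y \<partial>leb_Pi A)"
      by (rule order_trans[OF integral_norm_bound integral_mono]) (use int wi bound in auto)
    also have "\<dots> = W * B" by (simp add: W_def)
    finally show "integrable (leb_Pi A) (\<lambda>y. \<phi> (embed_vec A y) * complex_of_real (rdens k s A y)) \<and>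
       norm (\<integral>y. \<phi> (embed_vec A y) * complex_of_real (rdens k s A y) \<partial>leb_Pi A) \<le> W * B" using int by simp
  qed
qed

lemma schwartz_measurable: "schwartz f \<Longrightarrow> f \<in> borel_measurable borel"
  by (intro borel_measurable_continuous_onI smooth_fun_continuous schwartz_smooth)

lemma schwartz_decay:
  assumes "schwartz f" shows "\<exists>B. \<forall>x. (1 + norm x) ^ m * norm (f x) \<le> B"
  using assms unfolding schwartz_def by (metis iter_pdiff_Nil)

lemma integral_lag_complex:
  assumes A: "finite A" and q: "q \<in> borel_measurable (leb_Pi A)"
  shows "(\<integral>y. complex_of_real (q y * exp (- (\<Sum>i\<in>A. y i)) * rdens k s A y) \<partial>leb_Pi A) = complex_of_real (\<integral>y. q y \<partial>lag k s A)"
proof -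
  have "(\<integral>y. q y \<partial>lag k s A) = (\<integral>y. lag_dens k s A y * q y \<partial>leb_Pi A)"
    unfolding lag_def by (subst integral_density) (use A q in \<open>auto simp: lag_dens_nonneg\<close>)
  also have "\<dots> = (\<integral>y. q y * exp (- (\<Sum>i\<in>A. y i)) * rdens k s A y \<partial>leb_Pi A)"
    by (intro Bochner_Integration.integral_cong refl) (simp add: lag_dens_def rdens_def)
  finally show ?thesis by (simp only: integral_complex_of_real)
qed

text \<open>By Selberg's formula the normalising constant of \<open>rint\<close> equals the total
  mass of the Laguerre weight. On functions containing exp(-\<Sum> x_i) the integral is therefore an
  expectation in the ensemble.\<close>

lemma rint_cutoff_expo:
  fixes A :: "'n::{finite,linorder} set"
  assumes s: "s > 0" and k: "k > 0" and q: "q \<in> borel_measurable (leb_Pi A)"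
    and g: "\<And>y. pos_on A y \<Longrightarrow> g (embed_vec A y) = complex_of_real (q y)"
  shows "rint k s A (\<lambda>x. cutoff x * (g x * expo (\<lambda>_. 1) x)) = complex_of_real ((\<integral>y. q y \<partial>lag k s A) / lag_Z k s A)"
proof -
  have A: "finite A" by simp
  have "(\<integral>y. cutoff (embed_vec A y) * (g (embed_vec A y) * expo (\<lambda>_. 1) (embed_vec A y)) * complex_of_real (rdens k s A y) \<partial>leb_Pi A) =
    (\<integral>y. complex_of_real (q y * exp (- (\<Sum>i\<in>A. y i)) * rdens k s A y) \<partial>leb_Pi A)"
  proof (rule Bochner_Integration.integral_cong[OF refl])
    fix y
    show "cutoff (embed_vec A y) * (g (embed_vec A y) * expo (\<lambda>_. 1) (embed_vec A y)) * complex_of_real (rdens k s A y) =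
      complex_of_real (q y * exp (- (\<Sum>i\<in>A. y i)) * rdens k s A y)"
    proof (cases "pos_on A y")
      case True
      have "cutoff (embed_vec A y) = 1" using True by (intro cutoff_eq_1) (auto simp: embed_vec_def pos_on_def less_imp_le)
      moreover have "(\<Sum>i\<in>UNIV. embed_vec A y $ i) = (\<Sum>i\<in>A. y i)"
        by (simp add: embed_vec_def sum.If_cases)
      ultimately show ?thesis using g[OF True] by (simp add: expo_eq_rexpo rexpo_def)
    qed (simp add: rdens_def)
  qed
  also have "\<dots> = complex_of_real (\<integral>y. q y \<partial>lag k s A)" by (rule integral_lag_complex[OF A q])
  finally show ?thesis unfolding rint_def selberg_laguerre[OF A s k] by simp
qed

section \<open>Duality of the loop equations\<close>

text \<open>\<open>H bs\<close> stands for the expectation of the product of the power sums with exponents \<open>bs\<close> in \<open>N\<close>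
  variables at parameter \<open>\<mu>\<close>.\<close>
definition loop_eqs :: "real \<Rightarrow> nat \<Rightarrow> complex \<Rightarrow> (nat list \<Rightarrow> complex) \<Rightarrow> bool" where
  "loop_eqs k N \<mu> H \<longleftrightarrow>
     (\<forall>a bs. H (Suc a # bs) = (\<mu> - of_real (k * (real N - 1)) + of_nat a) * H (a # bs)
        + of_real k * ((\<Sum>c\<le>a. H (c # (a - c) # bs)) - (of_nat a + 1) * H (a # bs))
        + (\<Sum>(c, l)\<leftarrow>shifts a bs. of_nat c * H l)) \<and>
     (\<forall>bs. H (0 # bs) = of_nat N * H bs) \<and> (\<forall>b bs. H (b # 0 # bs) = of_nat N * H (b # bs))"

text \<open>Written out for positive indices, the equations only involve \<open>\<mu> + k N\<close> and \<open>\<mu> k N\<close>, so they are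
  invariant under exchanging \<open>\<mu>\<close> with \<open>k N\<close>.\<close>
lemma loop_eqs_dual:
  assumes H: "loop_eqs k N (of_real (k * real N')) H" and H': "loop_eqs k N' (of_real (k * real N)) H'"
    and Nil: "H [] = H' []" and pos: "\<forall>b\<in>set bs. 0 < b"
  shows "H bs = H' bs"
  using pos
proof (induction "sum_list bs" arbitrary: bs rule: less_induct)
  case less
  show ?case
  proof (cases bs)
    case Nil
    then show ?thesis using assms(3) by simp
  next
    case (Cons b cs)
    then obtain a where b: "b = Suc a" using less.prems by (cases b) auto
    have cs: "\<forall>b\<in>set cs. 0 < b" using less.prems Cons by simp
    have IH: "H l = H' l" if "sum_list l \<le> a + sum_list cs" "\<forall>b\<in>set l. 0 < b" for l
      using less.hyps[of l] that by (simp add: Cons b)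
    have S: "(\<Sum>(c, l)\<leftarrow>shifts a cs. of_nat c * H l) = (\<Sum>(c, l)\<leftarrow>shifts a cs. of_nat c * H' l)"
    proof (rule arg_cong[where f = sum_list], rule map_cong[OF refl])
      fix p assume "p \<in> set (shifts a cs)"
      moreover obtain c l where p: "p = (c, l)" by (cases p)
      ultimately have mem: "(c, l) \<in> set (shifts a cs)" by simp
      have "H l = H' l" by (rule IH) (use shifts_sum_list[OF mem] shifts_pos[OF mem cs] in auto)
      then show "(case p of (c, l) \<Rightarrow> of_nat c * H l) = (case p of (c, l) \<Rightarrow> of_nat c * H' l)" by (simp add: p)
    qed
    \<comment> \<open>Once indices 0 are eliminated, the end terms c = 0 and c = a of the quadratic
      sum contribute 2 k M, so the coefficient becomes k M' + k M + a - k a. For a = 0 the two ends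
      coincide and everything collapses to k M M'. Both expressions are symmetric in M and
      M'.\<close>
    have exp: "G (Suc a # cs) = (if a = 0 then of_real (k * real M * real M') * G cs else
        (of_real (k * real M' + k * real M + real a - k * real a)) * G (a # cs)
        + of_real k * (\<Sum>c\<in>{1..<a}. G (c # (a - c) # cs))) + (\<Sum>(c, l)\<leftarrow>shifts a cs. of_nat c * G l)"
      if G: "loop_eqs k M (of_real (k * real M')) G" for G M M'
    proof -
      have g1: "G (Suc a # cs) = (of_real (k * real M') - of_real (k * (real M - 1)) + of_nat a) * G (a # cs)
        + of_real k * ((\<Sum>c\<le>a. G (c # (a - c) # cs)) - (of_nat a + 1) * G (a # cs))
        + (\<Sum>(c, l)\<leftarrow>shifts a cs. of_nat c * G l)"
        using G unfolding loop_eqs_def by blast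
      have g2: "G (0 # bs) = of_nat M * G bs" "G (b # 0 # bs) = of_nat M * G (b # bs)" for b bs
        using G unfolding loop_eqs_def by blast+
      show ?thesis
      proof (cases "a = 0")
        case True
        then show ?thesis unfolding g1 by (simp add: g2 algebra_simps)
      next
        case False
        have "{..a} = insert 0 (insert a {1..<a})" using False by auto
        then have "(\<Sum>c\<le>a. G (c # (a - c) # cs)) = 2 * of_nat M * G (a # cs) + (\<Sum>c\<in>{1..<a}. G (c # (a - c) # cs))"
          using False by (simp add: g2)
        then show ?thesis unfolding g1 using False by (simp add: algebra_simps)
      qed
    qed
    have T: "(\<Sum>c\<in>{1..<a}. H (c # (a - c) # cs)) = (\<Sum>c\<in>{1..<a}. H' (c # (a - c) # cs))"
      using cs by (intro sum.cong refl IH) auto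
    have 1: "H (a # cs) = H' (a # cs)" if "a \<noteq> 0" using that cs by (intro IH) auto
    have 2: "H cs = H' cs" using cs by (intro IH) auto
    show ?thesis unfolding Cons b exp[OF H] exp[OF H'] S T 2 using 1 by (simp add: algebra_simps)
  qed
qed

section \<open>Analytic continuation in the parameter\<close>

lemma entire_eq_0_of_real_ray:
  fixes f :: "complex \<Rightarrow> complex"
  assumes f: "f holomorphic_on UNIV" and zero: "\<And>x :: real. x > c \<Longrightarrow> f (of_real x) = 0"
  shows "f z = 0"
proof (rule analytic_continuation[OF f open_UNIV connected_UNIV subset_UNIV UNIV_I])
  show "complex_of_real (c + 1) islimpt complex_of_real ` {c<..}"
    unfolding islimpt_approachable
  proof (intro allI impI)
    fix e :: real assume e: "e > 0"
    show "\<exists>x'\<in>complex_of_real ` {c<..}. x' \<noteq> complex_of_real (c + 1) \<and> dist x' (complex_of_real (c + 1)) < e"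
    proof (rule bexI[of _ "complex_of_real (c + 1 + e / 2)"])
      have "complex_of_real (c + 1 + e / 2) = complex_of_real (c + 1) + complex_of_real (e / 2)" by simp
      then have "dist (complex_of_real (c + 1 + e / 2)) (complex_of_real (c + 1)) = \<bar>e / 2\<bar>"
        by (simp only: dist_norm add_diff_cancel_left' norm_of_real)
      then show "complex_of_real (c + 1 + e / 2) \<noteq> complex_of_real (c + 1) \<and> dist (complex_of_real (c + 1 + e / 2)) (complex_of_real (c + 1)) < e"
        using e by (auto simp del: of_real_add)
      show "complex_of_real (c + 1 + e / 2) \<in> complex_of_real ` {c<..}"
        using e by (intro imageI) simp
    qed
  qed
qed (use zero in auto)

lemma holomorphic_on_sum_list:
  "(\<And>p. p \<in> set L \<Longrightarrow> f p holomorphic_on S) \<Longrightarrow> (\<lambda>z. \<Sum>p\<leftarrow>L. f p z) holomorphic_on S"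
  by (induction L) (auto intro!: holomorphic_intros)

text \<open>The test functions on which the functional becomes a Laguerre expectation. The cutoff
  makes them Schwartz functions without changing them on the orthant.\<close>

definition lag_test :: "(real^'n::finite \<Rightarrow> complex) \<Rightarrow> real^'n \<Rightarrow> complex" where
  "lag_test g = (\<lambda>x. cutoff x * (g x * expo (\<lambda>_. 1) x))"

definition psums_fun :: "nat list \<Rightarrow> real^'n::finite \<Rightarrow> complex" where
  "psums_fun bs x = complex_of_real (psums UNIV bs (vec_nth x))"

lemma psums_fun_Nil: "psums_fun [] x = 1"
  by (simp add: psums_fun_def)

lemma psums_fun_Cons: "psums_fun (b # bs) x = (\<Sum>i\<in>UNIV. complex_of_real (x $ i) ^ b) * psums_fun bs x"
  by (simp add: psums_fun_def psum_def)

lemma poly_growth_psums_fun: "poly_growth (psums_fun bs)"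
proof (induction bs)
  case Nil
  then show ?case unfolding psums_fun_Nil[abs_def] by (rule poly_growth_const)
next
  case (Cons b bs)
  then show ?case unfolding psums_fun_Cons[abs_def]
    by (intro poly_growth_mult poly_growth_sum poly_growth_power poly_growth_coord)
qed

lemma schwartz_lag_test: "poly_growth g \<Longrightarrow> schwartz (lag_test g)"
  unfolding lag_test_def by (rule schwartz_cutoff_expo) auto

lemma lag_test_cmult: "lag_test (\<lambda>x. c * g x) = (\<lambda>x. c * lag_test g x)"
  by (simp add: lag_test_def fun_eq_iff mult_ac)

lemma lag_test_sum: "lag_test (\<lambda>x. \<Sum>i\<in>I. g i x) = (\<lambda>x. \<Sum>i\<in>I. lag_test (g i) x)"
  by (simp add: lag_test_def fun_eq_iff sum_distrib_left sum_distrib_right)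

context
  fixes k :: real and R :: "complex \<Rightarrow> (real^'n::{finite,linorder} \<Rightarrow> complex) \<Rightarrow> complex"
  assumes k: "k > 0" and fam: "is_riesz_family k R"
begin

lemma riesz_cts: "cts_functional (R \<mu>)"
  using fam by (intro tempered_cts_functional) (auto simp: is_riesz_family_def)

lemma riesz_holomorphic: "schwartz \<phi> \<Longrightarrow> (\<lambda>\<mu>. R \<mu> \<phi>) holomorphic_on UNIV"
  using fam by (auto simp: is_riesz_family_def)

lemma riesz_eq_rint:
  assumes "schwartz \<phi>" "s > 0"
  shows "R (of_real (s + k * (real CARD('n) - 1))) \<phi> = rint k s UNIV \<phi>"
proof -
  have "R (of_real (s + k * (real CARD('n) - 1))) \<phi> = riesz_int k (of_real (s + k * (real CARD('n) - 1))) \<phi>"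
    using fam assms unfolding is_riesz_family_def by (auto simp del: of_real_add)
  then show ?thesis using riesz_int_eq_rint[OF schwartz_measurable[OF assms(1)] assms(2)] by simp
qed

text \<open>Vanishing on a real ray suffices, so the complex powers in the Riesz integral never have
  to be evaluated at non-real exponents.\<close>

lemma riesz_continuation:
  assumes f: "f holomorphic_on UNIV"
    and eq: "\<And>s. s > 0 \<Longrightarrow> f (of_real (s + k * (real CARD('n) - 1))) = 0"
  shows "f z = 0"
proof (rule entire_eq_0_of_real_ray[OF f, where c = "k * (real CARD('n) - 1)"])
  fix x :: real assume "x > k * (real CARD('n) - 1)"
  then show "f (of_real x) = 0" using eq[of "x - k * (real CARD('n) - 1)"] by simp
qed

text \<open>Transfers properties visible on integrals, such as symmetry and insensitivity to values
  off the orthant, to parameters where no integral is at hand.\<close>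

lemma riesz_eq_continuation:
  assumes "schwartz \<phi>" "schwartz \<psi>" "\<And>s. s > 0 \<Longrightarrow> rint k s UNIV \<phi> = rint k s UNIV \<psi>"
  shows "R \<mu> \<phi> = R \<mu> \<psi>"
proof -
  have "(\<lambda>\<mu>. R \<mu> \<phi> - R \<mu> \<psi>) \<mu> = 0"
    by (rule riesz_continuation) (use assms in \<open>auto intro!: holomorphic_on_diff riesz_holomorphic simp: riesz_eq_rint simp del: of_real_add\<close>)
  then show ?thesis by simp
qed

lemma riesz_lag_test:
  assumes s: "s > 0"
  shows "R (of_real (s + k * (real CARD('n) - 1))) (lag_test (psums_fun bs)) =
     of_real (lag_setup.moment (UNIV :: 'n set) k s bs / lag_Z k s (UNIV :: 'n set))"
proof -
  interpret lag_setup "UNIV :: 'n set" k s by unfold_locales (use s k in auto)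
  have "R (of_real (s + k * (real CARD('n) - 1))) (lag_test (psums_fun bs)) = rint k s (UNIV :: 'n set) (lag_test (psums_fun bs))"
    using riesz_eq_rint[OF schwartz_lag_test[OF poly_growth_psums_fun[of bs]] s] .
  also have "\<dots> = of_real ((\<integral>y. psums UNIV bs y \<partial>lag k s (UNIV :: 'n set)) / lag_Z k s (UNIV :: 'n set))"
    unfolding lag_test_def
    by (rule rint_cutoff_expo[OF s k poly_bounded_measurable[OF poly_bounded_psums[OF finite]]])
       (auto simp: psums_fun_def embed_vec_def intro: psums_cong)
  finally show ?thesis unfolding moment_def .
qed

lemma lag_moment_loop_eqs:
  fixes A :: "'i::linorder set"
  assumes A: "finite A" and s: "s > 0"
  defines "H \<equiv> \<lambda>bs. complex_of_real (lag_setup.moment A k s bs / lag_Z k s A)"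
  shows "loop_eqs k (card A) (of_real (s + k * (real (card A) - 1))) H" "H [] = 1"
proof -
  interpret lag_setup A k s by unfold_locales (use A s k in auto)
  let ?Z = "lag_Z k s A"
  have Z: "?Z > 0" by (rule lag_Z_pos[OF A s k])
  have H: "H bs = of_real (moment bs / ?Z)" for bs by (simp add: H_def)
  have m0: "moment (0 # bs) = real (card A) * moment bs" "moment (b # 0 # bs) = real (card A) * moment (b # bs)" for b bs
    by (simp_all add: moment_def psum_def mult.left_commute)
  have sl: "(\<Sum>(c, l)\<leftarrow>L. of_nat c * H l) = of_real ((\<Sum>(c, l)\<leftarrow>L. real c * moment l) / ?Z)" for L
    by (induction L) (auto simp: H add_divide_distrib)
  show "loop_eqs k (card A) (of_real (s + k * (real (card A) - 1))) H"
    unfolding loop_eqs_def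
  proof (intro conjI allI)
    fix a bs
    have "H (Suc a # bs) = of_real (((s + real a) * moment (a # bs)
     + k * ((\<Sum>c\<le>a. moment (c # (a - c) # bs)) - (real a + 1) * moment (a # bs))
     + (\<Sum>(c, l)\<leftarrow>shifts a bs. real c * moment l)) / ?Z)"
      unfolding H moment_recursion ..
    also have "\<dots> = (of_real s + of_nat a) * H (a # bs)
        + of_real k * ((\<Sum>c\<le>a. H (c # (a - c) # bs)) - (of_nat a + 1) * H (a # bs))
        + (\<Sum>(c, l)\<leftarrow>shifts a bs. of_nat c * H l)"
      unfolding sl using Z by (simp add: H field_simps sum_divide_distrib[symmetric])
    finally show "H (Suc a # bs) = (of_real (s + k * (real (card A) - 1)) - of_real (k * (real (card A) - 1)) + of_nat a) * H (a # bs)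
        + of_real k * ((\<Sum>c\<le>a. H (c # (a - c) # bs)) - (of_nat a + 1) * H (a # bs))
        + (\<Sum>(c, l)\<leftarrow>shifts a bs. of_nat c * H l)" by simp
  qed (simp_all add: H m0)
  show "H [] = 1" using Z by (simp add: H moment_def lag_Z_def)
qed

text \<open>For fixed indices each equation says that an entire function of mu vanishes, and on the
  real ray of convergence it is an identity between Laguerre moments. The equations with an index 0
  hold by linearity at every mu.\<close>

lemma riesz_loop_eqs:
  "loop_eqs k CARD('n) \<mu> (\<lambda>bs. R \<mu> (lag_test (psums_fun bs)))" (is ?loop)
  and riesz_lag_test_Nil: "R \<mu> (lag_test (psums_fun [])) = 1" (is ?nil)
proof -
  define H where "H \<mu> bs = R \<mu> (lag_test (psums_fun bs))" for \<mu> bs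
  have real: "loop_eqs k CARD('n) (of_real (s + k * (real CARD('n) - 1))) (H (of_real (s + k * (real CARD('n) - 1))))"
    "H (of_real (s + k * (real CARD('n) - 1))) [] = 1" if "s > 0" for s
  proof -
    have eq: "H (of_real (s + k * (real CARD('n) - 1))) = (\<lambda>bs. of_real (lag_setup.moment (UNIV :: 'n set) k s bs / lag_Z k s (UNIV :: 'n set)))"
      unfolding H_def by (rule ext) (rule riesz_lag_test[OF that])
    show "loop_eqs k CARD('n) (of_real (s + k * (real CARD('n) - 1))) (H (of_real (s + k * (real CARD('n) - 1))))"
      "H (of_real (s + k * (real CARD('n) - 1))) [] = 1"
      unfolding eq using lag_moment_loop_eqs[OF finite that, of "UNIV :: 'n set"] by blast+
  qed
  have hol: "(\<lambda>\<mu>. H \<mu> bs) holomorphic_on UNIV" for bs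
    unfolding H_def by (rule riesz_holomorphic[OF schwartz_lag_test[OF poly_growth_psums_fun]])
  have "loop_eqs k CARD('n) \<mu> (H \<mu>)"
    unfolding loop_eqs_def
  proof (intro conjI allI)
    fix a bs
    define D where "D = (\<lambda>\<mu>. H \<mu> (Suc a # bs) - ((\<mu> - of_real (k * (real CARD('n) - 1)) + of_nat a) * H \<mu> (a # bs)
        + of_real k * ((\<Sum>c\<le>a. H \<mu> (c # (a - c) # bs)) - (of_nat a + 1) * H \<mu> (a # bs))
        + (\<Sum>p\<leftarrow>shifts a bs. of_nat (fst p) * H \<mu> (snd p))))"
    have "D \<mu> = 0"
    proof (rule riesz_continuation[where f = D])
      fix s :: real assume "s > 0"
      from real(1)[OF this] show "D (of_real (s + k * (real CARD('n) - 1))) = 0"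
        unfolding loop_eqs_def case_prod_unfold D_def right_minus_eq by blast
    qed (unfold D_def, intro holomorphic_intros holomorphic_on_sum_list hol)
    then show "H \<mu> (Suc a # bs) = (\<mu> - of_real (k * (real CARD('n) - 1)) + of_nat a) * H \<mu> (a # bs)
        + of_real k * ((\<Sum>c\<le>a. H \<mu> (c # (a - c) # bs)) - (of_nat a + 1) * H \<mu> (a # bs))
        + (\<Sum>(c, l)\<leftarrow>shifts a bs. of_nat c * H \<mu> l)"
      unfolding D_def case_prod_unfold right_minus_eq .
  next
    fix bs
    have "lag_test (psums_fun (0 # bs) :: (real, 'n) vec \<Rightarrow> complex) = (\<lambda>x. of_nat CARD('n) * lag_test (psums_fun bs) x)"
      unfolding lag_test_cmult[symmetric] psums_fun_Cons[abs_def] by simp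
    then show "H \<mu> (0 # bs) = of_nat CARD('n) * H \<mu> bs"
      unfolding H_def by (simp only: cts_functional_cmult[OF riesz_cts schwartz_lag_test[OF poly_growth_psums_fun]])
  next
    fix b bs
    have "lag_test (psums_fun (b # 0 # bs) :: (real, 'n) vec \<Rightarrow> complex) = (\<lambda>x. of_nat CARD('n) * lag_test (psums_fun (b # bs)) x)"
      unfolding lag_test_cmult[symmetric] psums_fun_Cons[abs_def] by (simp add: mult_ac)
    then show "H \<mu> (b # 0 # bs) = of_nat CARD('n) * H \<mu> (b # bs)"
      unfolding H_def by (simp only: cts_functional_cmult[OF riesz_cts schwartz_lag_test[OF poly_growth_psums_fun]])
  qed
  then show ?loop unfolding H_def .
  have "(\<lambda>\<mu>. H \<mu> [] - 1) \<mu> = 0"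
    by (rule riesz_continuation) (use real(2) in \<open>auto intro!: holomorphic_intros hol simp del: of_real_add\<close>)
  then show ?nil unfolding H_def by simp
qed

text \<open>The parameter s solves s + k (|A| - 1) = k n, which puts the ensemble on A at parameter
  k n, dual to n variables at k |A|. It is positive because |A| \<le> n.\<close>

lemma riesz_lag_test_eq_moment:
  fixes A :: "'n set"
  assumes A: "A \<noteq> {}" and pos: "\<forall>b\<in>set bs. 0 < b"
  defines "s \<equiv> k * real CARD('n) - k * (real (card A) - 1)"
  shows "s > 0" "R (of_real (k * real (card A))) (lag_test (psums_fun bs)) = of_real (lag_setup.moment A k s bs / lag_Z k s A)"
proof -
  have "card A \<le> CARD('n)" by (intro card_mono) auto
  then have "k * real (card A) \<le> k * real CARD('n)" using k by simp
  then show s: "s > 0" using k unfolding s_def right_diff_distrib by linarith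
  have e: "s + k * (real (card A) - 1) = k * real CARD('n)" by (simp add: s_def)
  show "R (of_real (k * real (card A))) (lag_test (psums_fun bs)) = of_real (lag_setup.moment A k s bs / lag_Z k s A)"
    by (rule loop_eqs_dual[OF riesz_loop_eqs lag_moment_loop_eqs(1)[where A = A, OF finite s, unfolded e] _ pos])
       (simp only: riesz_lag_test_Nil lag_moment_loop_eqs(2)[where A = A, OF finite s])
qed

end

section \<open>Symmetry under permutations of the coordinates\<close>

lemma perm_vec_nth: "perm_vec \<sigma> x $ j = x $ inv \<sigma> j"
  by (simp add: perm_vec_def)

lemma permutes_inv_bij: "\<sigma> permutes UNIV \<Longrightarrow> bij (inv \<sigma>)"
  using permutes_bij[OF permutes_inv] by blast

lemma perm_vec_sum: "\<sigma> permutes (UNIV :: 'n::finite set) \<Longrightarrow> (\<Sum>i\<in>UNIV. f (perm_vec \<sigma> x $ i)) = (\<Sum>i\<in>UNIV. f (x $ i))"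
  unfolding perm_vec_nth by (rule sum.reindex_bij_betw) (rule permutes_inv_bij)

lemma perm_vec_prod: "\<sigma> permutes (UNIV :: 'n::finite set) \<Longrightarrow> (\<Prod>i\<in>UNIV. f (perm_vec \<sigma> x $ i)) = (\<Prod>i\<in>UNIV. f (x $ i))"
  unfolding perm_vec_nth by (rule prod.reindex_bij_betw) (rule permutes_inv_bij)

lemma norm_perm_vec: "\<sigma> permutes UNIV \<Longrightarrow> norm (perm_vec \<sigma> x) = norm (x :: real^'n::finite)"
  unfolding norm_vec_def L2_set_def using perm_vec_sum[of \<sigma> "\<lambda>t. (norm t)\<^sup>2" x] by simp

lemma perm_vec_comp: "\<sigma> permutes UNIV \<Longrightarrow> \<tau> permutes UNIV \<Longrightarrow> perm_vec \<tau> (perm_vec \<sigma> x) = perm_vec (\<tau> \<circ> \<sigma>) x"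
  by (simp add: vec_eq_iff perm_vec_nth o_inv_distrib permutes_bij)

lemma continuous_on_perm_vec: "continuous_on S (perm_vec \<sigma> :: real^'n::finite \<Rightarrow> (real, 'n) vec)"
  unfolding perm_vec_def by (intro continuous_intros)

lemma borel_measurable_perm_vec [measurable]: "(perm_vec \<sigma> :: real^'n::finite \<Rightarrow> (real, 'n) vec) \<in> borel_measurable borel"
  by (rule borel_measurable_continuous_onI[OF continuous_on_perm_vec])

lemma cutoff_perm_vec: "\<sigma> permutes UNIV \<Longrightarrow> cutoff (perm_vec \<sigma> x) = cutoff (x :: real^'n::finite)"
  unfolding cutoff_def coord_fun_def by (rule perm_vec_prod)

lemma expo_perm_vec: "\<sigma> permutes UNIV \<Longrightarrow> expo (\<lambda>_. c) (perm_vec \<sigma> x) = expo (\<lambda>_. c) (x :: real^'n::finite)"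
  unfolding expo_def using perm_vec_sum[of \<sigma> "\<lambda>t. c * t" x] by simp

lemma psums_fun_perm_vec: "\<sigma> permutes UNIV \<Longrightarrow> psums_fun bs (perm_vec \<sigma> x) = psums_fun bs (x :: real^'n::finite)"
proof (induction bs)
  case (Cons b bs)
  then show ?case unfolding psums_fun_Cons using perm_vec_sum[of \<sigma> "\<lambda>t. complex_of_real t ^ b" x] by simp
qed (simp add: psums_fun_Nil)

lemma mono_fun_perm_vec: "\<sigma> permutes UNIV \<Longrightarrow> mono_fun a (perm_vec \<sigma> x) = mono_fun (a \<circ> \<sigma>) (x :: real^'n::finite)"
proof -
  assume \<sigma>: "\<sigma> permutes UNIV"
  have "(\<Prod>j\<in>UNIV. complex_of_real (x $ inv \<sigma> j) ^ a j) = (\<Prod>i\<in>UNIV. complex_of_real (x $ inv \<sigma> (\<sigma> i)) ^ a (\<sigma> i))"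
    by (rule prod.reindex_bij_betw[symmetric]) (rule permutes_bij[OF \<sigma>])
  then show ?thesis using \<sigma> by (simp add: mono_fun_def perm_vec_nth permutes_inverses)
qed

lemma lag_test_perm_vec:
  "\<sigma> permutes UNIV \<Longrightarrow> lag_test g (perm_vec \<sigma> x) = lag_test (\<lambda>x. g (perm_vec \<sigma> x)) (x :: real^'n::finite)"
  by (simp add: lag_test_def cutoff_perm_vec expo_perm_vec)

lemma leb_Pi_permute:
  fixes \<tau> :: "'n::finite \<Rightarrow> 'n"
  assumes \<tau>: "\<tau> permutes UNIV"
  shows "distr (leb_Pi UNIV) (leb_Pi UNIV) (\<lambda>y i. y (\<tau> i)) = leb_Pi UNIV"
proof (rule leb.PiM_eqI)
  have meas: "(\<lambda>y i. y (\<tau> i)) \<in> leb_Pi UNIV \<rightarrow>\<^sub>M leb_Pi UNIV"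
    using measurable_restrict[of UNIV "\<lambda>i y. y (\<tau> i)" "leb_Pi UNIV" "\<lambda>_. lborel"]
    by (simp add: measurable_leb_Pi_component restrict_UNIV)
  fix A :: "'n \<Rightarrow> real set" assume A: "\<And>i. i \<in> UNIV \<Longrightarrow> A i \<in> sets lborel"
  have "emeasure (distr (leb_Pi UNIV) (leb_Pi UNIV) (\<lambda>y i. y (\<tau> i))) (Pi\<^sub>E UNIV A) =
     emeasure (leb_Pi UNIV) ((\<lambda>y i. y (\<tau> i)) -` Pi\<^sub>E UNIV A \<inter> space (leb_Pi UNIV))"
    using A by (intro emeasure_distr meas sets_PiM_I_finite) auto
  also have "(\<lambda>y i. y (\<tau> i)) -` Pi\<^sub>E UNIV A \<inter> space (leb_Pi UNIV) = Pi\<^sub>E UNIV (\<lambda>i. A (inv \<tau> i))"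
  proof -
    have "(\<forall>i. y (\<tau> i) \<in> A i) \<longleftrightarrow> (\<forall>i. y i \<in> A (inv \<tau> i))" for y
      using permutes_inverses[OF \<tau>] by metis
    then show ?thesis by (simp add: set_eq_iff space_PiM PiE_def Pi_iff)
  qed
  also have "emeasure (leb_Pi UNIV) \<dots> = (\<Prod>i\<in>UNIV. emeasure lborel (A (inv \<tau> i)))"
    using A by (intro leb.emeasure_PiM) auto
  also have "\<dots> = (\<Prod>i\<in>UNIV. emeasure lborel (A i))"
    by (rule prod.reindex_bij_betw) (rule permutes_inv_bij[OF \<tau>])
  finally show "emeasure (distr (leb_Pi UNIV) (leb_Pi UNIV) (\<lambda>y i. y (\<tau> i))) (Pi\<^sub>E UNIV A) = (\<Prod>i\<in>UNIV. emeasure lborel (A i))" .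
qed simp_all

text \<open>Pairs are stored in increasing order, so a permuted pair may have to be turned around.
  The resulting map on pairs is injective, hence bijective on a finite set, and the factors do not
  notice the turning.\<close>

lemma omega_on_permute:
  fixes \<tau> :: "'n::{finite,linorder} \<Rightarrow> 'n"
  assumes \<tau>: "\<tau> permutes UNIV"
  shows "omega_on k UNIV (\<lambda>i. y (\<tau> i)) = omega_on k UNIV y"
proof -
  define f where "f i j = \<bar>y i - y j\<bar> powr (2 * k)" for i j
  have sym: "f i j = f j i" for i j by (simp add: f_def abs_minus_commute)
  define h where "h p = (if \<tau> (fst p) < \<tau> (snd p) then (\<tau> (fst p), \<tau> (snd p)) else (\<tau> (snd p), \<tau> (fst p)))" for p
  have inj: "\<tau> i = \<tau> j \<longleftrightarrow> i = j" for i j using permutes_inj[OF \<tau>] by (auto dest: injD)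
  have hinj: "inj_on h (pairs_on UNIV)"
    by (auto simp: inj_on_def h_def pairs_on_def inj split: if_splits)
  have "h ` pairs_on UNIV = pairs_on UNIV"
  proof (rule endo_inj_surj[OF _ _ hinj])
    show "h ` pairs_on UNIV \<subseteq> pairs_on UNIV"
    proof
      fix q assume "q \<in> h ` pairs_on UNIV"
      then obtain i j where ij: "i < j" "q = h (i, j)" by (auto simp: pairs_on_def)
      then have "\<tau> i \<noteq> \<tau> j" using inj by auto
      then show "q \<in> pairs_on UNIV" unfolding ij(2) by (auto simp: h_def pairs_on_def)
    qed
  qed simp
  then have "(\<Prod>p\<in>pairs_on UNIV. f (fst p) (snd p)) = (\<Prod>p\<in>pairs_on UNIV. f (fst (h p)) (snd (h p)))"
    using prod.reindex[OF hinj, of "\<lambda>p. f (fst p) (snd p)"] by (simp add: o_def)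
  also have "\<dots> = (\<Prod>p\<in>pairs_on UNIV. f (\<tau> (fst p)) (\<tau> (snd p)))"
    by (intro prod.cong refl) (auto simp: h_def sym)
  finally show ?thesis unfolding omega_on_pairs f_def by simp
qed

lemma rint_perm_vec:
  fixes f :: "real^'n::{finite,linorder} \<Rightarrow> complex"
  assumes f: "f \<in> borel_measurable borel" and \<sigma>: "\<sigma> permutes UNIV"
  shows "rint k s UNIV (\<lambda>x. f (perm_vec \<sigma> x)) = rint k s UNIV f"
proof -
  let ?\<tau> = "inv \<sigma>"
  have \<tau>: "?\<tau> permutes UNIV" by (rule permutes_inv[OF \<sigma>])
  have meas: "(\<lambda>y i. y (?\<tau> i)) \<in> leb_Pi UNIV \<rightarrow>\<^sub>M leb_Pi UNIV"
    using measurable_restrict[of UNIV "\<lambda>i y. y (?\<tau> i)" "leb_Pi UNIV" "\<lambda>_. lborel"]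
    by (simp add: measurable_leb_Pi_component restrict_UNIV)
  have e: "perm_vec \<sigma> (embed_vec UNIV y) = embed_vec UNIV (\<lambda>i. y (?\<tau> i))" for y
    by (simp add: vec_eq_iff perm_vec_nth embed_vec_def)
  have rd: "rdens k s UNIV y = rdens k s UNIV (\<lambda>i. y (?\<tau> i))" for y :: "'n \<Rightarrow> real"
  proof -
    have "(\<forall>i. 0 < y (?\<tau> i)) \<longleftrightarrow> (\<forall>i. 0 < y i)" using permutes_inverses[OF \<sigma>] by metis
    moreover have "D_on UNIV (\<lambda>i. y (?\<tau> i)) = D_on UNIV y"
      unfolding D_on_def by (rule prod.reindex_bij_betw) (rule permutes_bij[OF \<tau>])
    ultimately show ?thesis by (simp add: rdens_def pos_on_def omega_on_permute[OF \<tau>])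
  qed
  have fm: "(\<lambda>y. f (embed_vec UNIV y) * complex_of_real (rdens k s UNIV y)) \<in> borel_measurable (leb_Pi UNIV)"
    using f by measurable
  have "(\<integral>y. f (embed_vec UNIV y) * complex_of_real (rdens k s UNIV y) \<partial>leb_Pi UNIV) =
     (\<integral>y. f (embed_vec UNIV (\<lambda>i. y (?\<tau> i))) * complex_of_real (rdens k s UNIV (\<lambda>i. y (?\<tau> i))) \<partial>leb_Pi UNIV)"
    by (subst leb_Pi_permute[OF \<tau>, symmetric], rule integral_distr[OF meas fm])
  then show ?thesis unfolding rint_def e rd[symmetric] by simp
qed

definition sym_rint :: "real \<Rightarrow> real \<Rightarrow> 'n set \<Rightarrow> (real^'n::{finite,linorder} \<Rightarrow> complex) \<Rightarrow> complex" where
  "sym_rint k s A \<phi> = 1 / of_nat (fact CARD('n)) * (\<Sum>\<sigma>\<in>{\<sigma>. \<sigma> permutes UNIV}. rint k s A (\<lambda>x. \<phi> (perm_vec \<sigma> x)))"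

lemma card_perms: "card {\<sigma>. \<sigma> permutes (UNIV :: 'n::finite set)} = fact CARD('n)"
  by (rule card_permutations) auto

lemma sym_rint_perm_vec:
  fixes \<phi> :: "real^'n::{finite,linorder} \<Rightarrow> complex"
  assumes \<tau>: "\<tau> permutes UNIV" shows "sym_rint k s A (\<lambda>x. \<phi> (perm_vec \<tau> x)) = sym_rint k s A \<phi>"
proof -
  have "(\<Sum>\<sigma>\<in>{\<sigma>. \<sigma> permutes UNIV}. rint k s A (\<lambda>x. \<phi> (perm_vec \<tau> (perm_vec \<sigma> x)))) =
    (\<Sum>\<sigma>\<in>{\<sigma>. \<sigma> permutes UNIV}. rint k s A (\<lambda>x. \<phi> (perm_vec (\<tau> \<circ> \<sigma>) x)))"
    using \<tau> by (intro sum.cong refl) (simp add: perm_vec_comp)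
  also have "\<dots> = (\<Sum>\<sigma>\<in>{\<sigma>. \<sigma> permutes UNIV}. rint k s A (\<lambda>x. \<phi> (perm_vec \<sigma> x)))"
    by (rule setum_permutations_compose_left[OF \<tau>, of "\<lambda>\<sigma>. rint k s A (\<lambda>x. \<phi> (perm_vec \<sigma> x))", symmetric])
  finally show ?thesis by (simp add: sym_rint_def)
qed

text \<open>Permutations preserve the norm, so one decay order serves all summands.\<close>

lemma cts_functional_rint:
  fixes A :: "'n::{finite,linorder} set"
  assumes s: "s > 0" and k: "k > 0"
  shows "cts_functional (sym_rint k s A)"
proof -
  obtain N W where W: "W \<ge> 0" "\<forall>(\<phi> :: (real, 'n) vec \<Rightarrow> complex) B. \<phi> \<in> borel_measurable borel \<longrightarrow> (\<forall>x. (1 + norm x) ^ N * norm (\<phi> x) \<le> B) \<longrightarrow>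
       integrable (leb_Pi A) (\<lambda>y. \<phi> (embed_vec A y) * complex_of_real (rdens k s A y)) \<and>
       norm (\<integral>y. \<phi> (embed_vec A y) * complex_of_real (rdens k s A y) \<partial>leb_Pi A) \<le> W * B"
    by (rule rdens_integral_bound[OF s k])
  define c where "c = 1 / complex_of_real (d_const (card A) k * sel_G k (card A) s)"
  have int: "integrable (leb_Pi A) (\<lambda>y. \<phi> (perm_vec \<sigma> (embed_vec A y)) * complex_of_real (rdens k s A y))"
    if \<phi>: "schwartz \<phi>" and \<sigma>: "\<sigma> permutes UNIV" for \<phi> :: "(real, 'n) vec \<Rightarrow> complex" and \<sigma>
  proof -
    obtain B where B: "\<And>x. (1 + norm x) ^ N * norm (\<phi> x) \<le> B" using schwartz_decay[OF \<phi>] by blast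
    note [measurable] = schwartz_measurable[OF \<phi>]
    have m: "(\<lambda>x. \<phi> (perm_vec \<sigma> x)) \<in> borel_measurable borel" by measurable
    have "(1 + norm x) ^ N * norm (\<phi> (perm_vec \<sigma> x)) \<le> B" for x
      using B[of "perm_vec \<sigma> x"] norm_perm_vec[OF \<sigma>, of x] by simp
    from W(2)[rule_format, OF m this] show ?thesis by blast
  qed
  have add: "rint k s A (\<lambda>x. f (perm_vec \<sigma> x) + g (perm_vec \<sigma> x)) = rint k s A (\<lambda>x. f (perm_vec \<sigma> x)) + rint k s A (\<lambda>x. g (perm_vec \<sigma> x))"
    if "schwartz f" "schwartz g" "\<sigma> permutes UNIV" for f g \<sigma>
    using Bochner_Integration.integral_add[OF int[OF that(1,3)] int[OF that(2,3)]]
    unfolding rint_def distrib_right by (simp only: distrib_left)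
  have cm: "rint k s A (\<lambda>x. d * f (perm_vec \<sigma> x)) = d * rint k s A (\<lambda>x. f (perm_vec \<sigma> x))" for f d \<sigma>
    unfolding rint_def by (simp add: mult.assoc)
  have bound: "norm (sym_rint k s A \<phi>) \<le> (norm c * W) * B" if \<phi>: "schwartz \<phi>" and B: "seminorm_le N \<phi> B" for \<phi> :: "(real, 'n) vec \<Rightarrow> complex" and B
  proof -
    note [measurable] = schwartz_measurable[OF \<phi>]
    have b: "norm (rint k s A (\<lambda>x. \<phi> (perm_vec \<sigma> x))) \<le> norm c * (W * B)" if \<sigma>: "\<sigma> permutes UNIV" for \<sigma>
    proof -
      have m: "(\<lambda>x. \<phi> (perm_vec \<sigma> x)) \<in> borel_measurable borel" by measurable
      have "(1 + norm x) ^ N * norm (\<phi> (perm_vec \<sigma> x)) \<le> B" for x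
        using B[unfolded seminorm_le_def, rule_format, of "[]" "perm_vec \<sigma> x"] norm_perm_vec[OF \<sigma>, of x] by simp
      from W(2)[rule_format, OF m this] have "norm (\<integral>y. \<phi> (perm_vec \<sigma> (embed_vec A y)) * complex_of_real (rdens k s A y) \<partial>leb_Pi A) \<le> W * B" by blast
      then show ?thesis unfolding rint_def c_def[symmetric] norm_mult by (intro mult_left_mono) auto
    qed
    have "norm (sym_rint k s A \<phi>) = 1 / fact CARD('n) * norm (\<Sum>\<sigma>\<in>{\<sigma>. \<sigma> permutes UNIV}. rint k s A (\<lambda>x. \<phi> (perm_vec \<sigma> x)))"
      by (simp add: sym_rint_def norm_mult norm_divide)
    also have "\<dots> \<le> 1 / fact CARD('n) * (\<Sum>\<sigma>\<in>{\<sigma>. \<sigma> permutes (UNIV :: 'n set)}. norm c * (W * B))"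
      using b by (intro mult_left_mono sum_norm_le) auto
    also have "\<dots> = (norm c * W) * B" by (simp add: card_perms)
    finally show ?thesis .
  qed
  show ?thesis
    unfolding cts_functional_def
  proof (intro conjI allI impI)
    fix f g :: "(real, 'n) vec \<Rightarrow> complex" assume fg: "schwartz f" "schwartz g"
    show "sym_rint k s A (\<lambda>x. f x + g x) = sym_rint k s A f + sym_rint k s A g"
      unfolding sym_rint_def by (simp add: add[OF fg] sum.distrib distrib_left)
  next
    fix d and f :: "(real, 'n) vec \<Rightarrow> complex"
    show "sym_rint k s A (\<lambda>x. d * f x) = d * sym_rint k s A f"
      unfolding sym_rint_def cm by (simp add: sum_distrib_left)
  next
    show "\<exists>C N. 0 \<le> C \<and> (\<forall>f B. schwartz f \<longrightarrow> seminorm_le N f B \<longrightarrow> norm (sym_rint k s A f) \<le> C * B)"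
      using bound W(1) by (intro exI[of _ "norm c * W"] exI[of _ N]) auto
  qed
qed

lemma rint_cong_orthant:
  assumes "\<And>x. (\<And>i. 0 \<le> x $ i) \<Longrightarrow> f x = g x" shows "rint k s A f = rint k s A g"
proof -
  have eq: "f (embed_vec A y) * complex_of_real (rdens k s A y) = g (embed_vec A y) * complex_of_real (rdens k s A y)" for y
  proof (cases "pos_on A y")
    case True
    then have "f (embed_vec A y) = g (embed_vec A y)"
      by (intro assms) (auto simp: embed_vec_def pos_on_def less_imp_le)
    then show ?thesis by simp
  qed (simp add: rdens_def)
  show ?thesis unfolding rint_def eq ..
qed

text \<open>Indices must be positive here: the vanishing coordinates outside A contribute 0^b to a
  power sum, which is 0 only for b > 0.\<close>

lemma sym_rint_lag_test:
  fixes A :: "'n::{finite,linorder} set"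
  assumes s: "s > 0" and k: "k > 0" and pos: "\<forall>b\<in>set bs. 0 < b"
  shows "sym_rint k s A (lag_test (psums_fun bs)) = of_real (lag_setup.moment A k s bs / lag_Z k s A)"
proof -
  interpret lag_setup A k s by unfold_locales (use s k in auto)
  have ps: "psums UNIV bs (vec_nth (embed_vec A y)) = psums A bs y" for y
    using pos
  proof (induction bs)
    case (Cons b bs)
    have "psum UNIV b (vec_nth (embed_vec A y)) = (\<Sum>i\<in>UNIV. if i \<in> A then y i ^ b else 0)"
      unfolding psum_def embed_vec_def using Cons.prems by (intro sum.cong refl) (auto simp: zero_power)
    also have "\<dots> = psum A b y" by (simp add: psum_def sum.If_cases)
    finally show ?case using Cons by simp
  qed simp
  have "rint k s A (\<lambda>x. lag_test (psums_fun bs) (perm_vec \<sigma> x)) = of_real (moment bs / lag_Z k s A)"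
    if \<sigma>: "\<sigma> permutes UNIV" for \<sigma>
  proof -
    have "(\<lambda>x. lag_test (psums_fun bs) (perm_vec \<sigma> x)) = lag_test (psums_fun bs)"
      using \<sigma> by (simp add: fun_eq_iff lag_test_perm_vec psums_fun_perm_vec)
    moreover have "rint k s A (lag_test (psums_fun bs)) = of_real ((\<integral>y. psums A bs y \<partial>lag k s A) / lag_Z k s A)"
      unfolding lag_test_def
      by (rule rint_cutoff_expo[OF s k poly_bounded_measurable[OF poly_bounded_psums[OF finite]]])
         (simp add: psums_fun_def ps)
    ultimately show ?thesis by (simp add: moment_def)
  qed
  then show ?thesis unfolding sym_rint_def by (simp add: card_perms)
qed

section \<open>From power sums to all test functions\<close>

text \<open>Symmetrising over the free coordinates expresses monomials through power sums.\<close>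
lemma annihilates_monomials:
  fixes u :: "(real^'n::finite \<Rightarrow> complex) \<Rightarrow> complex"
  assumes u: "cts_functional u"
    and sym: "\<And>a bs \<tau>. \<tau> permutes UNIV \<Longrightarrow>
      u (lag_test (\<lambda>x. mono_fun (a \<circ> \<tau>) x * psums_fun bs x)) = u (lag_test (\<lambda>x. mono_fun a x * psums_fun bs x))"
    and ps: "\<And>bs. u (lag_test (psums_fun bs)) = 0"
  shows "(\<And>i. i \<notin> I \<Longrightarrow> a i = 0) \<Longrightarrow> u (lag_test (\<lambda>x. mono_fun a x * psums_fun bs x)) = 0"
proof (induction I arbitrary: a bs rule: finite_induct[OF finite])
  case 1
  then have "mono_fun a x = 1" for x :: "(real, 'n) vec" by (simp add: mono_fun_def)
  then show ?case using ps[of bs] by simp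
next
  case (2 i I)
  define b where "b = a i"
  define a0 where "a0 = a(i := 0)"
  have a0: "a0 j = 0" if "j \<notin> I" for j using 2(4)[of j] that by (auto simp: a0_def)
  \<comment> \<open>The value with the exponent of coordinate i moved to coordinate j. Multiplying
    the remaining monomial by the power sum of index b produces all U j at once. Those with j in I
    vanish by induction, the others agree by symmetry, so a nonzero multiple of U i is zero.\<close>
  define U where "U j = u (lag_test (\<lambda>x. mono_fun (a0(j := a0 j + b)) x * psums_fun bs x))" for j
  have sch: "schwartz (lag_test (\<lambda>x. mono_fun a x * psums_fun bs x))" for a bs
    by (intro schwartz_lag_test poly_growth_mult poly_growth_mono_fun poly_growth_psums_fun)
  have free: "U j = U i" if "j \<notin> I" for j
  proof -
    define \<tau> where "\<tau> = Transposition.transpose i j"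
    have \<tau>: "\<tau> permutes UNIV" unfolding \<tau>_def by (rule permutes_swap_id) auto
    have "a0(j := a0 j + b) = a0(i := a0 i + b) \<circ> \<tau>"
      using a0[OF that] a0[OF 2(2)] by (auto simp: fun_eq_iff \<tau>_def Transposition.transpose_def)
    then show ?thesis unfolding U_def using sym[OF \<tau>, of "a0(i := a0 i + b)" bs] by simp
  qed
  have zero: "U j = 0" if "j \<in> I" for j
    unfolding U_def by (rule 2(3)) (use a0 that in auto)
  have "(\<lambda>x. mono_fun a0 x * psums_fun (b # bs) x) = (\<lambda>x :: (real, 'n) vec. \<Sum>j\<in>UNIV. mono_fun (a0(j := a0 j + b)) x * psums_fun bs x)"
    by (simp add: fun_eq_iff psums_fun_Cons mono_fun_update sum_distrib_left sum_distrib_right mult_ac)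
  then have "u (lag_test (\<lambda>x. mono_fun a0 x * psums_fun (b # bs) x)) = (\<Sum>j\<in>UNIV. U j)"
    unfolding U_def by (simp only: lag_test_sum cts_functional_sum[OF u sch])
  moreover have "u (lag_test (\<lambda>x. mono_fun a0 x * psums_fun (b # bs) x)) = 0" by (rule 2(3)[OF a0])
  moreover have "(\<Sum>j\<in>UNIV. U j) = (\<Sum>j\<in>- I. U i)"
    using zero free by (intro sum.mono_neutral_cong_right) auto
  ultimately have "of_nat (card (- I)) * U i = 0" by simp
  moreover have "- I \<noteq> {}" using 2(2) by auto
  ultimately have "U i = 0" by (simp add: card_eq_0_iff)
  moreover have "a0(i := a0 i + b) = a" by (simp add: a0_def b_def)
  ultimately show ?case by (simp add: U_def)
qed

text \<open>The difference of both sides satisfies the hypotheses of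
  \<open>cts_functional_zero\<close>. For R, symmetry and insensitivity to the cutoff come by
  continuation from parameters where it is an integral.\<close>

theorem riesz_eq_sym_rint:
  fixes R :: "complex \<Rightarrow> (real^'n::{finite,linorder} \<Rightarrow> complex) \<Rightarrow> complex" and A :: "'n set"
  assumes k: "k > 0" and fam: "is_riesz_family k R" and A: "A \<noteq> {}" and \<phi>: "schwartz \<phi>"
  shows "R (of_real (k * real (card A))) \<phi> = sym_rint k (k * real CARD('n) - k * (real (card A) - 1)) A \<phi>"
proof -
  define s where "s = k * real CARD('n) - k * (real (card A) - 1)"
  define \<mu> where "\<mu> = complex_of_real (k * real (card A))"
  have s: "s > 0" unfolding s_def by (rule riesz_lag_test_eq_moment(1)[OF k fam A, of "[]"]) simp
  define u where "u \<psi> = R \<mu> \<psi> - sym_rint k s A \<psi>" for \<psi>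
  note ru = riesz_cts[OF k fam]
  have cu: "cts_functional u" unfolding u_def[abs_def] by (intro cts_functional_diff ru cts_functional_rint s k)
  have sch: "schwartz (lag_test (\<lambda>x. mono_fun a x * psums_fun bs x))" for a bs
    by (intro schwartz_lag_test poly_growth_mult poly_growth_mono_fun poly_growth_psums_fun)
  have perm: "(\<lambda>x. lag_test (\<lambda>x. mono_fun a x * psums_fun bs x) (perm_vec \<tau> x)) = lag_test (\<lambda>x :: (real, 'n) vec. mono_fun (a \<circ> \<tau>) x * psums_fun bs x)"
    if "\<tau> permutes UNIV" for a bs \<tau>
    using that by (simp add: fun_eq_iff lag_test_perm_vec mono_fun_perm_vec psums_fun_perm_vec)
  have sym: "u (lag_test (\<lambda>x. mono_fun (a \<circ> \<tau>) x * psums_fun bs x)) = u (lag_test (\<lambda>x. mono_fun a x * psums_fun bs x))"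
    if \<tau>: "\<tau> permutes UNIV" for a bs \<tau>
  proof -
    have "R \<mu> (lag_test (\<lambda>x. mono_fun (a \<circ> \<tau>) x * psums_fun bs x)) = R \<mu> (lag_test (\<lambda>x. mono_fun a x * psums_fun bs x))"
      by (rule riesz_eq_continuation[OF k fam sch sch])
         (simp only: perm[OF \<tau>, symmetric] rint_perm_vec[OF schwartz_measurable[OF sch] \<tau>])
    then show ?thesis unfolding u_def perm[OF \<tau>, symmetric] by (simp only: sym_rint_perm_vec[OF \<tau>])
  qed
  have ps_pos: "u (lag_test (psums_fun bs)) = 0" if "\<forall>b\<in>set bs. 0 < b" for bs
    unfolding u_def \<mu>_def using riesz_lag_test_eq_moment(2)[OF k fam A that] sym_rint_lag_test[OF s k that, of A]
    by (simp add: s_def[symmetric])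
  have ps: "u (lag_test (psums_fun bs)) = 0" for bs
  proof -
    \<comment> \<open>An index 0 contributes the constant factor n to a product of power sums, so it
      is removed before the case of positive indices applies.\<close>
    define cs where "cs = filter (\<lambda>b. 0 < b) bs"
    have "\<exists>c. \<forall>x :: (real, 'n) vec. psums_fun bs x = c * psums_fun cs x"
      unfolding cs_def
    proof (induction bs)
      case (Cons b bs)
      then obtain c where c: "\<And>x :: (real, 'n) vec. psums_fun bs x = c * psums_fun (filter (\<lambda>b. 0 < b) bs) x" by blast
      show ?case
        by (cases "b = 0", rule exI[of _ "of_nat CARD('n) * c"], simp add: psums_fun_Cons c,
            rule exI[of _ c], simp add: psums_fun_Cons c)
    qed (rule exI[of _ 1], simp)
    then obtain c where "psums_fun bs = (\<lambda>x :: (real, 'n) vec. c * psums_fun cs x)" by blast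
    then show ?thesis
      using ps_pos[of cs] by (simp add: lag_test_cmult cts_functional_cmult[OF cu schwartz_lag_test[OF poly_growth_psums_fun]] cs_def)
  qed
  have "u \<phi> = 0"
  proof (rule cts_functional_zero[OF cu _ _ \<phi>])
    fix a
    have "u (lag_test (\<lambda>x. mono_fun a x * psums_fun [] x)) = 0"
      by (rule annihilates_monomials[OF cu sym ps, of UNIV]) auto
    then show "u (\<lambda>x. cutoff x * (mono_fun a x * expo (\<lambda>_. 1) x)) = 0"
      by (simp add: lag_test_def psums_fun_Nil)
  next
    fix \<psi> :: "(real, 'n) vec \<Rightarrow> complex" assume \<psi>: "schwartz \<psi>"
    have eq: "rint k s B (\<lambda>x. cutoff (perm_vec \<sigma> x) * \<psi> (perm_vec \<sigma> x)) = rint k s B (\<lambda>x. \<psi> (perm_vec \<sigma> x))" for s B \<sigma>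
      by (rule rint_cong_orthant) (simp add: cutoff_eq_1 perm_vec_nth)
    have eq1: "rint k s B (\<lambda>x. cutoff x * \<psi> x) = rint k s B \<psi>" for s B
      by (rule rint_cong_orthant) (simp add: cutoff_eq_1)
    have "R \<mu> (\<lambda>x. cutoff x * \<psi> x) = R \<mu> \<psi>"
      by (rule riesz_eq_continuation[OF k fam schwartz_mult[OF poly_growth_cutoff \<psi>] \<psi>]) (rule eq1)
    then show "u (\<lambda>x. cutoff x * \<psi> x) = u \<psi>" unfolding u_def sym_rint_def eq by simp
  qed
  then show ?thesis by (simp add: u_def \<mu>_def s_def)
qed

subsection \<open>The measure and its support\<close>

lemma test_fun_schwartz:
  fixes f :: "real^'n::finite \<Rightarrow> complex"
  assumes "test_fun f" shows "schwartz f"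
  unfolding schwartz_def
proof (intro conjI allI)
  show sm: "smooth_fun f" using assms by (simp add: test_fun_def)
  fix "is" :: "'n list" and m :: nat
  define K where "K = closure {x. f x \<noteq> 0}"
  have K: "compact K" using assms by (simp add: test_fun_def K_def)
  have out: "iter_pdiff is f x = 0" if "x \<notin> K" for x
    by (rule iter_pdiff_zero[of "- K"]) (use that closure_subset[of "{x. f x \<noteq> 0}"] in \<open>auto simp: K_def\<close>)
  have "continuous_on K (\<lambda>x. (1 + norm x) ^ m * norm (iter_pdiff is f x))"
    using smooth_fun_continuous[OF smooth_fun_iter[OF sm, of "is"]]
    by (intro continuous_intros) (auto intro: continuous_on_subset)
  then have "bounded ((\<lambda>x. (1 + norm x) ^ m * norm (iter_pdiff is f x)) ` K)"
    by (intro compact_imp_bounded compact_continuous_image K)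
  then obtain B where B: "\<And>x. x \<in> K \<Longrightarrow> norm ((1 + norm x) ^ m * norm (iter_pdiff is f x)) \<le> B"
    unfolding bounded_iff by auto
  have "(1 + norm x) ^ m * norm (iter_pdiff is f x) \<le> max B 0" for x
    using B[of x] out[of x] by (cases "x \<in> K") auto
  then show "\<exists>B. \<forall>x. (1 + norm x) ^ m * norm (iter_pdiff is f x) \<le> B" by blast
qed

text \<open>In each coordinate a rising and a falling step are multiplied, giving positivity exactly
  on an open interval of half width \<delta>; the product over coordinates lives on a cube.\<close>

lemma ex_bump:
  fixes x0 :: "real^'n::finite"
  assumes U: "open U" "x0 \<in> U"
  obtains F \<delta> where "\<delta> > 0" "test_fun (\<lambda>x :: (real, 'n) vec. complex_of_real (F x))"
    "closure {x. complex_of_real (F x) \<noteq> 0} \<subseteq> U" "\<forall>x. 0 \<le> F x"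
    "\<forall>x. (\<forall>i. \<bar>x $ i - x0 $ i\<bar> < \<delta>) \<longrightarrow> 0 < F x"
proof -
  obtain e where e: "e > 0" "ball x0 e \<subseteq> U" using U openE by blast
  \<comment> \<open>By the l1 bound on the norm the cube of half width \<delta> lies in the closed
    ball of radius e / 2, which is compact and inside the open ball of radius e.\<close>
  define \<delta> where "\<delta> = e / (2 * real CARD('n))"
  have \<delta>: "\<delta> > 0" using e by (simp add: \<delta>_def)
  define G where "G a b j t = a ^ j * step_seq j (a * t + b)" for a b j t
  have G: "deriv_seq (G a b)" for a b
    unfolding G_def[abs_def] by (rule deriv_seq_affine[OF deriv_seq_step])
  define F where "F x = (\<Prod>i\<in>UNIV. G 1 (\<delta> - x0 $ i) 0 (x $ i) * G (-1) (\<delta> + x0 $ i) 0 (x $ i))" for x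
  have st: "0 \<le> step_seq 0 t" for t using step_0[of t] step_pos[of t] by (cases "t \<le> 0") auto
  have F0: "0 \<le> F x" for x unfolding F_def G_def by (intro prod_nonneg) (simp add: st)
  have Fpos: "0 < F x" if "\<And>i. \<bar>x $ i - x0 $ i\<bar> < \<delta>" for x
    unfolding F_def G_def
  proof (intro prod_pos ballI mult_pos_pos)
    fix i
    show "0 < step_seq 0 (1 * x $ i + (\<delta> - x0 $ i))" "0 < step_seq 0 (- 1 * x $ i + (\<delta> + x0 $ i))"
      using that[of i] by (auto intro!: step_pos)
  qed auto
  have sub: "{x. complex_of_real (F x) \<noteq> 0} \<subseteq> cball x0 (e / 2)"
  proof
    fix x assume "x \<in> {x. complex_of_real (F x) \<noteq> 0}"
    then have ne: "step_seq 0 (1 * x $ i + (\<delta> - x0 $ i)) \<noteq> 0 \<and> step_seq 0 (- 1 * x $ i + (\<delta> + x0 $ i)) \<noteq> 0" for i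
      by (auto simp: F_def G_def prod_zero_iff)
    have "\<bar>(x - x0) $ i\<bar> \<le> \<delta>" for i
    proof -
      have "\<not> 1 * x $ i + (\<delta> - x0 $ i) \<le> 0" "\<not> - 1 * x $ i + (\<delta> + x0 $ i) \<le> 0"
        using ne[of i] step_0 by blast+
      then show ?thesis by (simp add: abs_le_iff)
    qed
    then have "norm (x - x0) \<le> (\<Sum>i\<in>(UNIV :: 'n set). \<delta>)"
      by (intro order_trans[OF norm_le_l1_cart sum_mono])
    also have "\<dots> = e / 2" by (simp add: \<delta>_def)
    finally show "x \<in> cball x0 (e / 2)" by (simp add: dist_norm norm_minus_commute)
  qed
  then have cl: "closure {x. complex_of_real (F x) \<noteq> 0} \<subseteq> cball x0 (e / 2)"
    by (intro closure_minimal) auto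
  have F_eq: "(\<lambda>x :: (real, 'n) vec. complex_of_real (F x)) =
      (\<lambda>x. \<Prod>i\<in>UNIV. coord_fun i (G 1 (\<delta> - x0 $ i) 0) x * coord_fun i (G (-1) (\<delta> + x0 $ i) 0) x)"
    by (simp add: F_def coord_fun_def fun_eq_iff)
  have sm: "smooth_fun (\<lambda>x :: (real, 'n) vec. complex_of_real (F x))"
    unfolding F_eq by (intro smooth_fun_prod smooth_fun_mult smooth_coord_fun G)
  have "compact (closure {x. complex_of_real (F x) \<noteq> 0})"
    using cl by (meson compact_cball compact_closure bounded_subset bounded_cball closure_subset order_trans)
  with sm have tf: "test_fun (\<lambda>x :: (real, 'n) vec. complex_of_real (F x))" by (simp add: test_fun_def)
  have "cball x0 (e / 2) \<subseteq> ball x0 e" using e by auto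
  with cl e have "closure {x. complex_of_real (F x) \<noteq> 0} \<subseteq> U" by blast
  with \<delta> tf F0 Fpos show ?thesis using that[of \<delta> F] by simp
qed

section \<open>The symmetrised measure\<close>

lemma d_const_pos: "k > 0 \<Longrightarrow> 0 < d_const m k"
  unfolding d_const_def by (intro prod_pos) (auto intro!: divide_pos_pos Gamma_real_pos add_pos_nonneg)

definition rint_const :: "real \<Rightarrow> real \<Rightarrow> nat \<Rightarrow> real" where
  "rint_const k s m = 1 / (d_const m k * sel_G k m s)"

lemma rint_const_pos: "s > 0 \<Longrightarrow> k > 0 \<Longrightarrow> 0 < rint_const k s m"
  unfolding rint_const_def by (intro divide_pos_pos mult_pos_pos d_const_pos sel_G_pos) auto

lemma rint_eq: "rint k s A \<phi> = complex_of_real (rint_const k s (card A)) *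
    (\<integral>y. \<phi> (embed_vec A y) * complex_of_real (rdens k s A y) \<partial>leb_Pi A)"
  by (simp add: rint_def rint_const_def)

text \<open>The average over permutations is realised as one push-forward, with the permutation as
  an additional discrete coordinate, so that no sum of measures has to be formed. The density
  contains the factor 1/n!.\<close>

definition sym_measure :: "real \<Rightarrow> real \<Rightarrow> 'n set \<Rightarrow> (real^'n::{finite,linorder}) measure" where
  "sym_measure k s A = distr
     (density (count_space {\<sigma>. \<sigma> permutes UNIV} \<Otimes>\<^sub>M leb_Pi A)
       (\<lambda>p. ennreal (rint_const k s (card A) / fact CARD('n) * rdens k s A (snd p))))
     borel (\<lambda>p. perm_vec (fst p) (embed_vec A (snd p)))"

lemma integral_sym_measure:
  fixes A :: "'n::{finite,linorder} set"
  assumes s: "s > 0" and k: "k > 0"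
  shows "\<exists>N. \<forall>(\<phi> :: (real, 'n) vec \<Rightarrow> complex) B. \<phi> \<in> borel_measurable borel \<longrightarrow>
      (\<forall>x. (1 + norm x) ^ N * norm (\<phi> x) \<le> B) \<longrightarrow>
      integrable (sym_measure k s A) \<phi> \<and> integral\<^sup>L (sym_measure k s A) \<phi> = sym_rint k s A \<phi>"
proof -
  obtain N W where W: "W \<ge> 0" "\<forall>(\<phi> :: (real, 'n) vec \<Rightarrow> complex) B. \<phi> \<in> borel_measurable borel \<longrightarrow> (\<forall>x. (1 + norm x) ^ N * norm (\<phi> x) \<le> B) \<longrightarrow>
       integrable (leb_Pi A) (\<lambda>y. \<phi> (embed_vec A y) * complex_of_real (rdens k s A y)) \<and>
       norm (\<integral>y. \<phi> (embed_vec A y) * complex_of_real (rdens k s A y) \<partial>leb_Pi A) \<le> W * B"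
    by (rule rdens_integral_bound[OF s k])
  define S where "S = {\<sigma>. \<sigma> permutes (UNIV :: 'n set)}"
  have S: "finite S" by (simp add: S_def)
  define P where "P = count_space S \<Otimes>\<^sub>M leb_Pi A"
  define c where "c = rint_const k s (card A) / fact CARD('n)"
  define w where "w p = c * rdens k s A (snd p)" for p :: "('n \<Rightarrow> 'n) \<times> ('n \<Rightarrow> real)"
  define g where "g p = perm_vec (fst p) (embed_vec A (snd p))" for p :: "('n \<Rightarrow> 'n) \<times> ('n \<Rightarrow> real)"
  have c: "c > 0" unfolding c_def using rint_const_pos[OF s k] by simp
  have w0: "0 \<le> w p" for p unfolding w_def using c by (simp add: rdens_nonneg)
  have wm [measurable]: "w \<in> borel_measurable P"
    unfolding P_def w_def[abs_def] by (rule measurable_pair_measure_countable1) (use S in auto)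
  have gm [measurable]: "g \<in> borel_measurable P"
    unfolding P_def g_def[abs_def] by (rule measurable_pair_measure_countable1) (use S in auto)
  have M: "sym_measure k s A = distr (density P (\<lambda>p. ennreal (w p))) borel g"
    unfolding sym_measure_def P_def S_def w_def c_def g_def ..
  interpret S: sigma_finite_measure "count_space S" by (rule sigma_finite_measure_count_space_finite[OF S])
  interpret L: sigma_finite_measure "leb_Pi A" by (rule leb.sigma_finite) simp
  interpret PS: pair_sigma_finite "count_space S" "leb_Pi A" ..
  show ?thesis
  proof (rule exI[of _ N], intro allI impI)
    fix \<phi> :: "(real, 'n) vec \<Rightarrow> complex" and B
    assume \<phi> [measurable]: "\<phi> \<in> borel_measurable borel" and B: "\<forall>x. (1 + norm x) ^ N * norm (\<phi> x) \<le> B"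
    define h where "h p = w p *\<^sub>R \<phi> (g p)" for p
    have hm: "h \<in> borel_measurable P" unfolding h_def[abs_def] by measurable
    have int1: "integrable (leb_Pi A) (\<lambda>y. \<phi> (perm_vec \<sigma> (embed_vec A y)) * complex_of_real (rdens k s A y))" if "\<sigma> \<in> S" for \<sigma>
    proof -
      have \<sigma>: "\<sigma> permutes UNIV" using that by (simp add: S_def)
      have m: "(\<lambda>x. \<phi> (perm_vec \<sigma> x)) \<in> borel_measurable borel" by measurable
      have "\<forall>x. (1 + norm x) ^ N * norm (\<phi> (perm_vec \<sigma> x)) \<le> B"
        using B norm_perm_vec[OF \<sigma>] by metis
      with W(2) m show ?thesis by blast
    qed
    have h: "h (\<sigma>, y) = complex_of_real c * (\<phi> (perm_vec \<sigma> (embed_vec A y)) * complex_of_real (rdens k s A y))" for \<sigma> y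
      by (simp add: h_def w_def g_def scaleR_conv_of_real mult_ac)
    have hi: "integrable P h"
      unfolding P_def
    proof (rule PS.Fubini_integrable)
      show "h \<in> borel_measurable (count_space S \<Otimes>\<^sub>M leb_Pi A)" using hm by (simp add: P_def)
      show "integrable (count_space S) (\<lambda>x. \<integral>y. norm (h (x, y)) \<partial>leb_Pi A)"
        by (rule integrable_count_space[OF S])
      show "AE x in count_space S. integrable (leb_Pi A) (\<lambda>y. h (x, y))"
        unfolding h by (auto simp: AE_count_space intro!: integrable_mult_right int1)
    qed
    have "integral\<^sup>L P h = (\<integral>\<sigma>. (\<integral>y. h (\<sigma>, y) \<partial>leb_Pi A) \<partial>count_space S)"
      using PS.integral_fst'[of h] hi by (simp add: P_def)
    also have "\<dots> = (\<Sum>\<sigma>\<in>S. \<integral>y. h (\<sigma>, y) \<partial>leb_Pi A)"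
      by (rule lebesgue_integral_count_space_finite[OF S])
    also have "\<dots> = sym_rint k s A \<phi>"
      unfolding h sym_rint_def rint_eq S_def[symmetric] by (simp add: c_def sum_distrib_left)
    finally have hint: "integral\<^sup>L P h = sym_rint k s A \<phi>" .
    have "integrable (sym_measure k s A) \<phi>"
      unfolding M
      by (subst integrable_distr_eq) (auto simp: integrable_density w0 hi[unfolded h_def])
    moreover have "integral\<^sup>L (sym_measure k s A) \<phi> = sym_rint k s A \<phi>"
      unfolding M
      by (subst integral_distr) (auto simp: integral_density w0 hint[unfolded h_def])
    ultimately show "integrable (sym_measure k s A) \<phi> \<and> integral\<^sup>L (sym_measure k s A) \<phi> = sym_rint k s A \<phi>" ..
  qed
qed

lemma emeasure_sym_measure_compact:
  fixes K :: "(real^'n::{finite,linorder}) set"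
  assumes s: "s > 0" and k: "k > 0" and K: "compact K"
  shows "emeasure (sym_measure k s A) K < \<infinity>"
proof -
  obtain N where N: "\<forall>(\<phi> :: (real, 'n) vec \<Rightarrow> complex) B. \<phi> \<in> borel_measurable borel \<longrightarrow>
      (\<forall>x. (1 + norm x) ^ N * norm (\<phi> x) \<le> B) \<longrightarrow>
      integrable (sym_measure k s A) \<phi> \<and> integral\<^sup>L (sym_measure k s A) \<phi> = sym_rint k s A \<phi>"
    using integral_sym_measure[OF s k] by blast
  obtain b where b: "\<And>x. x \<in> K \<Longrightarrow> norm x \<le> b" using compact_imp_bounded[OF K] unfolding bounded_iff by blast
  have [measurable]: "K \<in> sets borel" by (intro borel_closed compact_imp_closed K)
  have "(\<lambda>x. complex_of_real (indicator K x)) \<in> borel_measurable borel" by measurable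
  moreover have "\<forall>x. (1 + norm x) ^ N * norm (complex_of_real (indicator K x)) \<le> (1 + \<bar>b\<bar>) ^ N"
  proof
    fix x
    show "(1 + norm x) ^ N * norm (complex_of_real (indicator K x)) \<le> (1 + \<bar>b\<bar>) ^ N"
      using b[of x] by (cases "x \<in> K") (auto intro!: power_mono)
  qed
  ultimately have "integrable (sym_measure k s A) (\<lambda>x. complex_of_real (indicator K x))" using N by blast
  then have "integrable (sym_measure k s A) (\<lambda>x. Re (complex_of_real (indicator K x)))" by (rule integrable_Re)
  then have "integrable (sym_measure k s A) (indicator K :: _ \<Rightarrow> real)" by simp
  then show ?thesis by (simp add: integrable_indicator_iff sym_measure_def)
qed

text \<open>A vanishing integral would force the integrand to vanish almost everywhere, but on the
  box it is positive almost everywhere. The box extends only upward from a, so it lies in the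
  positive orthant even when some a_i = 0.\<close>

lemma rint_pos:
  fixes A :: "'n::{finite,linorder} set" and F :: "(real, 'n) vec \<Rightarrow> real"
  assumes s: "s > 0" and k: "k > 0" and F0: "\<And>x. 0 \<le> F x"
    and int: "integrable (leb_Pi A) (\<lambda>y. F (embed_vec A y) * rdens k s A y)"
    and \<delta>: "\<delta> > 0" and a: "\<And>i. i \<in> A \<Longrightarrow> 0 \<le> a i"
    and F: "\<And>y. (\<And>i. i \<in> A \<Longrightarrow> a i < y i \<and> y i < a i + \<delta>) \<Longrightarrow> 0 < F (embed_vec A y)"
  shows "0 < (\<integral>y. F (embed_vec A y) * rdens k s A y \<partial>leb_Pi A)"
proof (rule ccontr)
  let ?g = "\<lambda>y. F (embed_vec A y) * rdens k s A y"
  let ?B = "Pi\<^sub>E A (\<lambda>i. {a i<..<a i + \<delta>})"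
  assume "\<not> ?thesis"
  moreover have g0: "0 \<le> ?g y" for y by (simp add: F0 rdens_nonneg)
  then have "0 \<le> (\<integral>y. ?g y \<partial>leb_Pi A)" by (rule Bochner_Integration.integral_nonneg)
  ultimately have "(\<integral>y. ?g y \<partial>leb_Pi A) = 0" by linarith
  then have "AE y in leb_Pi A. ?g y = 0"
    using integral_nonneg_eq_0_iff_AE[OF int] g0 by auto
  moreover have "AE y in leb_Pi A. pos_on A y \<longrightarrow> 0 < D_on A y \<and> 0 < omega_on k A y"
    by (rule AE_leb_Pi_weight_pos) simp
  ultimately have "AE y in leb_Pi A. y \<notin> ?B"
  proof eventually_elim
    case (elim y)
    show ?case
    proof
      assume y: "y \<in> ?B"
      then have pos: "pos_on A y" using a by (fastforce simp: pos_on_def PiE_def Pi_iff)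
      have "0 < F (embed_vec A y)" by (rule F) (use y in \<open>auto simp: PiE_def Pi_iff\<close>)
      moreover have "0 < rdens k s A y" using elim(2) pos by (simp add: rdens_def)
      ultimately show False using elim(1) by simp
    qed
  qed
  then have "emeasure (leb_Pi A) {y \<in> space (leb_Pi A). y \<in> ?B} = 0" by (rule emeasure_eq_0_AE)
  also have "{y \<in> space (leb_Pi A). y \<in> ?B} = ?B" by (auto simp: space_PiM PiE_def)
  finally show False using \<delta> by (subst (asm) emeasure_leb_Pi_box) auto
qed

section \<open>The support\<close>

lemma closed_boundary_r: "closed (boundary_r r :: (real^'n::{finite,linorder}) set)"
  unfolding boundary_r_def
proof (intro closed_UN ballI)
  fix \<sigma> :: "'n \<Rightarrow> 'n"
  have "{x :: (real, 'n) vec. (\<forall>i. 0 \<le> x $ i) \<and> (\<forall>i. i \<notin> first_idx r \<longrightarrow> x $ \<sigma> i = 0)} =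
      (\<Inter>i. {x. 0 \<le> x $ i}) \<inter> (\<Inter>i\<in>- first_idx r. {x. x $ \<sigma> i = 0})" by auto
  also have "closed \<dots>"
    by (intro closed_Int closed_INT ballI closed_Collect_le closed_Collect_eq continuous_intros)
  finally show "closed {x :: (real, 'n) vec. (\<forall>i. 0 \<le> x $ i) \<and> (\<forall>i. i \<notin> first_idx r \<longrightarrow> x $ \<sigma> i = 0)}" .
qed simp

text \<open>Off the closed set \<open>boundary_r\<close> all integrands vanish identically. At a
  point of it a bump gives a positive contribution for the permutation that carries the point, and
  nonnegative ones for the others, so no cancellation occurs.\<close>

lemma dist_support_sym_rint:
  fixes R :: "(real^'n::{finite,linorder} \<Rightarrow> complex) \<Rightarrow> complex"
  assumes s: "s > 0" and k: "k > 0" and R: "\<And>\<phi>. schwartz \<phi> \<Longrightarrow> R \<phi> = sym_rint k s (first_idx r) \<phi>"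
  shows "dist_support R = boundary_r r"
proof (intro equalityI subsetI)
  let ?A = "first_idx r :: 'n set"
  fix x assume x: "x \<in> dist_support R"
  show "x \<in> boundary_r r"
  proof (rule ccontr)
    assume "x \<notin> boundary_r r"
    then have "open (- boundary_r r) \<and> x \<in> - boundary_r r"
      by (simp add: open_Compl[OF closed_boundary_r])
    with x obtain f where f: "test_fun f" "closure {y. f y \<noteq> 0} \<subseteq> - boundary_r r" "R f \<noteq> 0"
      unfolding dist_support_def by blast
    have f0: "f y = 0" if "y \<in> boundary_r r" for y
      using f(2) closure_subset[of "{y. f y \<noteq> 0}"] that by blast
    have zero: "f (perm_vec \<sigma> (embed_vec ?A y)) * complex_of_real (rdens k s ?A y) = 0"
      if \<sigma>: "\<sigma> permutes UNIV" for \<sigma> y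
    proof (cases "pos_on ?A y")
      case True
      have "perm_vec \<sigma> (embed_vec ?A y) \<in> boundary_r r"
        unfolding boundary_r_def using True permutes_inverses[OF \<sigma>]
        by (intro UN_I[of \<sigma>]) (auto simp: \<sigma> perm_vec_nth embed_vec_def pos_on_def less_imp_le)
      then show ?thesis by (simp add: f0)
    qed (simp add: rdens_def)
    then have "rint k s ?A (\<lambda>x. f (perm_vec \<sigma> x)) = 0" if "\<sigma> permutes UNIV" for \<sigma>
      unfolding rint_def zero[OF that] by simp
    then have "sym_rint k s ?A f = 0" by (simp add: sym_rint_def)
    with f(3) R[OF test_fun_schwartz[OF f(1)]] show False by simp
  qed
next
  let ?A = "first_idx r :: 'n set"
  fix x :: "(real, 'n) vec" assume "x \<in> boundary_r r"
  then obtain \<sigma> where \<sigma>: "\<sigma> permutes UNIV" and x0: "\<And>i. 0 \<le> x $ i" and xz: "\<And>i. i \<notin> ?A \<Longrightarrow> x $ \<sigma> i = 0"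
    unfolding boundary_r_def by blast
  show "x \<in> dist_support R"
    unfolding dist_support_def
  proof (intro CollectI allI impI)
    fix U assume "open U \<and> x \<in> U"
    then have U: "open U" "x \<in> U" by auto
    obtain F \<delta> where \<delta>: "\<delta> > 0" and tf: "test_fun (\<lambda>x :: (real, 'n) vec. complex_of_real (F x))"
      and sub: "closure {x. complex_of_real (F x) \<noteq> 0} \<subseteq> U" and F0': "\<forall>x. 0 \<le> F x"
      and Fp: "\<forall>y. (\<forall>i. \<bar>y $ i - x $ i\<bar> < \<delta>) \<longrightarrow> 0 < F y"
      by (rule ex_bump[OF U])
    have F0: "0 \<le> F x" for x using F0' by blast
    have sch: "schwartz (\<lambda>x. complex_of_real (F x))" by (rule test_fun_schwartz[OF tf])
    define J where "J \<tau> = (\<integral>y. F (perm_vec \<tau> (embed_vec ?A y)) * rdens k s ?A y \<partial>leb_Pi ?A)" for \<tau>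
    have J0: "0 \<le> J \<tau>" for \<tau> unfolding J_def by (intro Bochner_Integration.integral_nonneg mult_nonneg_nonneg F0 rdens_nonneg)
    have rint_J: "rint k s ?A (\<lambda>x. complex_of_real (F (perm_vec \<tau> x))) = complex_of_real (rint_const k s (card ?A) * J \<tau>)" for \<tau>
      unfolding rint_eq J_def of_real_mult[symmetric] integral_complex_of_real ..
    obtain N W where W: "\<forall>(\<phi> :: (real, 'n) vec \<Rightarrow> complex) B. \<phi> \<in> borel_measurable borel \<longrightarrow> (\<forall>x. (1 + norm x) ^ N * norm (\<phi> x) \<le> B) \<longrightarrow>
       integrable (leb_Pi ?A) (\<lambda>y. \<phi> (embed_vec ?A y) * complex_of_real (rdens k s ?A y)) \<and>
       norm (\<integral>y. \<phi> (embed_vec ?A y) * complex_of_real (rdens k s ?A y) \<partial>leb_Pi ?A) \<le> W * B"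
      by (rule rdens_integral_bound[OF s k])
    have int: "integrable (leb_Pi ?A) (\<lambda>y. F (perm_vec \<sigma> (embed_vec ?A y)) * rdens k s ?A y)"
    proof -
      note [measurable] = schwartz_measurable[OF sch]
      obtain B where B: "\<forall>x. (1 + norm x) ^ N * norm (complex_of_real (F x)) \<le> B" using schwartz_decay[OF sch] by blast
      have m: "(\<lambda>x. complex_of_real (F (perm_vec \<sigma> x))) \<in> borel_measurable borel"
        using measurable_compose[OF borel_measurable_perm_vec schwartz_measurable[OF sch]] .
      have "\<forall>x. (1 + norm x) ^ N * norm (complex_of_real (F (perm_vec \<sigma> x))) \<le> B"
        using B norm_perm_vec[OF \<sigma>] by metis
      with W m have "integrable (leb_Pi ?A) (\<lambda>y. complex_of_real (F (perm_vec \<sigma> (embed_vec ?A y))) * complex_of_real (rdens k s ?A y))"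
        by blast
      from integrable_Re[OF this] show ?thesis by simp
    qed
    have J\<sigma>: "0 < J \<sigma>"
      unfolding J_def
    proof (rule rint_pos[OF s k F0 int \<delta>])
      \<comment> \<open>The box is centred on the preimage of x under the permutation: its
        coordinates on the first r indices are x at \<sigma> i, and the remaining ones are zero on
        both sides.\<close>
      show "0 \<le> x $ \<sigma> i" for i by (rule x0)
      fix y assume y: "\<And>i. i \<in> ?A \<Longrightarrow> x $ \<sigma> i < y i \<and> y i < x $ \<sigma> i + \<delta>"
      show "0 < F (perm_vec \<sigma> (embed_vec ?A y))"
      proof (rule Fp[rule_format])
        fix j
        have j: "\<sigma> (inv \<sigma> j) = j" using permutes_inverses(1)[OF \<sigma>] .
        show "\<bar>perm_vec \<sigma> (embed_vec ?A y) $ j - x $ j\<bar> < \<delta>"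
          using y[of "inv \<sigma> j"] xz[of "inv \<sigma> j"] \<delta> by (auto simp: perm_vec_nth embed_vec_def j)
      qed
    qed
    have "0 < (\<Sum>\<tau>\<in>{\<tau>. \<tau> permutes UNIV}. rint_const k s (card ?A) * J \<tau>)"
      by (rule sum_pos2[of _ \<sigma>]) (use \<sigma> J\<sigma> J0 rint_const_pos[OF s k, of "card ?A"] in auto)
    then have "sym_rint k s ?A (\<lambda>x. complex_of_real (F x)) \<noteq> 0"
      unfolding sym_rint_def rint_J of_real_sum[symmetric] by (auto simp del: of_real_mult of_real_sum)
    then show "\<exists>f. test_fun f \<and> closure {y. f y \<noteq> 0} \<subseteq> U \<and> R f \<noteq> 0"
      using tf sub R[OF sch] by (intro exI[of _ "\<lambda>x. complex_of_real (F x)"]) auto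
  qed
qed

theorem theorem5p11:
  fixes k :: real and r :: nat
    and R :: "complex \<Rightarrow> (real^'n::{finite,linorder} \<Rightarrow> complex) \<Rightarrow> complex"
  assumes "CARD('n) \<ge> 2" and "k > 0" and "1 \<le> r" and "r < CARD('n)"
    and "is_riesz_family k R"
  shows "(\<exists>M. sets M = sets borel \<and> (\<forall>K. compact K \<longrightarrow> emeasure M K < \<infinity>) \<and>
            (\<forall>\<phi>. schwartz \<phi> \<longrightarrow> integrable M \<phi> \<and> R (of_real (k * real r)) \<phi> = integral\<^sup>L M \<phi>))
       \<and> (\<forall>\<phi>. schwartz \<phi> \<longrightarrow>
            R (of_real (k * real r)) \<phi> =
              (1 / of_nat (fact CARD('n))) *
              (\<Sum>\<sigma>\<in>{\<sigma>. \<sigma> permutes (UNIV::'n set)}. perm_dist \<sigma> (Rprime_delta k r) \<phi>))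
       \<and> dist_support (R (of_real (k * real r))) = boundary_r r"
proof -
  define A where "A = (first_idx r :: 'n set)"
  define s where "s = k * real CARD('n) - k * (real r - 1)"
  have card: "card A = r" unfolding A_def by (rule card_first_idx) (use assms(4) in simp)
  have A: "A \<noteq> {}" using card assms(3) by auto
  have "s = k * (real CARD('n) - real r + 1)" by (simp add: s_def algebra_simps)
  then have s: "s > 0" using assms(2,4) by simp
  have main: "R (of_real (k * real r)) \<phi> = sym_rint k s A \<phi>" if "schwartz \<phi>" for \<phi>
    using riesz_eq_sym_rint[OF assms(2,5) A that] unfolding card s_def .
  have "integrable (sym_measure k s A) \<phi> \<and> R (of_real (k * real r)) \<phi> = integral\<^sup>L (sym_measure k s A) \<phi>" if "schwartz \<phi>" for \<phi>
    using integral_sym_measure[OF s assms(2), of A] schwartz_measurable[OF that] schwartz_decay[OF that] main[OF that]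
    by metis
  then have "\<exists>M. sets M = sets borel \<and> (\<forall>K. compact K \<longrightarrow> emeasure M K < \<infinity>) \<and>
            (\<forall>\<phi>. schwartz \<phi> \<longrightarrow> integrable M \<phi> \<and> R (of_real (k * real r)) \<phi> = integral\<^sup>L M \<phi>)"
    using emeasure_sym_measure_compact[OF s assms(2), of _ A]
    by (intro exI[of _ "sym_measure k s A"]) (simp add: sym_measure_def)
  moreover have "R (of_real (k * real r)) \<phi> = (1 / of_nat (fact CARD('n))) *
              (\<Sum>\<sigma>\<in>{\<sigma>. \<sigma> permutes (UNIV::'n set)}. perm_dist \<sigma> (Rprime_delta k r) \<phi>)" if "schwartz \<phi>" for \<phi>
    unfolding main[OF that] sym_rint_def perm_dist_def s_def
    by (simp only: Rprime_delta_eq_rint[OF card[unfolded A_def]] A_def)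
  moreover have "dist_support (R (of_real (k * real r))) = boundary_r r"
    by (rule dist_support_sym_rint[OF s assms(2)]) (use main in \<open>simp add: A_def\<close>)
  ultimately show ?thesis by blast
qed

end
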